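(* In the setting below, for every $D$ with $D_{\mathcal N,0}<D<\mathrm{mmse}(X\mid Y(M))+N(V(M))$, $$L(D)\le \frac12\log\frac{\sigma_X^2}{N(V(M))}+\frac M2\log\frac{1}{1-\frac{\sigma_W^2}{M}\left(\frac1D-\frac1{\sigma_X^2}\right)}-\frac12\log\frac{D}{D-\mathrm{mmse}(X\mid Y(M))},$$ equivalently $L(D)\le \frac{M}{M-1}L_{\mathcal N}(D)+\frac12\log\frac{\sigma_X^2}{N(V(M))}-\frac12\log\frac{D}{D-\mathrm{mmse}(X\mid Y(M))}$ (for $M\ge2$).
   Context: Let $X$ be a real random variable with a density, finite variance $\sigma_X^2>0$ and finite differential entropy. Fix an integer $M\ge1$ and $\sigma_W^2>0$; let $W_1,\dots,W_M$ be i.i.d. $\mathcal N(0,\sigma_W^2)$, independent of $X$, and $Y_i=X+W_i$. Set $Y(M)=\frac1M\sum_i Y_i$, $V(M)=\mathbb E[X\mid Y(M)]$, $\mathrm{mmse}(X\mid Y(M))=\mathbb E[(X-V(M))^2]$, $N(Z)=e^{2h(Z)}/(2\pi e)$ (entropy power; natural logs throughout), $D_{\mathcal N,0}=\frac{\sigma_X^2\sigma_W^2}{M\sigma_X^2+\sigma_W^2}$, and $L_{\mathcal N}(D)=\frac{M-1}{2}\log\frac{1}{1-\frac{\sigma_W^2}{M}(\frac1D-\frac1{\sigma_X^2})}$. Consider $n$ i.i.d. copies of $(X,Y_1,\dots,Y_M)$. CEO problem: encoder $i$ maps $Y_i^n$ to an index in $\{1,\dots,\lfloor e^{nR_i}\rfloor\}$,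 and a single decoder produces $\hat X^n$ from all $M$ indices; $R_X^{\mathrm{CEO}}(D)$ is the infimum of sum-rates $R_1+\dots+R_M$ such that for every $\varepsilon>0$ and all large $n$ there are such codes with $\frac1n\sum_t\mathbb E[(X_t-\hat X_t)^2]\le D+\varepsilon$. $R_X^{\mathrm R}(D)$ is defined the same way but with a single encoder observing all of $(Y_1^n,\dots,Y_M^n)$ with rate $R$. The rate loss is $L(D)=R_X^{\mathrm{CEO}}(D)-R_X^{\mathrm R}(D)$. *)

theory Defs
  imports "HOL-Probability.Probability"
begin

definition Xlaw :: "(real \<Rightarrow> real) \<Rightarrow> real measure" where
  "Xlaw f = density lborel (\<lambda>x. ennreal (f x))"

definition Wlaw :: "real \<Rightarrow> nat \<Rightarrow> (nat \<Rightarrow> real) measure" where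
  "Wlaw sW2 M = PiM {..<M} (\<lambda>_. density lborel (\<lambda>x. ennreal (normal_density 0 (sqrt sW2) x)))"

definition Src :: "(real \<Rightarrow> real) \<Rightarrow> real \<Rightarrow> nat \<Rightarrow> (real \<times> (nat \<Rightarrow> real)) measure" where
  "Src f sW2 M = distr (Xlaw f \<Otimes>\<^sub>M Wlaw sW2 M) (borel \<Otimes>\<^sub>M PiM {..<M} (\<lambda>_. borel))
      (\<lambda>(x, w). (x, \<lambda>i\<in>{..<M}. x + w i))"

definition Blk :: "(real \<Rightarrow> real) \<Rightarrow> real \<Rightarrow> nat \<Rightarrow> nat \<Rightarrow> (nat \<Rightarrow> real \<times> (nat \<Rightarrow> real)) measure" where
  "Blk f sW2 M n = PiM {..<n} (\<lambda>_. Src f sW2 M)"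

definition varX :: "(real \<Rightarrow> real) \<Rightarrow> real" where
  "varX f = prob_space.variance (Xlaw f) (\<lambda>x. x)"

definition Ybar :: "nat \<Rightarrow> real \<times> (nat \<Rightarrow> real) \<Rightarrow> real" where
  "Ybar M \<omega> = (\<Sum>i<M. snd \<omega> i) / real M"

definition Vcond :: "(real \<Rightarrow> real) \<Rightarrow> real \<Rightarrow> nat \<Rightarrow> real \<times> (nat \<Rightarrow> real) \<Rightarrow> real" where
  "Vcond f sW2 M = real_cond_exp (Src f sW2 M)
      (vimage_algebra (space (Src f sW2 M)) (Ybar M) borel) fst"

definition mmse :: "(real \<Rightarrow> real) \<Rightarrow> real \<Rightarrow> nat \<Rightarrow> real" where
  "mmse f sW2 M = (\<integral>\<omega>. (fst \<omega> - Vcond f sW2 M \<omega>)\<^sup>2 \<partial>Src f sW2 M)"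

definition NV :: "(real \<Rightarrow> real) \<Rightarrow> real \<Rightarrow> nat \<Rightarrow> real" where
  "NV f sW2 M = exp (2 * prob_space.entropy (Src f sW2 M) (exp 1) lborel (Vcond f sW2 M))
      / (2 * pi * exp 1)"

definition DN0 :: "(real \<Rightarrow> real) \<Rightarrow> real \<Rightarrow> nat \<Rightarrow> real" where
  "DN0 f sW2 M = varX f * sW2 / (real M * varX f + sW2)"

definition ceo_code :: "(real \<Rightarrow> real) \<Rightarrow> real \<Rightarrow> nat \<Rightarrow> nat \<Rightarrow> (nat \<Rightarrow> real) \<Rightarrow> real \<Rightarrow> bool" where
  "ceo_code f sW2 M n R D \<longleftrightarrow>
    (\<exists>(enc :: nat \<Rightarrow> (nat \<Rightarrow> real) \<Rightarrow> nat) (dec :: (nat \<Rightarrow> nat) \<Rightarrow> nat \<Rightarrow> real).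
      let est = (\<lambda>\<omega>. dec (\<lambda>i\<in>{..<M}. enc i (\<lambda>s\<in>{..<n}. snd (\<omega> s) i))) in
      (\<forall>i<M. \<forall>y. enc i y \<in> {1..nat \<lfloor>exp (real n * R i)\<rfloor>}) \<and>
      (\<forall>i<M. enc i \<in> measurable (PiM {..<n} (\<lambda>_. borel)) (count_space UNIV)) \<and>
      (\<forall>t<n. (\<lambda>\<omega>. est \<omega> t) \<in> borel_measurable (Blk f sW2 M n)) \<and>
      (\<forall>t<n. integrable (Blk f sW2 M n) (\<lambda>\<omega>. (fst (\<omega> t) - est \<omega> t)\<^sup>2)) \<and>
      (1 / real n) * (\<Sum>t<n. \<integral>\<omega>. (fst (\<omega> t) - est \<omega> t)\<^sup>2 \<partial>Blk f sW2 M n) \<le> D)"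

definition joint_code :: "(real \<Rightarrow> real) \<Rightarrow> real \<Rightarrow> nat \<Rightarrow> nat \<Rightarrow> real \<Rightarrow> real \<Rightarrow> bool" where
  "joint_code f sW2 M n R D \<longleftrightarrow>
    (\<exists>(enc :: (nat \<Rightarrow> nat \<Rightarrow> real) \<Rightarrow> nat) (dec :: nat \<Rightarrow> nat \<Rightarrow> real).
      let est = (\<lambda>\<omega>. dec (enc (\<lambda>s\<in>{..<n}. \<lambda>i\<in>{..<M}. snd (\<omega> s) i))) in
      (\<forall>y. enc y \<in> {1..nat \<lfloor>exp (real n * R)\<rfloor>}) \<and>
      enc \<in> measurable (PiM {..<n} (\<lambda>_. PiM {..<M} (\<lambda>_. borel))) (count_space UNIV) \<and>
      (\<forall>t<n. (\<lambda>\<omega>. est \<omega> t) \<in> borel_measurable (Blk f sW2 M n)) \<and>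
      (\<forall>t<n. integrable (Blk f sW2 M n) (\<lambda>\<omega>. (fst (\<omega> t) - est \<omega> t)\<^sup>2)) \<and>
      (1 / real n) * (\<Sum>t<n. \<integral>\<omega>. (fst (\<omega> t) - est \<omega> t)\<^sup>2 \<partial>Blk f sW2 M n) \<le> D)"

definition R_CEO :: "(real \<Rightarrow> real) \<Rightarrow> real \<Rightarrow> nat \<Rightarrow> real \<Rightarrow> real" where
  "R_CEO f sW2 M D = Inf {(\<Sum>i<M. R i) | R.
      \<forall>\<epsilon>>0. \<exists>N. \<forall>n\<ge>N. ceo_code f sW2 M n R (D + \<epsilon>)}"

definition R_joint :: "(real \<Rightarrow> real) \<Rightarrow> real \<Rightarrow> nat \<Rightarrow> real \<Rightarrow> real" where
  "R_joint f sW2 M D = Inf {R.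
      \<forall>\<epsilon>>0. \<exists>N. \<forall>n\<ge>N. joint_code f sW2 M n R (D + \<epsilon>)}"

definition rate_loss :: "(real \<Rightarrow> real) \<Rightarrow> real \<Rightarrow> nat \<Rightarrow> real \<Rightarrow> real" where
  "rate_loss f sW2 M D = R_CEO f sW2 M D - R_joint f sW2 M D"

end

theory Submission
  imports Defs
begin

text \<open>
  Upper bound on the CEO rate. Encoder \<open>i\<close> quantizes its block by \<open>U\<^sub>i = Y\<^sub>i + Z\<^sub>i\<close> with Gaussian test
  noise \<open>Z\<^sub>i\<close> and bins the codeword index. The codebook does not use the law of \<open>X\<close>: codewords are
  uniform on a large cube and are selected by rejection sampling from the Gaussian transition density,
  and the decoder looks, one encoder after another, for a codeword close to the \<^emph>\<open>linear\<close> prediction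
  from the codewords already decoded. Only the laws of large numbers for squared linear forms enter,
  and second moments of linear forms depend on \<open>X\<close> only through its variance; hence the Gaussian
  sum rate is achievable for every source with that variance.

  Lower bound on the joint rate. With \<open>V = E[X | Y(M)]\<close>, the mean square error of any reproduction
  splits into the mmse and the error of describing \<open>V\<close>. So a code of distortion \<open>D\<close> describes the block
  of \<open>V\<close> with distortion \<open>D - mmse\<close>, and Gibbs' inequality against the mixture of Gaussians centred at
  the finitely many reproductions yields the Shannon lower bound \<open>1/2 log (N(V) / (D - mmse))\<close>.
\<close>

subsection \<open>Random binning\<close>

text \<open>The obstacle is that the law of \<open>X\<close> is arbitrary, so typicality cannot
  refer to a Gaussian joint law. Rejection sampling makes an accepted codeword a truncated Gaussian
  perturbation of whatever was observed, and everything then reduces to squared norms of linear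
  forms. Replacing one ideal encoder by a real one multiplies the failure probability by a factor
  independent of the block length, so error levels are fixed backwards, from the last encoder to the
  first. Each encoder pays half the logarithm of an innovation variance over the quantization noise;
  these terms telescope. At the lower end of the range of \<open>D\<close> the quantization noise
  would vanish. The upper end forces \<open>D < varX f\<close>, since the entropy power of
  \<open>V\<close> is at most \<open>varX f - mmse\<close>; this makes the noise finite. The lower
  bound needs the entropy of \<open>V\<close> to be a genuine integral, as a Bochner integral
  without integrability is 0. The log-density of \<open>V\<close> contains the logarithm of the
  posterior variance, and finite entropy of \<open>X\<close> controls it from below on average. Both
  rates are infima of sets of reals: one must be shown bounded below, the other nonempty.\<close>

lemma card_residue_class_le:
  assumes "0 < (K::nat)"
  shows "real (card {j' \<in> {..<N}. j' mod K = r}) \<le> real N / real K + 1"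
proof -
  have "card {j' \<in> {..<N}. j' mod K = r} \<le> card {.. N div K}"
  proof (rule card_inj_on_le[where f="\<lambda>j. j div K"])
    show "inj_on (\<lambda>j. j div K) {j' \<in> {..<N}. j' mod K = r}"
      by (rule inj_onI) (metis (mono_tags, lifting) div_mult_mod_eq mem_Collect_eq)
  qed (auto intro: div_le_mono)
  then have "real (card {j' \<in> {..<N}. j' mod K = r}) \<le> real (N div K) + 1" by simp
  also have "real (N div K) \<le> real N / real K" by (rule of_nat_div_le_of_nat)
  finally show ?thesis by simp
qed

text \<open>Derandomisation: it fixes one codebook whose cost does not exceed the codebook average.
  If every value exceeded a finite \<open>b\<close>, the positive function \<open>f x - b\<close>
  would have integral 0.\<close>

lemma (in prob_space) exists_le_nn_integral:
  assumes f: "f \<in> borel_measurable M" and "(\<integral>\<^sup>+x. f x \<partial>M) \<le> b"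
  shows "\<exists>x\<in>space M. f x \<le> b"
proof (cases "b = \<infinity>")
  case True then show ?thesis using not_empty by auto
next
  case False
  show ?thesis
  proof (rule ccontr)
    assume "\<not> ?thesis"
    then have gt: "\<And>x. x \<in> space M \<Longrightarrow> b < f x" by (auto simp: not_le)
    have [measurable]: "f \<in> borel_measurable M" by fact
    have "(\<integral>\<^sup>+x. f x - b \<partial>M) = (\<integral>\<^sup>+x. f x \<partial>M) - (\<integral>\<^sup>+x. b \<partial>M)"
      using False gt by (intro nn_integral_diff) (auto simp: emeasure_space_1 less_imp_le top.not_eq_extremum)
    also have "\<dots> = 0"
      using assms False by (simp add: emeasure_space_1 diff_eq_0_ennreal le_less_trans top.not_eq_extremum)
    finally have "AE x in M. f x - b = 0" by (subst (asm) nn_integral_0_iff_AE) auto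
    then have "AE x in M. False"
      using AE_space
    proof eventually_elim
      case (elim x) then show ?case using gt[of x] by (auto simp: diff_eq_0_iff_ennreal not_less)
    qed
    then show False by simp
  qed
qed

lemma emeasure_PiM_none:
  assumes "prob_space Q" and A: "{e\<in>space Q. acc e} \<in> sets Q"
  shows "emeasure (PiM {..<N::nat} (\<lambda>_. Q)) {\<epsilon>\<in>space (PiM {..<N} (\<lambda>_. Q)). \<forall>j<N. \<not> acc (\<epsilon> j)}
     = (1 - emeasure Q {e\<in>space Q. acc e}) ^ N"
proof -
  interpret Q: prob_space Q by fact
  interpret product_prob_space "\<lambda>_. Q" "{..<N}" by unfold_locales
  have "{\<epsilon>\<in>space (PiM {..<N} (\<lambda>_. Q)). \<forall>j<N. \<not> acc (\<epsilon> j)} = (\<Pi>\<^sub>E j\<in>{..<N}. space Q - {e\<in>space Q. acc e})"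
    by (rule set_eqI, simp add: space_PiM PiE_iff Ball_def, blast)
  then show ?thesis
    using A by (simp add: emeasure_PiM emeasure_compl Q.emeasure_space_1 sets.compl_sets)
qed

lemma nn_integral_PiM_component:
  assumes "prob_space Q" and "j \<in> I" "finite I" and f: "f \<in> borel_measurable Q"
  shows "(\<integral>\<^sup>+\<epsilon>. f (\<epsilon> j) \<partial>PiM I (\<lambda>_. Q)) = (\<integral>\<^sup>+e. f e \<partial>Q)"
proof -
  interpret Q: prob_space Q by fact
  interpret product_prob_space "\<lambda>_. Q" I by unfold_locales
  have "(\<integral>\<^sup>+e. f e \<partial>Q) = (\<integral>\<^sup>+e. f e \<partial>distr (PiM I (\<lambda>_. Q)) Q (\<lambda>\<epsilon>. \<epsilon> j))"
    using PiM_component[OF assms(2)] by simp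
  also have "\<dots> = (\<integral>\<^sup>+\<epsilon>. f (\<epsilon> j) \<partial>PiM I (\<lambda>_. Q))"
    using assms by (intro nn_integral_distr) auto
  finally show ?thesis by simp
qed

text \<open>Padding with the constant 1 at the other coordinates reduces this to the product formula
  over \<open>I\<close>. The collision estimate rests on this independence of two distinct
  codewords.\<close>

lemma nn_integral_PiM_two_components:
  assumes "prob_space Q" and "j \<in> I" "j' \<in> I" "j \<noteq> j'" "finite I"
    and f: "f \<in> borel_measurable Q" and g: "g \<in> borel_measurable Q"
  shows "(\<integral>\<^sup>+\<epsilon>. f (\<epsilon> j) * g (\<epsilon> j') \<partial>PiM I (\<lambda>_. Q)) = (\<integral>\<^sup>+e. f e \<partial>Q) * (\<integral>\<^sup>+e. g e \<partial>Q)"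
proof -
  interpret Q: prob_space Q by fact
  interpret product_prob_space "\<lambda>_. Q" I by unfold_locales
  let ?h = "\<lambda>i e. if i = j then f e else if i = j' then g e else 1"
  have prod2: "(\<Prod>i\<in>I. a i) = a j * a j'" if "\<And>i. i \<in> I - {j, j'} \<Longrightarrow> a i = (1::ennreal)" for a
  proof -
    have "(\<Prod>i\<in>I. a i) = a j * (\<Prod>i\<in>I - {j}. a i)"
      using assms by (intro prod.remove) auto
    also have "(\<Prod>i\<in>I - {j}. a i) = a j' * (\<Prod>i\<in>I - {j} - {j'}. a i)"
      using assms by (intro prod.remove) auto
    also have "(\<Prod>i\<in>I - {j} - {j'}. a i) = 1"
      using that by (intro prod.neutral) auto
    finally show ?thesis by simp
  qed
  have "(\<Prod>i\<in>I. ?h i (\<epsilon> i)) = f (\<epsilon> j) * g (\<epsilon> j')" for \<epsilon>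
    using prod2[of "\<lambda>i. ?h i (\<epsilon> i)"] \<open>j \<noteq> j'\<close> by simp
  then have "(\<integral>\<^sup>+\<epsilon>. f (\<epsilon> j) * g (\<epsilon> j') \<partial>PiM I (\<lambda>_. Q)) = (\<integral>\<^sup>+\<epsilon>. (\<Prod>i\<in>I. ?h i (\<epsilon> i)) \<partial>PiM I (\<lambda>_. Q))"
    by (simp only:)
  also have "\<dots> = (\<Prod>i\<in>I. \<integral>\<^sup>+e. ?h i e \<partial>Q)"
  proof (rule product_nn_integral_prod[OF \<open>finite I\<close>])
    show "?h i \<in> borel_measurable Q" for i
      using f g by (cases "i = j"; cases "i = j'") auto
  qed
  also have "\<dots> = (\<integral>\<^sup>+e. f e \<partial>Q) * (\<integral>\<^sup>+e. g e \<partial>Q)"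
    using prod2[of "\<lambda>i. \<integral>\<^sup>+e. ?h i e \<partial>Q"] \<open>j \<noteq> j'\<close> Q.emeasure_space_1 by simp
  finally show ?thesis .
qed


text \<open>The four summands account for an atypical observation, no acceptable codeword, the ideal cost of an
  acceptable codeword which the side information \<open>c\<close> should also mark as close, and a confusable
  codeword in the same bin. The factor \<open>of_nat N\<close> in the third summand is harmless because acceptable
  codewords have probability of order \<open>1 / N\<close>.\<close>

lemma one_shot_random_binning:
  fixes P :: "'w measure" and Q :: "'e measure" and MY :: "'y measure"
    and y :: "'w \<Rightarrow> 'y" and c :: "'w \<Rightarrow> 'c" and \<Phi> :: "'w \<Rightarrow> 'e \<Rightarrow> ennreal"
    and acc :: "'y \<Rightarrow> 'e \<Rightarrow> bool" and close :: "'c \<Rightarrow> 'e \<Rightarrow> bool" and B p p' s :: real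
  assumes "prob_space P" "prob_space Q"
    and y[measurable]: "y \<in> measurable P MY"
    and acc[measurable]: "Measurable.pred (MY \<Otimes>\<^sub>M Q) (\<lambda>x. acc (fst x) (snd x))"
    and close[measurable]: "Measurable.pred (P \<Otimes>\<^sub>M Q) (\<lambda>x. close (c (fst x)) (snd x))"
    and \<Phi>[measurable]: "(\<lambda>x. \<Phi> (fst x) (snd x)) \<in> borel_measurable (P \<Otimes>\<^sub>M Q)"
    and \<Phi>_le: "\<And>\<omega> e. \<Phi> \<omega> e \<le> ennreal B"
    and G[measurable]: "G \<in> sets MY"
    and acc_ge: "\<And>y. y \<in> G \<Longrightarrow> ennreal p \<le> emeasure Q {e\<in>space Q. acc y e}"
    and acc_le: "\<And>y. y \<in> space MY \<Longrightarrow> emeasure Q {e\<in>space Q. acc y e} \<le> ennreal p'"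
    and close_le: "\<And>\<omega>. \<omega> \<in> space P \<Longrightarrow> emeasure Q {e\<in>space Q. close (c \<omega>) e} \<le> ennreal s"
    and pos: "0 < K" "0 < N" "0 \<le> B" "0 \<le> p'" "0 \<le> s"
  shows "\<exists>enc dec. enc \<in> measurable MY (count_space UNIV) \<and> (\<forall>y. enc y < (K::nat)) \<and> (\<forall>b c. dec b c \<in> space Q) \<and>
    (\<integral>\<^sup>+\<omega>. \<Phi> \<omega> (dec (enc (y \<omega>)) (c \<omega>)) \<partial>P) \<le>
      B * emeasure P {\<omega>\<in>space P. y \<omega> \<notin> G} + B * (1 - ennreal p) ^ N
      + of_nat N * (\<integral>\<^sup>+\<omega>. \<integral>\<^sup>+e. (if acc (y \<omega>) e then \<Phi> \<omega> e + (if close (c \<omega>) e then 0 else ennreal B) else 0) \<partial>Q \<partial>P)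
      + ennreal (B * (N * p' * ((real N / real K + 1) * s)))"
proof -
  interpret P: prob_space P by fact
  interpret Q: prob_space Q by fact
  \<comment> \<open>A codebook is a vector of \<open>N\<close> independent draws from
    \<open>Q\<close>. The bin of codeword \<open>j\<close> is \<open>j mod K\<close>, so
    \<open>S j\<close> below lists its rivals in the same bin.\<close>
  define C where "C = PiM {..<N} (\<lambda>_. Q)"
  interpret C: prob_space C unfolding C_def by (intro prob_space_PiM \<open>prob_space Q\<close>)
  interpret PC: pair_sigma_finite P C ..
  define af where "af = (\<lambda>y e. if acc y e then 1 else 0 :: ennreal)"
  define cf where "cf = (\<lambda>\<omega> e. if close (c \<omega>) e then 1 else 0 :: ennreal)"
  define T3 where "T3 = (\<lambda>\<omega> e. (if acc (y \<omega>) e then \<Phi> \<omega> e + (if close (c \<omega>) e then 0 else ennreal B) else 0))"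
  define S where "S = (\<lambda>j. {j'\<in>{..<N}. j' mod K = j mod K} - {j})"
  define none where "none = (\<lambda>y \<epsilon>. \<forall>j<N. \<not> acc y (\<epsilon> j))"
  \<comment> \<open>\<open>r\<close> dominates the cost for every codebook. Its two sums involve one
    and two codewords at a time, so their codebook averages reduce to integrals over
    \<open>Q\<close>.\<close>
  define r where "r = (\<lambda>\<omega> \<epsilon>. (if y \<omega> \<notin> G then ennreal B else 0)
     + (if y \<omega> \<in> G \<and> none (y \<omega>) \<epsilon> then ennreal B else 0)
     + (\<Sum>j<N. T3 \<omega> (\<epsilon> j)) + (\<Sum>j<N. \<Sum>j'\<in>S j. B * (af (y \<omega>) (\<epsilon> j) * cf \<omega> (\<epsilon> j'))))"
  have comp[measurable]: "(\<lambda>x. snd x j) \<in> measurable (P \<Otimes>\<^sub>M C) Q" if "j < N" for j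
    using that unfolding C_def by (intro measurable_compose[OF measurable_snd measurable_component_singleton]) auto
  have accj[measurable]: "Measurable.pred (P \<Otimes>\<^sub>M C) (\<lambda>x. acc (y (fst x)) (snd x j))" if "j < N" for j
  proof -
    have "(\<lambda>x. (y (fst x), snd x j)) \<in> measurable (P \<Otimes>\<^sub>M C) (MY \<Otimes>\<^sub>M Q)"
      using comp[OF that] by measurable
    from measurable_compose[OF this acc] show ?thesis by simp
  qed
  have closej[measurable]: "Measurable.pred (P \<Otimes>\<^sub>M C) (\<lambda>x. close (c (fst x)) (snd x j))" if "j < N" for j
  proof -
    have "(\<lambda>x. (fst x, snd x j)) \<in> measurable (P \<Otimes>\<^sub>M C) (P \<Otimes>\<^sub>M Q)"
      using comp[OF that] by measurable
    from measurable_compose[OF this close] show ?thesis by simp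
  qed
  have \<Phi>j[measurable]: "(\<lambda>x. \<Phi> (fst x) (snd x j)) \<in> borel_measurable (P \<Otimes>\<^sub>M C)" if "j < N" for j
  proof -
    have "(\<lambda>x. (fst x, snd x j)) \<in> measurable (P \<Otimes>\<^sub>M C) (P \<Otimes>\<^sub>M Q)"
      using comp[OF that] by measurable
    from measurable_compose[OF this \<Phi>] show ?thesis by simp
  qed
  have none_meas[measurable]: "Measurable.pred (P \<Otimes>\<^sub>M C) (\<lambda>x. none (y (fst x)) (snd x))"
  proof -
    have "Measurable.pred (P \<Otimes>\<^sub>M C) (\<lambda>x. j < N \<longrightarrow> \<not> acc (y (fst x)) (snd x j))" for j
      by (cases "j < N") auto
    then show ?thesis unfolding none_def by measurable
  qed
  have r_meas[measurable]: "(\<lambda>x. r (fst x) (snd x)) \<in> borel_measurable (P \<Otimes>\<^sub>M C)"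
  proof -
    have 1: "(\<lambda>x. T3 (fst x) (snd x j)) \<in> borel_measurable (P \<Otimes>\<^sub>M C)" if "j < N" for j
      unfolding T3_def using that by measurable
    have 2: "(\<lambda>x. B * (af (y (fst x)) (snd x j) * cf (fst x) (snd x j'))) \<in> borel_measurable (P \<Otimes>\<^sub>M C)"
      if "j < N" "j' < N" for j j'
      unfolding af_def cf_def using that by measurable
    have 3: "(\<lambda>x. \<Sum>j<N. T3 (fst x) (snd x j)) \<in> borel_measurable (P \<Otimes>\<^sub>M C)"
      using 1 by (intro borel_measurable_sum) auto
    have 4: "(\<lambda>x. \<Sum>j<N. \<Sum>j'\<in>S j. B * (af (y (fst x)) (snd x j) * cf (fst x) (snd x j'))) \<in> borel_measurable (P \<Otimes>\<^sub>M C)"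
      using 2 by (intro borel_measurable_sum) (auto simp: S_def)
    show ?thesis unfolding r_def using 3 4 by measurable
  qed
  have sec1: "{e\<in>space Q. acc v e} \<in> sets Q" if "v \<in> space MY" for v
    using measurable_compose[OF measurable_Pair1'[OF that, of Q] acc] by simp
  have sec1f: "af v \<in> borel_measurable Q" if "v \<in> space MY" for v
    using sec1[OF that] unfolding af_def by measurable
  have sec2: "Measurable.pred Q (\<lambda>e. close (c \<omega>) e)" if "\<omega> \<in> space P" for \<omega>
    using measurable_compose[OF measurable_Pair1'[OF that, of Q] close] by simp
  have sec2f: "cf \<omega> \<in> borel_measurable Q" if "\<omega> \<in> space P" for \<omega>
    using sec2[OF that] unfolding cf_def by measurable
  have sec3f: "T3 \<omega> \<in> borel_measurable Q" if "\<omega> \<in> space P" for \<omega>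
    using measurable_compose[OF measurable_Pair1'[OF that, of Q] \<Phi>] sec2[OF that]
      sec1[OF measurable_space[OF y that]] unfolding T3_def by simp
  have int_af: "(\<integral>\<^sup>+e. af v e \<partial>Q) \<le> ennreal p'" if "v \<in> space MY" for v
  proof -
    have "(\<integral>\<^sup>+e. af v e \<partial>Q) = (\<integral>\<^sup>+e. indicator {e\<in>space Q. acc v e} e \<partial>Q)"
      by (intro nn_integral_cong) (auto simp: af_def)
    then show ?thesis using sec1[OF that] acc_le[OF that] by simp
  qed
  have int_cf: "(\<integral>\<^sup>+e. cf \<omega> e \<partial>Q) \<le> ennreal s" if "\<omega> \<in> space P" for \<omega>
  proof -
    have "(\<integral>\<^sup>+e. cf \<omega> e \<partial>Q) = (\<integral>\<^sup>+e. indicator {e\<in>space Q. close (c \<omega>) e} e \<partial>Q)"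
      by (intro nn_integral_cong) (auto simp: cf_def)
    then show ?thesis using sec2[OF that] close_le[OF that] by simp
  qed
  have card_S: "real (card (S j)) \<le> real N / real K + 1" for j
  proof -
    have "card (S j) \<le> card {j'\<in>{..<N}. j' mod K = j mod K}"
      unfolding S_def by (intro card_mono) auto
    then show ?thesis using card_residue_class_le[OF pos(1), of N "j mod K"] by linarith
  qed
  have int_r: "(\<integral>\<^sup>+\<epsilon>. r \<omega> \<epsilon> \<partial>C) \<le> (if y \<omega> \<notin> G then ennreal B else 0) + B * (1 - ennreal p) ^ N
      + of_nat N * (\<integral>\<^sup>+e. T3 \<omega> e \<partial>Q) + ennreal (B * (N * p' * ((real N / real K + 1) * s)))"
    if \<omega>: "\<omega> \<in> space P" for \<omega>
  proof -
    have y\<omega>: "y \<omega> \<in> space MY" using measurable_space[OF y \<omega>] .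
    have pair: "(\<lambda>\<epsilon>. (\<omega>, \<epsilon>)) \<in> measurable C (P \<Otimes>\<^sub>M C)" using measurable_Pair1'[OF \<omega>] .
    have [measurable]: "Measurable.pred C (none (y \<omega>))"
      using measurable_compose[OF pair none_meas] by simp
    have cj: "(\<lambda>\<epsilon>. \<epsilon> j) \<in> measurable C Q" if "j < N" for j
      using that unfolding C_def by (intro measurable_component_singleton) auto
    have m1: "(\<lambda>\<epsilon>. T3 \<omega> (\<epsilon> j)) \<in> borel_measurable C" if "j < N" for j
      using measurable_compose[OF cj[OF that] sec3f[OF \<omega>]] .
    have m2: "(\<lambda>\<epsilon>. af (y \<omega>) (\<epsilon> j)) \<in> borel_measurable C" if "j < N" for j
      using measurable_compose[OF cj[OF that] sec1f[OF y\<omega>]] .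
    have m3: "(\<lambda>\<epsilon>. cf \<omega> (\<epsilon> j)) \<in> borel_measurable C" if "j < N" for j
      using measurable_compose[OF cj[OF that] sec2f[OF \<omega>]] .
    have S_lt: "j' < N" if "j' \<in> S j" for j j' using that by (auto simp: S_def)
    have "(\<integral>\<^sup>+\<epsilon>. r \<omega> \<epsilon> \<partial>C) = (\<integral>\<^sup>+\<epsilon>. (if y \<omega> \<notin> G then ennreal B else 0) \<partial>C)
      + (\<integral>\<^sup>+\<epsilon>. (if y \<omega> \<in> G \<and> none (y \<omega>) \<epsilon> then ennreal B else 0) \<partial>C)
      + (\<Sum>j<N. \<integral>\<^sup>+\<epsilon>. T3 \<omega> (\<epsilon> j) \<partial>C) + (\<Sum>j<N. \<Sum>j'\<in>S j. B * (\<integral>\<^sup>+\<epsilon>. af (y \<omega>) (\<epsilon> j) * cf \<omega> (\<epsilon> j') \<partial>C))"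
    proof -
      have b1: "(\<lambda>\<epsilon>. if y \<omega> \<in> G \<and> none (y \<omega>) \<epsilon> then ennreal B else 0) \<in> borel_measurable C"
        by measurable
      have b2: "(\<lambda>\<epsilon>. \<Sum>j<N. T3 \<omega> (\<epsilon> j)) \<in> borel_measurable C"
        using m1 by (intro borel_measurable_sum) auto
      have b3: "(\<lambda>\<epsilon>. af (y \<omega>) (\<epsilon> j) * cf \<omega> (\<epsilon> j')) \<in> borel_measurable C" if "j < N" "j' < N" for j j'
        using m2[OF that(1)] m3[OF that(2)] by measurable
      have b4: "(\<lambda>\<epsilon>. B * (af (y \<omega>) (\<epsilon> j) * cf \<omega> (\<epsilon> j'))) \<in> borel_measurable C" if "j < N" "j' < N" for j j'
        using b3[OF that] by measurable
      have b5: "(\<lambda>\<epsilon>. \<Sum>j'\<in>S j. B * (af (y \<omega>) (\<epsilon> j) * cf \<omega> (\<epsilon> j'))) \<in> borel_measurable C" if "j < N" for j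
        using b4[OF that] S_lt by (intro borel_measurable_sum) auto
      have b6: "(\<lambda>\<epsilon>. \<Sum>j<N. \<Sum>j'\<in>S j. B * (af (y \<omega>) (\<epsilon> j) * cf \<omega> (\<epsilon> j'))) \<in> borel_measurable C"
        by (rule borel_measurable_sum) (use b5 in auto)
      have i2: "(\<integral>\<^sup>+\<epsilon>. (\<Sum>j<N. T3 \<omega> (\<epsilon> j)) \<partial>C) = (\<Sum>j<N. \<integral>\<^sup>+\<epsilon>. T3 \<omega> (\<epsilon> j) \<partial>C)"
        using m1 by (intro nn_integral_sum) auto
      have i4: "(\<integral>\<^sup>+\<epsilon>. (\<Sum>j'\<in>S j. B * (af (y \<omega>) (\<epsilon> j) * cf \<omega> (\<epsilon> j'))) \<partial>C) =
          (\<Sum>j'\<in>S j. B * (\<integral>\<^sup>+\<epsilon>. af (y \<omega>) (\<epsilon> j) * cf \<omega> (\<epsilon> j') \<partial>C))" if "j < N" for j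
      proof -
        have "(\<integral>\<^sup>+\<epsilon>. (\<Sum>j'\<in>S j. B * (af (y \<omega>) (\<epsilon> j) * cf \<omega> (\<epsilon> j'))) \<partial>C) =
          (\<Sum>j'\<in>S j. \<integral>\<^sup>+\<epsilon>. B * (af (y \<omega>) (\<epsilon> j) * cf \<omega> (\<epsilon> j')) \<partial>C)"
          using b4[OF that] S_lt by (intro nn_integral_sum) auto
        also have "\<dots> = (\<Sum>j'\<in>S j. B * (\<integral>\<^sup>+\<epsilon>. af (y \<omega>) (\<epsilon> j) * cf \<omega> (\<epsilon> j') \<partial>C))"
          using b3[OF that] S_lt by (intro sum.cong refl nn_integral_cmult) auto
        finally show ?thesis .
      qed
      have i6: "(\<integral>\<^sup>+\<epsilon>. (\<Sum>j<N. \<Sum>j'\<in>S j. B * (af (y \<omega>) (\<epsilon> j) * cf \<omega> (\<epsilon> j'))) \<partial>C) =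
          (\<Sum>j<N. \<Sum>j'\<in>S j. B * (\<integral>\<^sup>+\<epsilon>. af (y \<omega>) (\<epsilon> j) * cf \<omega> (\<epsilon> j') \<partial>C))"
        using b5 i4 by (subst nn_integral_sum) (auto intro!: sum.cong)
      show ?thesis
        unfolding r_def i2[symmetric] i6[symmetric] using b1 b2 b6
        by (simp add: nn_integral_add)
    qed
    also have "(\<integral>\<^sup>+\<epsilon>. (if y \<omega> \<notin> G then ennreal B else 0) \<partial>C) = (if y \<omega> \<notin> G then ennreal B else 0)"
      by (simp add: C.emeasure_space_1)
    also have "(\<integral>\<^sup>+\<epsilon>. (if y \<omega> \<in> G \<and> none (y \<omega>) \<epsilon> then ennreal B else 0) \<partial>C) \<le> B * (1 - ennreal p) ^ N"
    proof (cases "y \<omega> \<in> G")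
      case True
      have "(\<integral>\<^sup>+\<epsilon>. (if y \<omega> \<in> G \<and> none (y \<omega>) \<epsilon> then ennreal B else 0) \<partial>C)
         = (\<integral>\<^sup>+\<epsilon>. ennreal B * indicator {\<epsilon>\<in>space C. none (y \<omega>) \<epsilon>} \<epsilon> \<partial>C)"
        using True by (intro nn_integral_cong) auto
      also have "\<dots> = B * emeasure C {\<epsilon>\<in>space C. none (y \<omega>) \<epsilon>}"
        by (intro nn_integral_cmult_indicator) measurable
      also have "emeasure C {\<epsilon>\<in>space C. none (y \<omega>) \<epsilon>} = (1 - emeasure Q {e\<in>space Q. acc (y \<omega>) e}) ^ N"
        unfolding C_def none_def by (intro emeasure_PiM_none \<open>prob_space Q\<close> sec1 y\<omega>)
      also have "\<dots> \<le> (1 - ennreal p) ^ N"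
        by (intro power_mono ennreal_minus_mono acc_ge True) auto
      finally show ?thesis by (simp add: mult_left_mono)
    qed simp
    also have "(\<Sum>j<N. \<integral>\<^sup>+\<epsilon>. T3 \<omega> (\<epsilon> j) \<partial>C) = of_nat N * (\<integral>\<^sup>+e. T3 \<omega> e \<partial>Q)"
      using sec3f[OF \<omega>] \<open>prob_space Q\<close> unfolding C_def by (simp add: nn_integral_PiM_component)
    also have "(\<Sum>j<N. \<Sum>j'\<in>S j. B * (\<integral>\<^sup>+\<epsilon>. af (y \<omega>) (\<epsilon> j) * cf \<omega> (\<epsilon> j') \<partial>C)) \<le> (\<Sum>j<N. \<Sum>j'\<in>S j. ennreal (B * (p' * s)))"
    proof (intro sum_mono)
      fix j j' assume j: "j \<in> {..<N}" "j' \<in> S j"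
      have "(\<integral>\<^sup>+\<epsilon>. af (y \<omega>) (\<epsilon> j) * cf \<omega> (\<epsilon> j') \<partial>C) = (\<integral>\<^sup>+e. af (y \<omega>) e \<partial>Q) * (\<integral>\<^sup>+e. cf \<omega> e \<partial>Q)"
        unfolding C_def using j
        by (intro nn_integral_PiM_two_components \<open>prob_space Q\<close> sec1f[OF y\<omega>] sec2f[OF \<omega>]) (auto simp: S_def)
      also have "\<dots> \<le> ennreal p' * ennreal s"
        by (intro mult_mono int_af int_cf y\<omega> \<omega>) auto
      finally show "B * (\<integral>\<^sup>+\<epsilon>. af (y \<omega>) (\<epsilon> j) * cf \<omega> (\<epsilon> j') \<partial>C) \<le> ennreal (B * (p' * s))"
        using pos by (simp add: ennreal_mult mult_left_mono)
    qed
    also have "(\<Sum>j<N. \<Sum>j'\<in>S j. ennreal (B * (p' * s))) = ennreal (\<Sum>j<N. real (card (S j)) * (B * (p' * s)))"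
    proof -
      have "0 \<le> B * (p' * s)" using pos by simp
      then have "(\<Sum>j'\<in>S j. ennreal (B * (p' * s))) = ennreal (real (card (S j)) * (B * (p' * s)))" for j
        by (subst sum_ennreal) simp_all
      then show ?thesis using pos by (simp only:) (intro sum_ennreal mult_nonneg_nonneg, simp_all)
    qed
    also have "\<dots> \<le> ennreal (\<Sum>j<N. (real N / real K + 1) * (B * (p' * s)))"
      using pos by (intro ennreal_leI sum_mono mult_right_mono card_S) auto
    also have "(\<Sum>j<N. (real N / real K + 1) * (B * (p' * s))) = B * (N * p' * ((real N / real K + 1) * s))"
      by simp
    finally show ?thesis by (simp add: add_mono)
  qed
  have "(\<integral>\<^sup>+\<epsilon>. \<integral>\<^sup>+\<omega>. r \<omega> \<epsilon> \<partial>P \<partial>C) = (\<integral>\<^sup>+\<omega>. \<integral>\<^sup>+\<epsilon>. r \<omega> \<epsilon> \<partial>C \<partial>P)"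
    using PC.Fubini'[of r] r_meas by (simp add: split_beta')
  also have "\<dots> \<le> (\<integral>\<^sup>+\<omega>. (if y \<omega> \<notin> G then ennreal B else 0) + B * (1 - ennreal p) ^ N
      + of_nat N * (\<integral>\<^sup>+e. T3 \<omega> e \<partial>Q) + ennreal (B * (N * p' * ((real N / real K + 1) * s))) \<partial>P)"
    using int_r by (intro nn_integral_mono) 
  also have "\<dots> = B * emeasure P {\<omega>\<in>space P. y \<omega> \<notin> G} + B * (1 - ennreal p) ^ N
      + of_nat N * (\<integral>\<^sup>+\<omega>. \<integral>\<^sup>+e. T3 \<omega> e \<partial>Q \<partial>P) + ennreal (B * (N * p' * ((real N / real K + 1) * s)))"
  proof -
    have [measurable]: "(\<lambda>x. T3 (fst x) (snd x)) \<in> borel_measurable (P \<Otimes>\<^sub>M Q)"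
      unfolding T3_def
      using measurable_compose[of "\<lambda>x. (y (fst x), snd x)" "P \<Otimes>\<^sub>M Q" "MY \<Otimes>\<^sub>M Q", OF _ acc] by simp
    have [measurable]: "(\<lambda>\<omega>. \<integral>\<^sup>+e. T3 \<omega> e \<partial>Q) \<in> borel_measurable P"
      using Q.borel_measurable_nn_integral[of T3 P] by (simp add: split_beta')
    have "(\<integral>\<^sup>+\<omega>. (if y \<omega> \<notin> G then ennreal B else 0) \<partial>P) = (\<integral>\<^sup>+\<omega>. ennreal B * indicator {\<omega>\<in>space P. y \<omega> \<notin> G} \<omega> \<partial>P)"
      by (intro nn_integral_cong) auto
    also have "\<dots> = B * emeasure P {\<omega>\<in>space P. y \<omega> \<notin> G}"
      by (intro nn_integral_cmult_indicator) measurable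
    finally have 1: "(\<integral>\<^sup>+\<omega>. (if y \<omega> \<notin> G then ennreal B else 0) \<partial>P) = B * emeasure P {\<omega>\<in>space P. y \<omega> \<notin> G}" .
    show ?thesis
      by (simp add: nn_integral_add nn_integral_cmult 1 P.emeasure_space_1)
  qed
  finally have le: "(\<integral>\<^sup>+\<epsilon>. \<integral>\<^sup>+\<omega>. r \<omega> \<epsilon> \<partial>P \<partial>C) \<le> \<dots>" .
  have "(\<lambda>\<epsilon>. \<integral>\<^sup>+\<omega>. r \<omega> \<epsilon> \<partial>P) \<in> borel_measurable C"
    using P.borel_measurable_nn_integral[of "\<lambda>\<epsilon> \<omega>. r \<omega> \<epsilon>" C] measurable_compose[OF measurable_pair_swap' r_meas]
    by (simp add: split_beta')
  from C.exists_le_nn_integral[OF this le] obtain \<epsilon> where \<epsilon>: "\<epsilon> \<in> space C"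
    and r_le: "(\<integral>\<^sup>+\<omega>. r \<omega> \<epsilon> \<partial>P) \<le> B * emeasure P {\<omega>\<in>space P. y \<omega> \<notin> G} + B * (1 - ennreal p) ^ N
      + of_nat N * (\<integral>\<^sup>+\<omega>. \<integral>\<^sup>+e. T3 \<omega> e \<partial>Q \<partial>P) + ennreal (B * (N * p' * ((real N / real K + 1) * s)))"
    by blast
  have \<epsilon>Q: "\<epsilon> j \<in> space Q" if "j < N" for j
    using \<epsilon> that by (auto simp: C_def space_PiM PiE_iff)
  define J where "J = (\<lambda>y. LEAST j. j < N \<and> acc y (\<epsilon> j))"
  define enc where "enc = (\<lambda>y. if none y \<epsilon> then 0 else J y mod K)"
  define jd where "jd = (\<lambda>b c. LEAST j. j < N \<and> j mod K = b \<and> close c (\<epsilon> j))"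
  \<comment> \<open>The fallback \<open>\<epsilon> 0\<close> exists because \<open>0 < N\<close>; it
    keeps every decoder value inside \<open>space Q\<close>.\<close>
  define dec where "dec = (\<lambda>b c. if \<exists>j<N. j mod K = b \<and> close c (\<epsilon> j) then \<epsilon> (jd b c) else \<epsilon> 0)"
  have acc\<epsilon>[measurable]: "Measurable.pred MY (\<lambda>y. acc y (\<epsilon> j))" if "j < N" for j
    using measurable_compose[OF measurable_Pair2'[OF \<epsilon>Q[OF that], of MY] acc] by simp
  have "enc \<in> measurable MY (count_space UNIV)"
  proof -
    have [measurable]: "Measurable.pred MY (\<lambda>y. j < N \<and> acc y (\<epsilon> j))" for j
      by (cases "j < N") auto
    have [measurable]: "J \<in> measurable MY (count_space UNIV)" unfolding J_def by measurable
    have "Measurable.pred MY (\<lambda>y. j < N \<longrightarrow> \<not> acc y (\<epsilon> j))" for j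
      by (cases "j < N") auto
    then have [measurable]: "Measurable.pred MY (\<lambda>y. none y \<epsilon>)" unfolding none_def by measurable
    show ?thesis unfolding enc_def by measurable
  qed
  moreover have "\<forall>y. enc y < K" using pos by (simp add: enc_def)
  moreover have "\<forall>b c. dec b c \<in> space Q"
  proof (intro allI)
    fix b c show "dec b c \<in> space Q"
    proof (cases "\<exists>j<N. j mod K = b \<and> close c (\<epsilon> j)")
      case True
      then have "jd b c < N" unfolding jd_def by (metis (mono_tags, lifting) LeastI_ex)
      then show ?thesis using True by (simp add: dec_def \<epsilon>Q)
    next
      case False then show ?thesis using \<epsilon>Q[OF pos(2)] by (simp only: dec_def if_False)
    qed
  qed
  \<comment> \<open>The delicate case: the encoder's codeword is close, yet the decoder returns a
    different one. That one is close and shares the bin, so the double sum contains a term equal to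
    \<open>B\<close>. If the encoder's codeword is not close, the penalty inside \<open>T3\<close>
    already pays \<open>B\<close>.\<close>
  moreover have "\<Phi> \<omega> (dec (enc (y \<omega>)) (c \<omega>)) \<le> r \<omega> \<epsilon>" for \<omega>
  proof -
    let ?x = "dec (enc (y \<omega>)) (c \<omega>)"
    consider "y \<omega> \<notin> G" | "y \<omega> \<in> G" "none (y \<omega>) \<epsilon>" | "\<not> none (y \<omega>) \<epsilon>" by blast
    then show ?thesis
    proof cases
      case 1 then show ?thesis using \<Phi>_le[of \<omega> ?x] unfolding r_def
        by (simp add: add.assoc add_increasing2)
    next
      case 2 then show ?thesis using \<Phi>_le[of \<omega> ?x] unfolding r_def
        by (simp add: add.assoc add_increasing2)
    next
      case 3
      then have J: "J (y \<omega>) < N \<and> acc (y \<omega>) (\<epsilon> (J (y \<omega>)))"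
        unfolding J_def none_def by (metis (mono_tags, lifting) LeastI_ex)
      let ?j = "J (y \<omega>)"
      have b: "enc (y \<omega>) = ?j mod K" using 3 by (simp add: enc_def)
      have r3: "T3 \<omega> (\<epsilon> ?j) \<le> r \<omega> \<epsilon>"
      proof -
        have "T3 \<omega> (\<epsilon> ?j) \<le> (\<Sum>j<N. T3 \<omega> (\<epsilon> j))"
          using J by (intro member_le_sum) auto
        also have "\<dots> \<le> r \<omega> \<epsilon>" unfolding r_def by (simp add: add.assoc add_increasing add_increasing2)
        finally show ?thesis .
      qed
      show ?thesis
      proof (cases "close (c \<omega>) (\<epsilon> ?j)")
        case False
        then have "ennreal B \<le> T3 \<omega> (\<epsilon> ?j)" using J by (simp add: T3_def add_increasing)
        then show ?thesis using r3 \<Phi>_le[of \<omega> ?x] by (meson order_trans)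
      next
        case True
        then have ex: "\<exists>j<N. j mod K = ?j mod K \<and> close (c \<omega>) (\<epsilon> j)" using J by blast
        let ?k = "jd (?j mod K) (c \<omega>)"
        have k: "?k < N \<and> ?k mod K = ?j mod K \<and> close (c \<omega>) (\<epsilon> ?k)"
          using ex unfolding jd_def by (metis (mono_tags, lifting) LeastI_ex)
        have x: "?x = \<epsilon> ?k" using ex by (simp add: dec_def b)
        show ?thesis
        proof (cases "?k = ?j")
          case True
          then show ?thesis using r3 J x by (simp add: T3_def) (metis add_increasing2 order_trans zero_le order_refl)
        next
          case False
          then have kS: "?k \<in> S ?j" using k by (auto simp: S_def)
          have "ennreal B = B * (af (y \<omega>) (\<epsilon> ?j) * cf \<omega> (\<epsilon> ?k))" using J k by (simp add: af_def cf_def)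
          also have "\<dots> \<le> (\<Sum>j'\<in>S ?j. B * (af (y \<omega>) (\<epsilon> ?j) * cf \<omega> (\<epsilon> j')))"
            using kS by (intro member_le_sum) (auto simp: S_def)
          also have "\<dots> \<le> (\<Sum>j<N. \<Sum>j'\<in>S j. B * (af (y \<omega>) (\<epsilon> j) * cf \<omega> (\<epsilon> j')))"
            using J by (intro member_le_sum[where f="\<lambda>j. \<Sum>j'\<in>S j. B * (af (y \<omega>) (\<epsilon> j) * cf \<omega> (\<epsilon> j'))"]) auto
          also have "\<dots> \<le> r \<omega> \<epsilon>" unfolding r_def by (simp add: add_increasing)
          finally show ?thesis using \<Phi>_le[of \<omega> ?x] by (meson order_trans)
        qed
      qed
    qed
  qed
  then have "(\<integral>\<^sup>+\<omega>. \<Phi> \<omega> (dec (enc (y \<omega>)) (c \<omega>)) \<partial>P) \<le> (\<integral>\<^sup>+\<omega>. r \<omega> \<epsilon> \<partial>P)"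
    by (intro nn_integral_mono)
  ultimately show ?thesis using r_le unfolding T3_def by (intro exI[of _ enc] exI[of _ dec]) auto
qed

subsection \<open>Gaussian quantization by rejection sampling\<close>

lemma PiM_density:
  assumes I: "finite I" and d: "\<And>i. i \<in> I \<Longrightarrow> d i \<in> borel_measurable lborel"
    and prob: "\<And>i. prob_space (density lborel (d i))"
  shows "PiM I (\<lambda>i. density lborel (d i)) = density (PiM I (\<lambda>_. lborel)) (\<lambda>x. \<Prod>i\<in>I. d i (x i :: real) :: ennreal)"
proof -
  interpret D: product_sigma_finite "\<lambda>i. density lborel (d i)"
    by (intro product_sigma_finite.intro prob_space_imp_sigma_finite prob)
  interpret L: product_sigma_finite "\<lambda>i. lborel :: real measure"
    by (intro product_sigma_finite.intro) unfold_locales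
  have m[measurable]: "(\<lambda>x. \<Prod>i\<in>I. d i (x i)) \<in> borel_measurable (PiM I (\<lambda>_. lborel))"
    using d by (intro borel_measurable_prod_ennreal) (auto intro!: measurable_compose[OF measurable_component_singleton])
  show ?thesis
  proof (rule D.PiM_eqI[OF I, symmetric])
    show "sets (density (PiM I (\<lambda>_. lborel)) (\<lambda>x. \<Prod>i\<in>I. d i (x i))) = sets (PiM I (\<lambda>i. density lborel (d i)))"
      by (simp cong: sets_PiM_cong)
    fix A assume A: "\<And>i. i \<in> I \<Longrightarrow> A i \<in> sets (density lborel (d i))"
    have Am: "Pi\<^sub>E I A \<in> sets (PiM I (\<lambda>_. lborel :: real measure))"
      using A I by (intro sets_PiM_I_finite) auto
    have "emeasure (density (PiM I (\<lambda>_. lborel)) (\<lambda>x. \<Prod>i\<in>I. d i (x i))) (Pi\<^sub>E I A)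
       = (\<integral>\<^sup>+x. (\<Prod>i\<in>I. d i (x i)) * indicator (Pi\<^sub>E I A) x \<partial>PiM I (\<lambda>_. lborel))"
      using Am by (intro emeasure_density) auto
    also have "\<dots> = (\<integral>\<^sup>+x. (\<Prod>i\<in>I. d i (x i) * indicator (A i) (x i)) \<partial>PiM I (\<lambda>_. lborel))"
    proof (intro nn_integral_cong)
      fix x :: "'a \<Rightarrow> real" assume x: "x \<in> space (PiM I (\<lambda>_. lborel))"
      have "indicator (Pi\<^sub>E I A) x = (\<Prod>i\<in>I. indicator (A i) (x i) :: ennreal)"
      proof (cases "x \<in> Pi\<^sub>E I A")
        case True then show ?thesis by (auto simp: PiE_iff)
      next
        case False
        then obtain i where "i \<in> I" "x i \<notin> A i" using x by (auto simp: space_PiM PiE_iff)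
        then have "(\<Prod>i\<in>I. indicator (A i) (x i) :: ennreal) = 0" using I by (intro prod_zero bexI[of _ i]) auto
        then show ?thesis using False by simp
      qed
      then show "(\<Prod>i\<in>I. d i (x i)) * indicator (Pi\<^sub>E I A) x = (\<Prod>i\<in>I. d i (x i) * indicator (A i) (x i))"
        by (simp add: prod.distrib)
    qed
    also have "\<dots> = (\<Prod>i\<in>I. \<integral>\<^sup>+x. d i x * indicator (A i) x \<partial>lborel)"
      using I d A by (intro L.product_nn_integral_prod) (auto intro!: borel_measurable_times_ennreal)
    also have "\<dots> = (\<Prod>i\<in>I. emeasure (density lborel (d i)) (A i))"
      using d A by (intro prod.cong refl emeasure_density[symmetric]) auto
    finally show "emeasure (density (PiM I (\<lambda>_. lborel)) (\<lambda>x. \<Prod>i\<in>I. d i (x i))) (Pi\<^sub>E I A) =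
        (\<Prod>i\<in>I. emeasure (density lborel (d i)) (A i))" .
  qed
qed

lemma distr_PiM_componentwise:
  assumes I: "finite I" and M: "\<And>i. prob_space (M i)" and f: "\<And>i. f i \<in> measurable (M i) (N i)"
  shows "distr (PiM I M) (PiM I N) (\<lambda>x. \<lambda>i\<in>I. f i (x i)) = PiM I (\<lambda>i. distr (M i) (N i) (f i))"
proof -
  have pr: "prob_space (distr (M i) (N i) (f i))" for i
    using prob_space.prob_space_distr[OF M f] .
  interpret D: product_sigma_finite "\<lambda>i. distr (M i) (N i) (f i)"
    by (intro product_sigma_finite.intro prob_space_imp_sigma_finite pr)
  interpret M: product_sigma_finite M
    by (intro product_sigma_finite.intro prob_space_imp_sigma_finite M)
  have fm[measurable]: "(\<lambda>x. \<lambda>i\<in>I. f i (x i)) \<in> measurable (PiM I M) (PiM I N)"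
    using f by (intro measurable_restrict) (auto intro!: measurable_compose[OF measurable_component_singleton])
  show ?thesis
  proof (rule D.PiM_eqI[OF I])
    show "sets (distr (PiM I M) (PiM I N) (\<lambda>x. \<lambda>i\<in>I. f i (x i))) = sets (PiM I (\<lambda>i. distr (M i) (N i) (f i)))"
      by (simp cong: sets_PiM_cong)
    fix A assume A: "\<And>i. i \<in> I \<Longrightarrow> A i \<in> sets (distr (M i) (N i) (f i))"
    then have "Pi\<^sub>E I A \<in> sets (PiM I N)" using I by (intro sets_PiM_I_finite) auto
    then have "emeasure (distr (PiM I M) (PiM I N) (\<lambda>x. \<lambda>i\<in>I. f i (x i))) (Pi\<^sub>E I A)
       = emeasure (PiM I M) ((\<lambda>x. \<lambda>i\<in>I. f i (x i)) -` Pi\<^sub>E I A \<inter> space (PiM I M))"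
      by (intro emeasure_distr fm)
    also have "(\<lambda>x. \<lambda>i\<in>I. f i (x i)) -` Pi\<^sub>E I A \<inter> space (PiM I M) = Pi\<^sub>E I (\<lambda>i. f i -` A i \<inter> space (M i))"
      by (auto simp: space_PiM PiE_iff)
    also have "emeasure (PiM I M) \<dots> = (\<Prod>i\<in>I. emeasure (M i) (f i -` A i \<inter> space (M i)))"
      using A f I by (intro M.emeasure_PiM) auto
    also have "\<dots> = (\<Prod>i\<in>I. emeasure (distr (M i) (N i) (f i)) (A i))"
      using A f by (intro prod.cong refl emeasure_distr[symmetric]) auto
    finally show "emeasure (distr (PiM I M) (PiM I N) (\<lambda>x. \<lambda>i\<in>I. f i (x i))) (Pi\<^sub>E I A) =
        (\<Prod>i\<in>I. emeasure (distr (M i) (N i) (f i)) (A i))" .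
  qed
qed

text \<open>\<open>q\<close> is a variance, whereas \<open>normal_density\<close> takes a standard
  deviation; noise powers then add up directly.\<close>

definition nrm :: "real \<Rightarrow> real measure" where
  "nrm q = density lborel (\<lambda>x. ennreal (normal_density 0 (sqrt q) x))"

definition nrmn :: "nat \<Rightarrow> real \<Rightarrow> (nat \<Rightarrow> real) measure" where
  "nrmn n q = PiM {..<n} (\<lambda>_. nrm q)"

lemma prob_space_nrm: "0 < q \<Longrightarrow> prob_space (nrm q)"
  unfolding nrm_def by (rule prob_space_normal_density) simp

lemma sets_nrm[simp, measurable_cong]: "sets (nrm q) = sets borel" and space_nrm[simp]: "space (nrm q) = UNIV"
  by (simp_all add: nrm_def)

lemma prob_space_nrmn: "0 < q \<Longrightarrow> prob_space (nrmn n q)"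
  unfolding nrmn_def by (intro prob_space_PiM prob_space_nrm)

lemma sets_nrmn[simp, measurable_cong]: "sets (nrmn n q) = sets (PiM {..<n} (\<lambda>_. borel))"
  by (auto simp: nrmn_def intro!: sets_PiM_cong)

lemma prod_normal_density:
  assumes "0 < q"
  shows "(\<Prod>t<n. normal_density (y t) (sqrt q) (u t))
    = (1 / sqrt (2 * pi * q)) ^ n * exp (- (\<Sum>t<n. (u t - y t)\<^sup>2) / (2 * q))"
  using assms
  by (simp add: normal_density_def prod.distrib exp_sum[symmetric] prod_dividef sum_divide_distrib sum_negf power_divide)

lemma nrm_shift:
  assumes "0 < q"
  shows "distr (nrm q) borel (\<lambda>x. a + x) = density lborel (\<lambda>x. ennreal (normal_density a (sqrt q) x))"
proof -
  interpret prob_space "nrm q" by (rule prob_space_nrm[OF assms])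
  have "distributed (nrm q) lborel (\<lambda>x. x) (normal_density 0 (sqrt q))"
    unfolding distributed_def nrm_def by (auto simp: distr_id2)
  from normal_density_affine[OF this, of 1 a] assms
  have "distributed (nrm q) lborel (\<lambda>x. a + x) (normal_density a (sqrt q))" by simp
  then have "distr (nrm q) lborel (\<lambda>x. a + x) = density lborel (\<lambda>x. ennreal (normal_density a (sqrt q) x))"
    by (rule distributed_distr_eq_density)
  then show ?thesis by (simp cong: distr_cong)
qed

text \<open>The bridge between the codebook side, where the Gaussian is a density against Lebesgue
  measure, and the ideal channel \<open>y + z\<close>. With \<open>F = 1\<close> it says that the
  product density has mass 1.\<close>

lemma nn_integral_nrmn_shift:
  assumes q: "0 < q" and F: "F \<in> borel_measurable (PiM {..<n} (\<lambda>_. borel))"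
  shows "(\<integral>\<^sup>+u. F u * ennreal (\<Prod>t<n. normal_density (y t) (sqrt q) (u t)) \<partial>PiM {..<n} (\<lambda>_. lborel))
    = (\<integral>\<^sup>+z. F (\<lambda>t\<in>{..<n}. y t + z t) \<partial>nrmn n q)"
proof -
  have [measurable_cong]: "sets (PiM {..<n} (\<lambda>_. lborel :: real measure)) = sets (PiM {..<n} (\<lambda>_. borel))"
    by (rule sets_PiM_cong) auto
  have D: "density (PiM {..<n} (\<lambda>_. lborel)) (\<lambda>u. \<Prod>t\<in>{..<n}. ennreal (normal_density (y t) (sqrt q) (u t)))
     = distr (nrmn n q) (PiM {..<n} (\<lambda>_. borel)) (\<lambda>z. \<lambda>t\<in>{..<n}. y t + z t)"
    unfolding nrmn_def using q
    by (subst distr_PiM_componentwise)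
      (auto simp: prob_space_nrm nrm_shift PiM_density prob_space_normal_density)
  have sm: "(\<lambda>z. \<lambda>t\<in>{..<n}. y t + z t) \<in> measurable (nrmn n q) (PiM {..<n} (\<lambda>_. borel))"
    by measurable
  have "(\<integral>\<^sup>+z. F (\<lambda>t\<in>{..<n}. y t + z t) \<partial>nrmn n q) =
    (\<integral>\<^sup>+u. F u \<partial>distr (nrmn n q) (PiM {..<n} (\<lambda>_. borel)) (\<lambda>z. \<lambda>t\<in>{..<n}. y t + z t))"
    by (rule nn_integral_distr[OF sm, symmetric]) (use F in simp)
  also have "\<dots> = (\<integral>\<^sup>+u. (\<Prod>t\<in>{..<n}. ennreal (normal_density (y t) (sqrt q) (u t))) * F u \<partial>PiM {..<n} (\<lambda>_. lborel))"
    unfolding D[symmetric] using F by (intro nn_integral_density) measurable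
  also have "\<dots> = (\<integral>\<^sup>+u. F u * ennreal (\<Prod>t<n. normal_density (y t) (sqrt q) (u t)) \<partial>PiM {..<n} (\<lambda>_. lborel))"
    by (simp add: prod_ennreal mult.commute)
  finally show ?thesis by simp
qed

lemma sets_PiM_lborel[measurable_cong]: "sets (PiM {..<n} (\<lambda>_. lborel :: real measure)) = sets (PiM {..<n} (\<lambda>_. borel))"
  by (rule sets_PiM_cong) auto

text \<open>\<open>x\<close> is the squared norm of a noise block. The lower bound caps the Gaussian
  density and so fixes the envelope of the rejection sampling; the generous upper bound serves to
  keep the codeword inside a cube.\<close>

definition gtyp :: "nat \<Rightarrow> real \<Rightarrow> real \<Rightarrow> real \<Rightarrow> bool" where
  "gtyp n q \<delta> x \<longleftrightarrow> real n * q * (1 - \<delta>) \<le> x \<and> x \<le> 2 * real n * q"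

text \<open>Tightness of the law of a finite block: the exceptional sets decrease to the empty set
  as the level runs through the integers.\<close>

lemma (in prob_space) exists_coordinate_bound:
  fixes y :: "'a \<Rightarrow> nat \<Rightarrow> real"
  assumes [measurable]: "\<And>t. t < n \<Longrightarrow> (\<lambda>\<omega>. y \<omega> t) \<in> borel_measurable M" and "0 < \<eta>"
  shows "\<exists>l>0. emeasure M {\<omega>\<in>space M. \<not> (\<forall>t<n. \<bar>y \<omega> t\<bar> \<le> l)} \<le> ennreal \<eta>"
proof -
  define A where "A k = {\<omega>\<in>space M. \<not> (\<forall>t<n. \<bar>y \<omega> t\<bar> \<le> real (k::nat))}" for k
  have "Measurable.pred M (\<lambda>\<omega>. t < n \<longrightarrow> \<bar>y \<omega> t\<bar> \<le> real k)" for t k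
    by (cases "t < n") auto
  then have [measurable]: "A k \<in> sets M" for k unfolding A_def by measurable
  have dec: "decseq A" unfolding decseq_def A_def by (auto intro: order_trans)
  have "(\<Inter>k. A k) = {}"
  proof (rule ccontr)
    assume "\<not> ?thesis"
    then obtain \<omega> where w: "\<And>k. \<omega> \<in> A k" by auto
    obtain k where k: "(\<Sum>t<n. \<bar>y \<omega> t\<bar>) \<le> real k" using real_arch_simple by blast
    have "\<bar>y \<omega> t\<bar> \<le> real k" if "t < n" for t
      using member_le_sum[of t "{..<n}" "\<lambda>t. \<bar>y \<omega> t\<bar>"] that k by auto
    then show False using w[of k] by (auto simp: A_def)
  qed
  then have "(\<lambda>k. emeasure M (A k)) \<longlonglongrightarrow> 0"
    using Lim_emeasure_decseq[OF _ dec] by (auto simp: image_subset_iff)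
  then have "\<forall>\<^sub>F k in sequentially. emeasure M (A k) < ennreal \<eta>"
    using \<open>0 < \<eta>\<close> by (intro order_tendstoD) auto
  then obtain k0 where "\<forall>k\<ge>k0. emeasure M (A k) < ennreal \<eta>" unfolding eventually_sequentially by blast
  then have "emeasure M (A (Suc k0)) < ennreal \<eta>" by simp
  then show ?thesis unfolding A_def by (intro exI[of _ "real (Suc k0)"]) auto
qed

context
  fixes n :: nat and q L \<delta> :: real
  assumes q: "0 < q" and L: "0 < L" and \<delta>: "0 < \<delta>" "\<delta> < 1" and n: "0 < n"
begin

definition peak :: real where "peak = (1 / sqrt (2 * pi * q)) ^ n * exp (- real n * (1 - \<delta>) / 2)"
definition cube :: "(nat \<Rightarrow> real) set" where "cube = (\<Pi>\<^sub>E t\<in>{..<n}. {-L..L})"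
definition codeword_law :: "((nat \<Rightarrow> real) \<times> real) measure" where
  "codeword_law = uniform_measure (PiM {..<n} (\<lambda>_. lborel)) cube \<Otimes>\<^sub>M uniform_measure lborel {0..1}"
\<comment> \<open>The mark \<open>snd e\<close> is uniform on \<open>[0, 1]\<close> and \<open>peak\<close> is the maximum of the density on the typical
  shell, so an accepted codeword is distributed like \<open>y\<close> plus Gaussian noise conditioned on that shell.\<close>
definition gacc :: "(nat \<Rightarrow> real) \<Rightarrow> (nat \<Rightarrow> real) \<times> real \<Rightarrow> bool" where
  "gacc y e \<longleftrightarrow> gtyp n q \<delta> (\<Sum>t<n. (fst e t - y t)\<^sup>2) \<and> snd e * peak \<le> (\<Prod>t<n. normal_density (y t) (sqrt q) (fst e t))"

lemma peak_pos: "0 < peak" unfolding peak_def using q by simp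

lemma emeasure_cube: "emeasure (PiM {..<n} (\<lambda>_. lborel)) cube = ennreal ((2 * L) ^ n)"
proof -
  interpret product_sigma_finite "\<lambda>i. lborel :: real measure"
    by (intro product_sigma_finite.intro) unfold_locales
  show ?thesis unfolding cube_def using L
    by (subst emeasure_PiM) (auto simp: ennreal_power)
qed

lemma sets_cube[measurable]: "cube \<in> sets (PiM {..<n} (\<lambda>_. borel))"
  unfolding cube_def by (intro sets_PiM_I_finite) auto

lemma prob_space_cube: "prob_space (uniform_measure (PiM {..<n} (\<lambda>_. lborel)) cube)"
  using L by (intro prob_space_uniform_measure) (auto simp: emeasure_cube)

lemma prob_space_unit: "prob_space (uniform_measure lborel {0..1::real})"
  by (intro prob_space_uniform_measure) auto

lemma prob_space_codeword_law: "prob_space codeword_law"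
proof -
  interpret A: prob_space "uniform_measure (PiM {..<n} (\<lambda>_. lborel)) cube" by (rule prob_space_cube)
  interpret B: prob_space "uniform_measure lborel {0..1::real}" by (rule prob_space_unit)
  interpret pair_prob_space "uniform_measure (PiM {..<n} (\<lambda>_. lborel)) cube" "uniform_measure lborel {0..1::real}" ..
  show ?thesis unfolding codeword_law_def by unfold_locales
qed

lemma sets_codeword_law[simp, measurable_cong]: "sets codeword_law = sets (PiM {..<n} (\<lambda>_. borel) \<Otimes>\<^sub>M borel)"
  unfolding codeword_law_def by (intro sets_pair_measure_cong) (auto simp: sets_PiM_lborel)

lemma space_codeword_law: "space codeword_law = space (PiM {..<n} (\<lambda>_. borel)) \<times> UNIV"
  using sets_eq_imp_space_eq[OF sets_codeword_law] by (simp add: space_pair_measure)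

lemma gtyp_meas[measurable]: "Measurable.pred borel (gtyp n q \<delta>)"
  unfolding gtyp_def by measurable

lemma gacc_meas: "Measurable.pred (PiM {..<n} (\<lambda>_. borel) \<Otimes>\<^sub>M codeword_law) (\<lambda>x. gacc (fst x) (snd x))"
proof -
  have [measurable]: "(\<lambda>x. normal_density (fst x t) (sqrt q) (fst (snd x) t))
      \<in> borel_measurable (PiM {..<n} (\<lambda>_. borel) \<Otimes>\<^sub>M codeword_law)" if "t \<in> {..<n}" for t
    unfolding normal_density_def using that by measurable
  have [measurable]: "(\<lambda>x. \<Sum>t<n. (fst (snd x) t - fst x t)\<^sup>2) \<in> borel_measurable (PiM {..<n} (\<lambda>_. borel) \<Otimes>\<^sub>M codeword_law)"
    by measurable
  have [measurable]: "(\<lambda>x. \<Prod>t<n. normal_density (fst x t) (sqrt q) (fst (snd x) t))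
      \<in> borel_measurable (PiM {..<n} (\<lambda>_. borel) \<Otimes>\<^sub>M codeword_law)"
    by (rule borel_measurable_prod) measurable
  show ?thesis unfolding gacc_def by measurable
qed

lemma density_le_peak:
  assumes "gtyp n q \<delta> (\<Sum>t<n. (u t - y t)\<^sup>2)"
  shows "(\<Prod>t<n. normal_density (y t) (sqrt q) (u t)) \<le> peak"
proof -
  have "- (\<Sum>t<n. (u t - y t)\<^sup>2) / (2 * q) \<le> - real n * (1 - \<delta>) / 2"
    using assms q by (simp add: gtyp_def field_simps)
  then show ?thesis unfolding prod_normal_density[OF q] peak_def
    using q by (intro mult_left_mono) auto
qed

lemma unit_mass: "0 \<le> x \<Longrightarrow> x \<le> 1 \<Longrightarrow> emeasure (uniform_measure lborel {0..1::real}) {a. a \<le> x} = ennreal x"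
proof -
  assume x: "0 \<le> x" "x \<le> 1"
  have "{0..1} \<inter> {a. a \<le> x} = {0..x}" using x by auto
  then show ?thesis using x divide_ennreal[of x 1] by (simp add: emeasure_uniform_measure)
qed

text \<open>Integrating out the uniform mark turns acceptance into the factor density over
  \<open>peak\<close>, which is at most 1 on the shell by \<open>density_le_peak\<close>; the cube
  contributes one over its volume. What remains is the Gaussian density centred at \<open>y\<close>,
  with a constant in front that is the same for every \<open>y\<close>.\<close>

lemma nn_integral_gacc:
  assumes F[measurable]: "F \<in> borel_measurable (PiM {..<n} (\<lambda>_. borel))"
    and y: "y \<in> space (PiM {..<n} (\<lambda>_. borel))"
  shows "(\<integral>\<^sup>+e. (if gacc y e then F (fst e) else 0) \<partial>codeword_law) =
    ennreal (1 / ((2 * L) ^ n * peak)) *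
    (\<integral>\<^sup>+z. indicator cube (\<lambda>t\<in>{..<n}. y t + z t) * (if gtyp n q \<delta> (\<Sum>t<n. (z t)\<^sup>2) then F (\<lambda>t\<in>{..<n}. y t + z t) else 0) \<partial>nrmn n q)"
proof -
  let ?U = "uniform_measure (PiM {..<n} (\<lambda>_. lborel)) cube"
  let ?I = "uniform_measure lborel {0..1::real}"
  let ?g = "\<lambda>u. \<Prod>t<n. normal_density (y t) (sqrt q) (u t)"
  define F' where "F' = (\<lambda>u. indicator cube u * (if gtyp n q \<delta> (\<Sum>t<n. (u t - y t)\<^sup>2) then F u else 0))"
  interpret U: prob_space ?U by (rule prob_space_cube)
  interpret I: prob_space ?I by (rule prob_space_unit)
  have setsU[measurable_cong]: "sets ?U = sets (PiM {..<n} (\<lambda>_. borel))" by (simp add: sets_PiM_lborel)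
  have g[measurable]: "?g \<in> borel_measurable (PiM {..<n} (\<lambda>_. borel))"
    by measurable
  have F'[measurable]: "F' \<in> borel_measurable (PiM {..<n} (\<lambda>_. borel))"
    unfolding F'_def by measurable
  have m1: "(\<lambda>e. if gacc y e then F (fst e) else 0) \<in> borel_measurable (?U \<Otimes>\<^sub>M ?I)"
  proof -
    have [measurable]: "Measurable.pred codeword_law (gacc y)"
      using measurable_compose[OF measurable_Pair1'[OF y, of codeword_law] gacc_meas] by simp
    have [measurable]: "(\<lambda>e. F (fst e)) \<in> borel_measurable codeword_law"
      by measurable
    have "(\<lambda>e. if gacc y e then F (fst e) else 0) \<in> borel_measurable codeword_law"
      by measurable
    then show ?thesis by (simp add: codeword_law_def)
  qed
  have "(\<integral>\<^sup>+e. (if gacc y e then F (fst e) else 0) \<partial>codeword_law) =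
      (\<integral>\<^sup>+u. \<integral>\<^sup>+a. (if gacc y (u, a) then F u else 0) \<partial>?I \<partial>?U)"
    unfolding codeword_law_def using I.nn_integral_fst[OF m1] by (simp only: fst_conv)
  also have "\<dots> = (\<integral>\<^sup>+u. (if gtyp n q \<delta> (\<Sum>t<n. (u t - y t)\<^sup>2) then F u else 0) * ennreal (?g u / peak) \<partial>?U)"
  proof (intro nn_integral_cong)
    fix u
    show "(\<integral>\<^sup>+a. (if gacc y (u, a) then F u else 0) \<partial>?I) = (if gtyp n q \<delta> (\<Sum>t<n. (u t - y t)\<^sup>2) then F u else 0) * ennreal (?g u / peak)"
    proof (cases "gtyp n q \<delta> (\<Sum>t<n. (u t - y t)\<^sup>2)")
      case True
      have "(\<integral>\<^sup>+a. (if gacc y (u, a) then F u else 0) \<partial>?I) = (\<integral>\<^sup>+a. F u * indicator {a. a \<le> ?g u / peak} a \<partial>?I)"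
        using True peak_pos by (intro nn_integral_cong) (auto simp: gacc_def field_simps)
      also have "\<dots> = F u * emeasure ?I {a. a \<le> ?g u / peak}"
        by (intro nn_integral_cmult_indicator) simp
      also have "emeasure ?I {a. a \<le> ?g u / peak} = ennreal (?g u / peak)"
        using density_le_peak[OF True] peak_pos by (intro unit_mass) (auto simp: prod_nonneg)
      finally show ?thesis using True by simp
    qed (simp add: gacc_def)
  qed
  also have "\<dots> = (\<integral>\<^sup>+u. F' u * ennreal (?g u / peak) \<partial>PiM {..<n} (\<lambda>_. lborel)) / ennreal ((2 * L) ^ n)"
  proof -
    have "(\<lambda>u. (if gtyp n q \<delta> (\<Sum>t<n. (u t - y t)\<^sup>2) then F u else 0) * ennreal (?g u / peak)) \<in> borel_measurable (PiM {..<n} (\<lambda>_. lborel))"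
      by measurable
    moreover have "cube \<in> sets (PiM {..<n} (\<lambda>_. lborel))" by measurable
    ultimately have "(\<integral>\<^sup>+u. (if gtyp n q \<delta> (\<Sum>t<n. (u t - y t)\<^sup>2) then F u else 0) * ennreal (?g u / peak) \<partial>?U) =
      (\<integral>\<^sup>+u. (if gtyp n q \<delta> (\<Sum>t<n. (u t - y t)\<^sup>2) then F u else 0) * ennreal (?g u / peak) * indicator cube u \<partial>PiM {..<n} (\<lambda>_. lborel))
        / emeasure (PiM {..<n} (\<lambda>_. lborel)) cube"
      by (rule nn_integral_uniform_measure)
    then show ?thesis
      unfolding emeasure_cube F'_def by (simp only: mult.assoc mult.commute[of "indicator cube _"])
  qed
  also have "(\<integral>\<^sup>+u. F' u * ennreal (?g u / peak) \<partial>PiM {..<n} (\<lambda>_. lborel)) = 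
     (\<integral>\<^sup>+u. ennreal (1 / peak) * (F' u * ennreal (?g u)) \<partial>PiM {..<n} (\<lambda>_. lborel))"
  proof (intro nn_integral_cong)
    fix u
    have "ennreal (?g u / peak) = ennreal (1 / peak) * ennreal (?g u)"
      using peak_pos by (subst ennreal_mult[symmetric]) (auto simp: prod_nonneg)
    then show "F' u * ennreal (?g u / peak) = ennreal (1 / peak) * (F' u * ennreal (?g u))"
      by (simp add: mult_ac)
  qed
  also have "\<dots> = ennreal (1 / peak) * (\<integral>\<^sup>+u. F' u * ennreal (?g u) \<partial>PiM {..<n} (\<lambda>_. lborel))"
    by (intro nn_integral_cmult) measurable
  also have "(\<integral>\<^sup>+u. F' u * ennreal (?g u) \<partial>PiM {..<n} (\<lambda>_. lborel)) = (\<integral>\<^sup>+z. F' (\<lambda>t\<in>{..<n}. y t + z t) \<partial>nrmn n q)"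
    by (intro nn_integral_nrmn_shift q F')
  finally have "(\<integral>\<^sup>+e. (if gacc y e then F (fst e) else 0) \<partial>codeword_law) =
     ennreal (1 / peak) * (\<integral>\<^sup>+z. F' (\<lambda>t\<in>{..<n}. y t + z t) \<partial>nrmn n q) / ennreal ((2 * L) ^ n)" .
  also have "\<dots> = ennreal (1 / ((2 * L) ^ n * peak)) * (\<integral>\<^sup>+z. F' (\<lambda>t\<in>{..<n}. y t + z t) \<partial>nrmn n q)"
  proof -
    have "ennreal (1 / ((2 * L) ^ n * peak)) = ennreal (1 / peak) * ennreal (1 / (2 * L) ^ n)"
      using peak_pos L by (subst ennreal_mult[symmetric]) (auto simp: field_simps)
    also have "ennreal (1 / (2 * L) ^ n) = 1 / ennreal ((2 * L) ^ n)"
      using L by (subst divide_ennreal[symmetric]) auto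
    finally show ?thesis by (simp only: divide_ennreal_def mult_1 mult_ac)
  qed
  finally show ?thesis by (simp add: F'_def cong: if_cong)
qed

text \<open>The acceptance probability is known up to a factor 2, uniformly over the admissible
  \<open>y\<close>. The upper bound drops cube and shell. For the lower one, typical noise moves no
  coordinate by more than \<open>sqrt (2 * real n * q)\<close>, so \<open>y + z\<close> stays in the
  cube and the mass of the shell survives.\<close>

lemma emeasure_gacc_le:
  assumes y: "y \<in> space (PiM {..<n} (\<lambda>_. borel))"
  shows "emeasure codeword_law {e\<in>space codeword_law. gacc y e} \<le> ennreal (1 / ((2 * L) ^ n * peak))"
    and "(\<forall>t<n. \<bar>y t\<bar> + sqrt (2 * real n * q) \<le> L) \<Longrightarrow>
      1/2 \<le> emeasure (nrmn n q) {z\<in>space (nrmn n q). gtyp n q \<delta> (\<Sum>t<n. (z t)\<^sup>2)} \<Longrightarrow>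
      ennreal (1 / ((2 * L) ^ n * peak) / 2) \<le> emeasure codeword_law {e\<in>space codeword_law. gacc y e}"
proof -
  interpret G: prob_space "nrmn n q" by (rule prob_space_nrmn[OF q])
  have [measurable]: "Measurable.pred codeword_law (gacc y)"
    using measurable_compose[OF measurable_Pair1'[OF y, of codeword_law] gacc_meas] by simp
  have eq: "emeasure codeword_law {e\<in>space codeword_law. gacc y e} =
    ennreal (1 / ((2 * L) ^ n * peak)) *
    (\<integral>\<^sup>+z. indicator cube (\<lambda>t\<in>{..<n}. y t + z t) * (if gtyp n q \<delta> (\<Sum>t<n. (z t)\<^sup>2) then 1 else 0) \<partial>nrmn n q)"
  proof -
    have "emeasure codeword_law {e\<in>space codeword_law. gacc y e} = (\<integral>\<^sup>+e. indicator {e\<in>space codeword_law. gacc y e} e \<partial>codeword_law)"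
      by (rule nn_integral_indicator[symmetric]) measurable
    also have "\<dots> = (\<integral>\<^sup>+e. (if gacc y e then 1 else 0) \<partial>codeword_law)"
      by (intro nn_integral_cong) (simp add: indicator_def)
    finally show ?thesis using nn_integral_gacc[of "\<lambda>_. 1", OF _ y] by simp
  qed
  have "(\<integral>\<^sup>+z. indicator cube (\<lambda>t\<in>{..<n}. y t + z t) * (if gtyp n q \<delta> (\<Sum>t<n. (z t)\<^sup>2) then 1 else 0) \<partial>nrmn n q) \<le> (\<integral>\<^sup>+z. 1 \<partial>nrmn n q)"
    by (intro nn_integral_mono) (auto simp: indicator_def)
  then show "emeasure codeword_law {e\<in>space codeword_law. gacc y e} \<le> ennreal (1 / ((2 * L) ^ n * peak))"
    unfolding eq using mult_left_mono[of _ 1 "ennreal (1 / ((2 * L) ^ n * peak))"] by (simp add: G.emeasure_space_1)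
  assume yL: "\<forall>t<n. \<bar>y t\<bar> + sqrt (2 * real n * q) \<le> L"
    and half: "1/2 \<le> emeasure (nrmn n q) {z\<in>space (nrmn n q). gtyp n q \<delta> (\<Sum>t<n. (z t)\<^sup>2)}"
  have "emeasure (nrmn n q) {z\<in>space (nrmn n q). gtyp n q \<delta> (\<Sum>t<n. (z t)\<^sup>2)} = 
    (\<integral>\<^sup>+z. indicator {z\<in>space (nrmn n q). gtyp n q \<delta> (\<Sum>t<n. (z t)\<^sup>2)} z \<partial>nrmn n q)"
    by (intro nn_integral_indicator[symmetric]) measurable
  also have "\<dots> \<le> (\<integral>\<^sup>+z. indicator cube (\<lambda>t\<in>{..<n}. y t + z t) * (if gtyp n q \<delta> (\<Sum>t<n. (z t)\<^sup>2) then 1 else 0) \<partial>nrmn n q)"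
  proof (intro nn_integral_mono)
    fix z
    have "(\<lambda>t\<in>{..<n}. y t + z t) \<in> cube" if g: "gtyp n q \<delta> (\<Sum>t<n. (z t)\<^sup>2)"
    proof -
      have "\<bar>z t\<bar> \<le> sqrt (2 * real n * q)" if "t < n" for t
      proof -
        have "(z t)\<^sup>2 \<le> (\<Sum>t<n. (z t)\<^sup>2)" using that by (intro member_le_sum) auto
        also have "\<dots> \<le> 2 * real n * q" using g by (simp add: gtyp_def)
        finally show ?thesis using real_le_rsqrt[of "\<bar>z t\<bar>"] by simp
      qed
      then have yz: "\<bar>y t + z t\<bar> \<le> L" if "t < n" for t
        using yL[rule_format, OF that] that abs_triangle_ineq[of "y t" "z t"] by fastforce
      have "- L \<le> y t + z t \<and> y t + z t \<le> L" if "t < n" for t using yz[OF that] by linarith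
      then show ?thesis by (auto simp: cube_def PiE_iff)
    qed
    then show "indicator {z\<in>space (nrmn n q). gtyp n q \<delta> (\<Sum>t<n. (z t)\<^sup>2)} z \<le>
      indicator cube (\<lambda>t\<in>{..<n}. y t + z t) * (if gtyp n q \<delta> (\<Sum>t<n. (z t)\<^sup>2) then 1 else 0 :: ennreal)"
      by (auto simp: indicator_def)
  qed
  finally have "1/2 \<le> (\<integral>\<^sup>+z. indicator cube (\<lambda>t\<in>{..<n}. y t + z t) * (if gtyp n q \<delta> (\<Sum>t<n. (z t)\<^sup>2) then 1 else 0) \<partial>nrmn n q)"
    using half by (rule order_trans[rotated])
  then have "ennreal (1 / ((2 * L) ^ n * peak)) * (1/2) \<le> emeasure codeword_law {e\<in>space codeword_law. gacc y e}"
    unfolding eq by (intro mult_left_mono) auto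
  moreover have "ennreal (1 / ((2 * L) ^ n * peak) / 2) = ennreal (1 / ((2 * L) ^ n * peak)) * (1/2)"
  proof -
    have "(1/2::ennreal) = ennreal (1/2)" using divide_ennreal[of 1 2] by simp
    then show ?thesis using peak_pos L by (simp only:) (subst ennreal_mult[symmetric], auto)
  qed
  ultimately show "ennreal (1 / ((2 * L) ^ n * peak) / 2) \<le> emeasure codeword_law {e\<in>space codeword_law. gacc y e}"
    by simp
qed

text \<open>A ball volume estimate without a volume formula: on the ball of squared radius
  \<open>n * r\<close> the Gaussian density of variance \<open>r\<close> is at least one over the
  stated n-th power, and its total mass is 1.\<close>

lemma emeasure_close_le:
  assumes r: "0 < r"
  shows "emeasure codeword_law {e\<in>space codeword_law. (\<Sum>t<n. (fst e t - v t)\<^sup>2) \<le> real n * r} \<le>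
    ennreal ((sqrt (2 * pi * r) * exp (1/2)) ^ n / (2 * L) ^ n)"
proof -
  let ?U = "uniform_measure (PiM {..<n} (\<lambda>_. lborel)) cube"
  let ?I = "uniform_measure lborel {0..1::real}"
  let ?\<kappa> = "(sqrt (2 * pi * r) * exp (1/2)) ^ n"
  interpret U: prob_space ?U by (rule prob_space_cube)
  interpret I: prob_space ?I by (rule prob_space_unit)
  interpret G: prob_space "nrmn n r" by (rule prob_space_nrmn[OF r])
  have setsU[measurable_cong]: "sets ?U = sets (PiM {..<n} (\<lambda>_. borel))" by (simp add: sets_PiM_lborel)
  let ?S = "{u\<in>space (PiM {..<n} (\<lambda>_. borel)). (\<Sum>t<n. (u t - v t)\<^sup>2) \<le> real n * r}"
  have S[measurable]: "?S \<in> sets (PiM {..<n} (\<lambda>_. borel))" by measurable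
  have eq: "{e\<in>space codeword_law. (\<Sum>t<n. (fst e t - v t)\<^sup>2) \<le> real n * r} = ?S \<times> UNIV"
    by (auto simp: space_codeword_law)
  have "emeasure codeword_law {e\<in>space codeword_law. (\<Sum>t<n. (fst e t - v t)\<^sup>2) \<le> real n * r} = emeasure ?U ?S * emeasure ?I UNIV"
    unfolding eq unfolding codeword_law_def using S by (intro I.emeasure_pair_measure_Times) (auto simp: setsU)
  also have "emeasure ?I UNIV = 1" using I.emeasure_space_1 by simp
  also have "emeasure ?U ?S = emeasure (PiM {..<n} (\<lambda>_. lborel)) (cube \<inter> ?S) / ennreal ((2 * L) ^ n)"
    unfolding emeasure_cube[symmetric] using S
    by (intro emeasure_uniform_measure) (auto simp: sets_PiM_lborel)
  also have "emeasure (PiM {..<n} (\<lambda>_. lborel)) (cube \<inter> ?S) \<le> ennreal ?\<kappa>"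
  proof -
    have "emeasure (PiM {..<n} (\<lambda>_. lborel)) (cube \<inter> ?S) = (\<integral>\<^sup>+u. indicator (cube \<inter> ?S) u \<partial>PiM {..<n} (\<lambda>_. lborel))"
      using S by (intro nn_integral_indicator[symmetric]) (auto simp: sets_PiM_lborel)
    also have "\<dots> \<le> (\<integral>\<^sup>+u. ennreal ?\<kappa> * ennreal (\<Prod>t<n. normal_density (v t) (sqrt r) (u t)) \<partial>PiM {..<n} (\<lambda>_. lborel))"
    proof (intro nn_integral_mono)
      fix u
      have "1 \<le> ?\<kappa> * (\<Prod>t<n. normal_density (v t) (sqrt r) (u t))" if "u \<in> ?S"
      proof -
        have "?\<kappa> * (\<Prod>t<n. normal_density (v t) (sqrt r) (u t)) =
          (sqrt (2 * pi * r) * (1 / sqrt (2 * pi * r))) ^ n * (exp (1/2) ^ n * exp (- (\<Sum>t<n. (u t - v t)\<^sup>2) / (2 * r)))"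
          unfolding prod_normal_density[OF r] power_mult_distrib by (simp add: mult_ac)
        also have "\<dots> = exp (real n / 2 - (\<Sum>t<n. (u t - v t)\<^sup>2) / (2 * r))"
          using r by (simp add: exp_of_nat_mult[symmetric] mult_exp_exp)
        also have "\<dots> \<ge> 1" using that r by (simp add: field_simps)
        finally show ?thesis .
      qed
      then show "indicator (cube \<inter> ?S) u \<le> ennreal ?\<kappa> * ennreal (\<Prod>t<n. normal_density (v t) (sqrt r) (u t))"
        using r by (subst ennreal_mult[symmetric]) (auto simp: indicator_def prod_nonneg simp flip: ennreal_1 intro!: ennreal_leI)
    qed
    also have "\<dots> = ennreal ?\<kappa> * (\<integral>\<^sup>+u. ennreal (\<Prod>t<n. normal_density (v t) (sqrt r) (u t)) \<partial>PiM {..<n} (\<lambda>_. lborel))"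
      by (intro nn_integral_cmult) measurable
    also have "(\<integral>\<^sup>+u. ennreal (\<Prod>t<n. normal_density (v t) (sqrt r) (u t)) \<partial>PiM {..<n} (\<lambda>_. lborel)) = 1"
      using nn_integral_nrmn_shift[OF r, of "\<lambda>_. 1" n v] by (simp add: G.emeasure_space_1)
    finally show ?thesis by simp
  qed
  finally have "emeasure codeword_law {e\<in>space codeword_law. (\<Sum>t<n. (fst e t - v t)\<^sup>2) \<le> real n * r} \<le> ennreal ?\<kappa> / ennreal ((2 * L) ^ n)"
    by (simp add: divide_right_mono_ennreal)
  also have "\<dots> = ennreal (?\<kappa> / (2 * L) ^ n)" using L r by (intro divide_ennreal) auto
  finally show ?thesis .
qed

end


section \<open>Binning with the Gaussian codebook\<close>

lemma exists_nat_multiple: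
  fixes T x :: real
  assumes "0 < T" "0 < x" "x \<le> 2"
  shows "\<exists>N::nat. T \<le> N * x \<and> N * x \<le> T + 2"
proof (intro exI conjI)
  have "0 \<le> T / x" using assms by simp
  then have N: "T / x \<le> nat \<lceil>T / x\<rceil>" "nat \<lceil>T / x\<rceil> \<le> T / x + 1"
    using ceiling_correct[of "T / x"] by (simp_all add: of_nat_nat)
  have "T / x * x \<le> nat \<lceil>T / x\<rceil> * x" using N(1) assms by (intro mult_right_mono) auto
  then show "T \<le> nat \<lceil>T / x\<rceil> * x" using assms by simp
  have "nat \<lceil>T / x\<rceil> * x \<le> (T / x + 1) * x" using N(2) assms by (intro mult_right_mono) auto
  then show "nat \<lceil>T / x\<rceil> * x \<le> T + 2" using assms by (simp add: distrib_right)
qed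

text \<open>The random binning bound with all codebook parameters eliminated. \<open>T\<close> is
  the expected number of acceptable codewords up to constants, and \<open>exp (- T / 2)\<close> the
  chance of finding none. A false match in the bin costs \<open>sqrt (r / q) ^ n / K\<close> up to
  \<open>exp (real n * \<delta> / 2)\<close>, so a rate slightly above
  \<open>1/2 * ln (r / q)\<close> suffices.\<close>

lemma gaussian_binning_step:
  fixes P :: "'w measure" and y :: "'w \<Rightarrow> nat \<Rightarrow> real" and c :: "'w \<Rightarrow> 'c" and ctr :: "'c \<Rightarrow> nat \<Rightarrow> real"
    and \<Phi> :: "'w \<Rightarrow> (nat \<Rightarrow> real) \<Rightarrow> ennreal" and n K :: nat and B q r \<delta> T \<eta> :: real
  assumes P: "prob_space P"
    and y[measurable]: "y \<in> measurable P (PiM {..<n} (\<lambda>_. borel))"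
    and ctr: "\<And>t. t < n \<Longrightarrow> (\<lambda>\<omega>. ctr (c \<omega>) t) \<in> borel_measurable P"
    and \<Phi>[measurable]: "(\<lambda>x. \<Phi> (fst x) (snd x)) \<in> borel_measurable (P \<Otimes>\<^sub>M PiM {..<n} (\<lambda>_. borel))"
    and \<Phi>_le: "\<And>\<omega> u. \<Phi> \<omega> u \<le> ennreal B"
    and pos: "0 \<le> B" "0 < q" "0 < r" "0 < \<delta>" "\<delta> < 1" "0 < T" "0 < \<eta>" "0 < n" "0 < K"
    and half: "1/2 \<le> emeasure (nrmn n q) {z\<in>space (nrmn n q). gtyp n q \<delta> (\<Sum>t<n. (z t)\<^sup>2)}"
  shows "\<exists>enc dec. enc \<in> measurable (PiM {..<n} (\<lambda>_. borel)) (count_space UNIV) \<and> (\<forall>y. enc y < K) \<and>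
    (\<forall>b c. dec b c \<in> space (PiM {..<n} (\<lambda>_. borel))) \<and>
    (\<integral>\<^sup>+\<omega>. \<Phi> \<omega> (dec (enc (y \<omega>)) (c \<omega>)) \<partial>P) \<le>
      ennreal (B * \<eta> + B * exp (- T / 2) + B * ((T + 2) * ((T + 2) * (sqrt (r / q) ^ n * exp (real n * \<delta> / 2) / K) + \<eta>)))
      + ennreal (T + 2) * (\<integral>\<^sup>+\<omega>. \<integral>\<^sup>+z. \<Phi> \<omega> (\<lambda>t\<in>{..<n}. y \<omega> t + z t)
          + (if (\<Sum>t<n. (y \<omega> t + z t - ctr (c \<omega>) t)\<^sup>2) \<le> real n * r then 0 else ennreal B) \<partial>nrmn n q \<partial>P)"
proof -
  interpret P: prob_space P by fact
  note q = pos(2) and r = pos(3) and \<delta> = pos(4,5) and n = pos(8)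
  have yt: "(\<lambda>\<omega>. y \<omega> t) \<in> borel_measurable P" if "t < n" for t
    using that by (intro measurable_compose[OF y measurable_component_singleton]) auto
  from P.exists_coordinate_bound[of n y \<eta>, OF yt pos(7)] obtain l where l: "0 < l"
    "emeasure P {\<omega>\<in>space P. \<not> (\<forall>t<n. \<bar>y \<omega> t\<bar> \<le> l)} \<le> ennreal \<eta>" by auto
  define \<kappa> where "\<kappa> = sqrt (2 * pi * r) * exp (1/2)"
  \<comment> \<open>The cube has to contain every good observation plus typical noise, and to be so
    large that the closeness probability \<open>?s\<close> is below \<open>\<eta>\<close>. The
    minimum with 1 keeps the base of that n-th power at most 1.\<close>
  define L where "L = max (l + sqrt (2 * real n * q)) (\<kappa> / (2 * min 1 \<eta>))"
  have \<kappa>: "0 < \<kappa>" using r by (simp add: \<kappa>_def)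
  have L: "0 < L" "l + sqrt (2 * real n * q) \<le> L" "\<kappa> / (2 * min 1 \<eta>) \<le> L"
    using l pos \<kappa> by (auto simp: L_def less_max_iff_disj intro: add_pos_nonneg)
  note ctx = q L(1) \<delta> n
  let ?p = "1 / ((2 * L) ^ n * peak n q \<delta>)"
  let ?s = "\<kappa> ^ n / (2 * L) ^ n"
  let ?Q = "codeword_law n L"
  let ?MY = "PiM {..<n} (\<lambda>_. borel :: real measure)"
  have p: "0 < ?p" using peak_pos[OF ctx] L(1) by simp
  have s: "0 < ?s" using \<kappa> L(1) by simp
  have s_le: "?s \<le> \<eta>"
  proof -
    define mn where "mn = min 1 \<eta>"
    have "0 < mn" "\<kappa> / (2 * mn) \<le> L" using L(3) pos(7) by (simp_all add: mn_def)
    then have x: "\<kappa> / (2 * L) \<le> min 1 \<eta>" unfolding mn_def[symmetric] using L(1) by (simp add: field_simps)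
    have "?s = (\<kappa> / (2 * L)) ^ n" by (simp add: power_divide)
    also have "\<dots> \<le> (\<kappa> / (2 * L)) ^ 1"
      using x \<kappa> L(1) n by (intro power_decreasing) auto
    finally show ?thesis using x by simp
  qed
  define G where "G = {y\<in>space ?MY. \<forall>t<n. \<bar>y t\<bar> \<le> l}"
  have G[measurable]: "G \<in> sets ?MY"
  proof -
    have "Measurable.pred ?MY (\<lambda>y. t < n \<longrightarrow> \<bar>y t\<bar> \<le> l)" for t
      by (cases "t \<in> {..<n}") auto
    then show ?thesis unfolding G_def by measurable
  qed
  have acc_ge: "ennreal (?p / 2) \<le> emeasure ?Q {e\<in>space ?Q. gacc n q \<delta> y e}" if "y \<in> G" for y
  proof (rule emeasure_gacc_le(2)[OF ctx])
    show "y \<in> space ?MY" using that by (simp add: G_def)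
    show "\<forall>t<n. \<bar>y t\<bar> + sqrt (2 * real n * q) \<le> L"
      using that L(2) by (auto simp: G_def intro: order_trans[rotated])
  qed (rule half)
  \<comment> \<open>The zero block lies in \<open>G\<close>, so \<open>?p / 2\<close> is a lower
    bound of a probability.\<close>
  have p_le: "?p \<le> 2"
  proof -
    interpret Q: prob_space ?Q by (rule prob_space_codeword_law[OF ctx])
    have "(\<lambda>t\<in>{..<n}. 0) \<in> G" using l(1) by (auto simp: G_def space_PiM)
    from acc_ge[OF this] have "ennreal (?p / 2) \<le> 1" by (rule order_trans) (rule Q.emeasure_le_1)
    then show ?thesis by simp
  qed
  \<comment> \<open>The codebook size makes \<open>N * ?p\<close> constant up to 2: large enough to
    find an acceptable codeword, small enough that the factor \<open>N\<close> in the binning bound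
    is cancelled by the acceptance probability.\<close>
  obtain N :: nat where N: "T \<le> N * ?p" "N * ?p \<le> T + 2"
    using exists_nat_multiple[OF pos(6) p p_le] by blast
  have N_pos: "0 < N" using N(1) pos(6) by (cases N) auto
  let ?close = "\<lambda>c e. (\<Sum>t<n. (fst e t - ctr c t)\<^sup>2) \<le> real n * r"
  have setsQ[measurable_cong]: "sets ?Q = sets (?MY \<Otimes>\<^sub>M borel)" by (rule sets_codeword_law[OF ctx])
  have "\<exists>enc dec. enc \<in> measurable ?MY (count_space UNIV) \<and> (\<forall>y. enc y < K) \<and> (\<forall>b c. dec b c \<in> space ?Q) \<and>
    (\<integral>\<^sup>+\<omega>. \<Phi> \<omega> (fst (dec (enc (y \<omega>)) (c \<omega>))) \<partial>P) \<le>
      B * emeasure P {\<omega>\<in>space P. y \<omega> \<notin> G} + B * (1 - ennreal (?p / 2)) ^ N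
      + of_nat N * (\<integral>\<^sup>+\<omega>. \<integral>\<^sup>+e. (if gacc n q \<delta> (y \<omega>) e then \<Phi> \<omega> (fst e) + (if ?close (c \<omega>) e then 0 else ennreal B) else 0) \<partial>?Q \<partial>P)
      + ennreal (B * (N * ?p * ((real N / real K + 1) * ?s)))"
  proof (rule one_shot_random_binning[where \<Phi>="\<lambda>\<omega> e. \<Phi> \<omega> (fst e)" and close="?close" and acc="gacc n q \<delta>" and G=G])
    show "prob_space P" by fact
    show "prob_space ?Q" by (rule prob_space_codeword_law[OF ctx])
    show "Measurable.pred (?MY \<Otimes>\<^sub>M ?Q) (\<lambda>x. gacc n q \<delta> (fst x) (snd x))" by (rule gacc_meas[OF ctx])
    show "Measurable.pred (P \<Otimes>\<^sub>M ?Q) (\<lambda>x. ?close (c (fst x)) (snd x))"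
    proof -
      have [measurable]: "(\<lambda>x. ctr (c (fst x)) t) \<in> borel_measurable (P \<Otimes>\<^sub>M ?Q)" if "t \<in> {..<n}" for t
        using that by (intro measurable_compose[OF measurable_fst ctr]) auto
      show ?thesis by measurable
    qed
    show "(\<lambda>x. \<Phi> (fst x) (fst (snd x))) \<in> borel_measurable (P \<Otimes>\<^sub>M ?Q)"
    proof -
      have "(\<lambda>x. (fst x, fst (snd x))) \<in> measurable (P \<Otimes>\<^sub>M ?Q) (P \<Otimes>\<^sub>M ?MY)" by measurable
      from measurable_compose[OF this \<Phi>] show ?thesis by simp
    qed
    show "emeasure ?Q {e\<in>space ?Q. gacc n q \<delta> y e} \<le> ennreal ?p" if "y \<in> space ?MY" for y
      using that by (rule emeasure_gacc_le(1)[OF ctx])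
    show "emeasure ?Q {e\<in>space ?Q. ?close (c \<omega>) e} \<le> ennreal ?s" for \<omega>
      using emeasure_close_le[OF ctx r, of "ctr (c \<omega>)"] by (simp add: \<kappa>_def)
  qed (use pos p s N_pos acc_ge y G \<Phi>_le in auto)
  then obtain enc dec where ed: "enc \<in> measurable ?MY (count_space UNIV)" "\<forall>y. enc y < K" "\<forall>b c. dec b c \<in> space ?Q"
    and le: "(\<integral>\<^sup>+\<omega>. \<Phi> \<omega> (fst (dec (enc (y \<omega>)) (c \<omega>))) \<partial>P) \<le>
      B * emeasure P {\<omega>\<in>space P. y \<omega> \<notin> G} + B * (1 - ennreal (?p / 2)) ^ N
      + of_nat N * (\<integral>\<^sup>+\<omega>. \<integral>\<^sup>+e. (if gacc n q \<delta> (y \<omega>) e then \<Phi> \<omega> (fst e) + (if ?close (c \<omega>) e then 0 else ennreal B) else 0) \<partial>?Q \<partial>P)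
      + ennreal (B * (N * ?p * ((real N / real K + 1) * ?s)))" by blast
  let ?I = "\<integral>\<^sup>+\<omega>. \<integral>\<^sup>+z. \<Phi> \<omega> (\<lambda>t\<in>{..<n}. y \<omega> t + z t)
          + (if (\<Sum>t<n. (y \<omega> t + z t - ctr (c \<omega>) t)\<^sup>2) \<le> real n * r then 0 else ennreal B) \<partial>nrmn n q \<partial>P"
  have t1: "B * emeasure P {\<omega>\<in>space P. y \<omega> \<notin> G} \<le> ennreal (B * \<eta>)"
  proof -
    have "{\<omega>\<in>space P. y \<omega> \<notin> G} = {\<omega>\<in>space P. \<not> (\<forall>t<n. \<bar>y \<omega> t\<bar> \<le> l)}"
      using measurable_space[OF y] by (auto simp: G_def)
    then show ?thesis using l(2) pos by (simp add: ennreal_mult mult_left_mono)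
  qed
  have t2: "B * (1 - ennreal (?p / 2)) ^ N \<le> ennreal (B * exp (- T / 2))"
  proof -
    have "1 - ennreal (?p / 2) = ennreal (1 - ?p / 2)" using p by (subst ennreal_minus[symmetric]) auto
    then have "(1 - ennreal (?p / 2)) ^ N = ennreal ((1 - ?p / 2) ^ N)"
      using p_le by (simp add: ennreal_power)
    also have "(1 - ?p / 2) ^ N \<le> exp (- (?p / 2)) ^ N"
      using p_le exp_ge_add_one_self[of "- (?p / 2)"] by (intro power_mono) auto
    also have "\<dots> = exp (- (N * ?p) / 2)" by (simp add: exp_of_nat_mult[symmetric])
    also have "\<dots> \<le> exp (- T / 2)" using N(1) by simp
    finally have "(1 - ennreal (?p / 2)) ^ N \<le> ennreal (exp (- T / 2))" by (simp add: ennreal_leI)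
    then show ?thesis using pos by (simp add: ennreal_mult mult_left_mono)
  qed
  have t3: "of_nat N * (\<integral>\<^sup>+\<omega>. \<integral>\<^sup>+e. (if gacc n q \<delta> (y \<omega>) e then \<Phi> \<omega> (fst e) + (if ?close (c \<omega>) e then 0 else ennreal B) else 0) \<partial>?Q \<partial>P)
      \<le> ennreal (T + 2) * ?I"
  proof -
    have "(\<integral>\<^sup>+e. (if gacc n q \<delta> (y \<omega>) e then \<Phi> \<omega> (fst e) + (if ?close (c \<omega>) e then 0 else ennreal B) else 0) \<partial>?Q)
      \<le> ennreal ?p * (\<integral>\<^sup>+z. \<Phi> \<omega> (\<lambda>t\<in>{..<n}. y \<omega> t + z t)
          + (if (\<Sum>t<n. (y \<omega> t + z t - ctr (c \<omega>) t)\<^sup>2) \<le> real n * r then 0 else ennreal B) \<partial>nrmn n q)" if "\<omega> \<in> space P" for \<omega>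
    proof -
      have F: "(\<lambda>u. \<Phi> \<omega> u + (if (\<Sum>t<n. (u t - ctr (c \<omega>) t)\<^sup>2) \<le> real n * r then 0 else ennreal B)) \<in> borel_measurable ?MY"
        using measurable_compose[OF measurable_Pair1'[OF that, of ?MY] \<Phi>] by simp
      have "(\<integral>\<^sup>+e. (if gacc n q \<delta> (y \<omega>) e then \<Phi> \<omega> (fst e) + (if ?close (c \<omega>) e then 0 else ennreal B) else 0) \<partial>?Q) =
        ennreal ?p * (\<integral>\<^sup>+z. indicator (cube n L) (\<lambda>t\<in>{..<n}. y \<omega> t + z t) * (if gtyp n q \<delta> (\<Sum>t<n. (z t)\<^sup>2) then
           \<Phi> \<omega> (\<lambda>t\<in>{..<n}. y \<omega> t + z t) + (if (\<Sum>t<n. ((\<lambda>t\<in>{..<n}. y \<omega> t + z t) t - ctr (c \<omega>) t)\<^sup>2) \<le> real n * r then 0 else ennreal B) else 0) \<partial>nrmn n q)"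
        by (rule nn_integral_gacc[OF ctx F measurable_space[OF y that]])
      also have "\<dots> \<le> ennreal ?p * (\<integral>\<^sup>+z. \<Phi> \<omega> (\<lambda>t\<in>{..<n}. y \<omega> t + z t)
          + (if (\<Sum>t<n. (y \<omega> t + z t - ctr (c \<omega>) t)\<^sup>2) \<le> real n * r then 0 else ennreal B) \<partial>nrmn n q)"
        by (intro mult_left_mono nn_integral_mono) (auto simp: indicator_def)
      finally show ?thesis .
    qed
    then have "(\<integral>\<^sup>+\<omega>. \<integral>\<^sup>+e. (if gacc n q \<delta> (y \<omega>) e then \<Phi> \<omega> (fst e) + (if ?close (c \<omega>) e then 0 else ennreal B) else 0) \<partial>?Q \<partial>P)
       \<le> (\<integral>\<^sup>+\<omega>. ennreal ?p * (\<integral>\<^sup>+z. \<Phi> \<omega> (\<lambda>t\<in>{..<n}. y \<omega> t + z t)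
          + (if (\<Sum>t<n. (y \<omega> t + z t - ctr (c \<omega>) t)\<^sup>2) \<le> real n * r then 0 else ennreal B) \<partial>nrmn n q) \<partial>P)"
      by (intro nn_integral_mono)
    also have "\<dots> = ennreal ?p * ?I"
    proof (rule nn_integral_cmult)
      interpret G: prob_space "nrmn n q" by (rule prob_space_nrmn[OF q])
      have "(\<lambda>x. (fst x, \<lambda>t\<in>{..<n}. y (fst x) t + snd x t)) \<in> measurable (P \<Otimes>\<^sub>M nrmn n q) (P \<Otimes>\<^sub>M ?MY)"
        by measurable
      from measurable_compose[OF this \<Phi>]
      have [measurable]: "(\<lambda>x. \<Phi> (fst x) (\<lambda>t\<in>{..<n}. y (fst x) t + snd x t)) \<in> borel_measurable (P \<Otimes>\<^sub>M nrmn n q)" by simp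
      have [measurable]: "(\<lambda>x. ctr (c (fst x)) t) \<in> borel_measurable (P \<Otimes>\<^sub>M nrmn n q)" if "t \<in> {..<n}" for t
        using that by (intro measurable_compose[OF measurable_fst ctr]) auto
      show "(\<lambda>\<omega>. \<integral>\<^sup>+z. \<Phi> \<omega> (\<lambda>t\<in>{..<n}. y \<omega> t + z t)
          + (if (\<Sum>t<n. (y \<omega> t + z t - ctr (c \<omega>) t)\<^sup>2) \<le> real n * r then 0 else ennreal B) \<partial>nrmn n q) \<in> borel_measurable P"
        by (rule G.borel_measurable_nn_integral) (simp add: split_beta')
    qed
    finally have "of_nat N * (\<integral>\<^sup>+\<omega>. \<integral>\<^sup>+e. (if gacc n q \<delta> (y \<omega>) e then \<Phi> \<omega> (fst e) + (if ?close (c \<omega>) e then 0 else ennreal B) else 0) \<partial>?Q \<partial>P)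
       \<le> of_nat N * (ennreal ?p * ?I)" by (intro mult_left_mono) auto
    also have "\<dots> = ennreal (N * ?p) * ?I"
    proof -
      have "ennreal (real N * ?p) = of_nat N * ennreal ?p"
        unfolding ennreal_of_nat_eq_real_of_nat using less_imp_le[OF p] by (rule ennreal_mult[OF of_nat_0_le_iff])
      then show ?thesis by (simp only: mult.assoc)
    qed
    also have "\<dots> \<le> ennreal (T + 2) * ?I" using N(2) by (intro mult_right_mono ennreal_leI) auto
    finally show ?thesis .
  qed
  have t4: "B * (N * ?p * ((real N / real K + 1) * ?s)) \<le> B * ((T + 2) * ((T + 2) * (sqrt (r / q) ^ n * exp (real n * \<delta> / 2) / K) + \<eta>))"
  proof -
    \<comment> \<open>In the quotient of \<open>?s\<close> and \<open>?p\<close> the volume of the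
      cube cancels, so the collision term does not see \<open>L\<close>; the leftover single
      \<open>?s\<close> is absorbed by \<open>\<eta>\<close>.\<close>
    have sp: "?s = ?p * (sqrt (r / q) ^ n * exp (real n * \<delta> / 2))"
    proof -
      have e: "exp (1 / 2 :: real) ^ n = exp (real n * \<delta> / 2) * exp (real n * (1 - \<delta>) / 2)"
        by (simp add: exp_of_nat_mult[symmetric] mult_exp_exp field_simps)
      have i: "inverse (peak n q \<delta>) = sqrt (2 * pi * q) ^ n * exp (real n * (1 - \<delta>) / 2)"
      proof -
        have "exp (- real n * (1 - \<delta>) / 2) = inverse (exp (real n * (1 - \<delta>) / 2))"
          by (simp add: exp_minus[symmetric])
        moreover have "inverse ((1 / a) ^ n * inverse b) = a ^ n * b" for a b :: real
          by (simp only: inverse_mult_distrib power_one_over inverse_inverse_eq inverse_eq_divide[symmetric] power_inverse)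
        ultimately show ?thesis unfolding peak_def[OF ctx] by (simp only:)
      qed
      have r': "sqrt (2 * pi * r) = sqrt (2 * pi * q) * sqrt (r / q)"
        using q by (simp add: real_sqrt_mult[symmetric])
      have "?p * (sqrt (r / q) ^ n * exp (real n * \<delta> / 2)) = inverse (peak n q \<delta>) * (sqrt (r / q) ^ n * exp (real n * \<delta> / 2)) / (2 * L) ^ n"
        by (simp only: divide_inverse inverse_mult_distrib mult_1 mult_ac)
      also have "\<dots> = ?s"
        unfolding i \<kappa>_def r' power_mult_distrib[of "sqrt (2 * pi * q) * sqrt (r / q)"]
          power_mult_distrib[of "sqrt (2 * pi * q)"] e by (simp only: divide_inverse mult_ac)
      finally show ?thesis by simp
    qed
    have "(real N / real K + 1) * ?s = (N * ?p) * (sqrt (r / q) ^ n * exp (real n * \<delta> / 2) / K) + ?s"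
      unfolding distrib_right by (subst sp) simp
    also have "\<dots> \<le> (T + 2) * (sqrt (r / q) ^ n * exp (real n * \<delta> / 2) / K) + \<eta>"
      using N(2) s_le r q by (intro add_mono mult_right_mono) auto
    finally have 1: "(real N / real K + 1) * ?s \<le> (T + 2) * (sqrt (r / q) ^ n * exp (real n * \<delta> / 2) / K) + \<eta>" .
    have "0 \<le> (real N / real K + 1) * ?s" using s by (intro mult_nonneg_nonneg) auto
    then show ?thesis using 1 N(2) pos by (intro mult_left_mono mult_mono) auto
  qed
  have "(\<integral>\<^sup>+\<omega>. \<Phi> \<omega> (fst (dec (enc (y \<omega>)) (c \<omega>))) \<partial>P) \<le>
     ennreal (B * \<eta>) + ennreal (B * exp (- T / 2)) + ennreal (T + 2) * ?I
      + ennreal (B * ((T + 2) * ((T + 2) * (sqrt (r / q) ^ n * exp (real n * \<delta> / 2) / K) + \<eta>)))"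
    using le by (rule order_trans) (intro add_mono t1 t2 t3 ennreal_leI t4)
  also have "\<dots> = ennreal (B * \<eta> + B * exp (- T / 2) + B * ((T + 2) * ((T + 2) * (sqrt (r / q) ^ n * exp (real n * \<delta> / 2) / K) + \<eta>)))
      + ennreal (T + 2) * ?I"
    using pos by (simp add: ennreal_plus[symmetric] add_ac del: ennreal_plus)
  finally show ?thesis
    using ed space_codeword_law[OF ctx]
    by (intro exI[of _ enc] exI[of _ "\<lambda>b c. fst (dec b c)"]) (auto simp: mem_Times_iff)
qed

subsection \<open>Laws of large numbers\<close>

lemma PiM_component_integral:
  fixes f :: "'a \<Rightarrow> real"
  assumes N: "\<And>i. prob_space (N i)" and i: "i \<in> I" and f: "integrable (N i) f"
  shows "integrable (PiM I N) (\<lambda>x. f (x i))" "(\<integral>x. f (x i) \<partial>PiM I N) = (\<integral>x. f x \<partial>N i)"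
proof -
  interpret product_prob_space N I
    by (intro product_prob_spaceI N)
  have d: "distr (PiM I N) (N i) (\<lambda>x. x i) = N i" by (rule PiM_component[OF i])
  have m: "(\<lambda>x. x i) \<in> measurable (PiM I N) (N i)" using i by (rule measurable_component_singleton)
  show "integrable (PiM I N) (\<lambda>x. f (x i))"
    using integrable_distr[OF m, of f] f d by simp
  show "(\<integral>x. f (x i) \<partial>PiM I N) = (\<integral>x. f x \<partial>N i)"
    using integral_distr[OF m, of f] f d by simp
qed

lemma PiM_two_components_integral:
  fixes f g :: "'a \<Rightarrow> real"
  assumes N: "\<And>i. prob_space (N i)" and I: "finite I" "i \<in> I" "j \<in> I" "i \<noteq> j"
    and f: "integrable (N i) f" and g: "integrable (N j) g"
  shows "integrable (PiM I N) (\<lambda>x. f (x i) * g (x j))"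
    "(\<integral>x. f (x i) * g (x j) \<partial>PiM I N) = (\<integral>x. f x \<partial>N i) * (\<integral>x. g x \<partial>N j)"
proof -
  interpret product_sigma_finite N
    by (intro product_sigma_finite.intro prob_space_imp_sigma_finite N)
  let ?h = "\<lambda>k e. if k = i then f e else if k = j then g e else 1"
  have prod2: "(\<Prod>k\<in>I. a k) = a i * a j" if "\<And>k. k \<in> I - {i, j} \<Longrightarrow> a k = (1::real)" for a
  proof -
    have "(\<Prod>k\<in>I. a k) = a i * (\<Prod>k\<in>I - {i}. a k)"
      using I by (intro prod.remove) auto
    also have "(\<Prod>k\<in>I - {i}. a k) = a j * (\<Prod>k\<in>I - {i} - {j}. a k)"
      using I by (intro prod.remove) auto
    also have "(\<Prod>k\<in>I - {i} - {j}. a k) = 1"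
      using that by (intro prod.neutral) auto
    finally show ?thesis by simp
  qed
  have eq: "(\<Prod>k\<in>I. ?h k (x k)) = f (x i) * g (x j)" for x
    using prod2[of "\<lambda>k. ?h k (x k)"] \<open>i \<noteq> j\<close> by simp
  have one: "integrable (N k) (\<lambda>_. 1::real)" "(\<integral>x. 1 \<partial>N k) = (1::real)" for k
  proof -
    interpret prob_space "N k" by (rule N)
    show "integrable (N k) (\<lambda>_. 1::real)" "(\<integral>x. 1 \<partial>N k) = (1::real)" by (simp_all add: prob_space)
  qed
  have h: "integrable (N k) (?h k)" for k
    using f g one(1)[of k] by (cases "k = i"; cases "k = j") simp_all
  show "integrable (PiM I N) (\<lambda>x. f (x i) * g (x j))"
    using product_integrable_prod[OF I(1), of ?h] h unfolding eq by simp
  have "(\<integral>x. f (x i) * g (x j) \<partial>PiM I N) = (\<Prod>k\<in>I. \<integral>x. ?h k x \<partial>N k)"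
    using product_integral_prod[OF I(1), of ?h] h unfolding eq by simp
  also have "\<dots> = (\<integral>x. f x \<partial>N i) * (\<integral>x. g x \<partial>N j)"
    using prod2[of "\<lambda>k. \<integral>x. ?h k x \<partial>N k"] \<open>i \<noteq> j\<close> one(2) by simp
  finally show "(\<integral>x. f (x i) * g (x j) \<partial>PiM I N) = (\<integral>x. f x \<partial>N i) * (\<integral>x. g x \<partial>N j)" .
qed

lemma sum_centered_second_moment:
  fixes g :: "'i \<Rightarrow> 'a \<Rightarrow> real"
  assumes N: "\<And>i. prob_space (N i)" and I: "finite I"
    and m: "\<And>i. i \<in> I \<Longrightarrow> g i \<in> borel_measurable (N i)"
    and sq: "\<And>i. i \<in> I \<Longrightarrow> integrable (N i) (\<lambda>x. (g i x)\<^sup>2)"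
    and c: "\<And>i. i \<in> I \<Longrightarrow> (\<integral>x. g i x \<partial>N i) = 0"
  shows "integrable (PiM I N) (\<lambda>x. (\<Sum>i\<in>I. g i (x i))\<^sup>2)"
    "(\<integral>x. (\<Sum>i\<in>I. g i (x i))\<^sup>2 \<partial>PiM I N) = (\<Sum>i\<in>I. \<integral>x. (g i x)\<^sup>2 \<partial>N i)"
proof -
  have i1: "integrable (N i) (g i)" if "i \<in> I" for i
  proof -
    interpret prob_space "N i" by (rule N)
    show ?thesis using square_integrable_imp_integrable[OF m sq] that by blast
  qed
  have eq: "(\<Sum>i\<in>I. g i (x i))\<^sup>2 = (\<Sum>i\<in>I. \<Sum>j\<in>I. g i (x i) * g j (x j))" for x
    by (simp add: power2_eq_square sum_product)
  have int: "integrable (PiM I N) (\<lambda>x. g i (x i) * g j (x j))" if "i \<in> I" "j \<in> I" for i j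
  proof (cases "i = j")
    case True
    then show ?thesis using PiM_component_integral(1)[where N=N and I=I and i=i and f="\<lambda>x. (g i x)\<^sup>2", OF N that(1) sq[OF that(1)]]
      by (simp add: power2_eq_square)
  next
    case False
    then show ?thesis using PiM_two_components_integral(1)[where N=N and f="g i" and g="g j", OF N I that False] i1 that by blast
  qed
  show "integrable (PiM I N) (\<lambda>x. (\<Sum>i\<in>I. g i (x i))\<^sup>2)"
    unfolding eq using int by (intro Bochner_Integration.integrable_sum)
  have "(\<integral>x. (\<Sum>i\<in>I. g i (x i))\<^sup>2 \<partial>PiM I N) = (\<Sum>i\<in>I. \<Sum>j\<in>I. \<integral>x. g i (x i) * g j (x j) \<partial>PiM I N)"
    unfolding eq using int by (subst Bochner_Integration.integral_sum) (auto intro!: sum.cong Bochner_Integration.integral_sum Bochner_Integration.integrable_sum)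
  also have "\<dots> = (\<Sum>i\<in>I. \<Sum>j\<in>I. if j = i then \<integral>x. (g i x)\<^sup>2 \<partial>N i else 0)"
  proof (intro sum.cong refl)
    fix i j assume ij: "i \<in> I" "j \<in> I"
    show "(\<integral>x. g i (x i) * g j (x j) \<partial>PiM I N) = (if j = i then \<integral>x. (g i x)\<^sup>2 \<partial>N i else 0)"
    proof (cases "j = i")
      case True
      then show ?thesis using PiM_component_integral(2)[where N=N and I=I and i=i and f="\<lambda>x. (g i x)\<^sup>2", OF N ij(1) sq[OF ij(1)]] by (simp add: power2_eq_square)
    next
      case False
      then have "i \<noteq> j" by simp
      then show ?thesis using PiM_two_components_integral(2)[where N=N and f="g i" and g="g j", OF N I ij \<open>i \<noteq> j\<close>] i1 ij c False by simp
    qed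
  qed
  also have "\<dots> = (\<Sum>i\<in>I. \<integral>x. (g i x)\<^sup>2 \<partial>N i)" using I by simp
  finally show "(\<integral>x. (\<Sum>i\<in>I. g i (x i))\<^sup>2 \<partial>PiM I N) = (\<Sum>i\<in>I. \<integral>x. (g i x)\<^sup>2 \<partial>N i)" .
qed

lemma chebyshev_sum:
  fixes g :: "'i \<Rightarrow> 'a \<Rightarrow> real"
  assumes N: "\<And>i. prob_space (N i)" and I: "finite I"
    and m: "\<And>i. i \<in> I \<Longrightarrow> g i \<in> borel_measurable (N i)"
    and sq: "\<And>i. i \<in> I \<Longrightarrow> integrable (N i) (\<lambda>x. (g i x)\<^sup>2)"
    and c: "\<And>i. i \<in> I \<Longrightarrow> (\<integral>x. g i x \<partial>N i) = 0" and a: "0 < a"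
    and V: "(\<Sum>i\<in>I. \<integral>x. (g i x)\<^sup>2 \<partial>N i) \<le> V"
  shows "emeasure (PiM I N) {x\<in>space (PiM I N). a \<le> \<bar>\<Sum>i\<in>I. g i (x i)\<bar>} \<le> ennreal (V / a\<^sup>2)"
proof -
  interpret prob_space "PiM I N" by (intro prob_space_PiM N)
  have [measurable]: "(\<lambda>x. \<Sum>i\<in>I. g i (x i)) \<in> borel_measurable (PiM I N)"
    using m by (intro borel_measurable_sum) (auto intro!: measurable_compose[OF measurable_component_singleton])
  have "measure (PiM I N) {x\<in>space (PiM I N). a \<le> \<bar>\<Sum>i\<in>I. g i (x i)\<bar>} \<le> (\<integral>x. (\<Sum>i\<in>I. g i (x i))\<^sup>2 \<partial>PiM I N) / a\<^sup>2"
    using sum_centered_second_moment(1)[OF N I m sq c] a by (intro second_moment_method) auto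
  also have "\<dots> \<le> V / a\<^sup>2"
    using sum_centered_second_moment(2)[OF N I m sq c] V by (intro divide_right_mono) auto
  finally show ?thesis by (simp add: emeasure_eq_measure ennreal_leI)
qed

text \<open>Truncation reduces the one-sided law of large numbers to Chebyshev's inequality, so that only a first moment is needed.\<close>

lemma weak_law_upper:
  fixes g :: "'a \<Rightarrow> real"
  assumes S: "prob_space S" and g: "integrable S g" and nn: "\<And>x. 0 \<le> g x"
    and \<theta>: "(\<integral>x. g x \<partial>S) < \<theta>" and \<eta>: "0 < \<eta>"
  shows "\<exists>n0. \<forall>n\<ge>n0::nat. emeasure (PiM {..<n} (\<lambda>_. S))
     {\<omega>\<in>space (PiM {..<n} (\<lambda>_. S)). n * \<theta> < (\<Sum>t<n. g (\<omega> t))} \<le> ennreal \<eta>"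
proof -
  interpret S: prob_space S by fact
  define \<epsilon> where "\<epsilon> = (\<theta> - (\<integral>x. g x \<partial>S)) / 2"
  have \<epsilon>: "0 < \<epsilon>" using \<theta> by (simp add: \<epsilon>_def)
  note gm = borel_measurable_integrable[OF g]
  have gT: "integrable S (\<lambda>x. min (g x) (real T))" for T
    using g by (rule Bochner_Integration.integrable_bound) (use gm nn in \<open>auto simp: min_def\<close>)
  have "(\<lambda>T. \<integral>x. min (g x) (real T) \<partial>S) \<longlonglongrightarrow> (\<integral>x. g x \<partial>S)"
  proof (rule integral_dominated_convergence[where w=g])
    show "AE x in S. (\<lambda>T. min (g x) (real T)) \<longlonglongrightarrow> g x"
    proof (rule AE_I2)
      fix x
      obtain T0 where "g x \<le> real T0" using real_arch_simple by blast
      then have "\<forall>\<^sub>F T in sequentially. min (g x) (real T) = g x"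
        unfolding eventually_sequentially by (intro exI[of _ T0]) (auto simp: min_def)
      then show "(\<lambda>T. min (g x) (real T)) \<longlonglongrightarrow> g x" by (rule tendsto_eventually)
    qed
  qed (use g gm nn in \<open>auto simp: min_def\<close>)
  then have "\<forall>\<^sub>F T in sequentially. (\<integral>x. g x \<partial>S) - \<epsilon> * \<eta> / 2 < (\<integral>x. min (g x) (real T) \<partial>S)"
    using \<epsilon> \<eta> by (intro order_tendstoD) auto
  \<comment> \<open>At this level the excess \<open>d\<close> has mean at most
    \<open>\<epsilon> * \<eta> / 2\<close>, so Markov's inequality at \<open>n * \<epsilon>\<close>
    costs \<open>\<eta> / 2\<close> for every \<open>n\<close>.\<close>
  then obtain T where T: "(\<integral>x. g x \<partial>S) - \<epsilon> * \<eta> / 2 < (\<integral>x. min (g x) (real T) \<partial>S)"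
    by (auto simp: eventually_sequentially)
  define m where "m = (\<integral>x. min (g x) (real T) \<partial>S)"
  define c where "c = (\<lambda>x. min (g x) (real T) - m)"
  define d where "d = (\<lambda>x. g x - min (g x) (real T))"
  have m_le: "m \<le> (\<integral>x. g x \<partial>S)" unfolding m_def by (intro integral_mono gT g) auto
  have m0: "0 \<le> m" "m \<le> T" unfolding m_def
    using integral_mono[OF gT, of "\<lambda>_. real T" T] nn
    by (auto intro!: Bochner_Integration.integral_nonneg simp: S.prob_space)
  have c_int: "integrable S c" "(\<integral>x. c x \<partial>S) = 0"
    using gT[of T] unfolding c_def by (auto simp: m_def S.prob_space)
  have c_bd: "(c x)\<^sup>2 \<le> (real T)\<^sup>2" for x
  proof -
    have "\<bar>c x\<bar> \<le> real T" using nn[of x] m0 by (auto simp: c_def min_def)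
    then show ?thesis by (metis abs_le_square_iff abs_of_nat)
  qed
  have c2: "integrable S (\<lambda>x. (c x)\<^sup>2)" "(\<integral>x. (c x)\<^sup>2 \<partial>S) \<le> (real T)\<^sup>2"
  proof -
    show i: "integrable S (\<lambda>x. (c x)\<^sup>2)"
      using c_bd gm by (intro S.integrable_const_bound[where B="(real T)\<^sup>2"]) (auto simp: c_def)
    have "(\<integral>x. (c x)\<^sup>2 \<partial>S) \<le> (\<integral>x. (real T)\<^sup>2 \<partial>S)"
      using i c_bd by (intro integral_mono) auto
    then show "(\<integral>x. (c x)\<^sup>2 \<partial>S) \<le> (real T)\<^sup>2" by (simp add: S.prob_space)
  qed
  have d_int: "integrable S d" "(\<integral>x. d x \<partial>S) \<le> \<epsilon> * \<eta> / 2" "\<And>x. 0 \<le> d x"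
    using g gT[of T] T unfolding d_def by (auto simp: m_def)
  \<comment> \<open>From here on the Chebyshev bound for the truncated part is at most
    \<open>\<eta> / 2\<close>.\<close>
  define n0 where "n0 = max 1 (nat \<lceil>2 * (real T)\<^sup>2 / (\<epsilon>\<^sup>2 * \<eta>)\<rceil>)"
  show ?thesis
  proof (intro exI[of _ n0] allI impI)
    fix n assume n: "n0 \<le> n"
    let ?P = "PiM {..<n} (\<lambda>_. S)"
    interpret P: prob_space ?P by (intro prob_space_PiM S)
    have n1: "0 < n" and n2: "2 * (real T)\<^sup>2 / (\<epsilon>\<^sup>2 * \<eta>) \<le> n"
      using n by (auto simp: n0_def)
    have cm[measurable]: "c \<in> borel_measurable S" and dm[measurable]: "d \<in> borel_measurable S"
      and gm'[measurable]: "g \<in> borel_measurable S"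
      using c_int(1) d_int(1) g by auto
    let ?A = "{\<omega>\<in>space ?P. n * \<epsilon> \<le> \<bar>\<Sum>t\<in>{..<n}. c (\<omega> t)\<bar>}"
    let ?B = "{\<omega>\<in>space ?P. n * \<epsilon> \<le> (\<Sum>t\<in>{..<n}. d (\<omega> t))}"
    have A: "emeasure ?P ?A \<le> ennreal (n * (real T)\<^sup>2 / (n * \<epsilon>)\<^sup>2)"
      using c2 c_int cm S n1 \<epsilon> by (intro chebyshev_sum) auto
    have "n * (real T)\<^sup>2 / (n * \<epsilon>)\<^sup>2 = (real T)\<^sup>2 / (n * \<epsilon>\<^sup>2)"
      using n1 by (simp add: power2_eq_square)
    also have "\<dots> \<le> \<eta> / 2"
      using n2 n1 \<epsilon> \<eta> by (simp add: field_simps)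
    finally have A: "emeasure ?P ?A \<le> ennreal (\<eta> / 2)"
      using A by (meson ennreal_leI order_trans)
    have dc: "integrable ?P (\<lambda>\<omega>. d (\<omega> t))" "(\<integral>\<omega>. d (\<omega> t) \<partial>?P) = (\<integral>x. d x \<partial>S)" if "t < n" for t
      using PiM_component_integral[of "\<lambda>_. S" t "{..<n}" d] that S d_int(1) by auto
    have "emeasure ?P ?B \<le> ennreal ((1 / (n * \<epsilon>)) * (\<integral>\<omega>. (\<Sum>t\<in>{..<n}. d (\<omega> t)) \<partial>?P))"
      using dc(1) d_int(3) n1 \<epsilon> by (intro integral_Markov_inequality) (auto intro!: sum_nonneg)
    also have "(\<integral>\<omega>. (\<Sum>t\<in>{..<n}. d (\<omega> t)) \<partial>?P) = n * (\<integral>x. d x \<partial>S)"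
      using dc by (subst Bochner_Integration.integral_sum) auto
    also have "(1 / (n * \<epsilon>)) * (n * (\<integral>x. d x \<partial>S)) \<le> \<eta> / 2"
      using d_int(2) n1 \<epsilon> by (simp add: field_simps)
    finally have B: "emeasure ?P ?B \<le> ennreal (\<eta> / 2)" by (simp add: ennreal_leI)
    have "{\<omega>\<in>space ?P. n * \<theta> < (\<Sum>t<n. g (\<omega> t))} \<subseteq> ?A \<union> ?B"
    proof
      fix \<omega> assume w: "\<omega> \<in> {\<omega>\<in>space ?P. n * \<theta> < (\<Sum>t<n. g (\<omega> t))}"
      have "(\<Sum>t<n. g (\<omega> t)) = (\<Sum>t<n. c (\<omega> t)) + (\<Sum>t<n. d (\<omega> t)) + n * m"
        by (simp add: c_def d_def sum_subtractf)
      moreover have "n * m \<le> n * (\<integral>x. g x \<partial>S)" using m_le by (intro mult_left_mono) auto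
      moreover have "n * \<theta> = n * (\<integral>x. g x \<partial>S) + n * \<epsilon> + n * \<epsilon>" by (simp add: \<epsilon>_def field_simps)
      ultimately have "n * \<epsilon> \<le> \<bar>\<Sum>t<n. c (\<omega> t)\<bar> \<or> n * \<epsilon> \<le> (\<Sum>t<n. d (\<omega> t))"
        using w unfolding mem_Collect_eq by linarith
      then show "\<omega> \<in> ?A \<union> ?B" using w by auto
    qed
    then have "emeasure ?P {\<omega>\<in>space ?P. n * \<theta> < (\<Sum>t<n. g (\<omega> t))} \<le> emeasure ?P (?A \<union> ?B)"
      by (intro emeasure_mono) measurable
    also have "\<dots> \<le> emeasure ?P ?A + emeasure ?P ?B"
      by (intro emeasure_subadditive) measurable
    also have "\<dots> \<le> ennreal (\<eta> / 2) + ennreal (\<eta> / 2)" by (intro add_mono A B)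
    also have "\<dots> = ennreal \<eta>" using \<eta> by (simp flip: ennreal_plus)
    finally show "emeasure ?P {\<omega>\<in>space ?P. n * \<theta> < (\<Sum>t<n. g (\<omega> t))} \<le> ennreal \<eta>" .
  qed
qed

lemma nrm_moments:
  assumes q: "0 < q"
  shows "integrable (nrm q) (\<lambda>x. x)" "(\<integral>x. x \<partial>nrm q) = 0"
    "integrable (nrm q) (\<lambda>x. x\<^sup>2)" "(\<integral>x. x\<^sup>2 \<partial>nrm q) = q"
    "integrable (nrm q) (\<lambda>x. x ^ 4)" "(\<integral>x. x ^ 4 \<partial>nrm q) = 3 * q\<^sup>2"
proof -
  have I: "integrable (nrm q) g \<longleftrightarrow> integrable lborel (\<lambda>x. normal_density 0 (sqrt q) x * g x)"
    and E: "(\<integral>x. g x \<partial>nrm q) = (\<integral>x. normal_density 0 (sqrt q) x * g x \<partial>lborel)"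
    if "g \<in> borel_measurable borel" for g :: "real \<Rightarrow> real"
    using that unfolding nrm_def by (auto simp: integrable_real_density integral_real_density)
  have s: "0 < sqrt q" using q by simp
  show "integrable (nrm q) (\<lambda>x. x)" "(\<integral>x. x \<partial>nrm q) = 0"
    using integrable_normal_moment_nz_1[OF s] integral_normal_moment_nz_1[OF s, of 0] by (simp_all add: I E)
  show "integrable (nrm q) (\<lambda>x. x\<^sup>2)" "(\<integral>x. x\<^sup>2 \<partial>nrm q) = q"
    using integrable_normal_moment[OF s, of 0 2] integral_normal_moment_even[OF s, of 0 1] q
    by (simp_all add: I E fact_numeral)
  show "integrable (nrm q) (\<lambda>x. x ^ 4)" "(\<integral>x. x ^ 4 \<partial>nrm q) = 3 * q\<^sup>2"
    using integrable_normal_moment[OF s, of 0 4] integral_normal_moment_even[OF s, of 0 2] q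
    by (simp_all add: I E fact_numeral power2_eq_square)
qed

text \<open>\<open>a * x + b * (x\<^sup>2 - q)\<close> is the centred part of the square of a
  shifted Gaussian. The fourth moment \<open>3 * q\<^sup>2\<close> gives
  \<open>x\<^sup>2 - q\<close> the variance \<open>2 * q\<^sup>2\<close>, and the crude bound on the
  square of a sum doubles both contributions.\<close>

lemma chi_square_moment:
  assumes q: "0 < q"
  shows "integrable (nrm q) (\<lambda>x. (a * x + b * (x\<^sup>2 - q))\<^sup>2)"
    "(\<integral>x. (a * x + b * (x\<^sup>2 - q))\<^sup>2 \<partial>nrm q) \<le> 2 * a\<^sup>2 * q + 4 * b\<^sup>2 * q\<^sup>2"
    "(\<integral>x. a * x + b * (x\<^sup>2 - q) \<partial>nrm q) = 0"
proof -
  interpret prob_space "nrm q" by (rule prob_space_nrm[OF q])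
  note M = nrm_moments[OF q]
  have i2: "integrable (nrm q) (\<lambda>x. (x\<^sup>2 - q)\<^sup>2)"
  proof -
    have "(\<lambda>x::real. (x\<^sup>2 - q)\<^sup>2) = (\<lambda>x. x ^ 4 - 2 * q * x\<^sup>2 + q\<^sup>2)"
      by (auto simp: fun_eq_iff power2_eq_square algebra_simps power4_eq_xxxx)
    then show ?thesis using M by simp
  qed
  have e2: "(\<integral>x. (x\<^sup>2 - q)\<^sup>2 \<partial>nrm q) = 2 * q\<^sup>2"
  proof -
    have "(\<lambda>x::real. (x\<^sup>2 - q)\<^sup>2) = (\<lambda>x. x ^ 4 - 2 * q * x\<^sup>2 + q\<^sup>2)"
      by (auto simp: fun_eq_iff power2_eq_square algebra_simps power4_eq_xxxx)
    then have "(\<integral>x. (x\<^sup>2 - q)\<^sup>2 \<partial>nrm q) = (\<integral>x. x ^ 4 - 2 * q * x\<^sup>2 + q\<^sup>2 \<partial>nrm q)" by simp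
    also have "\<dots> = 3 * q\<^sup>2 - 2 * q * q + q\<^sup>2" using M prob_space by simp
    finally show ?thesis by (simp add: power2_eq_square)
  qed
  have bd: "(a * x + b * (x\<^sup>2 - q))\<^sup>2 \<le> 2 * a\<^sup>2 * x\<^sup>2 + 2 * b\<^sup>2 * (x\<^sup>2 - q)\<^sup>2" for x
  proof -
    have "(u + v)\<^sup>2 \<le> 2 * u\<^sup>2 + 2 * v\<^sup>2" for u v :: real
      using sum_squares_bound[of u v] by (simp add: power2_sum)
    from this[of "a * x" "b * (x\<^sup>2 - q)"] show ?thesis by (simp add: power_mult_distrib mult.assoc)
  qed
  have di: "integrable (nrm q) (\<lambda>x. 2 * a\<^sup>2 * x\<^sup>2 + 2 * b\<^sup>2 * (x\<^sup>2 - q)\<^sup>2)" using M(3) i2 by simp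
  show i: "integrable (nrm q) (\<lambda>x. (a * x + b * (x\<^sup>2 - q))\<^sup>2)"
    using di by (rule Bochner_Integration.integrable_bound) (use bd in auto)
  have "(\<integral>x. (a * x + b * (x\<^sup>2 - q))\<^sup>2 \<partial>nrm q) \<le> (\<integral>x. 2 * a\<^sup>2 * x\<^sup>2 + 2 * b\<^sup>2 * (x\<^sup>2 - q)\<^sup>2 \<partial>nrm q)"
    using i di bd by (intro integral_mono) auto
  also have "\<dots> = 2 * a\<^sup>2 * q + 4 * b\<^sup>2 * q\<^sup>2" using M i2 e2 by simp
  finally show "(\<integral>x. (a * x + b * (x\<^sup>2 - q))\<^sup>2 \<partial>nrm q) \<le> 2 * a\<^sup>2 * q + 4 * b\<^sup>2 * q\<^sup>2" .
  show "(\<integral>x. a * x + b * (x\<^sup>2 - q) \<partial>nrm q) = 0" using M prob_space by simp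
qed

text \<open>Independent noise raises the normalised squared norm of any fixed vector by about
  \<open>\<beta>\<^sup>2 * q\<close>. Expanding the square leaves a centred sum for Chebyshev, whose
  variance depends on \<open>v\<close> only through the bound \<open>A\<close>; hence the estimate
  can be applied conditionally on source and earlier codewords.\<close>

lemma gaussian_perturbation_norm:
  assumes q: "0 < q" and \<epsilon>: "0 < \<epsilon>" and A: "(\<Sum>t<n. (v t)\<^sup>2) \<le> n * A" and n: "0 < n"
  shows "emeasure (nrmn n q) {z\<in>space (nrmn n q). n * (A + \<beta>\<^sup>2 * q + \<epsilon>) < (\<Sum>t<n. (v t + \<beta> * z t)\<^sup>2)}
    \<le> ennreal ((8 * \<beta>\<^sup>2 * q * A + 4 * \<beta> ^ 4 * q\<^sup>2) / (n * \<epsilon>\<^sup>2))"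
proof -
  interpret P: prob_space "nrmn n q" by (rule prob_space_nrmn[OF q])
  let ?g = "\<lambda>t x. (2 * \<beta> * v t) * x + \<beta>\<^sup>2 * (x\<^sup>2 - q)"
  have "emeasure (nrmn n q) {z\<in>space (nrmn n q). n * (A + \<beta>\<^sup>2 * q + \<epsilon>) < (\<Sum>t<n. (v t + \<beta> * z t)\<^sup>2)}
     \<le> emeasure (nrmn n q) {z\<in>space (nrmn n q). n * \<epsilon> \<le> \<bar>\<Sum>t\<in>{..<n}. ?g t (z t)\<bar>}"
  proof (intro emeasure_mono subsetI)
    fix z assume z: "z \<in> {z\<in>space (nrmn n q). n * (A + \<beta>\<^sup>2 * q + \<epsilon>) < (\<Sum>t<n. (v t + \<beta> * z t)\<^sup>2)}"
    have "(v t + \<beta> * z t)\<^sup>2 = (v t)\<^sup>2 + ?g t (z t) + \<beta>\<^sup>2 * q" for t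
      by (simp add: power2_eq_square algebra_simps)
    then have "(\<Sum>t<n. (v t + \<beta> * z t)\<^sup>2) = (\<Sum>t<n. (v t)\<^sup>2) + (\<Sum>t<n. ?g t (z t)) + n * (\<beta>\<^sup>2 * q)"
      by (simp add: sum.distrib)
    then show "z \<in> {z\<in>space (nrmn n q). n * \<epsilon> \<le> \<bar>\<Sum>t\<in>{..<n}. ?g t (z t)\<bar>}"
      using z A by (auto simp: algebra_simps)
  qed measurable
  also have "\<dots> \<le> ennreal ((n * (8 * \<beta>\<^sup>2 * q * A + 4 * \<beta> ^ 4 * q\<^sup>2)) / (n * \<epsilon>)\<^sup>2)"
    unfolding nrmn_def
  proof (intro chebyshev_sum)
    show "prob_space (nrm q)" by (rule prob_space_nrm[OF q])
    show "?g t \<in> borel_measurable (nrm q)" for t by measurable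
    show "integrable (nrm q) (\<lambda>x. (?g t x)\<^sup>2)" for t by (rule chi_square_moment[OF q])
    show "(\<integral>x. ?g t x \<partial>nrm q) = 0" for t by (rule chi_square_moment[OF q])
    have "(\<Sum>t<n. \<integral>x. (?g t x)\<^sup>2 \<partial>nrm q) \<le> (\<Sum>t<n. 2 * (2 * \<beta> * v t)\<^sup>2 * q + 4 * (\<beta>\<^sup>2)\<^sup>2 * q\<^sup>2)"
      by (intro sum_mono chi_square_moment[OF q])
    also have "\<dots> = 8 * \<beta>\<^sup>2 * q * (\<Sum>t<n. (v t)\<^sup>2) + n * (4 * \<beta> ^ 4 * q\<^sup>2)"
      by (simp add: sum.distrib sum_distrib_left power_mult_distrib mult_ac flip: power_mult)
    also have "\<dots> \<le> 8 * \<beta>\<^sup>2 * q * (n * A) + n * (4 * \<beta> ^ 4 * q\<^sup>2)"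
      using A q by (intro add_mono mult_left_mono) auto
    finally show "(\<Sum>t<n. \<integral>x. (?g t x)\<^sup>2 \<partial>nrm q) \<le> n * (8 * \<beta>\<^sup>2 * q * A + 4 * \<beta> ^ 4 * q\<^sup>2)"
      by (simp add: algebra_simps)
  qed (use \<epsilon> n in auto)
  also have "(n * (8 * \<beta>\<^sup>2 * q * A + 4 * \<beta> ^ 4 * q\<^sup>2)) / (n * \<epsilon>)\<^sup>2 = (8 * \<beta>\<^sup>2 * q * A + 4 * \<beta> ^ 4 * q\<^sup>2) / (n * \<epsilon>\<^sup>2)"
    using n by (simp add: power2_eq_square)
  finally show ?thesis .
qed

text \<open>Chebyshev with variance bound \<open>4 * q\<^sup>2\<close> per letter leaves failure
  probability at most \<open>4 / (n * \<delta>\<^sup>2)\<close>, whence the constant 8. The upper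
  end of the shell follows from \<open>\<delta> \<le> 1\<close>.\<close>

lemma gtyp_half:
  assumes q: "0 < q" and \<delta>: "0 < \<delta>" "\<delta> \<le> 1" and n: "0 < n" "8 / \<delta>\<^sup>2 \<le> n"
  shows "1/2 \<le> emeasure (nrmn n q) {z\<in>space (nrmn n q). gtyp n q \<delta> (\<Sum>t<n. (z t)\<^sup>2)}"
proof -
  interpret P: prob_space "nrmn n q" by (rule prob_space_nrmn[OF q])
  let ?T = "{z\<in>space (nrmn n q). gtyp n q \<delta> (\<Sum>t<n. (z t)\<^sup>2)}"
  let ?F = "{z\<in>space (nrmn n q). n * (q * \<delta>) \<le> \<bar>\<Sum>t\<in>{..<n}. 0 * z t + 1 * ((z t)\<^sup>2 - q)\<bar>}"
  have T[measurable]: "?T \<in> sets (nrmn n q)" unfolding gtyp_def by measurable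
  have F: "emeasure (nrmn n q) ?F \<le> ennreal ((n * (4 * q\<^sup>2)) / (n * (q * \<delta>))\<^sup>2)"
    unfolding nrmn_def
  proof (intro chebyshev_sum)
    show "prob_space (nrm q)" by (rule prob_space_nrm[OF q])
    show "(\<lambda>x. 0 * x + 1 * (x\<^sup>2 - q)) \<in> borel_measurable (nrm q)" by measurable
    show "integrable (nrm q) (\<lambda>x. (0 * x + 1 * (x\<^sup>2 - q))\<^sup>2)" by (rule chi_square_moment[OF q])
    show "(\<integral>x. 0 * x + 1 * (x\<^sup>2 - q) \<partial>nrm q) = 0" by (rule chi_square_moment[OF q])
    have "(\<Sum>t<n. \<integral>x. (0 * x + 1 * (x\<^sup>2 - q))\<^sup>2 \<partial>nrm q) \<le> (\<Sum>t<n. 2 * 0\<^sup>2 * q + 4 * 1\<^sup>2 * q\<^sup>2)"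
      by (intro sum_mono chi_square_moment[OF q])
    then show "(\<Sum>t<n. \<integral>x. (0 * x + 1 * (x\<^sup>2 - q))\<^sup>2 \<partial>nrm q) \<le> n * (4 * q\<^sup>2)" by simp
  qed (use q \<delta> n in auto)
  have "(n * (4 * q\<^sup>2)) / (n * (q * \<delta>))\<^sup>2 = 4 / (n * \<delta>\<^sup>2)"
    using q n by (simp add: power2_eq_square field_simps)
  also have "\<dots> \<le> 1/2" using n \<delta> by (simp add: field_simps)
  finally have F: "measure (nrmn n q) ?F \<le> 1/2"
    using F by (simp add: P.emeasure_eq_measure)
  have [measurable]: "?F \<in> sets (nrmn n q)" by measurable
  have "space (nrmn n q) - ?F \<subseteq> ?T"
  proof
    fix z assume z: "z \<in> space (nrmn n q) - ?F"
    have "(\<Sum>t\<in>{..<n}. 0 * z t + 1 * ((z t)\<^sup>2 - q)) = (\<Sum>t<n. (z t)\<^sup>2) - n * q" by (simp add: sum_subtractf)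
    moreover have "n * (q * \<delta>) \<le> n * q" using q \<delta> by (intro mult_left_mono) (auto simp: mult_le_cancel_left1)
    ultimately show "z \<in> ?T" using z by (auto simp: gtyp_def algebra_simps)
  qed
  then have "measure (nrmn n q) (space (nrmn n q) - ?F) \<le> measure (nrmn n q) ?T"
    using T by (rule P.finite_measure_mono)
  then have "1 - measure (nrmn n q) ?F \<le> measure (nrmn n q) ?T"
    using P.prob_compl[OF \<open>?F \<in> sets (nrmn n q)\<close>] by simp
  then have "1/2 \<le> measure (nrmn n q) ?T" using F by simp
  then have "ennreal (1/2) \<le> emeasure (nrmn n q) ?T" unfolding P.emeasure_eq_measure by (rule ennreal_leI)
  then show ?thesis using divide_ennreal[of 1 2] by simp
qed

lemma (in pair_prob_space) integral_product_fst_snd: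
  fixes f g :: "_ \<Rightarrow> real"
  assumes f: "integrable M1 f" and g: "integrable M2 g"
  shows "integrable (M1 \<Otimes>\<^sub>M M2) (\<lambda>p. f (fst p) * g (snd p))"
    "(\<integral>p. f (fst p) * g (snd p) \<partial>(M1 \<Otimes>\<^sub>M M2)) = (\<integral>x. f x \<partial>M1) * (\<integral>x. g x \<partial>M2)"
proof -
  have [measurable]: "f \<in> borel_measurable M1" "g \<in> borel_measurable M2" using f g by auto
  show i: "integrable (M1 \<Otimes>\<^sub>M M2) (\<lambda>p. f (fst p) * g (snd p))"
    using f g by (intro Fubini_integrable) (auto simp: abs_mult)
  show "(\<integral>p. f (fst p) * g (snd p) \<partial>(M1 \<Otimes>\<^sub>M M2)) = (\<integral>x. f x \<partial>M1) * (\<integral>x. g x \<partial>M2)"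
    using integral_fst'[OF i] by simp
qed

subsection \<open>The source\<close>

locale ceo_source =
  fixes f :: "real \<Rightarrow> real" and sW2 :: real and M :: nat
  assumes f_meas[measurable]: "f \<in> borel_measurable lborel"
    and f_nonneg: "\<And>x. f x \<ge> 0"
    and f_prob: "(\<integral>\<^sup>+x. ennreal (f x) \<partial>lborel) = 1"
    and fin_var: "integrable lborel (\<lambda>x. x\<^sup>2 * f x)"
    and var_pos: "varX f > 0"
    and M_pos: "M \<ge> 1"
    and sW2_pos: "sW2 > 0"
begin

lemma sets_Xlaw[simp, measurable_cong]: "sets (Xlaw f) = sets borel" and space_Xlaw[simp]: "space (Xlaw f) = UNIV"
  by (simp_all add: Xlaw_def)

lemma prob_space_Xlaw: "prob_space (Xlaw f)"
  using f_prob by (intro prob_spaceI) (simp add: Xlaw_def emeasure_density)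

lemma Wlaw_eq: "Wlaw sW2 M = PiM {..<M} (\<lambda>_. nrm sW2)"
  by (simp add: Wlaw_def nrm_def)

lemma prob_space_Wlaw: "prob_space (Wlaw sW2 M)"
  unfolding Wlaw_eq by (intro prob_space_PiM prob_space_nrm sW2_pos)

lemma sets_Wlaw[simp, measurable_cong]: "sets (Wlaw sW2 M) = sets (PiM {..<M} (\<lambda>_. borel))"
  unfolding Wlaw_eq by (intro sets_PiM_cong) auto

sublocale X: prob_space "Xlaw f" by (rule prob_space_Xlaw)
lemma prob_Xlaw_UNIV[simp]: "measure (Xlaw f) UNIV = 1"
  using X.prob_space by simp

sublocale W: prob_space "Wlaw sW2 M" by (rule prob_space_Wlaw)
sublocale XW: pair_prob_space "Xlaw f" "Wlaw sW2 M" ..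

definition chan :: "real \<times> (nat \<Rightarrow> real) \<Rightarrow> real \<times> (nat \<Rightarrow> real)" where
  "chan = (\<lambda>(x, w). (x, \<lambda>i\<in>{..<M}. x + w i))"

lemma chan_meas[measurable]: "chan \<in> measurable (Xlaw f \<Otimes>\<^sub>M Wlaw sW2 M) (borel \<Otimes>\<^sub>M PiM {..<M} (\<lambda>_. borel))"
  unfolding chan_def by measurable

lemma Src_eq: "Src f sW2 M = distr (Xlaw f \<Otimes>\<^sub>M Wlaw sW2 M) (borel \<Otimes>\<^sub>M PiM {..<M} (\<lambda>_. borel)) chan"
  by (simp add: Src_def chan_def)

lemma sets_Src[simp, measurable_cong]: "sets (Src f sW2 M) = sets (borel \<Otimes>\<^sub>M PiM {..<M} (\<lambda>_. borel))"
  by (simp add: Src_eq)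

lemma prob_space_Src: "prob_space (Src f sW2 M)"
  unfolding Src_eq by (intro XW.prob_space_distr chan_meas)

sublocale S: prob_space "Src f sW2 M" by (rule prob_space_Src)

lemma integral_Src:
  fixes F :: "_ \<Rightarrow> real"
  assumes "F \<in> borel_measurable (Src f sW2 M)"
  shows "(\<integral>\<omega>. F \<omega> \<partial>Src f sW2 M) = (\<integral>p. F (chan p) \<partial>(Xlaw f \<Otimes>\<^sub>M Wlaw sW2 M))"
    "integrable (Src f sW2 M) F \<longleftrightarrow> integrable (Xlaw f \<Otimes>\<^sub>M Wlaw sW2 M) (\<lambda>p. F (chan p))"
  using assms unfolding Src_eq
  by (auto intro!: integral_distr integrable_distr_eq simp: measurable_distr_eq1)

lemma nn_integral_Src:
  assumes "F \<in> borel_measurable (Src f sW2 M)"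
  shows "(\<integral>\<^sup>+\<omega>. F \<omega> \<partial>Src f sW2 M) = (\<integral>\<^sup>+p. F (chan p) \<partial>(Xlaw f \<Otimes>\<^sub>M Wlaw sW2 M))"
  using assms unfolding Src_eq by (intro nn_integral_distr) (auto simp: measurable_distr_eq1)

lemma integrable_X2: "integrable (Xlaw f) (\<lambda>x. x\<^sup>2)"
  using fin_var f_nonneg unfolding Xlaw_def by (subst integrable_real_density) (auto simp: mult.commute)

lemma integrable_X: "integrable (Xlaw f) (\<lambda>x. x)"
  using X.square_integrable_imp_integrable[OF _ integrable_X2] by auto

definition \<mu> :: real where "\<mu> = (\<integral>x. x \<partial>Xlaw f)"

lemma varX_eq: "varX f = (\<integral>x. (x - \<mu>)\<^sup>2 \<partial>Xlaw f)"
  by (simp add: varX_def \<mu>_def)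

lemma integrable_centered: "integrable (Xlaw f) (\<lambda>x. (x - \<mu>)\<^sup>2)" "integrable (Xlaw f) (\<lambda>x. x - \<mu>)"
  "(\<integral>x. x - \<mu> \<partial>Xlaw f) = 0"
proof -
  have "(\<lambda>x. (x - \<mu>)\<^sup>2) = (\<lambda>x. x\<^sup>2 - 2 * \<mu> * x + \<mu>\<^sup>2)" by (auto simp: fun_eq_iff power2_eq_square algebra_simps)
  then show "integrable (Xlaw f) (\<lambda>x. (x - \<mu>)\<^sup>2)" using integrable_X2 integrable_X by simp
  show "integrable (Xlaw f) (\<lambda>x. x - \<mu>)" using integrable_X by simp
  show "(\<integral>x. x - \<mu> \<partial>Xlaw f) = 0" using integrable_X by (simp add: \<mu>_def X.prob_space)
qed

text \<open>Source and observations all have mean \<open>\<mu>\<close>, so every such form is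
  centred.\<close>

definition form :: "real \<Rightarrow> (nat \<Rightarrow> real) \<Rightarrow> real \<times> (nat \<Rightarrow> real) \<Rightarrow> real" where
  "form \<alpha> \<beta> \<omega> = \<alpha> * (fst \<omega> - \<mu>) + (\<Sum>i<M. \<beta> i * (snd \<omega> i - \<mu>))"

lemma form_meas[measurable]: "form \<alpha> \<beta> \<in> borel_measurable (borel \<Otimes>\<^sub>M PiM {..<M} (\<lambda>_. borel))"
  unfolding form_def by measurable

text \<open>In terms of the independent variables the form is
  \<open>(\<alpha> + sum of \<beta>) * (x - \<mu>)\<close> plus a linear form in the noises, and the
  cross term vanishes. This is why the tests, and hence the rates, see the law of \<open>X\<close>
  through its variance alone.\<close>

lemma form_second_moment:
  shows "integrable (Src f sW2 M) (\<lambda>\<omega>. (form \<alpha> \<beta> \<omega>)\<^sup>2)"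
    "(\<integral>\<omega>. (form \<alpha> \<beta> \<omega>)\<^sup>2 \<partial>Src f sW2 M) = (\<alpha> + (\<Sum>i<M. \<beta> i))\<^sup>2 * varX f + sW2 * (\<Sum>i<M. (\<beta> i)\<^sup>2)"
proof -
  let ?a = "\<alpha> + (\<Sum>i<M. \<beta> i)"
  let ?S = "\<lambda>w. \<Sum>i<M. \<beta> i * w i"
  let ?P = "Xlaw f \<Otimes>\<^sub>M Wlaw sW2 M"
  have eq: "form \<alpha> \<beta> (chan (x, w)) = ?a * (x - \<mu>) + ?S w" for x w
  proof -
    have "(\<Sum>i<M. \<beta> i * (x + w i - \<mu>)) = (\<Sum>i<M. \<beta> i * (x - \<mu>) + \<beta> i * w i)"
      by (intro sum.cong refl) (simp add: algebra_simps)
    also have "\<dots> = (\<Sum>i<M. \<beta> i) * (x - \<mu>) + ?S w"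
      by (simp only: sum.distrib sum_distrib_right)
    finally show ?thesis by (simp add: form_def chan_def distrib_right)
  qed
  note nm = nrm_moments[OF sW2_pos]
  have c1: "(\<integral>x. \<beta> i * x \<partial>nrm sW2) = 0" for i using nm by simp
  have c2: "integrable (nrm sW2) (\<lambda>x. (\<beta> i * x)\<^sup>2)" for i using nm by (simp add: power_mult_distrib)
  note S = sum_centered_second_moment[of "\<lambda>_. nrm sW2" "{..<M}" "\<lambda>i x. \<beta> i * x", OF prob_space_nrm[OF sW2_pos] finite_lessThan _ c2 c1]
  have S2: "integrable (Wlaw sW2 M) (\<lambda>w. (?S w)\<^sup>2)" "(\<integral>w. (?S w)\<^sup>2 \<partial>Wlaw sW2 M) = sW2 * (\<Sum>i<M. (\<beta> i)\<^sup>2)"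
  proof -
    show "integrable (Wlaw sW2 M) (\<lambda>w. (?S w)\<^sup>2)" unfolding Wlaw_eq by (rule S(1)) simp
    have "(\<integral>w. (?S w)\<^sup>2 \<partial>Wlaw sW2 M) = (\<Sum>i<M. \<integral>x. (\<beta> i * x)\<^sup>2 \<partial>nrm sW2)"
      unfolding Wlaw_eq by (rule S(2)) simp
    also have "\<dots> = (\<Sum>i<M. sW2 * (\<beta> i)\<^sup>2)"
      using nm by (simp add: power_mult_distrib mult.commute[of sW2])
    finally show "(\<integral>w. (?S w)\<^sup>2 \<partial>Wlaw sW2 M) = sW2 * (\<Sum>i<M. (\<beta> i)\<^sup>2)" by (simp add: sum_distrib_left)
  qed
  have S1: "integrable (Wlaw sW2 M) ?S" "(\<integral>w. ?S w \<partial>Wlaw sW2 M) = 0"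
    using PiM_component_integral[of "\<lambda>_. nrm sW2" _ "{..<M}" "\<lambda>x. x"] prob_space_nrm[OF sW2_pos] nm
    unfolding Wlaw_eq by (auto intro!: Bochner_Integration.integrable_sum simp: Bochner_Integration.integral_sum)
  note cX = integrable_centered
  have o: "integrable (Wlaw sW2 M) (\<lambda>_. 1::real)" "(\<integral>w. 1 \<partial>Wlaw sW2 M) = (1::real)"
    "integrable (Xlaw f) (\<lambda>_. 1::real)" "(\<integral>w. 1 \<partial>Xlaw f) = (1::real)"
    by (simp_all add: W.prob_space X.prob_space)
  have exp: "(form \<alpha> \<beta> (chan p))\<^sup>2 = ?a\<^sup>2 * ((fst p - \<mu>)\<^sup>2 * 1) + 2 * ?a * ((fst p - \<mu>) * ?S (snd p)) + 1 * (?S (snd p))\<^sup>2" for p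
  proof -
    have "(A * x + S)\<^sup>2 = A\<^sup>2 * (x\<^sup>2 * 1) + 2 * A * (x * S) + 1 * S\<^sup>2" for A x S :: real
      by (simp add: power2_eq_square algebra_simps)
    then show ?thesis using eq[of "fst p" "snd p"] by simp
  qed
  note p1 = XW.integral_product_fst_snd[OF cX(1) o(1)] and p2 = XW.integral_product_fst_snd[OF cX(2) S1(1)]
    and p3 = XW.integral_product_fst_snd[OF o(3) S2(1)]
  have m: "(\<lambda>\<omega>. (form \<alpha> \<beta> \<omega>)\<^sup>2) \<in> borel_measurable (Src f sW2 M)" by measurable
  show "integrable (Src f sW2 M) (\<lambda>\<omega>. (form \<alpha> \<beta> \<omega>)\<^sup>2)"
    unfolding integral_Src(2)[OF m] exp
    by (intro Bochner_Integration.integrable_add integrable_mult_right p1 p2 p3)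
  have "(\<integral>\<omega>. (form \<alpha> \<beta> \<omega>)\<^sup>2 \<partial>Src f sW2 M) = ?a\<^sup>2 * (varX f * 1) + 2 * ?a * (0 * 0) + 1 * (sW2 * (\<Sum>i<M. (\<beta> i)\<^sup>2))"
    unfolding integral_Src(1)[OF m] exp
    using p1 p2 p3 cX(3) S1(2) S2(2) o(2,4) by (simp only: Bochner_Integration.integral_add Bochner_Integration.integrable_add integrable_mult_right integral_mult_right_zero varX_eq)
  then show "(\<integral>\<omega>. (form \<alpha> \<beta> \<omega>)\<^sup>2 \<partial>Src f sW2 M) = (\<alpha> + (\<Sum>i<M. \<beta> i))\<^sup>2 * varX f + sW2 * (\<Sum>i<M. (\<beta> i)\<^sup>2)"
    by simp
qed

section \<open>Blocks, ideal codewords and linear tests\<close>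

lemma prob_space_Blk: "prob_space (Blk f sW2 M n)"
  unfolding Blk_def by (intro prob_space_PiM prob_space_Src)

abbreviation "MY n \<equiv> PiM {..<n} (\<lambda>_. borel :: real measure)"

definition yv :: "nat \<Rightarrow> (nat \<Rightarrow> real \<times> (nat \<Rightarrow> real)) \<Rightarrow> nat \<Rightarrow> nat \<Rightarrow> real" where
  "yv n \<omega> i = (\<lambda>s\<in>{..<n}. snd (\<omega> s) i)"

lemma Blk_component[measurable]: "t \<in> {..<n} \<Longrightarrow> (\<lambda>\<omega>. \<omega> t) \<in> measurable (Blk f sW2 M n) (borel \<Otimes>\<^sub>M PiM {..<M} (\<lambda>_. borel))"
  using measurable_component_singleton[of t "{..<n}" "\<lambda>_. Src f sW2 M"]
  by (simp add: Blk_def measurable_cong_sets[OF refl sets_Src])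

lemma Blk_fst[measurable]: "t \<in> {..<n} \<Longrightarrow> (\<lambda>\<omega>. fst (\<omega> t)) \<in> borel_measurable (Blk f sW2 M n)"
  by (rule measurable_compose[OF Blk_component measurable_fst])

lemma Blk_snd[measurable]: "t \<in> {..<n} \<Longrightarrow> i \<in> {..<M} \<Longrightarrow> (\<lambda>\<omega>. snd (\<omega> t) i) \<in> borel_measurable (Blk f sW2 M n)"
  by (rule measurable_compose[OF Blk_component]) simp_all

lemma yv_meas[measurable]: "i \<in> {..<M} \<Longrightarrow> (\<lambda>\<omega>. yv n \<omega> i) \<in> measurable (Blk f sW2 M n) (MY n)"
  unfolding yv_def by (intro measurable_restrict) (rule Blk_snd)

text \<open>\<open>ideal_avg m k\<close> averages over the \<open>m\<close> encoders from \<open>k\<close> on, each of them replaced by an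
  independent Gaussian perturbation of its own observation.\<close>

fun ideal_avg :: "nat \<Rightarrow> real \<Rightarrow> (nat \<Rightarrow> nat \<Rightarrow> real) \<Rightarrow> ((nat \<Rightarrow> nat \<Rightarrow> real) \<Rightarrow> ennreal) \<Rightarrow> nat \<Rightarrow> nat \<Rightarrow> (nat \<Rightarrow> nat \<Rightarrow> real) \<Rightarrow> ennreal" where
  "ideal_avg n q y \<Phi> 0 k u = \<Phi> u"
| "ideal_avg n q y \<Phi> (Suc m) k u = (\<integral>\<^sup>+z. ideal_avg n q y \<Phi> m (Suc k) (u(k := \<lambda>t\<in>{..<n}. y k t + z t)) \<partial>nrmn n q)"

text \<open>A bound decided by the codewords below \<open>k\<close> is not affected by averaging
  over the later ones. It is used to read off, before the remaining encoders have acted, that a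
  prediction test is already lost.\<close>

lemma ideal_avg_ge:
  assumes "0 < q" and "\<And>u'. (\<forall>i<k. u' i = u i) \<Longrightarrow> c \<le> \<Phi> u'"
  shows "c \<le> ideal_avg n q y \<Phi> m k u"
  using assms(2)
proof (induction m arbitrary: k u)
  case 0 then show ?case by simp
next
  case (Suc m)
  interpret G: prob_space "nrmn n q" by (rule prob_space_nrmn[OF assms(1)])
  have "c = (\<integral>\<^sup>+z. c \<partial>nrmn n q)" by (simp add: G.emeasure_space_1)
  also have "\<dots> \<le> (\<integral>\<^sup>+z. ideal_avg n q y \<Phi> m (Suc k) (u(k := \<lambda>t\<in>{..<n}. y k t + z t)) \<partial>nrmn n q)"
    by (intro nn_integral_mono Suc.IH Suc.prems) auto
  finally show ?case by simp
qed

lemma ideal_avg_le: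
  assumes "0 < q" and "\<And>u. \<Phi> u \<le> B"
  shows "ideal_avg n q y \<Phi> m k u \<le> B"
proof (induction m arbitrary: k u)
  case 0 then show ?case using assms by simp
next
  case (Suc m)
  interpret G: prob_space "nrmn n q" by (rule prob_space_nrmn[OF assms(1)])
  have "ideal_avg n q y \<Phi> (Suc m) k u \<le> (\<integral>\<^sup>+z. B \<partial>nrmn n q)"
    unfolding ideal_avg.simps by (intro nn_integral_mono Suc.IH)
  then show ?case by (simp add: G.emeasure_space_1)
qed

lemma ideal_avg_meas:
  assumes q: "0 < q" and y: "\<And>i. i \<in> {..<M} \<Longrightarrow> (\<lambda>\<omega>. y \<omega> i) \<in> measurable P (MY n)"
    and \<Phi>: "(\<lambda>x. \<Phi> (fst x) (snd x)) \<in> borel_measurable (P \<Otimes>\<^sub>M PiM {..<M} (\<lambda>_. MY n))"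
    and "k + m \<le> M"
  shows "(\<lambda>x. ideal_avg n q (y (fst x)) (\<Phi> (fst x)) m k (snd x)) \<in> borel_measurable (P \<Otimes>\<^sub>M PiM {..<M} (\<lambda>_. MY n))"
  using assms(4)
proof (induction m arbitrary: k)
  case 0 then show ?case using \<Phi> by simp
next
  case (Suc m)
  interpret G: prob_space "nrmn n q" by (rule prob_space_nrmn[OF q])
  let ?A = "P \<Otimes>\<^sub>M PiM {..<M} (\<lambda>_. MY n)"
  have k: "k \<in> {..<M}" using Suc.prems by simp
  have [measurable]: "(\<lambda>x. y (fst (fst x)) k) \<in> measurable (?A \<Otimes>\<^sub>M nrmn n q) (MY n)"
    by (rule measurable_compose[OF _ y[OF k]]) measurable
  have 1: "(\<lambda>x. (snd (fst x))(k := \<lambda>t\<in>{..<n}. y (fst (fst x)) k t + snd x t)) \<in> measurable (?A \<Otimes>\<^sub>M nrmn n q) (PiM {..<M} (\<lambda>_. MY n))"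
    by (rule measurable_fun_upd[where J="{..<M}"]) (use k in auto, measurable)
  have "(\<lambda>x. (fst (fst x), (snd (fst x))(k := \<lambda>t\<in>{..<n}. y (fst (fst x)) k t + snd x t))) \<in> measurable (?A \<Otimes>\<^sub>M nrmn n q) ?A"
    using 1 by measurable
  from measurable_compose[OF this Suc.IH[of "Suc k"]] Suc.prems
  have "(\<lambda>x. ideal_avg n q (y (fst (fst x))) (\<Phi> (fst (fst x))) m (Suc k) ((snd (fst x))(k := \<lambda>t\<in>{..<n}. y (fst (fst x)) k t + snd x t))) \<in> borel_measurable (?A \<Otimes>\<^sub>M nrmn n q)"
    by (simp add: fun_upd_def)
  then show ?case unfolding ideal_avg.simps
    by (intro G.borel_measurable_nn_integral) (simp add: split_beta')
qed

text \<open>A hybrid: encoders below \<open>k\<close> enter with their codewords, the others with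
  their raw observations. At \<open>k = 0\<close> it is \<open>form\<close> letter by letter, at
  \<open>k = M\<close> it is what the decoder's tests concern.\<close>

definition pform :: "real \<Rightarrow> (nat \<Rightarrow> real) \<Rightarrow> nat \<Rightarrow> (nat \<Rightarrow> real \<times> (nat \<Rightarrow> real)) \<Rightarrow> (nat \<Rightarrow> nat \<Rightarrow> real) \<Rightarrow> nat \<Rightarrow> real" where
  "pform \<alpha> \<beta> k \<omega> u t = \<alpha> * (fst (\<omega> t) - \<mu>) + (\<Sum>i<M. \<beta> i * ((if i < k then u i t else snd (\<omega> t) i) - \<mu>))"

definition pbad :: "nat \<Rightarrow> real \<Rightarrow> (nat \<Rightarrow> real) \<Rightarrow> real \<Rightarrow> nat \<Rightarrow> (nat \<Rightarrow> real \<times> (nat \<Rightarrow> real)) \<Rightarrow> (nat \<Rightarrow> nat \<Rightarrow> real) \<Rightarrow> ennreal" where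
  "pbad n \<alpha> \<beta> \<theta> k \<omega> u = (if n * \<theta> < (\<Sum>t<n. (pform \<alpha> \<beta> k \<omega> u t)\<^sup>2) then 1 else 0)"

lemma pbad_le_1: "pbad n \<alpha> \<beta> \<theta> k \<omega> u \<le> 1"
  by (simp add: pbad_def)

lemma pform_step:
  assumes "k < M" "t < n"
  shows "pform \<alpha> \<beta> (Suc k) \<omega> (u(k := \<lambda>t\<in>{..<n}. yv n \<omega> k t + z t)) t = pform \<alpha> \<beta> k \<omega> u t + \<beta> k * z t"
proof -
  have "(\<Sum>i<M. \<beta> i * ((if i < Suc k then (u(k := \<lambda>t\<in>{..<n}. yv n \<omega> k t + z t)) i t else snd (\<omega> t) i) - \<mu>)) =
    (\<Sum>i<M. \<beta> i * ((if i < k then u i t else snd (\<omega> t) i) - \<mu>) + (if i = k then \<beta> k * z t else 0))"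
    using assms by (intro sum.cong refl) (auto simp: yv_def algebra_simps)
  also have "\<dots> = (\<Sum>i<M. \<beta> i * ((if i < k then u i t else snd (\<omega> t) i) - \<mu>)) + \<beta> k * z t"
    using assms by (simp add: sum.distrib)
  finally show ?thesis by (simp add: pform_def)
qed

lemma pbad_meas: "(\<lambda>x. pbad n \<alpha> \<beta> \<theta> k (fst x) (snd x)) \<in> borel_measurable (Blk f sW2 M n \<Otimes>\<^sub>M PiM {..<M} (\<lambda>_. MY n))"
proof -
  let ?A = "Blk f sW2 M n \<Otimes>\<^sub>M PiM {..<M} (\<lambda>_. MY n)"
  have 1: "(\<lambda>x. fst (fst x t)) \<in> borel_measurable ?A" if "t \<in> {..<n}" for t
    by (rule measurable_compose[OF measurable_fst Blk_fst[OF that]])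
  have 2: "(\<lambda>x. snd (fst x t) i) \<in> borel_measurable ?A" if "t \<in> {..<n}" "i \<in> {..<M}" for t i
    by (rule measurable_compose[OF measurable_fst Blk_snd[OF that]])
  have 3: "(\<lambda>x. snd x i t) \<in> borel_measurable ?A" if "t \<in> {..<n}" "i \<in> {..<M}" for t i
    by (rule measurable_compose[OF measurable_compose[OF measurable_snd measurable_component_singleton[OF that(2)]] measurable_component_singleton[OF that(1)]])
  have 4: "(\<lambda>x. (if i < k then snd x i t else snd (fst x t) i)) \<in> borel_measurable ?A" if "t \<in> {..<n}" "i \<in> {..<M}" for t i
    using 2[OF that] 3[OF that] by (cases "i < k") auto
  have "(\<lambda>x. pform \<alpha> \<beta> k (fst x) (snd x) t) \<in> borel_measurable ?A" if "t \<in> {..<n}" for t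
    unfolding pform_def using 1[OF that] 4[OF that]
    by (intro borel_measurable_add borel_measurable_times borel_measurable_sum borel_measurable_diff borel_measurable_const) auto
  then have [measurable]: "(\<lambda>x. \<Sum>t<n. (pform \<alpha> \<beta> k (fst x) (snd x) t)\<^sup>2) \<in> borel_measurable ?A"
    by (intro borel_measurable_sum borel_measurable_power) auto
  show ?thesis unfolding pbad_def by measurable
qed

text \<open>The final threshold \<open>\<theta>\<close> moved back: each encoder not yet replaced
  will still add the noise power \<open>(\<beta> i)\<^sup>2 * q\<close> and a slack
  \<open>\<epsilon>\<close>.\<close>

definition thr :: "real \<Rightarrow> (nat \<Rightarrow> real) \<Rightarrow> real \<Rightarrow> real \<Rightarrow> nat \<Rightarrow> real" where
  "thr q \<beta> \<theta> \<epsilon> k = \<theta> - (\<Sum>i\<in>{k..<M}. (\<beta> i)\<^sup>2 * q + \<epsilon>)"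

text \<open>The Chebyshev constants of \<open>gaussian_perturbation_norm\<close>, added over all
  encoders so that one constant serves every step; \<open>\<bar>\<theta>\<bar>\<close> stands in for
  all intermediate thresholds.\<close>

definition fluct :: "real \<Rightarrow> (nat \<Rightarrow> real) \<Rightarrow> real \<Rightarrow> real \<Rightarrow> real" where
  "fluct q \<beta> \<theta> \<epsilon> = (\<Sum>i<M. (8 * (\<beta> i)\<^sup>2 * q * \<bar>\<theta>\<bar> + 4 * \<beta> i ^ 4 * q\<^sup>2) / \<epsilon>\<^sup>2)"

text \<open>If the test already fails at stage \<open>k\<close>, the right side is at least 1.
  Otherwise \<open>pform_step\<close> adds the noise \<open>\<beta> k * z t\<close> to a vector of
  controlled norm, and the perturbation estimate bounds the chance of crossing the next
  threshold.\<close>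

lemma pbad_average_step:
  assumes q: "0 < q" and \<epsilon>: "0 < \<epsilon>" and k: "k < M" and n: "0 < n"
  shows "(\<integral>\<^sup>+z. pbad n \<alpha> \<beta> (thr q \<beta> \<theta> \<epsilon> (Suc k)) (Suc k) \<omega> (u(k := \<lambda>t\<in>{..<n}. yv n \<omega> k t + z t)) \<partial>nrmn n q)
    \<le> pbad n \<alpha> \<beta> (thr q \<beta> \<theta> \<epsilon> k) k \<omega> u + ennreal (fluct q \<beta> \<theta> \<epsilon> / n)"
    (is "?L \<le> _")
    and "(\<lambda>z. pbad n \<alpha> \<beta> (thr q \<beta> \<theta> \<epsilon> (Suc k)) (Suc k) \<omega> (u(k := \<lambda>t\<in>{..<n}. yv n \<omega> k t + z t))) \<in> borel_measurable (nrmn n q)"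
proof -
  interpret G: prob_space "nrmn n q" by (rule prob_space_nrmn[OF q])
  let ?v = "\<lambda>t. pform \<alpha> \<beta> k \<omega> u t"
  let ?A = "thr q \<beta> \<theta> \<epsilon> k"
  have T: "thr q \<beta> \<theta> \<epsilon> (Suc k) = ?A + (\<beta> k)\<^sup>2 * q + \<epsilon>"
    unfolding thr_def using k by (subst (2) sum.atLeast_Suc_lessThan) auto
  have eq: "pbad n \<alpha> \<beta> (thr q \<beta> \<theta> \<epsilon> (Suc k)) (Suc k) \<omega> (u(k := \<lambda>t\<in>{..<n}. yv n \<omega> k t + z t))
     = (if n * (?A + (\<beta> k)\<^sup>2 * q + \<epsilon>) < (\<Sum>t<n. (?v t + \<beta> k * z t)\<^sup>2) then 1 else 0)" for z
  proof -
    have "(\<Sum>t<n. (pform \<alpha> \<beta> (Suc k) \<omega> (u(k := \<lambda>t\<in>{..<n}. yv n \<omega> k t + z t)) t)\<^sup>2) = (\<Sum>t<n. (?v t + \<beta> k * z t)\<^sup>2)"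
      using k by (intro sum.cong refl) (subst pform_step, auto)
    then show ?thesis unfolding pbad_def T by simp
  qed
  show "(\<lambda>z. pbad n \<alpha> \<beta> (thr q \<beta> \<theta> \<epsilon> (Suc k)) (Suc k) \<omega> (u(k := \<lambda>t\<in>{..<n}. yv n \<omega> k t + z t))) \<in> borel_measurable (nrmn n q)"
    unfolding eq by measurable
  show "?L \<le> pbad n \<alpha> \<beta> ?A k \<omega> u + ennreal (fluct q \<beta> \<theta> \<epsilon> / n)"
  proof (cases "(\<Sum>t<n. (?v t)\<^sup>2) \<le> n * ?A")
    case False
    have "?L \<le> (\<integral>\<^sup>+z. 1 \<partial>nrmn n q)" by (intro nn_integral_mono pbad_le_1)
    also have "\<dots> = 1" by (simp add: G.emeasure_space_1)
    also have "1 = pbad n \<alpha> \<beta> ?A k \<omega> u" using False by (simp add: pbad_def)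
    finally show ?thesis by (simp add: add_increasing2)
  next
    case True
    have "?L = (\<integral>\<^sup>+z. indicator {z\<in>space (nrmn n q). n * (?A + (\<beta> k)\<^sup>2 * q + \<epsilon>) < (\<Sum>t<n. (?v t + \<beta> k * z t)\<^sup>2)} z \<partial>nrmn n q)"
      unfolding eq by (intro nn_integral_cong) (simp add: indicator_def)
    also have "\<dots> = emeasure (nrmn n q) {z\<in>space (nrmn n q). n * (?A + (\<beta> k)\<^sup>2 * q + \<epsilon>) < (\<Sum>t<n. (?v t + \<beta> k * z t)\<^sup>2)}"
      by (rule nn_integral_indicator) measurable
    also have "\<dots> \<le> ennreal ((8 * (\<beta> k)\<^sup>2 * q * ?A + 4 * \<beta> k ^ 4 * q\<^sup>2) / (n * \<epsilon>\<^sup>2))"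
      by (rule gaussian_perturbation_norm[OF q \<epsilon> True n])
    also have "(8 * (\<beta> k)\<^sup>2 * q * ?A + 4 * \<beta> k ^ 4 * q\<^sup>2) / (n * \<epsilon>\<^sup>2) \<le> fluct q \<beta> \<theta> \<epsilon> / n"
    proof -
      have "?A \<le> \<bar>\<theta>\<bar>" unfolding thr_def using q \<epsilon>
        by (intro order_trans[OF _ abs_ge_self]) (auto intro!: sum_nonneg add_nonneg_nonneg)
      then have "(8 * (\<beta> k)\<^sup>2 * q * ?A + 4 * \<beta> k ^ 4 * q\<^sup>2) / \<epsilon>\<^sup>2 \<le> (8 * (\<beta> k)\<^sup>2 * q * \<bar>\<theta>\<bar> + 4 * \<beta> k ^ 4 * q\<^sup>2) / \<epsilon>\<^sup>2"
        using q by (intro divide_right_mono add_mono mult_left_mono) auto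
      also have "\<dots> \<le> fluct q \<beta> \<theta> \<epsilon>"
        unfolding fluct_def using k q
        by (intro member_le_sum[where f="\<lambda>i. (8 * (\<beta> i)\<^sup>2 * q * \<bar>\<theta>\<bar> + 4 * \<beta> i ^ 4 * q\<^sup>2) / \<epsilon>\<^sup>2"]) auto
      finally have "(8 * (\<beta> k)\<^sup>2 * q * ?A + 4 * \<beta> k ^ 4 * q\<^sup>2) / \<epsilon>\<^sup>2 / n \<le> fluct q \<beta> \<theta> \<epsilon> / n"
        by (intro divide_right_mono) auto
      then show ?thesis by (simp add: mult.commute)
    qed
    finally show ?thesis by (simp add: add_increasing ennreal_leI)
  qed
qed

lemma ideal_avg_pbad:
  fixes J :: nat
  assumes q: "0 < q" and \<epsilon>: "\<And>j. j < J \<Longrightarrow> 0 < \<epsilon> j" and n: "0 < n" and "k + m = M"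
  shows "ideal_avg n q (yv n \<omega>) (\<lambda>u. \<Sum>j<J. pbad n (\<alpha> j) (\<beta> j) (\<theta> j) M \<omega> u) m k u \<le>
    (\<Sum>j<J. pbad n (\<alpha> j) (\<beta> j) (thr q (\<beta> j) (\<theta> j) (\<epsilon> j) k) k \<omega> u + of_nat m * ennreal (fluct q (\<beta> j) (\<theta> j) (\<epsilon> j) / n))"
  using assms(4)
proof (induction m arbitrary: k u)
  case 0 then show ?case by (simp add: thr_def)
next
  case (Suc m)
  interpret G: prob_space "nrmn n q" by (rule prob_space_nrmn[OF q])
  have k: "k < M" using Suc.prems by simp
  let ?u = "\<lambda>z. u(k := \<lambda>t\<in>{..<n}. yv n \<omega> k t + z t)"
  let ?F = "\<lambda>j. ennreal (fluct q (\<beta> j) (\<theta> j) (\<epsilon> j) / n)"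
  let ?b = "\<lambda>j z. pbad n (\<alpha> j) (\<beta> j) (thr q (\<beta> j) (\<theta> j) (\<epsilon> j) (Suc k)) (Suc k) \<omega> (?u z)"
  have mb: "?b j \<in> borel_measurable (nrmn n q)" if "j < J" for j
    by (rule pbad_average_step(2)[OF q \<epsilon>[OF that] k n])
  have "ideal_avg n q (yv n \<omega>) (\<lambda>u. \<Sum>j<J. pbad n (\<alpha> j) (\<beta> j) (\<theta> j) M \<omega> u) (Suc m) k u
    \<le> (\<integral>\<^sup>+z. (\<Sum>j<J. ?b j z + of_nat m * ?F j) \<partial>nrmn n q)"
    unfolding ideal_avg.simps using Suc.prems by (intro nn_integral_mono Suc.IH) simp
  also have "\<dots> = (\<Sum>j<J. \<integral>\<^sup>+z. ?b j z + of_nat m * ?F j \<partial>nrmn n q)"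
    using mb by (intro nn_integral_sum) auto
  also have "\<dots> = (\<Sum>j<J. (\<integral>\<^sup>+z. ?b j z \<partial>nrmn n q) + of_nat m * ?F j)"
    using mb by (intro sum.cong refl) (subst nn_integral_add, auto simp: G.emeasure_space_1)
  also have "\<dots> \<le> (\<Sum>j<J. (pbad n (\<alpha> j) (\<beta> j) (thr q (\<beta> j) (\<theta> j) (\<epsilon> j) k) k \<omega> u + ?F j) + of_nat m * ?F j)"
    by (intro sum_mono add_right_mono pbad_average_step(1) q \<epsilon> k n) auto
  also have "\<dots> = (\<Sum>j<J. pbad n (\<alpha> j) (\<beta> j) (thr q (\<beta> j) (\<theta> j) (\<epsilon> j) k) k \<omega> u + of_nat (Suc m) * ?F j)"
    by (simp add: distrib_right add_ac)
  finally show ?case .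
qed

text \<open>The left side of the hypothesis is the second moment of the form when every observation
  carries the extra noise \<open>q\<close>. The source part is handled by the law of large numbers,
  the noise part by the stepwise perturbation bound. At stage 0 no codeword is present, so
  \<open>u\<close> is arbitrary.\<close>

lemma ideal_avg_vanishes:
  fixes J :: nat
  assumes q: "0 < q"
    and \<theta>: "\<And>j. j < J \<Longrightarrow> (\<alpha> j + (\<Sum>i<M. \<beta> j i))\<^sup>2 * varX f + (sW2 + q) * (\<Sum>i<M. (\<beta> j i)\<^sup>2) < \<theta> j"
    and \<eta>: "0 < \<eta>"
  shows "\<exists>n0. \<forall>n\<ge>n0::nat. \<forall>u. (\<integral>\<^sup>+\<omega>. ideal_avg n q (yv n \<omega>) (\<lambda>u. \<Sum>j<J. pbad n (\<alpha> j) (\<beta> j) (\<theta> j) M \<omega> u) M 0 u \<partial>Blk f sW2 M n) \<le> ennreal \<eta>"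
proof -
  let ?m = "\<lambda>j. (\<alpha> j + (\<Sum>i<M. \<beta> j i))\<^sup>2 * varX f + (sW2 + q) * (\<Sum>i<M. (\<beta> j i)\<^sup>2)"
  \<comment> \<open>Half of the gap below \<open>\<theta> j\<close> is shared by the
    \<open>M\<close> perturbations; the other half remains for the law of large numbers, as
    \<open>T\<close> records.\<close>
  define \<epsilon> where "\<epsilon> j = (\<theta> j - ?m j) / (2 * M)" for j
  have \<epsilon>: "0 < \<epsilon> j" if "j < J" for j using \<theta>[OF that] M_pos by (simp add: \<epsilon>_def)
  let ?T = "\<lambda>j. thr q (\<beta> j) (\<theta> j) (\<epsilon> j) 0"
  have T: "(\<integral>\<omega>. (form (\<alpha> j) (\<beta> j) \<omega>)\<^sup>2 \<partial>Src f sW2 M) < ?T j" if "j < J" for j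
  proof -
    have "?T j = \<theta> j - (q * (\<Sum>i<M. (\<beta> j i)\<^sup>2) + M * \<epsilon> j)"
      by (simp add: thr_def sum.distrib sum_distrib_left mult.commute lessThan_atLeast0)
    moreover have "M * \<epsilon> j = (\<theta> j - ?m j) / 2" using M_pos by (simp add: \<epsilon>_def)
    moreover have "?m j < \<theta> j" using \<theta>[OF that] .
    moreover have "?m j = (\<integral>\<omega>. (form (\<alpha> j) (\<beta> j) \<omega>)\<^sup>2 \<partial>Src f sW2 M) + q * (\<Sum>i<M. (\<beta> j i)\<^sup>2)"
      by (simp add: form_second_moment(2) algebra_simps)
    moreover have "t = a - (b + d) \<Longrightarrow> d = (a - m) / 2 \<Longrightarrow> m < a \<Longrightarrow> m = e + b \<Longrightarrow> e < t" for t a b d m e :: real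
      by (simp add: field_simps)
    ultimately show ?thesis by blast
  qed
  define \<eta>' where "\<eta>' = \<eta> / (2 * (J + 1))"
  have \<eta>': "0 < \<eta>'" "J * \<eta>' \<le> \<eta> / 2" using \<eta> by (auto simp: \<eta>'_def field_simps)
  have "\<exists>n0. \<forall>n\<ge>n0::nat. emeasure (PiM {..<n} (\<lambda>_. Src f sW2 M))
     {\<omega>\<in>space (PiM {..<n} (\<lambda>_. Src f sW2 M)). n * ?T j < (\<Sum>t<n. (form (\<alpha> j) (\<beta> j) (\<omega> t))\<^sup>2)} \<le> ennreal \<eta>'" if "j < J" for j
    by (intro weak_law_upper prob_space_Src form_second_moment T that \<eta>' zero_le_power2)
  then have "\<forall>j\<in>{..<J}. \<exists>n0. \<forall>n\<ge>n0::nat. emeasure (PiM {..<n} (\<lambda>_. Src f sW2 M))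
     {\<omega>\<in>space (PiM {..<n} (\<lambda>_. Src f sW2 M)). n * ?T j < (\<Sum>t<n. (form (\<alpha> j) (\<beta> j) (\<omega> t))\<^sup>2)} \<le> ennreal \<eta>'" by blast
  from bchoice[OF this] obtain n1 :: "nat \<Rightarrow> nat" where n1: "\<And>j n. j < J \<Longrightarrow> n1 j \<le> n \<Longrightarrow> emeasure (PiM {..<n} (\<lambda>_. Src f sW2 M))
     {\<omega>\<in>space (PiM {..<n} (\<lambda>_. Src f sW2 M)). real n * ?T j < (\<Sum>t<n. (form (\<alpha> j) (\<beta> j) (\<omega> t))\<^sup>2)} \<le> ennreal \<eta>'"
    by auto
  define C where "C = (\<Sum>j<J. M * fluct q (\<beta> j) (\<theta> j) (\<epsilon> j))"
  have fl: "0 \<le> fluct q (\<beta> j) (\<theta> j) (\<epsilon> j)" for j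
    unfolding fluct_def using q by (intro sum_nonneg) auto
  have C: "0 \<le> C" unfolding C_def using fl by (intro sum_nonneg) auto
  define n0 where "n0 = Max (insert (nat \<lceil>2 * C / \<eta>\<rceil> + 1) (n1 ` {..<J}))"
  show ?thesis
  proof (intro exI[of _ n0] allI impI)
    fix n :: nat and u assume n: "n0 \<le> n"
    have nn: "nat \<lceil>2 * C / \<eta>\<rceil> + 1 \<le> n" "\<And>j. j < J \<Longrightarrow> n1 j \<le> n"
      using n unfolding n0_def by (auto simp: Max_le_iff)
    then have n_pos: "0 < n" and nC: "2 * C / \<eta> \<le> n" by linarith+
    interpret B: prob_space "Blk f sW2 M n" by (rule prob_space_Blk)
    let ?b = "\<lambda>j \<omega>. pbad n (\<alpha> j) (\<beta> j) (?T j) 0 \<omega> u"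
    let ?F = "\<lambda>j. ennreal (fluct q (\<beta> j) (\<theta> j) (\<epsilon> j) / n)"
    have b_eq: "?b j \<omega> = (if n * ?T j < (\<Sum>t<n. (form (\<alpha> j) (\<beta> j) (\<omega> t))\<^sup>2) then 1 else 0)" for j \<omega>
      by (simp add: pbad_def pform_def form_def)
    have fm: "(\<lambda>\<omega>. \<Sum>t<n. (form (\<alpha> j) (\<beta> j) (\<omega> t))\<^sup>2) \<in> borel_measurable (Blk f sW2 M n)" for j
      by (intro borel_measurable_sum borel_measurable_power measurable_compose[OF Blk_component form_meas]) auto
    have bm: "?b j \<in> borel_measurable (Blk f sW2 M n)" for j
      unfolding b_eq using fm[of j] by measurable
    have bi: "(\<integral>\<^sup>+\<omega>. ?b j \<omega> \<partial>Blk f sW2 M n) \<le> ennreal \<eta>'" if "j < J" for j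
    proof -
      have "(\<integral>\<^sup>+\<omega>. ?b j \<omega> \<partial>Blk f sW2 M n) = (\<integral>\<^sup>+\<omega>. indicator {\<omega>\<in>space (Blk f sW2 M n). n * ?T j < (\<Sum>t<n. (form (\<alpha> j) (\<beta> j) (\<omega> t))\<^sup>2)} \<omega> \<partial>Blk f sW2 M n)"
        unfolding b_eq by (intro nn_integral_cong) (simp add: indicator_def)
      also have "\<dots> = emeasure (Blk f sW2 M n) {\<omega>\<in>space (Blk f sW2 M n). n * ?T j < (\<Sum>t<n. (form (\<alpha> j) (\<beta> j) (\<omega> t))\<^sup>2)}"
        using fm[of j] by (intro nn_integral_indicator) measurable
      also have "\<dots> \<le> ennreal \<eta>'" unfolding Blk_def by (rule n1[OF that nn(2)[OF that]])
      finally show ?thesis .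
    qed
    have "(\<integral>\<^sup>+\<omega>. ideal_avg n q (yv n \<omega>) (\<lambda>u. \<Sum>j<J. pbad n (\<alpha> j) (\<beta> j) (\<theta> j) M \<omega> u) M 0 u \<partial>Blk f sW2 M n)
      \<le> (\<integral>\<^sup>+\<omega>. (\<Sum>j<J. ?b j \<omega> + of_nat M * ?F j) \<partial>Blk f sW2 M n)"
      by (intro nn_integral_mono ideal_avg_pbad q \<epsilon> n_pos) simp_all
    also have "\<dots> = (\<Sum>j<J. \<integral>\<^sup>+\<omega>. ?b j \<omega> + of_nat M * ?F j \<partial>Blk f sW2 M n)"
      using bm by (intro nn_integral_sum) auto
    also have "\<dots> = (\<Sum>j<J. (\<integral>\<^sup>+\<omega>. ?b j \<omega> \<partial>Blk f sW2 M n) + of_nat M * ?F j)"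
      using bm by (intro sum.cong refl) (subst nn_integral_add, auto simp: B.emeasure_space_1)
    also have "\<dots> \<le> (\<Sum>j<J. ennreal (\<eta>' + M * fluct q (\<beta> j) (\<theta> j) (\<epsilon> j) / n))"
    proof (intro sum_mono)
      fix j assume "j \<in> {..<J}"
      then have "(\<integral>\<^sup>+\<omega>. ?b j \<omega> \<partial>Blk f sW2 M n) + of_nat M * ?F j \<le> ennreal \<eta>' + ennreal M * ?F j"
        using bi by (auto intro!: add_mono simp: ennreal_of_nat_eq_real_of_nat)
      also have "\<dots> = ennreal (\<eta>' + M * (fluct q (\<beta> j) (\<theta> j) (\<epsilon> j) / n))"
        using \<eta>' fl[of j] by (subst ennreal_plus) (auto simp: ennreal_mult[symmetric])
      finally show "(\<integral>\<^sup>+\<omega>. ?b j \<omega> \<partial>Blk f sW2 M n) + of_nat M * ?F j \<le> ennreal (\<eta>' + M * fluct q (\<beta> j) (\<theta> j) (\<epsilon> j) / n)" by simp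
    qed
    also have "\<dots> = ennreal (\<Sum>j<J. \<eta>' + M * fluct q (\<beta> j) (\<theta> j) (\<epsilon> j) / n)"
      using \<eta>' fl by (intro sum_ennreal) auto
    also have "(\<Sum>j<J. \<eta>' + M * fluct q (\<beta> j) (\<theta> j) (\<epsilon> j) / n) = J * \<eta>' + C / n"
      by (simp add: C_def sum.distrib sum_divide_distrib)
    also have "\<dots> \<le> \<eta>"
    proof -
      have "C / n \<le> \<eta> / 2" using nC n_pos \<eta> by (simp add: field_simps)
      then show ?thesis using \<eta>'(2) by linarith
    qed
    finally show "(\<integral>\<^sup>+\<omega>. ideal_avg n q (yv n \<omega>) (\<lambda>u. \<Sum>j<J. pbad n (\<alpha> j) (\<beta> j) (\<theta> j) M \<omega> u) M 0 u \<partial>Blk f sW2 M n) \<le> ennreal \<eta>"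
      by (simp add: ennreal_leI)
  qed
qed


subsection \<open>Achievability of the Gaussian sum rate\<close>

definition idx :: "(nat \<Rightarrow> (nat \<Rightarrow> real) \<Rightarrow> nat) \<Rightarrow> nat \<Rightarrow> nat \<Rightarrow> (nat \<Rightarrow> real \<times> (nat \<Rightarrow> real)) \<Rightarrow> nat \<Rightarrow> nat" where
  "idx enc n k \<omega> = (\<lambda>i\<in>{..<k}. enc i (yv n \<omega> i))"

text \<open>Index tuples form a countable discrete space, so any function of them is measurable;
  decoders can therefore be built by choice without further care.\<close>

lemma idx_compose_meas:
  assumes enc: "\<And>i. i < k \<Longrightarrow> enc i \<in> measurable (MY n) (count_space UNIV)" and k: "k \<le> M"
    and D: "\<And>b. D b \<in> space N"
  shows "(\<lambda>\<omega>. D (idx enc n k \<omega>)) \<in> measurable (Blk f sW2 M n) N"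
proof -
  have "PiM {..<k} (\<lambda>_. count_space (UNIV :: nat set)) = count_space (PiE {..<k} (\<lambda>_. UNIV))"
    by (rule count_space_PiM_finite) auto
  moreover have "idx enc n k \<in> measurable (Blk f sW2 M n) (PiM {..<k} (\<lambda>_. count_space UNIV))"
    unfolding idx_def
  proof (rule measurable_restrict)
    fix i assume "i \<in> {..<k}"
    then show "(\<lambda>\<omega>. enc i (yv n \<omega> i)) \<in> measurable (Blk f sW2 M n) (count_space UNIV)"
      using k by (intro measurable_compose[OF yv_meas enc]) auto
  qed
  ultimately have i: "idx enc n k \<in> measurable (Blk f sW2 M n) (count_space (PiE {..<k} (\<lambda>_. UNIV)))" by simp
  show ?thesis by (rule measurable_compose[OF i]) (use D in \<open>auto simp: measurable_count_space_eq1\<close>)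
qed

definition badness :: "nat \<Rightarrow> nat \<Rightarrow> (nat \<Rightarrow> real) \<Rightarrow> (nat \<Rightarrow> nat \<Rightarrow> real) \<Rightarrow> (nat \<Rightarrow> real) \<Rightarrow> (nat \<Rightarrow> real \<times> (nat \<Rightarrow> real)) \<Rightarrow> (nat \<Rightarrow> nat \<Rightarrow> real) \<Rightarrow> ennreal" where
  "badness n J \<alpha> \<beta> \<theta> \<omega> u = (\<Sum>j<J. pbad n (\<alpha> j) (\<beta> j) (\<theta> j) M \<omega> u)"

lemma badness_le: "badness n J \<alpha> \<beta> \<theta> \<omega> u \<le> ennreal (real J)"
proof -
  have "badness n J \<alpha> \<beta> \<theta> \<omega> u \<le> (\<Sum>j<J. 1)" unfolding badness_def by (intro sum_mono pbad_le_1)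
  then show ?thesis by (simp add: ennreal_of_nat_eq_real_of_nat)
qed

lemma badness_ge: "j < J \<Longrightarrow> pbad n (\<alpha> j) (\<beta> j) (\<theta> j) M \<omega> u \<le> badness n J \<alpha> \<beta> \<theta> \<omega> u"
  unfolding badness_def by (intro member_le_sum) auto

lemma badness_meas: "(\<lambda>x. badness n J \<alpha> \<beta> \<theta> (fst x) (snd x)) \<in> borel_measurable (Blk f sW2 M n \<Otimes>\<^sub>M PiM {..<M} (\<lambda>_. MY n))"
  unfolding badness_def by (intro borel_measurable_sum pbad_meas)

text \<open>The hybrid used in the induction: the first \<open>k\<close> encoders are actual codes with decoder \<open>D\<close>, the
  remaining ones are ideal. \<open>badness\<close> counts the linear tests failed by the resulting codewords.\<close>

definition stage :: "nat \<Rightarrow> real \<Rightarrow> nat \<Rightarrow> (nat \<Rightarrow> real) \<Rightarrow> (nat \<Rightarrow> nat \<Rightarrow> real) \<Rightarrow> (nat \<Rightarrow> real) \<Rightarrow> nat \<Rightarrow>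
    (nat \<Rightarrow> (nat \<Rightarrow> real) \<Rightarrow> nat) \<Rightarrow> ((nat \<Rightarrow> nat) \<Rightarrow> nat \<Rightarrow> nat \<Rightarrow> real) \<Rightarrow> ennreal" where
  "stage n q J \<alpha> \<beta> \<theta> k enc D =
    (\<integral>\<^sup>+\<omega>. ideal_avg n q (yv n \<omega>) (badness n J \<alpha> \<beta> \<theta> \<omega>) (M - k) k (\<lambda>i\<in>{..<M}. D (idx enc n k \<omega>) i) \<partial>Blk f sW2 M n)"

text \<open>Test \<open>k\<close> is exactly the prediction test of encoder \<open>k\<close>:
  coefficient 1 on its own codeword and \<open>- a\<close> on the earlier ones. A codeword that is
  not close to the prediction thus already fails a test, so the closeness penalty is at most
  \<open>J\<close> times the badness. The step therefore costs the factor
  \<open>(T + 2) * (1 + J)\<close> and an additive error.\<close>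

lemma code_step:
  fixes a \<eta> T \<delta> :: real and J K n k :: nat
  assumes q: "0 < q" and n: "0 < n" and k: "k < M" and kJ: "k < J"
    and \<alpha>: "\<alpha> k = 0" and \<beta>: "\<beta> k = (\<lambda>i. if i = k then 1 else if i < k then - a else 0)"
    and pos: "0 < \<theta> k" "0 < \<delta>" "\<delta> < 1" "0 < T" "0 < \<eta>" "0 < K"
    and half: "1/2 \<le> emeasure (nrmn n q) {z\<in>space (nrmn n q). gtyp n q \<delta> (\<Sum>t<n. (z t)\<^sup>2)}"
    and enc: "\<And>i. i < k \<Longrightarrow> enc i \<in> measurable (MY n) (count_space UNIV)"
    and D: "\<And>b i. D b i \<in> space (MY n)"
  shows "\<exists>e D'. e \<in> measurable (MY n) (count_space UNIV) \<and> (\<forall>y. e y < K) \<and> (\<forall>b i. D' b i \<in> space (MY n)) \<and>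
    stage n q J \<alpha> \<beta> \<theta> (Suc k) (enc(k := e)) D' \<le>
      ennreal (J * \<eta> + J * exp (- T / 2) + J * ((T + 2) * ((T + 2) * (sqrt (\<theta> k / q) ^ n * exp (real n * \<delta> / 2) / K) + \<eta>)))
      + ennreal (T + 2) * (ennreal (1 + J) * stage n q J \<alpha> \<beta> \<theta> k enc D)"
proof -
  let ?P = "Blk f sW2 M n"
  interpret G: prob_space "nrmn n q" by (rule prob_space_nrmn[OF q])
  define c where "c = idx enc n k"
  define U where "U = (\<lambda>\<omega>. \<lambda>i\<in>{..<M}. D (c \<omega>) i)"
  \<comment> \<open>The expected badness when codeword \<open>k\<close> is \<open>v\<close>, the
    earlier codewords are those actually decoded, and the later encoders are ideal.\<close>
  define \<Psi> where "\<Psi> = (\<lambda>\<omega> v. ideal_avg n q (yv n \<omega>) (badness n J \<alpha> \<beta> \<theta> \<omega>) (M - Suc k) (Suc k) ((U \<omega>)(k := v)))"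
  \<comment> \<open>The linear prediction of codeword \<open>k\<close>; it is computable from the
    bins received from the earlier encoders, which play the role of side information.\<close>
  define ctr where "ctr = (\<lambda>b t. \<mu> + a * (\<Sum>l<k. D b l t - \<mu>))"
  have U_meas: "U \<in> measurable ?P (PiM {..<M} (\<lambda>_. MY n))"
    unfolding U_def c_def
    by (rule idx_compose_meas[where D="\<lambda>b. \<lambda>i\<in>{..<M}. D b i"]) (use enc k D in \<open>auto simp: space_PiM\<close>)
  have \<Psi>_meas: "(\<lambda>x. \<Psi> (fst x) (snd x)) \<in> borel_measurable (?P \<Otimes>\<^sub>M MY n)"
  proof -
    have 1: "(\<lambda>x. (U (fst x))(k := snd x)) \<in> measurable (?P \<Otimes>\<^sub>M MY n) (PiM {..<M} (\<lambda>_. MY n))"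
      using k by (intro measurable_fun_upd[where J="{..<M}"] measurable_compose[OF measurable_fst U_meas]) auto
    have "(\<lambda>x. (fst x, (U (fst x))(k := snd x))) \<in> measurable (?P \<Otimes>\<^sub>M MY n) (?P \<Otimes>\<^sub>M PiM {..<M} (\<lambda>_. MY n))"
      using 1 by measurable
    from measurable_compose[OF this ideal_avg_meas[where k="Suc k" and m="M - Suc k", OF q yv_meas badness_meas]] k
    show ?thesis unfolding \<Psi>_def by (simp add: fun_upd_def)
  qed
  have \<Psi>_le: "\<Psi> \<omega> v \<le> ennreal (real J)" for \<omega> v
    unfolding \<Psi>_def by (intro ideal_avg_le q badness_le)
  have ctr_meas: "(\<lambda>\<omega>. ctr (c \<omega>) t) \<in> borel_measurable ?P" if "t < n" for t
    unfolding c_def by (rule idx_compose_meas[where D="\<lambda>b. ctr b t"]) (use enc k in auto)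
  have P: "prob_space ?P" by (rule prob_space_Blk)
  have yk: "(\<lambda>\<omega>. yv n \<omega> k) \<in> measurable ?P (MY n)" using k by (intro yv_meas) auto
  have J0: "0 \<le> real J" by simp
  obtain e dec where e: "e \<in> measurable (MY n) (count_space UNIV)" "\<forall>y. e y < K" and dec: "\<forall>b c. dec b c \<in> space (MY n)"
    and le: "(\<integral>\<^sup>+\<omega>. \<Psi> \<omega> (dec (e (yv n \<omega> k)) (c \<omega>)) \<partial>?P) \<le>
      ennreal (J * \<eta> + J * exp (- T / 2) + J * ((T + 2) * ((T + 2) * (sqrt (\<theta> k / q) ^ n * exp (real n * \<delta> / 2) / K) + \<eta>)))
      + ennreal (T + 2) * (\<integral>\<^sup>+\<omega>. \<integral>\<^sup>+z. \<Psi> \<omega> (\<lambda>t\<in>{..<n}. yv n \<omega> k t + z t)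
          + (if (\<Sum>t<n. (yv n \<omega> k t + z t - ctr (c \<omega>) t)\<^sup>2) \<le> real n * \<theta> k then 0 else ennreal J) \<partial>nrmn n q \<partial>?P)"
    using gaussian_binning_step[where P="?P" and y="\<lambda>\<omega>. yv n \<omega> k" and c=c and ctr=ctr and \<Phi>=\<Psi> and B="real J",
        OF P yk ctr_meas \<Psi>_meas \<Psi>_le J0 q pos(1-5) n pos(6) half] by blast
  define D' where "D' = (\<lambda>b i. if i = k then dec (b k) (restrict b {..<k}) else D (restrict b {..<k}) i)"
  have idx': "restrict (idx (enc(k := e)) n (Suc k) \<omega>) {..<k} = c \<omega>" "idx (enc(k := e)) n (Suc k) \<omega> k = e (yv n \<omega> k)" for \<omega>
    by (auto simp: idx_def c_def fun_eq_iff)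
  have st: "stage n q J \<alpha> \<beta> \<theta> (Suc k) (enc(k := e)) D' = (\<integral>\<^sup>+\<omega>. \<Psi> \<omega> (dec (e (yv n \<omega> k)) (c \<omega>)) \<partial>?P)"
  proof -
    have "(\<lambda>i\<in>{..<M}. D' (idx (enc(k := e)) n (Suc k) \<omega>) i) = (U \<omega>)(k := dec (e (yv n \<omega> k)) (c \<omega>))" for \<omega>
      using k by (auto simp: D'_def idx' U_def fun_eq_iff)
    then show ?thesis unfolding stage_def \<Psi>_def by simp
  qed
  let ?A = "\<lambda>\<omega>. \<integral>\<^sup>+z. \<Psi> \<omega> (\<lambda>t\<in>{..<n}. yv n \<omega> k t + z t) \<partial>nrmn n q"
  have A_eq: "?A \<omega> = ideal_avg n q (yv n \<omega>) (badness n J \<alpha> \<beta> \<theta> \<omega>) (M - k) k (U \<omega>)" for \<omega>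
  proof -
    have "M - k = Suc (M - Suc k)" using k by simp
    then show ?thesis by (simp add: \<Psi>_def)
  qed
  have A_meas: "?A \<in> borel_measurable ?P"
  proof -
    have "(\<lambda>\<omega>. (\<omega>, U \<omega>)) \<in> measurable ?P (?P \<Otimes>\<^sub>M PiM {..<M} (\<lambda>_. MY n))" using U_meas by measurable
    from measurable_compose[OF this ideal_avg_meas[where k=k and m="M - k", OF q yv_meas badness_meas]] k
    show ?thesis unfolding A_eq by simp
  qed
  \<comment> \<open>\<open>\<Psi>\<close> averages over later codewords only, while test
    \<open>k\<close> has coefficient 0 on them, so its outcome is settled once \<open>v\<close> is
    given.\<close>
  have notclose: "(if (\<Sum>t<n. (v t - ctr (c \<omega>) t)\<^sup>2) \<le> real n * \<theta> k then 0 else 1) \<le> \<Psi> \<omega> v" for \<omega> v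
    unfolding \<Psi>_def
  proof (rule ideal_avg_ge[OF q])
    fix u' assume u': "\<forall>i<Suc k. u' i = ((U \<omega>)(k := v)) i"
    have uk: "u' k = v" using u' by simp
    have ul: "u' i = D (c \<omega>) i" if "i < k" for i
      using u' that k by (simp add: U_def)
    have pf: "pform (\<alpha> k) (\<beta> k) M \<omega> u' t = v t - ctr (c \<omega>) t" for t
    proof -
      have "(\<Sum>i<M. \<beta> k i * ((if i < M then u' i t else snd (\<omega> t) i) - \<mu>)) =
         (\<Sum>i<M. (if i = k then v t - \<mu> else 0) + (if i \<in> {..<k} then - (a * (D (c \<omega>) i t - \<mu>)) else 0))"
        using uk ul by (intro sum.cong refl) (auto simp: \<beta>)
      also have "\<dots> = (v t - \<mu>) + (\<Sum>i\<in>{..<M} \<inter> {..<k}. - (a * (D (c \<omega>) i t - \<mu>)))"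
        using k by (simp add: sum.distrib sum.inter_restrict)
      also have "{..<M} \<inter> {..<k} = {..<k}" using k by auto
      finally show ?thesis by (simp add: pform_def \<alpha> ctr_def sum_distrib_left sum_negf)
    qed
    have "(if (\<Sum>t<n. (v t - ctr (c \<omega>) t)\<^sup>2) \<le> real n * \<theta> k then 0 else 1) \<le> pbad n (\<alpha> k) (\<beta> k) (\<theta> k) M \<omega> u'"
      by (simp add: pbad_def pf)
    also have "\<dots> \<le> badness n J \<alpha> \<beta> \<theta> \<omega> u'" by (rule badness_ge[OF kJ])
    finally show "(if (\<Sum>t<n. (v t - ctr (c \<omega>) t)\<^sup>2) \<le> real n * \<theta> k then 0 else 1) \<le> badness n J \<alpha> \<beta> \<theta> \<omega> u'" .
  qed
  have "(\<integral>\<^sup>+\<omega>. \<integral>\<^sup>+z. \<Psi> \<omega> (\<lambda>t\<in>{..<n}. yv n \<omega> k t + z t)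
          + (if (\<Sum>t<n. (yv n \<omega> k t + z t - ctr (c \<omega>) t)\<^sup>2) \<le> real n * \<theta> k then 0 else ennreal J) \<partial>nrmn n q \<partial>?P)
     \<le> (\<integral>\<^sup>+\<omega>. ennreal (1 + J) * ?A \<omega> \<partial>?P)"
  proof (intro nn_integral_mono)
    fix \<omega> assume \<omega>: "\<omega> \<in> space ?P"
    have m: "(\<lambda>z. \<Psi> \<omega> (\<lambda>t\<in>{..<n}. yv n \<omega> k t + z t)) \<in> borel_measurable (nrmn n q)"
    proof -
      have "(\<lambda>z. \<lambda>t\<in>{..<n}. yv n \<omega> k t + z t) \<in> measurable (nrmn n q) (MY n)" by measurable
      from measurable_compose[OF this measurable_compose[OF measurable_Pair1'[OF \<omega>] \<Psi>_meas]] show ?thesis by simp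
    qed
    have "(\<integral>\<^sup>+z. \<Psi> \<omega> (\<lambda>t\<in>{..<n}. yv n \<omega> k t + z t)
          + (if (\<Sum>t<n. (yv n \<omega> k t + z t - ctr (c \<omega>) t)\<^sup>2) \<le> real n * \<theta> k then 0 else ennreal J) \<partial>nrmn n q)
      \<le> (\<integral>\<^sup>+z. ennreal (1 + J) * \<Psi> \<omega> (\<lambda>t\<in>{..<n}. yv n \<omega> k t + z t) \<partial>nrmn n q)"
    proof (intro nn_integral_mono)
      fix z
      let ?v = "\<lambda>t\<in>{..<n}. yv n \<omega> k t + z t"
      have nc: "(if (\<Sum>t<n. (yv n \<omega> k t + z t - ctr (c \<omega>) t)\<^sup>2) \<le> real n * \<theta> k then 0 else 1) \<le> \<Psi> \<omega> ?v"
        using notclose[of ?v \<omega>] by simp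
      have "(if (\<Sum>t<n. (yv n \<omega> k t + z t - ctr (c \<omega>) t)\<^sup>2) \<le> real n * \<theta> k then 0 else ennreal J)
        = ennreal J * (if (\<Sum>t<n. (yv n \<omega> k t + z t - ctr (c \<omega>) t)\<^sup>2) \<le> real n * \<theta> k then 0 else 1)" by simp
      also have "\<dots> \<le> ennreal J * \<Psi> \<omega> ?v" using nc by (rule mult_left_mono) simp
      finally have "\<Psi> \<omega> ?v + (if (\<Sum>t<n. (yv n \<omega> k t + z t - ctr (c \<omega>) t)\<^sup>2) \<le> real n * \<theta> k then 0 else ennreal J)
        \<le> \<Psi> \<omega> ?v + ennreal J * \<Psi> \<omega> ?v" by (rule add_left_mono)
      also have "\<dots> = ennreal (1 + J) * \<Psi> \<omega> ?v" by (simp add: distrib_right)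
      finally show "\<Psi> \<omega> ?v + (if (\<Sum>t<n. (yv n \<omega> k t + z t - ctr (c \<omega>) t)\<^sup>2) \<le> real n * \<theta> k then 0 else ennreal J)
        \<le> ennreal (1 + J) * \<Psi> \<omega> ?v" .
    qed
    also have "\<dots> = ennreal (1 + J) * ?A \<omega>" by (rule nn_integral_cmult[OF m])
    finally show "(\<integral>\<^sup>+z. \<Psi> \<omega> (\<lambda>t\<in>{..<n}. yv n \<omega> k t + z t)
          + (if (\<Sum>t<n. (yv n \<omega> k t + z t - ctr (c \<omega>) t)\<^sup>2) \<le> real n * \<theta> k then 0 else ennreal J) \<partial>nrmn n q) \<le> ennreal (1 + J) * ?A \<omega>" .
  qed
  also have "\<dots> = ennreal (1 + J) * (\<integral>\<^sup>+\<omega>. ?A \<omega> \<partial>?P)" by (rule nn_integral_cmult[OF A_meas])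
  also have "(\<integral>\<^sup>+\<omega>. ?A \<omega> \<partial>?P) = stage n q J \<alpha> \<beta> \<theta> k enc D"
    unfolding stage_def A_eq U_def c_def ..
  finally have I: "(\<integral>\<^sup>+\<omega>. \<integral>\<^sup>+z. \<Psi> \<omega> (\<lambda>t\<in>{..<n}. yv n \<omega> k t + z t)
          + (if (\<Sum>t<n. (yv n \<omega> k t + z t - ctr (c \<omega>) t)\<^sup>2) \<le> real n * \<theta> k then 0 else ennreal J) \<partial>nrmn n q \<partial>?P)
     \<le> ennreal (1 + J) * stage n q J \<alpha> \<beta> \<theta> k enc D" .
  have "\<forall>b i. D' b i \<in> space (MY n)" using dec D by (auto simp: D'_def)
  moreover have "stage n q J \<alpha> \<beta> \<theta> (Suc k) (enc(k := e)) D' \<le>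
      ennreal (J * \<eta> + J * exp (- T / 2) + J * ((T + 2) * ((T + 2) * (sqrt (\<theta> k / q) ^ n * exp (real n * \<delta> / 2) / K) + \<eta>)))
      + ennreal (T + 2) * (ennreal (1 + J) * stage n q J \<alpha> \<beta> \<theta> k enc D)"
    unfolding st using le by (rule order_trans) (intro add_left_mono mult_left_mono I, simp)
  ultimately show ?thesis using e by blast
qed

text \<open>Rounding down costs at most a factor 2, and \<open>exp (n * (R - c))\<close> is at least
  \<open>n * (R - c)\<close>; this yields the explicit \<open>n0\<close>.\<close>

lemma codebook_ratio_vanishes:
  fixes c R \<tau> :: real
  assumes "c < R" "0 \<le> R" "0 < \<tau>"
  shows "\<exists>n0. \<forall>n\<ge>n0::nat. exp (n * c) / nat \<lfloor>exp (n * R)\<rfloor> \<le> \<tau>"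
proof -
  define n0 where "n0 = nat \<lceil>2 / (\<tau> * (R - c))\<rceil>"
  show ?thesis
  proof (intro exI[of _ n0] allI impI)
    fix n :: nat assume "n0 \<le> n"
    then have "2 / (\<tau> * (R - c)) \<le> n" unfolding n0_def by linarith
    then have n: "2 \<le> \<tau> * (n * (R - c))" using assms by (simp add: field_simps)
    have e1: "1 \<le> exp (n * R)" using assms by simp
    have "1 \<le> \<lfloor>exp (n * R)\<rfloor>" using e1 by (simp add: le_floor_iff)
    then have "real (nat \<lfloor>exp (n * R)\<rfloor>) = real_of_int \<lfloor>exp (n * R)\<rfloor>" "1 \<le> real_of_int \<lfloor>exp (n * R)\<rfloor>" by auto
    then have "exp (n * R) / 2 \<le> nat \<lfloor>exp (n * R)\<rfloor>"
      using floor_correct[of "exp (n * R)"] by linarith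
    then have "exp (n * c) / nat \<lfloor>exp (n * R)\<rfloor> \<le> exp (n * c) / (exp (n * R) / 2)"
      using \<open>1 \<le> \<lfloor>exp (n * R)\<rfloor>\<close> by (intro divide_left_mono) auto
    also have "\<dots> = 2 * inverse (exp (n * (R - c)))"
      by (simp add: exp_diff right_diff_distrib field_simps)
    also have "\<dots> \<le> \<tau>"
    proof -
      have "n * (R - c) \<le> exp (n * (R - c))" using exp_ge_add_one_self[of "n * (R - c)"] by linarith
      then have "\<tau> * (n * (R - c)) \<le> \<tau> * exp (n * (R - c))" using assms by (intro mult_left_mono) auto
      then have "2 \<le> \<tau> * exp (n * (R - c))" using n by linarith
      then show ?thesis by (simp add: field_simps)
    qed
    finally show "exp (n * c) / nat \<lfloor>exp (n * R)\<rfloor> \<le> \<tau>" .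
  qed
qed

text \<open>Induction on the number of real encoders. The target \<open>\<eta>\<close> is
  generalised because the induction hypothesis is used at a smaller level, divided by the loss
  factor of \<open>code_step\<close>.\<close>

lemma code_induction:
  fixes a :: "nat \<Rightarrow> real" and J k :: nat and \<delta> \<eta> :: real
  assumes q: "0 < q" and \<delta>: "0 < \<delta>" "\<delta> < 1" and MJ: "M \<le> J"
    and \<alpha>: "\<And>k. k < M \<Longrightarrow> \<alpha> k = 0"
    and \<beta>: "\<And>k. k < M \<Longrightarrow> \<beta> k = (\<lambda>i. if i = k then 1 else if i < k then - a k else 0)"
    and \<theta>0: "\<And>k. k < M \<Longrightarrow> 0 < \<theta> k"
    and R: "\<And>k. k < M \<Longrightarrow> 1/2 * ln (\<theta> k / q) + \<delta> / 2 < R k" "\<And>k. k < M \<Longrightarrow> 0 \<le> R k"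
    and \<theta>: "\<And>j. j < J \<Longrightarrow> (\<alpha> j + (\<Sum>i<M. \<beta> j i))\<^sup>2 * varX f + (sW2 + q) * (\<Sum>i<M. (\<beta> j i)\<^sup>2) < \<theta> j"
    and "k \<le> M" "0 < \<eta>"
  shows "\<exists>n0. \<forall>n\<ge>n0. \<exists>enc D. (\<forall>i<k. enc i \<in> measurable (MY n) (count_space UNIV) \<and> (\<forall>y. enc i y < nat \<lfloor>exp (real n * R i)\<rfloor>)) \<and>
    (\<forall>b i. D b i \<in> space (MY n)) \<and> stage n q J \<alpha> \<beta> \<theta> k enc D \<le> ennreal \<eta>"
  using assms(11,12)
proof (induction k arbitrary: \<eta>)
  case 0
  from ideal_avg_vanishes[where J=J and \<alpha>=\<alpha> and \<beta>=\<beta> and \<theta>=\<theta>, OF q \<theta> 0(2)] obtain n0 :: nat where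
    n0: "\<And>n u. n0 \<le> n \<Longrightarrow> (\<integral>\<^sup>+\<omega>. ideal_avg n q (yv n \<omega>) (\<lambda>u. \<Sum>j<J. pbad n (\<alpha> j) (\<beta> j) (\<theta> j) M \<omega> u) M 0 u \<partial>Blk f sW2 M n) \<le> ennreal \<eta>"
    by blast
  show ?case
  proof (intro exI[of _ n0] allI impI)
    fix n assume n: "n0 \<le> n"
    let ?D = "\<lambda>(b::nat \<Rightarrow> nat) (i::nat). \<lambda>t\<in>{..<n}. 0 :: real"
    have "stage n q J \<alpha> \<beta> \<theta> 0 enc ?D \<le> ennreal \<eta>" for enc
      unfolding stage_def badness_def[abs_def] using n0[OF n] by simp
    then show "\<exists>enc D. (\<forall>i<0. enc i \<in> measurable (MY n) (count_space UNIV) \<and> (\<forall>y. enc i y < nat \<lfloor>exp (real n * R i)\<rfloor>)) \<and>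
      (\<forall>b i. D b i \<in> space (MY n)) \<and> stage n q J \<alpha> \<beta> \<theta> 0 enc D \<le> ennreal \<eta>"
      by (intro exI[of _ undefined] exI[of _ ?D]) (auto simp: space_PiM)
  qed
next
  case (Suc k)
  have k: "k < M" "k \<le> M" and kJ: "k < J" using Suc.prems MJ by auto
  have \<eta>: "0 < \<eta>" by (rule Suc.prems)
  have J0: "0 < real J" using kJ by simp
  \<comment> \<open>The four levels depend on one another in this order. \<open>T\<close> makes
    \<open>J * exp (- T / 2)\<close> at most \<open>\<eta> / 4\<close>, \<open>\<eta>1\<close>
    contributes \<open>\<eta> / 8\<close>, while \<open>\<tau>\<close> and \<open>\<eta>2\<close>
    bring the collision term and the inherited badness to \<open>\<eta> / 4\<close> each.\<close>
  define T where "T = 8 * J / \<eta>"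
  have T: "0 < T" using J0 \<eta> by (simp add: T_def)
  define \<eta>1 where "\<eta>1 = \<eta> / (8 * J * (T + 3))"
  have \<eta>1: "0 < \<eta>1" using J0 \<eta> T by (simp add: \<eta>1_def)
  define \<tau> where "\<tau> = \<eta> / (4 * J * (T + 2)\<^sup>2)"
  have \<tau>: "0 < \<tau>" using J0 \<eta> T by (simp add: \<tau>_def)
  define \<eta>2 where "\<eta>2 = \<eta> / (4 * (T + 2) * (1 + J))"
  have \<eta>2: "0 < \<eta>2" using J0 \<eta> T by (simp add: \<eta>2_def)
  from Suc.IH[OF k(2) \<eta>2] obtain n1 where n1: "\<And>n. n1 \<le> n \<Longrightarrow> \<exists>enc D. (\<forall>i<k. enc i \<in> measurable (MY n) (count_space UNIV) \<and> (\<forall>y. enc i y < nat \<lfloor>exp (real n * R i)\<rfloor>)) \<and>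
    (\<forall>b i. D b i \<in> space (MY n)) \<and> stage n q J \<alpha> \<beta> \<theta> k enc D \<le> ennreal \<eta>2" by blast
  from codebook_ratio_vanishes[OF R(1)[OF k(1)] R(2)[OF k(1)] \<tau>] obtain n2 :: nat where
    n2: "\<And>n. n2 \<le> n \<Longrightarrow> exp (n * (1/2 * ln (\<theta> k / q) + \<delta> / 2)) / nat \<lfloor>exp (n * R k)\<rfloor> \<le> \<tau>" by blast
  define n0 where "n0 = Max {n1, n2, 1, nat \<lceil>8 / \<delta>\<^sup>2\<rceil>}"
  show ?case
  proof (intro exI[of _ n0] allI impI)
    fix n assume n: "n0 \<le> n"
    then have nn: "n1 \<le> n" "n2 \<le> n" "0 < n" "nat \<lceil>8 / \<delta>\<^sup>2\<rceil> \<le> n" unfolding n0_def by auto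
    then have n\<delta>: "8 / \<delta>\<^sup>2 \<le> n" by linarith
    let ?K = "nat \<lfloor>exp (real n * R k)\<rfloor>"
    from n1[OF nn(1)] obtain enc D where ed: "\<forall>i<k. enc i \<in> measurable (MY n) (count_space UNIV) \<and> (\<forall>y. enc i y < nat \<lfloor>exp (real n * R i)\<rfloor>)"
      "\<forall>b i. D b i \<in> space (MY n)" and st: "stage n q J \<alpha> \<beta> \<theta> k enc D \<le> ennreal \<eta>2" by blast
    have "1 \<le> exp (real n * R k)" using R(2)[OF k(1)] by simp
    then have K: "0 < ?K" by (simp add: less_nat_zero_code le_floor_iff zero_less_nat_eq)
    have half: "1/2 \<le> emeasure (nrmn n q) {z\<in>space (nrmn n q). gtyp n q \<delta> (\<Sum>t<n. (z t)\<^sup>2)}"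
      using \<delta> by (intro gtyp_half q nn(3) n\<delta>) auto
    let ?ratio = "sqrt (\<theta> k / q) ^ n * exp (real n * \<delta> / 2) / ?K"
    have enc: "\<And>i. i < k \<Longrightarrow> enc i \<in> measurable (MY n) (count_space UNIV)" and D: "\<And>b i. D b i \<in> space (MY n)"
      using ed by auto
    obtain e D' where e: "e \<in> measurable (MY n) (count_space UNIV)" "\<forall>y. e y < ?K" "\<forall>b i. D' b i \<in> space (MY n)"
      and le: "stage n q J \<alpha> \<beta> \<theta> (Suc k) (enc(k := e)) D' \<le>
        ennreal (J * \<eta>1 + J * exp (- T / 2) + J * ((T + 2) * ((T + 2) * ?ratio + \<eta>1)))
        + ennreal (T + 2) * (ennreal (1 + J) * stage n q J \<alpha> \<beta> \<theta> k enc D)"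
      using code_step[where a="a k" and J=J and k=k and \<alpha>=\<alpha> and \<beta>=\<beta> and \<theta>=\<theta> and enc=enc and D=D, OF q nn(3) k(1) kJ \<alpha>[OF k(1)] \<beta>[OF k(1)] \<theta>0[OF k(1)] \<delta> T \<eta>1 K half enc D] by blast
    have ratio: "?ratio \<le> \<tau>"
    proof -
      have x: "0 < \<theta> k / q" using \<theta>0[OF k(1)] q by simp
      have "sqrt (\<theta> k / q) = exp (1/2 * ln (\<theta> k / q))"
        using x by (simp add: ln_sqrt[symmetric])
      then have "sqrt (\<theta> k / q) ^ n * exp (real n * \<delta> / 2) = exp (n * (1/2 * ln (\<theta> k / q) + \<delta> / 2))"
        by (simp add: exp_of_nat_mult[symmetric] mult_exp_exp distrib_left)
      then show ?thesis using n2[OF nn(2)] by simp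
    qed
    have 1: "J * exp (- T / 2) \<le> \<eta> / 4"
    proof -
      have "T / 2 \<le> exp (T / 2)" using exp_ge_add_one_self[of "T / 2"] by linarith
      then have "exp (- T / 2) \<le> 1 / (T / 2)" using T by (simp add: exp_minus field_simps)
      then have "J * exp (- T / 2) \<le> J * (1 / (T / 2))" by (intro mult_left_mono) auto
      also have "\<dots> = \<eta> / 4" using J0 \<eta> by (simp add: T_def)
      finally show ?thesis .
    qed
    have 2: "J * \<eta>1 + J * ((T + 2) * \<eta>1) \<le> \<eta> / 8"
    proof -
      have "J * \<eta>1 + J * ((T + 2) * \<eta>1) = J * (T + 3) * \<eta>1" by (simp add: algebra_simps)
      also have "\<dots> = \<eta> / 8"
      proof -
        have "x * y * (\<eta> / (8 * x * y)) = \<eta> / 8" if "x \<noteq> 0" "y \<noteq> 0" for x y :: real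
          using that by simp
        from this[of "real J" "T + 3"] show ?thesis using J0 T unfolding \<eta>1_def by simp
      qed
      finally show ?thesis by simp
    qed
    have 3: "J * ((T + 2) * ((T + 2) * ?ratio)) \<le> \<eta> / 4"
    proof -
      have "J * ((T + 2) * ((T + 2) * ?ratio)) \<le> J * ((T + 2) * ((T + 2) * \<tau>))"
        using T ratio by (intro mult_left_mono) auto
      also have "\<dots> = \<eta> / 4"
      proof -
        have "x * (y * (y * (\<eta> / (4 * x * y\<^sup>2)))) = \<eta> / 4" if "x \<noteq> 0" "y \<noteq> 0" for x y :: real
          using that by (simp add: power2_eq_square)
        from this[of "real J" "T + 2"] show ?thesis using J0 T unfolding \<tau>_def by simp
      qed
      finally show ?thesis .
    qed
    have 4: "ennreal (T + 2) * (ennreal (1 + J) * stage n q J \<alpha> \<beta> \<theta> k enc D) \<le> ennreal (\<eta> / 4)"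
    proof -
      have "ennreal (T + 2) * (ennreal (1 + J) * stage n q J \<alpha> \<beta> \<theta> k enc D) \<le> ennreal (T + 2) * (ennreal (1 + J) * ennreal \<eta>2)"
        by (intro mult_left_mono st) auto
      also have "\<dots> = ennreal ((T + 2) * ((1 + J) * \<eta>2))"
        using T \<eta>2 by (simp add: ennreal_mult'')
      also have "(T + 2) * ((1 + J) * \<eta>2) = \<eta> / 4"
      proof -
        have "y * (x * (\<eta> / (4 * y * x))) = \<eta> / 4" if "x \<noteq> 0" "y \<noteq> 0" for x y :: real
          using that by simp
        from this[of "1 + real J" "T + 2"] show ?thesis using T unfolding \<eta>2_def by simp
      qed
      finally show ?thesis .
    qed
    have "J * \<eta>1 + J * exp (- T / 2) + J * ((T + 2) * ((T + 2) * ?ratio + \<eta>1)) =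
        J * exp (- T / 2) + (J * \<eta>1 + J * ((T + 2) * \<eta>1)) + J * ((T + 2) * ((T + 2) * ?ratio))"
      by (simp add: distrib_left)
    also have "\<dots> \<le> \<eta> / 4 + \<eta> / 8 + \<eta> / 4" by (intro add_mono 1 2 3)
    finally have "stage n q J \<alpha> \<beta> \<theta> (Suc k) (enc(k := e)) D' \<le> ennreal (\<eta> / 4 + \<eta> / 8 + \<eta> / 4) + ennreal (\<eta> / 4)"
      using le 4 by (meson add_mono ennreal_leI order_trans)
    also have "\<dots> \<le> ennreal \<eta>" using \<eta> by (subst ennreal_plus[symmetric]) (auto intro: ennreal_leI)
    finally have "stage n q J \<alpha> \<beta> \<theta> (Suc k) (enc(k := e)) D' \<le> ennreal \<eta>" .
    then show "\<exists>enc D. (\<forall>i<Suc k. enc i \<in> measurable (MY n) (count_space UNIV) \<and> (\<forall>y. enc i y < nat \<lfloor>exp (real n * R i)\<rfloor>)) \<and>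
      (\<forall>b i. D b i \<in> space (MY n)) \<and> stage n q J \<alpha> \<beta> \<theta> (Suc k) enc D \<le> ennreal \<eta>"
      using e ed by (intro exI[of _ "enc(k := e)"] exI[of _ D']) (auto simp: less_Suc_eq)
  qed
qed

end

section \<open>From decoded codewords to a code of small distortion\<close>

lemma tail_integral_small:
  fixes g :: "'a \<Rightarrow> real"
  assumes g: "integrable S g" and nn: "\<And>x. 0 \<le> g x" and \<epsilon>: "0 < \<epsilon>"
  shows "\<exists>T\<ge>0. integrable S (\<lambda>x. if T < g x then g x else 0) \<and> (\<integral>x. (if T < g x then g x else 0) \<partial>S) \<le> \<epsilon>"
proof -
  note gm[measurable] = borel_measurable_integrable[OF g]
  have i: "integrable S (\<lambda>x. if T < g x then g x else 0)" for T
    using g by (rule Bochner_Integration.integrable_bound) (use nn in auto)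
  have "(\<lambda>T. \<integral>x. (if real T < g x then g x else 0) \<partial>S) \<longlonglongrightarrow> (\<integral>x. 0 \<partial>S)"
  proof (rule integral_dominated_convergence[where w=g])
    show "AE x in S. (\<lambda>T. if real T < g x then g x else 0) \<longlonglongrightarrow> 0"
    proof (rule AE_I2)
      fix x
      obtain T0 where "g x \<le> real T0" using real_arch_simple by blast
      then have "\<forall>\<^sub>F T in sequentially. (if real T < g x then g x else 0) = 0"
        unfolding eventually_sequentially by (intro exI[of _ T0]) auto
      then show "(\<lambda>T. if real T < g x then g x else 0) \<longlonglongrightarrow> 0" by (rule tendsto_eventually)
    qed
  qed (use g nn in auto)
  then have "\<forall>\<^sub>F T in sequentially. (\<integral>x. (if real T < g x then g x else 0) \<partial>S) < \<epsilon>"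
    using \<epsilon> by (intro order_tendstoD) auto
  then obtain T where "(\<integral>x. (if real T < g x then g x else 0) \<partial>S) < \<epsilon>"
    by (auto simp: eventually_sequentially)
  then show ?thesis using i by (intro exI[of _ "real T"]) auto
qed

context ceo_source
begin

lemma Blk_X_moment:
  assumes g: "integrable (Xlaw f) g" and t: "t < n"
  shows "integrable (Blk f sW2 M n) (\<lambda>\<omega>. g (fst (\<omega> t)) :: real)"
    "(\<integral>\<omega>. g (fst (\<omega> t)) \<partial>Blk f sW2 M n) = (\<integral>x. g x \<partial>Xlaw f)"
proof -
  have gm: "(\<lambda>\<omega>. g (fst \<omega>)) \<in> borel_measurable (Src f sW2 M)"
  proof -
    have "g \<in> borel_measurable borel"
      using borel_measurable_integrable[OF g] by (simp add: measurable_cong_sets[OF sets_Xlaw refl])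
    moreover have "fst \<in> measurable (Src f sW2 M) borel" by (simp add: measurable_cong_sets[OF sets_Src refl])
    ultimately show ?thesis by (rule measurable_compose[rotated])
  qed
  have o: "integrable (Wlaw sW2 M) (\<lambda>_. 1::real)" "(\<integral>w. 1 \<partial>Wlaw sW2 M) = (1::real)"
    by (simp_all add: W.prob_space)
  note p = XW.integral_product_fst_snd[OF g o(1)]
  have c: "g (fst (chan x)) = g (fst x) * 1" for x by (cases x) (simp add: chan_def)
  have S: "integrable (Src f sW2 M) (\<lambda>\<omega>. g (fst \<omega>))" "(\<integral>\<omega>. g (fst \<omega>) \<partial>Src f sW2 M) = (\<integral>x. g x \<partial>Xlaw f)"
    unfolding integral_Src[OF gm] c using p o(2) by simp_all
  show "integrable (Blk f sW2 M n) (\<lambda>\<omega>. g (fst (\<omega> t)))"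
    "(\<integral>\<omega>. g (fst (\<omega> t)) \<partial>Blk f sW2 M n) = (\<integral>x. g x \<partial>Xlaw f)"
    unfolding Blk_def
    using PiM_component_integral[where N="\<lambda>_. Src f sW2 M" and I="{..<n}" and i=t and f="\<lambda>\<omega>. g (fst \<omega>)", OF prob_space_Src _ S(1)] t S(2)
    by auto
qed

text \<open>Two tests beyond the prediction tests turn badness into distortion: test
  \<open>M\<close> measures the error of the linear estimate, test \<open>Suc M\<close> its norm.
  Squared error is unbounded on the rare bad event, so the estimate is clipped and the source is
  split at level \<open>T\<close>. Test threshold, bad event and source tail each spend a quarter of
  \<open>\<epsilon>\<close>.\<close>

lemma stage_to_code:
  fixes A C d \<epsilon> :: real and n J :: nat
  assumes n: "0 < n" and C: "0 \<le> C" and \<epsilon>: "0 < \<epsilon>" and d: "0 \<le> d"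
    and enc: "\<And>i. i < M \<Longrightarrow> enc i \<in> measurable (MY n) (count_space UNIV) \<and> (\<forall>y. enc i y < nat \<lfloor>exp (real n * R i)\<rfloor>)"
    and D: "\<And>b i. D b i \<in> space (MY n)"
    and J: "J = M + 2" and \<alpha>: "\<alpha> M = 1" "\<alpha> (Suc M) = 0" and \<beta>: "\<beta> M = (\<lambda>i. - A)" "\<beta> (Suc M) = (\<lambda>i. A)"
    and \<theta>: "\<theta> M = d + \<epsilon> / 4" "\<theta> (Suc M) = C"
    and T: "0 \<le> T" "integrable (Xlaw f) (\<lambda>x. if T < (x - \<mu>)\<^sup>2 then (x - \<mu>)\<^sup>2 else 0)"
      "(\<integral>x. (if T < (x - \<mu>)\<^sup>2 then (x - \<mu>)\<^sup>2 else 0) \<partial>Xlaw f) \<le> \<epsilon> / 8"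
    and \<eta>: "0 \<le> \<eta>" "(2 * T + 2 * C) * \<eta> \<le> \<epsilon> / 4"
    and st: "stage n q J \<alpha> \<beta> \<theta> M enc D \<le> ennreal \<eta>"
  shows "ceo_code f sW2 M n R (d + \<epsilon>)"
proof -
  let ?P = "Blk f sW2 M n"
  interpret B: prob_space ?P by (rule prob_space_Blk)
  define c where "c = idx enc n M"
  define U where "U = (\<lambda>\<omega>. \<lambda>i\<in>{..<M}. D (c \<omega>) i)"
  define xr where "xr = (\<lambda>b t. \<mu> + A * (\<Sum>i<M. D b i t - \<mu>))"
  \<comment> \<open>An estimate of excessive norm is replaced by the mean, so that its contribution
    is at most \<open>n * C\<close> even on the bad event.\<close>
  define xh where "xh = (\<lambda>b t. if (\<Sum>t<n. (xr b t - \<mu>)\<^sup>2) \<le> n * C then xr b t else \<mu>)"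
  \<comment> \<open>Codes number their messages from 1, the binning indices start at 0;
    \<open>dec'\<close> undoes the shift.\<close>
  define enc' where "enc' = (\<lambda>i y. Suc (enc i y))"
  define dec' where "dec' = (\<lambda>b. xh (\<lambda>i\<in>{..<M}. b i - 1))"
  define est where "est = (\<lambda>\<omega>. xh (c \<omega>))"
  have encm: "\<And>i. i < M \<Longrightarrow> enc i \<in> measurable (MY n) (count_space UNIV)" using enc by blast
  have est_eq: "dec' (\<lambda>i\<in>{..<M}. enc' i (\<lambda>s\<in>{..<n}. snd (\<omega> s) i)) = est \<omega>" for \<omega>
  proof -
    have "(\<lambda>i\<in>{..<M}. (\<lambda>i\<in>{..<M}. enc' i (\<lambda>s\<in>{..<n}. snd (\<omega> s) i)) i - 1) = c \<omega>"
      by (auto simp: fun_eq_iff c_def idx_def enc'_def yv_def)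
    then show ?thesis by (simp add: dec'_def est_def)
  qed
  have U_meas: "U \<in> measurable ?P (PiM {..<M} (\<lambda>_. MY n))"
    unfolding U_def c_def
    by (rule idx_compose_meas[where D="\<lambda>b. \<lambda>i\<in>{..<M}. D b i"]) (use encm D in \<open>auto simp: space_PiM\<close>)
  have est_meas[measurable]: "(\<lambda>\<omega>. est \<omega> t) \<in> borel_measurable ?P" for t
    unfolding est_def c_def by (rule idx_compose_meas[where D="\<lambda>b. xh b t"]) (use encm in auto)
  have xm[measurable]: "(\<lambda>\<omega>. fst (\<omega> t)) \<in> borel_measurable ?P" if "t < n" for t
    using that by (intro Blk_fst) auto
  define bad where "bad = (\<lambda>\<omega>. badness n J \<alpha> \<beta> \<theta> \<omega> (U \<omega>))"
  have bad_meas: "bad \<in> borel_measurable ?P"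
  proof -
    have "(\<lambda>\<omega>. (\<omega>, U \<omega>)) \<in> measurable ?P (?P \<Otimes>\<^sub>M PiM {..<M} (\<lambda>_. MY n))" using U_meas by measurable
    from measurable_compose[OF this badness_meas] show ?thesis by (simp add: bad_def)
  qed
  \<comment> \<open>\<open>bad\<close> is a sum of 0/1 values, so outside \<open>Bd\<close> every
    test is passed.\<close>
  define Bd where "Bd = {\<omega>\<in>space ?P. 1 \<le> bad \<omega>}"
  have Bd[measurable]: "Bd \<in> sets ?P" unfolding Bd_def using bad_meas by measurable
  have Bd_le: "measure ?P Bd \<le> \<eta>"
  proof -
    have "emeasure ?P Bd = (\<integral>\<^sup>+\<omega>. indicator Bd \<omega> \<partial>?P)" by simp
    also have "\<dots> \<le> (\<integral>\<^sup>+\<omega>. bad \<omega> \<partial>?P)"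
      by (intro nn_integral_mono) (auto simp: Bd_def indicator_def)
    also have "\<dots> \<le> ennreal \<eta>" using st unfolding stage_def bad_def U_def c_def by simp
    finally show ?thesis using \<eta>(1) by (simp add: B.emeasure_eq_measure)
  qed
  have xh_bd: "(xh b t - \<mu>)\<^sup>2 \<le> n * C" if "t < n" for b t
  proof (cases "(\<Sum>t<n. (xr b t - \<mu>)\<^sup>2) \<le> n * C")
    case True
    have "(xr b t - \<mu>)\<^sup>2 \<le> (\<Sum>t<n. (xr b t - \<mu>)\<^sup>2)" using that by (intro member_le_sum) auto
    then show ?thesis using True by (simp add: xh_def)
  qed (use C in \<open>simp add: xh_def\<close>)
  have xh_sum: "(\<Sum>t<n. (xh b t - \<mu>)\<^sup>2) \<le> n * C" for b
    using C by (cases "(\<Sum>t<n. (xr b t - \<mu>)\<^sup>2) \<le> n * C") (auto simp: xh_def)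
  have sq2: "(x - y)\<^sup>2 \<le> 2 * (x - \<mu>)\<^sup>2 + 2 * (y - \<mu>)\<^sup>2" for x y :: real
  proof -
    have "0 \<le> ((x - \<mu>) + (y - \<mu>))\<^sup>2" by simp
    then show ?thesis by (simp add: power2_eq_square algebra_simps)
  qed
  have iX: "integrable ?P (\<lambda>\<omega>. (fst (\<omega> t) - \<mu>)\<^sup>2)" if "t < n" for t
    using Blk_X_moment(1)[OF integrable_centered(1) that] .
  have int: "integrable ?P (\<lambda>\<omega>. (fst (\<omega> t) - est \<omega> t)\<^sup>2)" if t: "t < n" for t
  proof (rule Bochner_Integration.integrable_bound)
    show "integrable ?P (\<lambda>\<omega>. 2 * (fst (\<omega> t) - \<mu>)\<^sup>2 + 2 * (n * C))" using iX[OF t] by simp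
    show "(\<lambda>\<omega>. (fst (\<omega> t) - est \<omega> t)\<^sup>2) \<in> borel_measurable ?P" using xm[OF t] by measurable
    show "AE \<omega> in ?P. norm ((fst (\<omega> t) - est \<omega> t)\<^sup>2) \<le> norm (2 * (fst (\<omega> t) - \<mu>)\<^sup>2 + 2 * (n * C))"
    proof (rule AE_I2)
      fix \<omega>
      have "(fst (\<omega> t) - est \<omega> t)\<^sup>2 \<le> 2 * (fst (\<omega> t) - \<mu>)\<^sup>2 + 2 * (n * C)"
        using sq2[of "fst (\<omega> t)" "est \<omega> t"] xh_bd[OF t, of "c \<omega>"] unfolding est_def by linarith
      then show "norm ((fst (\<omega> t) - est \<omega> t)\<^sup>2) \<le> norm (2 * (fst (\<omega> t) - \<mu>)\<^sup>2 + 2 * (n * C))" by simp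
    qed
  qed
  let ?g = "\<lambda>x. if T < (x - \<mu>)\<^sup>2 then (x - \<mu>)\<^sup>2 else 0"
  \<comment> \<open>Pointwise majorant of the block error: the distortion on the good event,
    \<open>2 * T + 2 * C\<close> per letter on \<open>Bd\<close>, and the source excess above
    \<open>T\<close> throughout.\<close>
  let ?b = "\<lambda>\<omega>. n * (d + \<epsilon> / 4) + (2 * (n * T) + 2 * (n * C)) * indicator Bd \<omega> + 2 * (\<Sum>t<n. ?g (fst (\<omega> t)))"
  have pw: "(\<Sum>t<n. (fst (\<omega> t) - est \<omega> t)\<^sup>2) \<le> ?b \<omega>" if \<omega>: "\<omega> \<in> space ?P" for \<omega>
  proof (cases "\<omega> \<in> Bd")
    case True
    have "(\<Sum>t<n. (fst (\<omega> t) - est \<omega> t)\<^sup>2) \<le> (\<Sum>t<n. 2 * (fst (\<omega> t) - \<mu>)\<^sup>2 + 2 * (est \<omega> t - \<mu>)\<^sup>2)"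
      by (intro sum_mono sq2)
    also have "\<dots> = 2 * (\<Sum>t<n. (fst (\<omega> t) - \<mu>)\<^sup>2) + 2 * (\<Sum>t<n. (est \<omega> t - \<mu>)\<^sup>2)"
      by (simp add: sum.distrib sum_distrib_left)
    also have "(\<Sum>t<n. (est \<omega> t - \<mu>)\<^sup>2) \<le> n * C" unfolding est_def by (rule xh_sum)
    also have "(\<Sum>t<n. (fst (\<omega> t) - \<mu>)\<^sup>2) \<le> (\<Sum>t<n. T + ?g (fst (\<omega> t)))"
      using T(1) by (intro sum_mono) auto
    also have "\<dots> = n * T + (\<Sum>t<n. ?g (fst (\<omega> t)))" by (simp add: sum.distrib)
    finally have "(\<Sum>t<n. (fst (\<omega> t) - est \<omega> t)\<^sup>2) \<le> 2 * (n * T + (\<Sum>t<n. ?g (fst (\<omega> t)))) + 2 * (n * C)" by simp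
    moreover have "0 \<le> n * (d + \<epsilon> / 4)" using d \<epsilon> by simp
    ultimately show ?thesis using True by (simp add: distrib_left)
  next
    case False
    then have lt: "bad \<omega> < 1" using \<omega> by (auto simp: Bd_def)
    have pb: "pbad n (\<alpha> j) (\<beta> j) (\<theta> j) M \<omega> (U \<omega>) < 1" if "j < J" for j
      using badness_ge[OF that, of n \<alpha> \<beta> \<theta> \<omega> "U \<omega>"] lt unfolding bad_def by (rule order_le_less_trans)
    have Ui: "i < M \<Longrightarrow> U \<omega> i t = D (c \<omega>) i t" for i t by (simp add: U_def)
    have p1: "pform (\<alpha> M) (\<beta> M) M \<omega> (U \<omega>) t = fst (\<omega> t) - xr (c \<omega>) t" for t
      using Ui by (simp add: pform_def \<alpha> \<beta> xr_def sum_distrib_left sum_negf)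
    have p2: "pform (\<alpha> (Suc M)) (\<beta> (Suc M)) M \<omega> (U \<omega>) t = xr (c \<omega>) t - \<mu>" for t
      using Ui by (simp add: pform_def \<alpha> \<beta> xr_def sum_distrib_left)
    have "(\<Sum>t<n. (fst (\<omega> t) - xr (c \<omega>) t)\<^sup>2) \<le> n * (d + \<epsilon> / 4)"
      using pb[of M] by (simp add: J pbad_def p1 \<theta> split: if_splits)
    moreover have "(\<Sum>t<n. (xr (c \<omega>) t - \<mu>)\<^sup>2) \<le> n * C"
      using pb[of "Suc M"] by (simp add: J pbad_def p2 \<theta> split: if_splits)
    moreover have "0 \<le> (\<Sum>t<n. ?g (fst (\<omega> t)))" by (intro sum_nonneg) auto
    ultimately show ?thesis using False by (simp add: est_def xh_def)
  qed
  have ig: "integrable ?P (\<lambda>\<omega>. ?g (fst (\<omega> t)))" "(\<integral>\<omega>. ?g (fst (\<omega> t)) \<partial>?P) \<le> \<epsilon> / 8" if "t < n" for t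
    using Blk_X_moment[OF T(2) that] T(3) by simp_all
  have ib: "integrable ?P ?b"
    using ig(1) by (intro Bochner_Integration.integrable_add Bochner_Integration.integrable_sum integrable_mult_right)
      (auto simp: B.emeasure_eq_measure)
  have "(\<Sum>t<n. \<integral>\<omega>. (fst (\<omega> t) - est \<omega> t)\<^sup>2 \<partial>?P) = (\<integral>\<omega>. (\<Sum>t<n. (fst (\<omega> t) - est \<omega> t)\<^sup>2) \<partial>?P)"
    using int by (intro Bochner_Integration.integral_sum[symmetric]) auto
  also have "\<dots> \<le> (\<integral>\<omega>. ?b \<omega> \<partial>?P)"
    using int pw by (intro integral_mono ib Bochner_Integration.integrable_sum) auto
  also have "\<dots> = n * (d + \<epsilon> / 4) + (2 * (n * T) + 2 * (n * C)) * measure ?P Bd + 2 * (\<Sum>t<n. \<integral>\<omega>. ?g (fst (\<omega> t)) \<partial>?P)"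
  proof -
    have 1: "integrable ?P (\<lambda>\<omega>. (2 * (n * T) + 2 * (n * C)) * indicator Bd \<omega>)" by (auto simp: B.emeasure_eq_measure)
    have 2: "integrable ?P (\<lambda>\<omega>. 2 * (\<Sum>t<n. ?g (fst (\<omega> t))))" using ig(1) by (intro integrable_mult_right Bochner_Integration.integrable_sum) auto
    have 3: "(\<integral>\<omega>. (\<Sum>t<n. ?g (fst (\<omega> t))) \<partial>?P) = (\<Sum>t<n. \<integral>\<omega>. ?g (fst (\<omega> t)) \<partial>?P)"
      using ig(1) by (intro Bochner_Integration.integral_sum) auto
    show ?thesis
      using Bd by (simp only: Bochner_Integration.integral_add[OF Bochner_Integration.integrable_add[OF _ 1] 2] Bochner_Integration.integral_add[OF _ 1]
        B.integrable_const integral_mult_right_zero 3 integral_indicator lebesgue_integral_const B.prob_space scaleR_one)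
        (simp add: B.prob_space)
  qed
  also have "\<dots> \<le> n * (d + \<epsilon> / 4) + n * (\<epsilon> / 4) + 2 * (n * (\<epsilon> / 8))"
  proof -
    have "(2 * (n * T) + 2 * (n * C)) * measure ?P Bd \<le> (2 * (n * T) + 2 * (n * C)) * \<eta>"
      using Bd_le T(1) C by (intro mult_left_mono) auto
    also have "\<dots> = n * ((2 * T + 2 * C) * \<eta>)" by (simp add: algebra_simps)
    also have "\<dots> \<le> n * (\<epsilon> / 4)" using \<eta>(2) by (intro mult_left_mono) auto
    finally have 1: "(2 * (n * T) + 2 * (n * C)) * measure ?P Bd \<le> n * (\<epsilon> / 4)" .
    have "(\<Sum>t<n. \<integral>\<omega>. ?g (fst (\<omega> t)) \<partial>?P) \<le> (\<Sum>t<n. \<epsilon> / 8)" using ig(2) by (intro sum_mono) auto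
    then have 2: "(\<Sum>t<n. \<integral>\<omega>. ?g (fst (\<omega> t)) \<partial>?P) \<le> n * (\<epsilon> / 8)" by simp
    show ?thesis using 1 2 by linarith
  qed
  also have "\<dots> \<le> n * (d + \<epsilon>)" using \<epsilon> n by (simp add: algebra_simps)
  finally have "(1 / real n) * (\<Sum>t<n. \<integral>\<omega>. (fst (\<omega> t) - est \<omega> t)\<^sup>2 \<partial>?P) \<le> d + \<epsilon>"
    using n by (simp add: field_simps)
  moreover have "enc' i \<in> measurable (MY n) (count_space UNIV)" if "i < M" for i
    unfolding enc'_def using encm[OF that] by measurable
  moreover have "enc' i y \<in> {1..nat \<lfloor>exp (real n * R i)\<rfloor>}" if "i < M" for i y
    using enc[OF that] by (auto simp: enc'_def Suc_le_eq)
  ultimately show ?thesis unfolding ceo_code_def Let_def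
    by (intro exI[of _ enc'] exI[of _ dec']) (use int in \<open>auto simp: est_eq\<close>)
qed


section \<open>The sum rate of the symmetric quadratic Gaussian CEO problem\<close>

definition gauss_sum_rate :: "real \<Rightarrow> real" where
  "gauss_sum_rate D = 1/2 * ln (varX f / D) + real M / 2 * ln (1 / (1 - sW2 / real M * (1 / D - 1 / varX f)))"

lemma predictor_sums:
  fixes c s \<tau> :: real
  assumes k: "k < M"
  shows "(\<Sum>i<M. (if i = k then 1 else if i < k then - c else 0)) = 1 - k * c"
    "(\<Sum>i<M. (if i = k then 1 else if i < k then - c else 0)\<^sup>2) = 1 + k * c\<^sup>2"
proof -
  have *: "(\<Sum>i<M. (if i = k then x else if i < k then y else 0)) = x + k * y" for x y :: real
  proof -
    have "(\<Sum>i<M. (if i = k then x else if i < k then y else 0)) = (\<Sum>i<M. (if i = k then x else 0) + (if i \<in> {..<k} then y else 0))"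
      by (intro sum.cong) auto
    also have "\<dots> = (\<Sum>i<M. if i = k then x else 0) + (\<Sum>i<M. if i \<in> {..<k} then y else 0)"
      by (rule sum.distrib)
    also have "(\<Sum>i<M. if i = k then x else 0) = x" using k by simp
    also have "(\<Sum>i<M. if i \<in> {..<k} then y else 0) = (\<Sum>i\<in>{..<M} \<inter> {..<k}. y)"
      by (rule sum.inter_restrict[symmetric]) simp
    also have "{..<M} \<inter> {..<k} = {..<k}" using k by auto
    finally show ?thesis by simp
  qed
  show "(\<Sum>i<M. (if i = k then 1 else if i < k then - c else 0)) = 1 - k * c"
    using *[of 1 "- c"] by simp
  have "(\<Sum>i<M. (if i = k then 1 else if i < k then - c else 0)\<^sup>2) = (\<Sum>i<M. (if i = k then 1 else if i < k then c\<^sup>2 else 0))"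
    by (intro sum.cong) auto
  then show "(\<Sum>i<M. (if i = k then 1 else if i < k then - c else 0)\<^sup>2) = 1 + k * c\<^sup>2"
    using *[of 1 "c\<^sup>2"] by simp
qed

text \<open>\<open>c\<close> is the coefficient of the best linear predictor of a variable of
  variance \<open>s\<close> from \<open>k\<close> copies with independent noise of variance
  \<open>\<tau>\<close>. The first value is the resulting error; the second adds
  \<open>\<tau>\<close> and is the variance of the innovation in the next copy.\<close>

lemma innovation_variance:
  fixes s \<tau> k :: real
  assumes "0 < s" "0 < \<tau>" "0 \<le> k"
  defines "c \<equiv> s / (k * s + \<tau>)"
  shows "(1 - k * c)\<^sup>2 * s + \<tau> * (k * c\<^sup>2) = s * \<tau> / (k * s + \<tau>)"
    and "(1 - k * c)\<^sup>2 * s + \<tau> * (1 + k * c\<^sup>2) = \<tau> * ((k + 1) * s + \<tau>) / (k * s + \<tau>)"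
proof -
  have p: "0 < k * s + \<tau>" using assms by (simp add: add_nonneg_pos)
  have c1: "1 - k * c = \<tau> / (k * s + \<tau>)" using p by (simp add: c_def field_simps)
  have "(1 - k * c)\<^sup>2 * s + \<tau> * (k * c\<^sup>2) = (\<tau>\<^sup>2 * s + \<tau> * (k * s\<^sup>2)) / (k * s + \<tau>)\<^sup>2"
    unfolding c1 by (simp add: c_def power_divide add_divide_distrib)
  also have "\<tau>\<^sup>2 * s + \<tau> * (k * s\<^sup>2) = (s * \<tau>) * (k * s + \<tau>)" by (simp add: power2_eq_square algebra_simps)
  also have "\<dots> / (k * s + \<tau>)\<^sup>2 = s * \<tau> / (k * s + \<tau>)" using p by (simp add: power2_eq_square)
  finally show 1: "(1 - k * c)\<^sup>2 * s + \<tau> * (k * c\<^sup>2) = s * \<tau> / (k * s + \<tau>)" .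
  have "(1 - k * c)\<^sup>2 * s + \<tau> * (1 + k * c\<^sup>2) = s * \<tau> / (k * s + \<tau>) + \<tau>" using 1 by (simp add: distrib_left)
  also have "\<dots> = \<tau> * ((k + 1) * s + \<tau>) / (k * s + \<tau>)" using p by (simp add: field_simps)
  finally show "(1 - k * c)\<^sup>2 * s + \<tau> * (1 + k * c\<^sup>2) = \<tau> * ((k + 1) * s + \<tau>) / (k * s + \<tau>)" .
qed

text \<open>The chain rule for the determinant of the covariance of \<open>m\<close> noisy copies:
  consecutive innovation variances cancel except for \<open>\<tau> ^ m\<close> and the last
  numerator over \<open>\<tau>\<close>.\<close>

lemma telescoping_rate:
  fixes s \<tau> q :: real
  assumes "0 < s" "0 < \<tau>" "0 < q"
  shows "(\<Sum>k<m. 1/2 * ln (\<tau> * ((real k + 1) * s + \<tau>) / (real k * s + \<tau>) / q)) = m / 2 * ln (\<tau> / q) + 1/2 * ln ((m * s + \<tau>) / \<tau>)"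
proof (induction m)
  case 0 then show ?case using assms by simp
next
  case (Suc m)
  have p: "0 < real m * s + \<tau>" "0 < (real m + 1) * s + \<tau>" using assms by (simp_all add: add_nonneg_pos)
  have "\<tau> * ((real m + 1) * s + \<tau>) / (real m * s + \<tau>) / q = (\<tau> / q) * (((real m + 1) * s + \<tau>) / (real m * s + \<tau>))"
    by simp
  also have "ln \<dots> = ln (\<tau> / q) + (ln ((real m + 1) * s + \<tau>) - ln (real m * s + \<tau>))"
    using p assms by (simp add: ln_mult ln_div)
  finally have "1/2 * ln (\<tau> * ((real m + 1) * s + \<tau>) / (real m * s + \<tau>) / q) = 1/2 * ln (\<tau> / q) + 1/2 * (ln ((real m + 1) * s + \<tau>) - ln (real m * s + \<tau>))"
    by simp
  moreover have "ln ((real m * s + \<tau>) / \<tau>) = ln (real m * s + \<tau>) - ln \<tau>" "ln ((real (Suc m) * s + \<tau>) / \<tau>) = ln ((real m + 1) * s + \<tau>) - ln \<tau>"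
    using p assms by (simp_all add: ln_div add.commute)
  ultimately show ?case unfolding sum.lessThan_Suc Suc.IH by (simp add: field_simps)
qed

text \<open>The rates have to be chosen before \<open>\<epsilon>\<close>; among the tests, the one
  with index \<open>M\<close> alone depends on \<open>\<epsilon>\<close>, and it influences block
  length but no rate.\<close>

lemma ceo_achievable:
  fixes D \<rho> :: real
  assumes D: "DN0 f sW2 M < D" "D < varX f" and \<rho>: "0 < \<rho>" "\<rho> < 1"
  shows "\<exists>R. (\<forall>\<epsilon>>0. \<exists>N. \<forall>n\<ge>N. ceo_code f sW2 M n R (D + \<epsilon>)) \<and> (\<Sum>i<M. R i) = gauss_sum_rate D + M * \<rho>"
proof -
  define s where "s = varX f"
  have s: "0 < s" using var_pos by (simp add: s_def)
  have M: "0 < real M" using M_pos by simp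
  have DN: "0 < DN0 f sW2 M" using s M sW2_pos by (simp add: DN0_def s_def[symmetric] add_pos_pos)
  have D0: "0 < D" using D DN by linarith
  define h where "h = 1 / D - 1 / s"
  have h: "0 < h" using D(2) D0 s by (simp add: h_def s_def[symmetric] field_simps)
  have hM: "h < M / sW2"
  proof -
    have "1 / D < 1 / DN0 f sW2 M" using D(1) DN by (intro divide_strict_left_mono) auto
    also have "\<dots> = M / sW2 + 1 / s" using s sW2_pos M by (simp add: DN0_def s_def[symmetric] field_simps)
    finally show ?thesis by (simp add: h_def)
  qed
  \<comment> \<open>Total noise, observation plus quantization, at which the linear estimate from
    \<open>M\<close> codewords has error exactly \<open>D\<close>: the solution of
    \<open>1 / D = 1 / s + M / \<tau>\<close>.\<close>
  define \<tau> where "\<tau> = M / h"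
  have \<tau>: "0 < \<tau>" using M h by (simp add: \<tau>_def)
  \<comment> \<open>Positivity of this quantization noise is the inequality \<open>hM\<close>, that
    is \<open>DN0 f sW2 M < D\<close>.\<close>
  define q where "q = \<tau> - sW2"
  have q: "0 < q" using h hM sW2_pos by (simp add: q_def \<tau>_def field_simps)
  have \<tau>q: "sW2 + q = \<tau>" by (simp add: q_def)
  have D_eq: "s * \<tau> / (M * s + \<tau>) = D"
  proof -
    have "M / \<tau> = h" using M by (simp add: \<tau>_def)
    then have "1 / D = 1 / s + M / \<tau>" by (simp add: h_def)
    also have "\<dots> = (M * s + \<tau>) / (s * \<tau>)" using s \<tau> by (simp add: field_simps)
    finally have "1 / (1 / D) = s * \<tau> / (M * s + \<tau>)" by (simp only: divide_divide_eq_right mult_1)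
    then show ?thesis by simp
  qed
  define a where "a k = s / (real k * s + \<tau>)" for k :: nat
  define v where "v k = \<tau> * ((real k + 1) * s + \<tau>) / (real k * s + \<tau>)" for k :: nat
  have den: "0 < real k * s + \<tau>" for k using s \<tau> by (simp add: add_nonneg_pos)
  have v\<tau>: "\<tau> \<le> v k" for k
  proof -
    have "v k = \<tau> + s * \<tau> / (real k * s + \<tau>)" using den[of k] by (simp add: v_def field_simps)
    then show ?thesis using den[of k] s \<tau> by simp
  qed
  have v: "0 < v k" "q \<le> v k" for k using v\<tau>[of k] \<tau> sW2_pos by (auto simp: q_def)
  \<comment> \<open>Of the surplus \<open>\<rho>\<close>, a quarter will pay for enlarging
    \<open>v k\<close> to the test threshold and a quarter for the shell width
    \<open>\<rho> / 2\<close>; the rest keeps the rate inequality strict. Since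
    \<open>q \<le> v k\<close>, the rate is nonnegative.\<close>
  define R where "R k = 1/2 * ln (v k / q) + \<rho>" for k :: nat
  define \<alpha> where "\<alpha> j = (if j = M then 1 else 0 :: real)" for j
  define \<beta> where "\<beta> j = (if j < M then (\<lambda>i. if i = j then 1 else if i < j then - a j else 0)
     else if j = M then (\<lambda>_. - a M) else (\<lambda>_. a M))" for j :: nat
  \<comment> \<open>Second moment of the linear estimate about \<open>\<mu>\<close> under ideal
    codewords; the added 1 makes the last test strict.\<close>
  define C where "C = (M * a M)\<^sup>2 * s + \<tau> * (M * (a M)\<^sup>2) + 1"
  have C: "0 \<le> C" using s \<tau> by (simp add: C_def add_nonneg_nonneg)
  show ?thesis
  proof (intro exI[of _ R] conjI allI impI)
    have "(\<Sum>i<M. R i) = (\<Sum>k<M. 1/2 * ln (\<tau> * ((real k + 1) * s + \<tau>) / (real k * s + \<tau>) / q)) + M * \<rho>"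
      by (simp add: R_def v_def sum.distrib)
    also have "\<dots> = M / 2 * ln (\<tau> / q) + 1/2 * ln ((M * s + \<tau>) / \<tau>) + M * \<rho>"
      by (subst telescoping_rate[OF s \<tau> q]) simp
    also have "(M * s + \<tau>) / \<tau> = s / D" unfolding D_eq[symmetric] using s \<tau> den[of M] by simp
    also have "\<tau> / q = 1 / (1 - sW2 / M * h)"
    proof -
      have "sW2 / M * h = sW2 / \<tau>" using M by (simp add: \<tau>_def)
      then have "1 - sW2 / M * h = q / \<tau>" using \<tau> by (simp add: q_def field_simps)
      then show ?thesis using q \<tau> by simp
    qed
    finally show "(\<Sum>i<M. R i) = gauss_sum_rate D + M * \<rho>"
      by (simp add: gauss_sum_rate_def h_def s_def)
  next
    fix \<epsilon> :: real assume \<epsilon>: "0 < \<epsilon>"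
    \<comment> \<open>The factor \<open>exp (\<rho> / 2)\<close> gives the prediction tests a strict
      margin and adds only \<open>\<rho> / 4\<close> to the logarithm of the bin count per
      letter.\<close>
    define \<theta> where "\<theta> j = (if j < M then v j * exp (\<rho> / 2) else if j = M then D + \<epsilon> / 4 else C)" for j
    have \<theta>: "(\<alpha> j + (\<Sum>i<M. \<beta> j i))\<^sup>2 * varX f + (sW2 + q) * (\<Sum>i<M. (\<beta> j i)\<^sup>2) < \<theta> j" if j: "j < M + 2" for j
    proof -
      consider "j < M" | "j = M" | "j = Suc M" using j by linarith
      then show ?thesis
      proof cases
        case 1
        have "(1 - j * a j)\<^sup>2 * s + \<tau> * (1 + j * (a j)\<^sup>2) = v j"
          using innovation_variance(2)[OF s \<tau>, of "real j"] by (simp add: a_def v_def)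
        moreover have "v j < v j * exp (\<rho> / 2)" using v(1)[of j] \<rho> by simp
        ultimately show ?thesis using 1 unfolding \<tau>q s_def[symmetric] \<alpha>_def \<beta>_def \<theta>_def
          by (simp add: predictor_sums)
      next
        case 2
        have "(1 - M * a M)\<^sup>2 * s + \<tau> * (M * (a M)\<^sup>2) = D"
          using innovation_variance(1)[OF s \<tau>, of "real M"] D_eq by (simp add: a_def)
        then show ?thesis using 2 \<epsilon> unfolding \<tau>q s_def[symmetric] \<alpha>_def \<beta>_def \<theta>_def by simp
      next
        case 3
        then show ?thesis unfolding \<tau>q s_def[symmetric] \<alpha>_def \<beta>_def \<theta>_def C_def by simp
      qed
    qed
    from tail_integral_small[OF integrable_centered(1), of "\<epsilon> / 8"] \<epsilon>
    obtain T where T: "0 \<le> T" "integrable (Xlaw f) (\<lambda>x. if T < (x - \<mu>)\<^sup>2 then (x - \<mu>)\<^sup>2 else 0)"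
      "(\<integral>x. (if T < (x - \<mu>)\<^sup>2 then (x - \<mu>)\<^sup>2 else 0) \<partial>Xlaw f) \<le> \<epsilon> / 8" by auto
    define \<eta> where "\<eta> = \<epsilon> / (4 * (2 * T + 2 * C + 1))"
    have \<eta>: "0 < \<eta>" "(2 * T + 2 * C) * \<eta> \<le> \<epsilon> / 4"
    proof -
      have p: "0 < 2 * T + 2 * C + 1" using T(1) C by linarith
      then show "0 < \<eta>" using \<epsilon> by (simp add: \<eta>_def)
      then have "(2 * T + 2 * C) * \<eta> \<le> (2 * T + 2 * C + 1) * \<eta>" by (intro mult_right_mono) auto
      also have "\<dots> = \<epsilon> / 4"
      proof -
        have "x * (\<epsilon> / (4 * x)) = \<epsilon> / 4" if "x \<noteq> 0" for x using that by simp
        from this[of "2 * T + 2 * C + 1"] p show ?thesis unfolding \<eta>_def by simp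
      qed
      finally show "(2 * T + 2 * C) * \<eta> \<le> \<epsilon> / 4" .
    qed
    have "\<exists>n0. \<forall>n\<ge>n0. \<exists>enc dd. (\<forall>i<M. enc i \<in> measurable (MY n) (count_space UNIV) \<and> (\<forall>y. enc i y < nat \<lfloor>exp (real n * R i)\<rfloor>)) \<and>
      (\<forall>b i. dd b i \<in> space (MY n)) \<and> stage n q (M + 2) \<alpha> \<beta> \<theta> M enc dd \<le> ennreal \<eta>"
    proof (rule code_induction[where \<delta>="\<rho> / 2" and a=a])
      show "0 < q" by fact
      show "\<beta> k = (\<lambda>i. if i = k then 1 else if i < k then - a k else 0)" if "k < M" for k using that by (simp add: \<beta>_def)
      show "0 < \<theta> k" if "k < M" for k using that v by (simp add: \<theta>_def)
      show "1/2 * ln (\<theta> k / q) + \<rho> / 2 / 2 < R k" if "k < M" for k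
      proof -
        have "ln (\<theta> k / q) = ln (v k / q) + \<rho> / 2"
          using that v(1)[of k] q by (simp add: \<theta>_def ln_mult ln_div)
        then show ?thesis using \<rho> by (simp add: R_def add_divide_distrib)
      qed
      show "0 \<le> R k" for k using v(2)[of k] q \<rho> by (simp add: R_def)
      show "(\<alpha> j + (\<Sum>i<M. \<beta> j i))\<^sup>2 * varX f + (sW2 + q) * (\<Sum>i<M. (\<beta> j i)\<^sup>2) < \<theta> j" if "j < M + 2" for j
        by (rule \<theta>[OF that])
    qed (use \<rho> \<eta> in \<open>auto simp: \<alpha>_def\<close>)
    then obtain n0 where n0: "\<And>n. n0 \<le> n \<Longrightarrow> \<exists>enc dd. (\<forall>i<M. enc i \<in> measurable (MY n) (count_space UNIV) \<and> (\<forall>y. enc i y < nat \<lfloor>exp (real n * R i)\<rfloor>)) \<and>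
      (\<forall>b i. dd b i \<in> space (MY n)) \<and> stage n q (M + 2) \<alpha> \<beta> \<theta> M enc dd \<le> ennreal \<eta>" by blast
    show "\<exists>N. \<forall>n\<ge>N. ceo_code f sW2 M n R (D + \<epsilon>)"
    proof (intro exI[of _ "max 1 n0"] allI impI)
      fix n assume "max 1 n0 \<le> n"
      then have n: "0 < n" "n0 \<le> n" by auto
      from n0[OF n(2)] obtain enc dd where ed: "\<forall>i<M. enc i \<in> measurable (MY n) (count_space UNIV) \<and> (\<forall>y. enc i y < nat \<lfloor>exp (real n * R i)\<rfloor>)"
        "\<forall>b i. dd b i \<in> space (MY n)" "stage n q (M + 2) \<alpha> \<beta> \<theta> M enc dd \<le> ennreal \<eta>" by blast
      show "ceo_code f sW2 M n R (D + \<epsilon>)"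
        by (rule stage_to_code[where A="a M" and C=C and \<alpha>=\<alpha> and \<beta>=\<beta> and \<theta>=\<theta> and enc=enc and D=dd and T=T and \<eta>=\<eta> and J="M+2" and q=q])
          (use n C \<epsilon> D0 ed T \<eta> in \<open>auto simp: \<alpha>_def \<beta>_def \<theta>_def\<close>)
    qed
  qed
qed

text \<open>The message set must be nonempty, which forces \<open>exp (n * R i)\<close> to be at
  least 1. This bounds the set of sum rates from below, as the infimum of reals requires.\<close>

lemma ceo_rate_nonneg:
  assumes "ceo_code f sW2 M n R d" "0 < n" "i < M"
  shows "0 \<le> R i"
proof -
  from assms obtain enc :: "nat \<Rightarrow> (nat \<Rightarrow> real) \<Rightarrow> nat" where "enc i (\<lambda>_. 0) \<in> {1..nat \<lfloor>exp (real n * R i)\<rfloor>}"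
    unfolding ceo_code_def Let_def by blast
  then have "1 \<le> nat \<lfloor>exp (real n * R i)\<rfloor>" by auto
  then have "1 \<le> exp (real n * R i)" by linarith
  then show ?thesis using assms(2) by (simp add: zero_le_mult_iff)
qed

lemma R_CEO_le:
  assumes D: "DN0 f sW2 M < D" "D < varX f"
  shows "R_CEO f sW2 M D \<le> gauss_sum_rate D"
proof -
  let ?S = "{(\<Sum>i<M. R i) | R. \<forall>\<epsilon>>0. \<exists>N. \<forall>n\<ge>N. ceo_code f sW2 M n R (D + \<epsilon>)}"
  have bdd: "bdd_below ?S"
  proof (rule bdd_belowI[of _ 0])
    fix x assume "x \<in> ?S"
    then obtain R where x: "x = (\<Sum>i<M. R i)" and R: "\<forall>\<epsilon>>0. \<exists>N. \<forall>n\<ge>N. ceo_code f sW2 M n R (D + \<epsilon>)" by blast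
    from R[rule_format, of 1] obtain N where N: "\<forall>n\<ge>N. ceo_code f sW2 M n R (D + 1)" by auto
    then have "ceo_code f sW2 M (max 1 N) R (D + 1)" by simp
    then have "0 \<le> R i" if "i < M" for i using ceo_rate_nonneg[OF _ _ that] by (metis less_max_iff_disj zero_less_one)
    then show "0 \<le> x" unfolding x by (intro sum_nonneg) auto
  qed
  have le: "R_CEO f sW2 M D \<le> gauss_sum_rate D + M * \<rho>" if "0 < \<rho>" "\<rho> < 1" for \<rho> :: real
  proof -
    from ceo_achievable[OF D that] obtain R where R1: "\<forall>\<epsilon>>0. \<exists>N. \<forall>n\<ge>N. ceo_code f sW2 M n R (D + \<epsilon>)"
      and R2: "(\<Sum>i<M. R i) = gauss_sum_rate D + M * \<rho>" by blast
    have "gauss_sum_rate D + M * \<rho> \<in> ?S"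
      by (rule CollectI, rule exI[of _ R], rule conjI[OF R2[symmetric] R1])
    then show ?thesis unfolding R_CEO_def by (intro cInf_lower bdd)
  qed
  show ?thesis
  proof (rule field_le_epsilon)
    fix e :: real assume e: "0 < e"
    define \<rho> where "\<rho> = min (1/2) (e / M)"
    have "0 < \<rho>" "\<rho> < 1" "\<rho> \<le> e / M" using e M_pos by (auto simp: \<rho>_def)
    moreover from this(3) have "M * \<rho> \<le> e" using M_pos by (simp add: field_simps)
    ultimately show "R_CEO f sW2 M D \<le> gauss_sum_rate D + e" using le[of \<rho>] by linarith
  qed
qed


text \<open>One encoder that sees everything can send the number of the whole index tuple, and the
  product of the rounded message counts is at most the exponential of the summed rates. It serves to
  show that the set of joint rates is nonempty, without which a lower bound on its infimum could not
  be inferred elementwise.\<close>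

lemma ceo_code_imp_joint_code:
  assumes code: "ceo_code f sW2 M n R d"
  shows "joint_code f sW2 M n (\<Sum>i<M. R i) d"
proof -
  let ?K = "\<lambda>i. nat \<lfloor>exp (real n * R i)\<rfloor>"
  let ?P = "Blk f sW2 M n"
  from code obtain enc :: "nat \<Rightarrow> (nat \<Rightarrow> real) \<Rightarrow> nat" and dec :: "(nat \<Rightarrow> nat) \<Rightarrow> nat \<Rightarrow> real" where
    e1: "\<And>i y. i < M \<Longrightarrow> enc i y \<in> {1..?K i}" and
    e2: "\<And>i. i < M \<Longrightarrow> enc i \<in> measurable (MY n) (count_space UNIV)" and
    e3: "\<forall>t<n. (\<lambda>\<omega>. dec (\<lambda>i\<in>{..<M}. enc i (\<lambda>s\<in>{..<n}. snd (\<omega> s) i)) t) \<in> borel_measurable ?P"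
      "\<forall>t<n. integrable ?P (\<lambda>\<omega>. (fst (\<omega> t) - dec (\<lambda>i\<in>{..<M}. enc i (\<lambda>s\<in>{..<n}. snd (\<omega> s) i)) t)\<^sup>2)"
      "(1 / real n) * (\<Sum>t<n. \<integral>\<omega>. (fst (\<omega> t) - dec (\<lambda>i\<in>{..<M}. enc i (\<lambda>s\<in>{..<n}. snd (\<omega> s) i)) t)\<^sup>2 \<partial>?P) \<le> d"
    unfolding ceo_code_def Let_def by blast
  define S where "S = (\<Pi>\<^sub>E i\<in>{..<M}. {1..?K i})"
  have fin: "finite S" unfolding S_def by (intro finite_PiE) auto
  obtain h where h: "bij_betw h S {0..<card S}" using ex_bij_betw_finite_nat[OF fin] by blast
  define tup where "tup = (\<lambda>y. \<lambda>i\<in>{..<M}. enc i (\<lambda>s\<in>{..<n}. (y :: nat \<Rightarrow> nat \<Rightarrow> real) s i))"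
  have tupS: "tup y \<in> S" for y unfolding tup_def S_def using e1 by auto
  define encj where "encj = (\<lambda>y. Suc (h (tup y)))"
  define decj where "decj = (\<lambda>m. dec (inv_into S h (m - 1)))"
  have dec_eq: "decj (encj (\<lambda>s\<in>{..<n}. \<lambda>i\<in>{..<M}. snd (\<omega> s) i)) = dec (\<lambda>i\<in>{..<M}. enc i (\<lambda>s\<in>{..<n}. snd (\<omega> s) i))" for \<omega> :: "nat \<Rightarrow> real \<times> (nat \<Rightarrow> real)"
  proof -
    have "decj (encj y) = dec (tup y)" for y
      using inv_into_f_f[OF bij_betw_imp_inj_on[OF h] tupS] by (simp add: decj_def encj_def)
    moreover have "tup (\<lambda>s\<in>{..<n}. \<lambda>i\<in>{..<M}. snd (\<omega> s) i) = (\<lambda>i\<in>{..<M}. enc i (\<lambda>s\<in>{..<n}. snd (\<omega> s) i))"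
      unfolding tup_def by (intro restrict_ext arg_cong[of _ _ "enc _"]) auto
    ultimately show ?thesis by simp
  qed
  have K_le: "real (card S) \<le> exp (real n * (\<Sum>i<M. R i))"
  proof -
    have "real (card S) = (\<Prod>i<M. real (?K i))" unfolding S_def by (simp add: card_PiE)
    also have "\<dots> \<le> (\<Prod>i<M. exp (real n * R i))" by (intro prod_mono) auto
    also have "\<dots> = exp (real n * (\<Sum>i<M. R i))" by (simp add: exp_sum[symmetric] sum_distrib_left)
    finally show ?thesis .
  qed
  have rng: "encj y \<in> {1..nat \<lfloor>exp (real n * (\<Sum>i<M. R i))\<rfloor>}" for y
  proof -
    have "h (tup y) < card S" using h tupS[of y] by (auto simp: bij_betw_def)
    moreover have "card S \<le> nat \<lfloor>exp (real n * (\<Sum>i<M. R i))\<rfloor>" using K_le by (simp add: le_nat_floor)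
    ultimately show ?thesis by (simp add: encj_def)
  qed
  have meas: "encj \<in> measurable (PiM {..<n} (\<lambda>_. PiM {..<M} (\<lambda>_. borel))) (count_space UNIV)"
  proof -
    let ?N = "PiM {..<n} (\<lambda>_. PiM {..<M} (\<lambda>_. borel :: real measure))"
    have c: "PiM {..<M} (\<lambda>_. count_space (UNIV :: nat set)) = count_space (PiE {..<M} (\<lambda>_. UNIV))"
      by (rule count_space_PiM_finite) auto
    have "tup \<in> measurable ?N (PiM {..<M} (\<lambda>_. count_space UNIV))"
      unfolding tup_def
    proof (rule measurable_restrict)
      fix i assume i: "i \<in> {..<M}"
      have "(\<lambda>y. \<lambda>s\<in>{..<n}. y s i) \<in> measurable ?N (MY n)"
      proof (rule measurable_restrict)
        fix s assume s: "s \<in> {..<n}"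
        show "(\<lambda>y. y s i) \<in> borel_measurable ?N"
          by (rule measurable_compose[OF measurable_component_singleton[OF s] measurable_component_singleton[OF i]])
      qed
      then show "(\<lambda>y. enc i (\<lambda>s\<in>{..<n}. y s i)) \<in> measurable ?N (count_space UNIV)"
        using e2 i by (auto intro: measurable_compose)
    qed
    then have "tup \<in> measurable ?N (count_space (PiE {..<M} (\<lambda>_. UNIV)))" unfolding c .
    then show ?thesis unfolding encj_def by (rule measurable_compose) simp
  qed
  show ?thesis unfolding joint_code_def Let_def
    by (intro exI[of _ encj] exI[of _ decj]) (use rng meas e3 in \<open>simp only: dec_eq, blast\<close>)
qed

lemma joint_achievable:
  assumes D: "DN0 f sW2 M < D" "D < varX f"
  shows "{R. \<forall>\<epsilon>>0. \<exists>N. \<forall>n\<ge>N. joint_code f sW2 M n R (D + \<epsilon>)} \<noteq> {}"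
proof -
  from ceo_achievable[OF D, of "1/2"] obtain R where "\<forall>\<epsilon>>0. \<exists>N. \<forall>n\<ge>N. ceo_code f sW2 M n R (D + \<epsilon>)" by auto
  then have "\<forall>\<epsilon>>0. \<exists>N. \<forall>n\<ge>N. joint_code f sW2 M n (\<Sum>i<M. R i) (D + \<epsilon>)"
    using ceo_code_imp_joint_code by blast
  then show ?thesis by blast
qed

end

subsection \<open>The posterior mean and its density\<close>

text \<open>A Taylor remainder valid for all \<open>u\<close>, in a shape that can be integrated
  against the kernel \<open>K\<close>. For nonnegative \<open>u\<close> it iterates
  \<open>exp u - 1 \<le> u * exp u\<close>; for negative \<open>u\<close> even
  \<open>u\<^sup>2\<close> suffices.\<close>

lemma exp_second_order_bound: "\<bar>exp u - 1 - u\<bar> \<le> u\<^sup>2 * exp \<bar>u\<bar>" for u :: real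
proof -
  have lo: "0 \<le> exp u - 1 - u" using exp_ge_add_one_self[of u] by linarith
  have "1 - u \<le> exp (- u)" using exp_ge_add_one_self[of "- u"] by simp
  then have "(1 - u) * exp u \<le> exp (- u) * exp u" by (intro mult_right_mono) auto
  then have a: "exp u - 1 \<le> u * exp u" by (simp add: mult_exp_exp algebra_simps)
  have "exp u - 1 - u \<le> u\<^sup>2 * exp \<bar>u\<bar>"
  proof (cases "0 \<le> u")
    case True
    have "exp u - 1 - u \<le> u * (exp u - 1)" using a by (simp add: algebra_simps)
    also have "\<dots> \<le> u * (u * exp u)" using True a by (intro mult_left_mono) auto
    finally show ?thesis using True by (simp add: power2_eq_square)
  next
    case False
    have "exp u - 1 - u \<le> u * exp u - u" using a by simp
    also have "\<dots> = (- u) * (1 - exp u)" by (simp add: algebra_simps)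
    also have "\<dots> \<le> (- u) * (- u)"
    proof (rule mult_left_mono)
      show "1 - exp u \<le> - u" using exp_ge_add_one_self[of u] by linarith
    qed (use False in auto)
    also have "\<dots> \<le> u\<^sup>2 * exp \<bar>u\<bar>" by (simp add: power2_eq_square mult_le_cancel_left1)
    finally show ?thesis .
  qed
  then show ?thesis using lo by simp
qed

text \<open>With an explicit remainder, differentiation under the integral sign reduces to
  integrating a pointwise inequality.\<close>

lemma DERIV_from_quadratic_remainder:
  fixes F :: "real \<Rightarrow> real"
  assumes "\<And>h. \<bar>h\<bar> \<le> 1 \<Longrightarrow> \<bar>F (y + h) - F y - h * D\<bar> \<le> h\<^sup>2 * C"
  shows "(F has_real_derivative D) (at y)"
proof -
  have "((\<lambda>h. (F (y + h) - F y) / h - D) \<longlongrightarrow> 0) (at 0)"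
  proof (rule Lim_null_comparison[where g="\<lambda>h. \<bar>h\<bar> * C"])
    show "\<forall>\<^sub>F h in at 0. norm ((F (y + h) - F y) / h - D) \<le> \<bar>h\<bar> * C"
      unfolding eventually_at
    proof (intro exI[of _ 1] conjI ballI impI)
      fix h :: real assume h: "h \<noteq> 0 \<and> dist h 0 < 1"
      have "norm ((F (y + h) - F y) / h - D) = \<bar>F (y + h) - F y - h * D\<bar> / \<bar>h\<bar>"
        using h by (simp add: abs_divide[symmetric] diff_divide_distrib)
      also have "\<dots> \<le> h\<^sup>2 * C / \<bar>h\<bar>" using h assms[of h] by (intro divide_right_mono) auto
      also have "\<dots> = \<bar>h\<bar> * C" using h by (simp add: power2_eq_square field_simps abs_mult_self_eq flip: abs_mult)
      finally show "norm ((F (y + h) - F y) / h - D) \<le> \<bar>h\<bar> * C" .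
    qed simp
    have "((\<lambda>h::real. \<bar>h\<bar> * C) \<longlongrightarrow> \<bar>0\<bar> * C) (at 0)" by (intro tendsto_intros)
    then show "((\<lambda>h::real. \<bar>h\<bar> * C) \<longlongrightarrow> 0) (at 0)" by simp
  qed
  then show ?thesis unfolding DERIV_def by (simp add: LIM_zero_iff)
qed

context ceo_source
begin

declare Blk_component[measurable del] Blk_fst[measurable del] Blk_snd[measurable del]

definition nv :: real where "nv = sW2 / M"

lemma nv_pos: "0 < nv" using sW2_pos M_pos by (simp add: nv_def)

text \<open>Given the sample mean \<open>y\<close>, the posterior density of \<open>X\<close> relative to its prior is \<open>K x y / mom 0 y\<close>.
  Hence \<open>g\<close> is the posterior mean, \<open>cvar\<close> the posterior variance, and \<open>g' = cvar / nv\<close>.\<close>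

definition K :: "real \<Rightarrow> real \<Rightarrow> real" where "K x y = exp (- x\<^sup>2 / (2 * nv) + x * y / nv)"

definition mom :: "nat \<Rightarrow> real \<Rightarrow> real" where "mom k y = (\<integral>x. x ^ k * K x y \<partial>Xlaw f)"

lemma K_pos: "0 < K x y" by (simp add: K_def)

lemma K_meas[measurable]: "(\<lambda>p. K (fst p) (snd p)) \<in> borel_measurable (borel \<Otimes>\<^sub>M borel)"
  unfolding K_def by measurable

lemma K_meas1[measurable]: "(\<lambda>x. K x y) \<in> borel_measurable borel"
  unfolding K_def by measurable

text \<open>The power is absorbed into an exponential of \<open>\<bar>x\<bar>\<close>, and
  completing the square shows that the Gaussian factor of \<open>K\<close> beats it. The bound is
  uniform in \<open>x\<close>, so weighted moments of every order exist.\<close>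

lemma K_bound:
  assumes "0 \<le> c"
  shows "\<bar>x\<bar> ^ k * exp (c * \<bar>x\<bar>) * K x y \<le> exp (nv * (real k + c + \<bar>y\<bar> / nv)\<^sup>2 / 2)"
proof -
  let ?B = "real k + c + \<bar>y\<bar> / nv"
  have "\<bar>x\<bar> \<le> exp \<bar>x\<bar>" using exp_ge_add_one_self[of "\<bar>x\<bar>"] by linarith
  then have "\<bar>x\<bar> ^ k \<le> exp \<bar>x\<bar> ^ k" by (intro power_mono) auto
  also have "\<dots> = exp (real k * \<bar>x\<bar>)" by (simp add: exp_of_nat_mult)
  finally have "\<bar>x\<bar> ^ k * exp (c * \<bar>x\<bar>) * K x y \<le> exp (real k * \<bar>x\<bar>) * exp (c * \<bar>x\<bar>) * K x y"
    using K_pos[of x y] by (intro mult_right_mono) auto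
  also have "\<dots> = exp (real k * \<bar>x\<bar> + c * \<bar>x\<bar> + (- x\<^sup>2 / (2 * nv) + x * y / nv))"
    by (simp add: K_def exp_add)
  also have "\<dots> \<le> exp (nv * ?B\<^sup>2 / 2)"
  proof -
    have "x * y / nv \<le> \<bar>x\<bar> * \<bar>y\<bar> / nv" using nv_pos abs_ge_self[of "x * y"] by (intro divide_right_mono) (auto simp: abs_mult)
    then have "real k * \<bar>x\<bar> + c * \<bar>x\<bar> + (- x\<^sup>2 / (2 * nv) + x * y / nv) \<le> ?B * \<bar>x\<bar> - \<bar>x\<bar>\<^sup>2 / (2 * nv)"
      by (simp add: algebra_simps)
    also have "\<dots> \<le> nv * ?B\<^sup>2 / 2"
    proof -
      have "0 \<le> (\<bar>x\<bar> - nv * ?B)\<^sup>2 / (2 * nv)" using nv_pos by simp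
      also have "\<dots> = \<bar>x\<bar>\<^sup>2 / (2 * nv) - ?B * \<bar>x\<bar> + nv * ?B\<^sup>2 / 2"
      proof -
        have "(X - nv * B)\<^sup>2 / (2 * nv) = X\<^sup>2 / (2 * nv) - B * X + nv * B\<^sup>2 / 2" for X B
          using nv_pos by (simp add: power2_eq_square field_simps)
        then show ?thesis .
      qed
      finally show ?thesis by linarith
    qed
    finally show ?thesis by simp
  qed
  finally show ?thesis .
qed

lemma integrable_XK_bounded:
  assumes [measurable]: "h \<in> borel_measurable borel" and c: "0 \<le> c" and h: "\<And>x. \<bar>h x\<bar> \<le> A * (\<bar>x\<bar> ^ k * exp (c * \<bar>x\<bar>) * K x y)" and A: "0 \<le> A"
  shows "integrable (Xlaw f) h"
proof (rule X.integrable_const_bound[where B="A * exp (nv * (real k + c + \<bar>y\<bar> / nv)\<^sup>2 / 2)"])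
  show "AE x in Xlaw f. norm (h x) \<le> A * exp (nv * (real k + c + \<bar>y\<bar> / nv)\<^sup>2 / 2)"
  proof (rule AE_I2)
    fix x
    show "norm (h x) \<le> A * exp (nv * (real k + c + \<bar>y\<bar> / nv)\<^sup>2 / 2)"
      using h[of x] mult_left_mono[OF K_bound[OF c, of x k y] A] by simp
  qed
qed measurable

lemma integrable_mom: "integrable (Xlaw f) (\<lambda>x. x ^ k * K x y)"
  by (rule integrable_XK_bounded[where A=1 and c=0 and k=k and y=y]) (auto simp: abs_mult power_abs K_pos less_imp_le abs_of_pos)

lemma integrable_K: "integrable (Xlaw f) (\<lambda>x. K x y)"
  using integrable_mom[of 0 y] by simp

text \<open>Moving \<open>y\<close> by \<open>h\<close> multiplies the kernel by
  \<open>exp u\<close> with \<open>u = h * x / nv\<close>. The second-order remainder brings two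
  more powers of \<open>x\<close> and, as \<open>\<bar>h\<bar> \<le> 1\<close>, at most the factor
  \<open>exp (\<bar>x\<bar> / nv)\<close>; hence the constant is \<open>K_bound\<close> at
  \<open>k + 2\<close> and \<open>c = 1 / nv\<close>.\<close>

lemma mom_deriv: "(mom k has_real_derivative mom (Suc k) y / nv) (at y)"
proof (rule DERIV_from_quadratic_remainder[where C="exp (nv * (real (k+2) + 1 / nv + \<bar>y\<bar> / nv)\<^sup>2 / 2) / nv\<^sup>2"])
  fix h :: real assume h: "\<bar>h\<bar> \<le> 1"
  let ?C = "exp (nv * (real (k+2) + 1 / nv + \<bar>y\<bar> / nv)\<^sup>2 / 2)"
  have eq: "mom k (y + h) - mom k y - h * (mom (Suc k) y / nv) = (\<integral>x. x ^ k * K x (y + h) - x ^ k * K x y - (h / nv) * (x ^ Suc k * K x y) \<partial>Xlaw f)"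
    using integrable_mom[of k "y + h"] integrable_mom[of k y] integrable_mom[of "Suc k" y]
    by (simp add: mom_def Bochner_Integration.integral_diff)
  have bd: "\<bar>x ^ k * K x (y + h) - x ^ k * K x y - (h / nv) * (x ^ Suc k * K x y)\<bar> \<le> h\<^sup>2 * (?C / nv\<^sup>2)" for x
  proof -
    define u where "u = h * x / nv"
    have Ku: "K x (y + h) = K x y * exp u" by (simp add: K_def u_def exp_add[symmetric] add_divide_distrib distrib_left mult.commute)
    have "x ^ k * K x (y + h) - x ^ k * K x y - (h / nv) * (x ^ Suc k * K x y) = x ^ k * K x y * (exp u - 1 - u)"
      unfolding Ku by (simp add: u_def algebra_simps)
    then have "\<bar>x ^ k * K x (y + h) - x ^ k * K x y - (h / nv) * (x ^ Suc k * K x y)\<bar> = \<bar>x\<bar> ^ k * K x y * \<bar>exp u - 1 - u\<bar>"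
      using K_pos[of x y] by (simp add: abs_mult power_abs)
    also have "\<dots> \<le> \<bar>x\<bar> ^ k * K x y * (u\<^sup>2 * exp \<bar>u\<bar>)"
      using K_pos[of x y] by (intro mult_left_mono exp_second_order_bound) auto
    also have "\<dots> \<le> \<bar>x\<bar> ^ k * K x y * (u\<^sup>2 * exp (1 / nv * \<bar>x\<bar>))"
    proof -
      have "\<bar>u\<bar> \<le> 1 / nv * \<bar>x\<bar>" using h nv_pos by (simp add: u_def abs_mult divide_right_mono mult_left_le_one_le)
      then show ?thesis using K_pos[of x y] by (intro mult_left_mono) auto
    qed
    also have "\<dots> = (h\<^sup>2 / nv\<^sup>2) * (\<bar>x\<bar> ^ (k + 2) * exp (1 / nv * \<bar>x\<bar>) * K x y)"
      by (simp add: u_def power_divide power_mult_distrib power_add power2_eq_square)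
    also have "\<dots> \<le> (h\<^sup>2 / nv\<^sup>2) * ?C" using nv_pos by (intro mult_left_mono K_bound) auto
    finally show ?thesis by simp
  qed
  have "norm (\<integral>x. x ^ k * K x (y + h) - x ^ k * K x y - (h / nv) * (x ^ Suc k * K x y) \<partial>Xlaw f) \<le> (\<integral>x. h\<^sup>2 * (?C / nv\<^sup>2) \<partial>Xlaw f)"
    using integrable_mom[of k "y + h"] integrable_mom[of k y] integrable_mom[of "Suc k" y] bd
    by (intro Bochner_Integration.integral_norm_bound_integral Bochner_Integration.integrable_diff integrable_mult_right) (auto simp del: power_Suc)
  then show "\<bar>mom k (y + h) - mom k y - h * (mom (Suc k) y / nv)\<bar> \<le> h\<^sup>2 * (?C / nv\<^sup>2)"
    unfolding eq by simp
qed

lemma mom_cont: "continuous_on A (mom k)"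
  by (meson DERIV_isCont continuous_at_imp_continuous_on mom_deriv)

lemma mom_meas[measurable]: "mom k \<in> borel_measurable borel"
  by (rule borel_measurable_continuous_onI[OF mom_cont])

lemma mom0_pos: "0 < mom 0 y"
proof -
  have "0 \<le> mom 0 y" using K_pos by (simp add: mom_def less_imp_le)
  moreover have "mom 0 y \<noteq> 0"
  proof
    assume "mom 0 y = 0"
    then have "AE x in Xlaw f. K x y = 0"
      using integral_nonneg_eq_0_iff_AE[OF integrable_K[of y]] K_pos by (simp add: mom_def less_imp_le)
    then have "AE x in Xlaw f. False" using K_pos by (simp add: less_imp_neq[THEN not_sym])
    then show False by simp
  qed
  ultimately show ?thesis by simp
qed

definition g :: "real \<Rightarrow> real" where "g y = mom 1 y / mom 0 y"

lemma g_meas[measurable]: "g \<in> borel_measurable borel"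
  unfolding g_def by measurable

definition cvar :: "real \<Rightarrow> real" where "cvar y = mom 2 y / mom 0 y - (g y)\<^sup>2"

text \<open>Bias-variance decomposition under the unnormalised posterior weight.\<close>

lemma weighted_square:
  "integrable (Xlaw f) (\<lambda>x. (x - c)\<^sup>2 * K x y)"
  "(\<integral>x. (x - c)\<^sup>2 * K x y \<partial>Xlaw f) = mom 0 y * (cvar y + (g y - c)\<^sup>2)"
proof -
  have eq: "(x - c)\<^sup>2 * K x y = x ^ 2 * K x y - (2 * c) * (x ^ 1 * K x y) + c\<^sup>2 * (x ^ 0 * K x y)" for x
    by (simp add: power2_eq_square algebra_simps)
  show "integrable (Xlaw f) (\<lambda>x. (x - c)\<^sup>2 * K x y)"
    unfolding eq by (intro Bochner_Integration.integrable_add Bochner_Integration.integrable_diff integrable_mult_right integrable_mom)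
  have "(\<integral>x. (x - c)\<^sup>2 * K x y \<partial>Xlaw f) = mom 2 y - 2 * c * mom 1 y + c\<^sup>2 * mom 0 y"
    unfolding eq using integrable_mom[of 2 y] integrable_mom[of 1 y] integrable_mom[of 0 y] 
    by (simp add: mom_def Bochner_Integration.integral_diff Bochner_Integration.integral_add del: power_one_right power_0)
  also have "\<dots> = mom 0 y * (cvar y + (g y - c)\<^sup>2)"
    using mom0_pos[of y] by (simp add: cvar_def g_def power2_eq_square field_simps)
  finally show "(\<integral>x. (x - c)\<^sup>2 * K x y \<partial>Xlaw f) = mom 0 y * (cvar y + (g y - c)\<^sup>2)" .
qed

text \<open>The kernel is positive, so zero posterior variance would make \<open>X\<close> itself
  almost surely constant, against \<open>var_pos\<close>.\<close>

lemma cvar_pos: "0 < cvar y"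
proof -
  have eq: "(\<integral>x. (x - g y)\<^sup>2 * K x y \<partial>Xlaw f) = mom 0 y * cvar y" by (simp add: weighted_square(2))
  have nn: "0 \<le> (\<integral>x. (x - g y)\<^sup>2 * K x y \<partial>Xlaw f)" using K_pos by (intro Bochner_Integration.integral_nonneg) (simp add: less_imp_le)
  have "(\<integral>x. (x - g y)\<^sup>2 * K x y \<partial>Xlaw f) \<noteq> 0"
  proof
    assume "(\<integral>x. (x - g y)\<^sup>2 * K x y \<partial>Xlaw f) = 0"
    then have "AE x in Xlaw f. (x - g y)\<^sup>2 * K x y = 0"
      using integral_nonneg_eq_0_iff_AE[OF weighted_square(1)[of "g y" y]] K_pos by (simp add: less_imp_le)
    then have ae: "AE x in Xlaw f. x = g y" using K_pos by (simp add: less_imp_neq[THEN not_sym])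
    then have "\<mu> = (\<integral>x. g y \<partial>Xlaw f)" unfolding \<mu>_def by (intro integral_cong_AE) auto
    then have m: "\<mu> = g y" by simp
    have "varX f = (\<integral>x. 0 \<partial>Xlaw f)" unfolding varX_eq m using ae by (intro integral_cong_AE) auto
    then show False using var_pos by simp
  qed
  then have "0 < (\<integral>x. (x - g y)\<^sup>2 * K x y \<partial>Xlaw f)" using nn by linarith
  then have "0 < mom 0 y * cvar y" unfolding eq .
  then show ?thesis using mom0_pos[of y] by (simp add: zero_less_mult_iff)
qed

lemma nn_weighted_square:
  "(\<integral>\<^sup>+x. ennreal ((x - c)\<^sup>2) * ennreal (K x y) \<partial>Xlaw f) = ennreal (mom 0 y * (cvar y + (g y - c)\<^sup>2))"
  using nn_integral_eq_integral[OF weighted_square(1)[of c y]] K_pos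
  by (simp add: weighted_square(2) ennreal_mult[symmetric] less_imp_le)

lemma nn_weighted_const: "(\<integral>\<^sup>+x. c * ennreal (K x y) \<partial>Xlaw f) = c * ennreal (mom 0 y)"
  using nn_integral_eq_integral[OF integrable_K[of y]] K_pos
  by (subst nn_integral_cmult) (simp_all add: mom_def less_imp_le)

section \<open>Disintegration along the observations\<close>

abbreviation ybar :: "(nat \<Rightarrow> real) \<Rightarrow> real" where "ybar u \<equiv> (\<Sum>i<M. u i) / real M"

lemma Ybar_eq: "Ybar M \<omega> = ybar (snd \<omega>)" by (simp add: Ybar_def)

lemma Ybar_meas[measurable]: "Ybar M \<in> borel_measurable (borel \<Otimes>\<^sub>M PiM {..<M} (\<lambda>_. borel))"
  unfolding Ybar_def by measurable

definition cden :: "(nat \<Rightarrow> real) \<Rightarrow> real" where "cden u = (\<Prod>i<M. normal_density 0 (sqrt sW2) (u i))"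

text \<open>Sufficiency of the sample mean in factorised form: expanding the squares,
  \<open>x\<close> interacts with the observations only through their sum.\<close>

lemma cden_factor: "(\<Prod>i<M. normal_density x (sqrt sW2) (u i)) = cden u * K x (ybar u)"
proof -
  have M: "0 < real M" using M_pos by simp
  have A: "(\<Sum>i<M. (u i - x)\<^sup>2) = (\<Sum>i<M. (u i - 0)\<^sup>2) - 2 * x * (\<Sum>i<M. u i) + M * x\<^sup>2"
    by (simp add: power2_diff sum.distrib sum_subtractf sum_distrib_left algebra_simps)
  have gen: "- (B - 2 * x * S + m * x\<^sup>2) / (2 * w) = - B / (2 * w) + (- x\<^sup>2 / (2 * (w / m)) + x * (S / m) / (w / m))"
    if "0 < w" "0 < m" for B S m w :: real
    using that by (simp add: field_simps)
  have "- (\<Sum>i<M. (u i - x)\<^sup>2) / (2 * sW2) = - (\<Sum>i<M. (u i - 0)\<^sup>2) / (2 * sW2) + (- x\<^sup>2 / (2 * nv) + x * ybar u / nv)"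
    unfolding A nv_def by (rule gen[OF sW2_pos M])
  then show ?thesis
    unfolding cden_def prod_normal_density[OF sW2_pos] K_def by (simp only: exp_add mult.assoc)
qed

lemma cden_nonneg: "0 \<le> cden u" unfolding cden_def by (intro prod_nonneg) auto

lemma cden_meas[measurable]: "cden \<in> borel_measurable (PiM {..<M} (\<lambda>_. borel))"
  unfolding cden_def by measurable

text \<open>An unnormalised Bayes formula: the observations are integrated on the outside and
  \<open>X\<close> inside, weighted by its likelihood. Conditional statements become identities for
  each fixed \<open>u\<close>.\<close>

lemma nn_Src_density:
  assumes F: "F \<in> borel_measurable (borel \<Otimes>\<^sub>M PiM {..<M} (\<lambda>_. borel))"
  shows "(\<integral>\<^sup>+\<omega>. F \<omega> \<partial>Src f sW2 M) =
    (\<integral>\<^sup>+u. ennreal (cden u) * (\<integral>\<^sup>+x. F (x, u) * ennreal (K x (ybar u)) \<partial>Xlaw f) \<partial>PiM {..<M} (\<lambda>_. lborel))"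
proof -
  let ?L = "PiM {..<M} (\<lambda>_. lborel :: real measure)"
  interpret L0: product_sigma_finite "\<lambda>_. lborel :: real measure" by (intro product_sigma_finite.intro) unfold_locales
  interpret L: sigma_finite_measure ?L by (rule L0.sigma_finite) simp
  interpret XL: pair_sigma_finite "Xlaw f" ?L ..
  have [measurable]: "F \<in> borel_measurable (Xlaw f \<Otimes>\<^sub>M ?L)"
    using F by (simp add: measurable_cong_sets[OF sets_pair_measure_cong[OF sets_Xlaw sets_PiM_lborel] refl])
  have [measurable]: "(\<lambda>p. K (fst p) (ybar (snd p))) \<in> borel_measurable (Xlaw f \<Otimes>\<^sub>M ?L)"
  proof -
    have "(\<lambda>p. (fst p, ybar (snd p))) \<in> measurable (Xlaw f \<Otimes>\<^sub>M ?L) (borel \<Otimes>\<^sub>M borel)" by measurable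
    from measurable_compose[OF this K_meas] show ?thesis by simp
  qed
  have FS: "F \<in> borel_measurable (Src f sW2 M)" using F by (simp add: measurable_cong_sets[OF sets_Src refl])
  have Fc: "(\<lambda>p. F (chan p)) \<in> borel_measurable (Xlaw f \<Otimes>\<^sub>M Wlaw sW2 M)"
    by (rule measurable_compose[OF chan_meas F])
  have Fx: "(\<lambda>u. F (x, u)) \<in> borel_measurable (PiM {..<M} (\<lambda>_. borel))" for x
    by (rule measurable_compose[OF measurable_Pair1' F]) simp
  have "(\<integral>\<^sup>+\<omega>. F \<omega> \<partial>Src f sW2 M) = (\<integral>\<^sup>+p. F (chan p) \<partial>(Xlaw f \<Otimes>\<^sub>M Wlaw sW2 M))"
    by (rule nn_integral_Src[OF FS])
  also have "\<dots> = (\<integral>\<^sup>+x. \<integral>\<^sup>+w. F (chan (x, w)) \<partial>Wlaw sW2 M \<partial>Xlaw f)"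
    by (rule W.nn_integral_fst[symmetric, OF Fc])
  also have "\<dots> = (\<integral>\<^sup>+x. \<integral>\<^sup>+u. F (x, u) * ennreal (cden u * K x (ybar u)) \<partial>?L \<partial>Xlaw f)"
  proof (intro nn_integral_cong)
    fix x
    have "(\<integral>\<^sup>+u. F (x, u) * ennreal (cden u * K x (ybar u)) \<partial>?L) = (\<integral>\<^sup>+z. F (x, \<lambda>t\<in>{..<M}. x + z t) \<partial>nrmn M sW2)"
      using nn_integral_nrmn_shift[OF sW2_pos Fx, of x "\<lambda>_. x"] by (simp add: cden_factor)
    then show "(\<integral>\<^sup>+w. F (chan (x, w)) \<partial>Wlaw sW2 M) = (\<integral>\<^sup>+u. F (x, u) * ennreal (cden u * K x (ybar u)) \<partial>?L)"
      by (simp add: chan_def Wlaw_eq nrmn_def)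
  qed
  also have "\<dots> = (\<integral>\<^sup>+u. \<integral>\<^sup>+x. F (x, u) * ennreal (cden u * K x (ybar u)) \<partial>Xlaw f \<partial>?L)"
    by (rule XL.Fubini'[symmetric]) (simp add: split_beta')
  also have "\<dots> = (\<integral>\<^sup>+u. ennreal (cden u) * (\<integral>\<^sup>+x. F (x, u) * ennreal (K x (ybar u)) \<partial>Xlaw f) \<partial>?L)"
  proof (intro nn_integral_cong)
    fix u assume u: "u \<in> space ?L"
    have [measurable]: "(\<lambda>x. F (x, u)) \<in> borel_measurable (Xlaw f)"
      using u by (intro measurable_compose[OF measurable_Pair2' \<open>F \<in> borel_measurable (Xlaw f \<Otimes>\<^sub>M ?L)\<close>])
    have "(\<integral>\<^sup>+x. F (x, u) * ennreal (cden u * K x (ybar u)) \<partial>Xlaw f) = (\<integral>\<^sup>+x. ennreal (cden u) * (F (x, u) * ennreal (K x (ybar u))) \<partial>Xlaw f)"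
      using cden_nonneg K_pos by (intro nn_integral_cong) (simp add: ennreal_mult less_imp_le mult_ac)
    also have "\<dots> = ennreal (cden u) * (\<integral>\<^sup>+x. F (x, u) * ennreal (K x (ybar u)) \<partial>Xlaw f)"
      by (intro nn_integral_cmult) measurable
    finally show "(\<integral>\<^sup>+x. F (x, u) * ennreal (cden u * K x (ybar u)) \<partial>Xlaw f) = ennreal (cden u) * (\<integral>\<^sup>+x. F (x, u) * ennreal (K x (ybar u)) \<partial>Xlaw f)" .
  qed
  finally show ?thesis .
qed

text \<open>For fixed observations this is the bias-variance decomposition at
  \<open>c = h u\<close>. So \<open>g (Ybar M \<omega>)\<close> is the orthogonal projection of
  \<open>X\<close> onto functions of all observations, not just of their mean. Nonnegative integrals
  allow the integrability of both parts to be deduced from the left side.\<close>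

lemma Src_pythagoras:
  assumes h[measurable]: "h \<in> borel_measurable (PiM {..<M} (\<lambda>_. borel))"
  shows "(\<integral>\<^sup>+\<omega>. ennreal ((fst \<omega> - h (snd \<omega>))\<^sup>2) \<partial>Src f sW2 M) =
    (\<integral>\<^sup>+\<omega>. ennreal ((fst \<omega> - g (Ybar M \<omega>))\<^sup>2) \<partial>Src f sW2 M) + (\<integral>\<^sup>+\<omega>. ennreal ((g (Ybar M \<omega>) - h (snd \<omega>))\<^sup>2) \<partial>Src f sW2 M)"
proof -
  let ?L = "PiM {..<M} (\<lambda>_. lborel :: real measure)"
  have c: "0 \<le> cvar y" "0 \<le> mom 0 y" for y using cvar_pos[of y] mom0_pos[of y] by auto
  have [measurable]: "(\<lambda>u. cvar (ybar u)) \<in> borel_measurable (PiM {..<M} (\<lambda>_. borel))"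
    unfolding cvar_def by measurable
  have "(\<integral>\<^sup>+\<omega>. ennreal ((fst \<omega> - h (snd \<omega>))\<^sup>2) \<partial>Src f sW2 M) =
    (\<integral>\<^sup>+u. ennreal (cden u) * ennreal (mom 0 (ybar u) * (cvar (ybar u) + (g (ybar u) - h u)\<^sup>2)) \<partial>?L)"
    by (subst nn_Src_density) (simp_all add: nn_weighted_square)
  \<comment> \<open>The vanishing square is kept on purpose: it is the instance
    \<open>c = g (ybar u)\<close> of \<open>nn_weighted_square\<close>, which folds the first
    summand back.\<close>
  also have "\<dots> = (\<integral>\<^sup>+u. ennreal (cden u) * ennreal (mom 0 (ybar u) * (cvar (ybar u) + (g (ybar u) - g (ybar u))\<^sup>2))
      + ennreal (cden u) * (ennreal ((g (ybar u) - h u)\<^sup>2) * ennreal (mom 0 (ybar u))) \<partial>?L)"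
    using c by (intro nn_integral_cong) (simp add: distrib_left ennreal_plus ennreal_mult mult_ac)
  also have "\<dots> = (\<integral>\<^sup>+u. ennreal (cden u) * ennreal (mom 0 (ybar u) * (cvar (ybar u) + (g (ybar u) - g (ybar u))\<^sup>2)) \<partial>?L)
      + (\<integral>\<^sup>+u. ennreal (cden u) * (ennreal ((g (ybar u) - h u)\<^sup>2) * ennreal (mom 0 (ybar u))) \<partial>?L)"
    by (intro nn_integral_add) measurable
  also have "(\<integral>\<^sup>+u. ennreal (cden u) * ennreal (mom 0 (ybar u) * (cvar (ybar u) + (g (ybar u) - g (ybar u))\<^sup>2)) \<partial>?L)
     = (\<integral>\<^sup>+\<omega>. ennreal ((fst \<omega> - g (Ybar M \<omega>))\<^sup>2) \<partial>Src f sW2 M)"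
    by (subst nn_Src_density) (simp_all add: nn_weighted_square Ybar_eq)
  also have "(\<integral>\<^sup>+u. ennreal (cden u) * (ennreal ((g (ybar u) - h u)\<^sup>2) * ennreal (mom 0 (ybar u))) \<partial>?L)
     = (\<integral>\<^sup>+\<omega>. ennreal ((g (Ybar M \<omega>) - h (snd \<omega>))\<^sup>2) \<partial>Src f sW2 M)"
    by (subst nn_Src_density) (simp_all add: nn_weighted_const Ybar_eq)
  finally show ?thesis .
qed


lemma measurable_Src_iff: "F \<in> measurable (Src f sW2 M) N \<longleftrightarrow> F \<in> measurable (borel \<Otimes>\<^sub>M PiM {..<M} (\<lambda>_. borel)) N"
  by (simp add: measurable_cong_sets[OF sets_Src refl])

lemma Src_pythagoras_real:
  assumes h[measurable]: "h \<in> borel_measurable (PiM {..<M} (\<lambda>_. borel))"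
    and i: "integrable (Src f sW2 M) (\<lambda>\<omega>. (fst \<omega> - h (snd \<omega>))\<^sup>2)"
  shows "integrable (Src f sW2 M) (\<lambda>\<omega>. (fst \<omega> - g (Ybar M \<omega>))\<^sup>2)"
    "integrable (Src f sW2 M) (\<lambda>\<omega>. (g (Ybar M \<omega>) - h (snd \<omega>))\<^sup>2)"
    "(\<integral>\<omega>. (fst \<omega> - h (snd \<omega>))\<^sup>2 \<partial>Src f sW2 M) =
      (\<integral>\<omega>. (fst \<omega> - g (Ybar M \<omega>))\<^sup>2 \<partial>Src f sW2 M) + (\<integral>\<omega>. (g (Ybar M \<omega>) - h (snd \<omega>))\<^sup>2 \<partial>Src f sW2 M)"
proof -
  let ?S = "Src f sW2 M"
  have e: "(\<integral>\<^sup>+\<omega>. ennreal ((fst \<omega> - h (snd \<omega>))\<^sup>2) \<partial>?S) = ennreal (\<integral>\<omega>. (fst \<omega> - h (snd \<omega>))\<^sup>2 \<partial>?S)"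
    using i by (intro nn_integral_eq_integral) auto
  note p = Src_pythagoras[OF h, unfolded e]
  have m1: "(\<lambda>\<omega>. (fst \<omega> - g (Ybar M \<omega>))\<^sup>2) \<in> borel_measurable ?S" and m2: "(\<lambda>\<omega>. (g (Ybar M \<omega>) - h (snd \<omega>))\<^sup>2) \<in> borel_measurable ?S"
    unfolding measurable_Src_iff by measurable
  have "(\<integral>\<^sup>+\<omega>. ennreal ((fst \<omega> - g (Ybar M \<omega>))\<^sup>2) \<partial>?S) + (\<integral>\<^sup>+\<omega>. ennreal ((g (Ybar M \<omega>) - h (snd \<omega>))\<^sup>2) \<partial>?S) < \<top>"
    unfolding p[symmetric] by simp
  then have f1: "(\<integral>\<^sup>+\<omega>. ennreal ((fst \<omega> - g (Ybar M \<omega>))\<^sup>2) \<partial>?S) < \<infinity>" and f2: "(\<integral>\<^sup>+\<omega>. ennreal ((g (Ybar M \<omega>) - h (snd \<omega>))\<^sup>2) \<partial>?S) < \<infinity>"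
    by (auto simp: ennreal_add_less_top)
  show i1: "integrable ?S (\<lambda>\<omega>. (fst \<omega> - g (Ybar M \<omega>))\<^sup>2)" using m1 f1 by (intro integrableI_nonneg) auto
  show i2: "integrable ?S (\<lambda>\<omega>. (g (Ybar M \<omega>) - h (snd \<omega>))\<^sup>2)" using m2 f2 by (intro integrableI_nonneg) auto
  have "ennreal (\<integral>\<omega>. (fst \<omega> - h (snd \<omega>))\<^sup>2 \<partial>?S) = ennreal ((\<integral>\<omega>. (fst \<omega> - g (Ybar M \<omega>))\<^sup>2 \<partial>?S) + (\<integral>\<omega>. (g (Ybar M \<omega>) - h (snd \<omega>))\<^sup>2 \<partial>?S))"
    using p nn_integral_eq_integral[OF i1] nn_integral_eq_integral[OF i2] by (simp add: ennreal_plus)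
  then show "(\<integral>\<omega>. (fst \<omega> - h (snd \<omega>))\<^sup>2 \<partial>?S) =
      (\<integral>\<omega>. (fst \<omega> - g (Ybar M \<omega>))\<^sup>2 \<partial>?S) + (\<integral>\<omega>. (g (Ybar M \<omega>) - h (snd \<omega>))\<^sup>2 \<partial>?S)"
    by (subst (asm) ennreal_inj) (auto intro: add_nonneg_nonneg)
qed

lemma form_X: "form 1 (\<lambda>_. 0) \<omega> = fst \<omega> - \<mu>" by (simp add: form_def)

lemma Src_X: "integrable (Src f sW2 M) (\<lambda>\<omega>. (fst \<omega> - \<mu>)\<^sup>2)" "(\<integral>\<omega>. (fst \<omega> - \<mu>)\<^sup>2 \<partial>Src f sW2 M) = varX f"
  using form_second_moment[of 1 "\<lambda>_. 0"] by (simp_all add: form_X)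

lemma Src_g:
  "integrable (Src f sW2 M) (\<lambda>\<omega>. (fst \<omega> - g (Ybar M \<omega>))\<^sup>2)"
  "integrable (Src f sW2 M) (\<lambda>\<omega>. (g (Ybar M \<omega>) - \<mu>)\<^sup>2)"
  "varX f = (\<integral>\<omega>. (fst \<omega> - g (Ybar M \<omega>))\<^sup>2 \<partial>Src f sW2 M) + (\<integral>\<omega>. (g (Ybar M \<omega>) - \<mu>)\<^sup>2 \<partial>Src f sW2 M)"
  using Src_pythagoras_real[of "\<lambda>_. \<mu>"] Src_X by simp_all

lemma square_integrable_prod:
  fixes a b :: "'z \<Rightarrow> real"
  assumes m: "a \<in> borel_measurable N" "b \<in> borel_measurable N" and i: "integrable N (\<lambda>x. (a x)\<^sup>2)" "integrable N (\<lambda>x. (b x)\<^sup>2)"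
  shows "integrable N (\<lambda>x. a x * b x)"
proof (rule Bochner_Integration.integrable_bound)
  show "integrable N (\<lambda>x. (a x)\<^sup>2 + (b x)\<^sup>2)" using i by simp
  show "(\<lambda>x. a x * b x) \<in> borel_measurable N" using m by measurable
  show "AE x in N. norm (a x * b x) \<le> norm ((a x)\<^sup>2 + (b x)\<^sup>2)"
  proof (rule AE_I2)
    fix x
    have "0 \<le> (\<bar>a x\<bar> - \<bar>b x\<bar>)\<^sup>2" "0 \<le> (a x)\<^sup>2" "0 \<le> (b x)\<^sup>2" by simp_all
    then have "2 * (\<bar>a x\<bar> * \<bar>b x\<bar>) \<le> (a x)\<^sup>2 + (b x)\<^sup>2" by (simp add: power2_diff)
    moreover have "0 \<le> \<bar>a x\<bar> * \<bar>b x\<bar>" by simp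
    ultimately have "\<bar>a x\<bar> * \<bar>b x\<bar> \<le> (a x)\<^sup>2 + (b x)\<^sup>2" by linarith
    then show "norm (a x * b x) \<le> norm ((a x)\<^sup>2 + (b x)\<^sup>2)" by (simp add: abs_mult)
  qed
qed

text \<open>Orthogonality read off from Pythagoras: perturb the projection by the indicator of
  \<open>B\<close>; since the identity holds for the perturbed estimator, the cross term in the
  expanded square has to vanish.\<close>

lemma g_set_integral:
  assumes B: "B \<in> sets borel"
  shows "(\<integral>\<omega>. indicator B (Ybar M \<omega>) * (fst \<omega> - g (Ybar M \<omega>)) \<partial>Src f sW2 M) = 0"
proof -
  let ?S = "Src f sW2 M"
  define b where "b \<omega> = (indicator B (Ybar M \<omega>) :: real)" for \<omega>
  have bm[measurable]: "b \<in> borel_measurable ?S" unfolding b_def measurable_Src_iff using B by measurable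
  have b2: "(b \<omega>)\<^sup>2 = b \<omega>" for \<omega> by (simp add: b_def indicator_def)
  have bi: "integrable ?S b" by (intro S.integrable_const_bound[where B=1] bm) (auto simp: b_def)
  have em: "(\<lambda>\<omega>. fst \<omega> - g (Ybar M \<omega>)) \<in> borel_measurable ?S" unfolding measurable_Src_iff by measurable
  have pi: "integrable ?S (\<lambda>\<omega>. (fst \<omega> - g (Ybar M \<omega>)) * b \<omega>)"
    using square_integrable_prod[OF em bm Src_g(1)] bi by (simp add: b2)
  let ?h = "\<lambda>u. g (ybar u) + indicator B (ybar u)"
  have hm: "?h \<in> borel_measurable (PiM {..<M} (\<lambda>_. borel))" using B by measurable
  have eq: "(fst \<omega> - ?h (snd \<omega>))\<^sup>2 = (fst \<omega> - g (Ybar M \<omega>))\<^sup>2 - 2 * ((fst \<omega> - g (Ybar M \<omega>)) * b \<omega>) + b \<omega>" for \<omega>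
    using b2[of \<omega>] by (simp add: b_def Ybar_eq power2_eq_square algebra_simps)
  have i: "integrable ?S (\<lambda>\<omega>. (fst \<omega> - ?h (snd \<omega>))\<^sup>2)"
    unfolding eq using Src_g(1) pi bi by simp
  have "(\<integral>\<omega>. (fst \<omega> - ?h (snd \<omega>))\<^sup>2 \<partial>?S) = (\<integral>\<omega>. (fst \<omega> - g (Ybar M \<omega>))\<^sup>2 \<partial>?S) - 2 * (\<integral>\<omega>. (fst \<omega> - g (Ybar M \<omega>)) * b \<omega> \<partial>?S) + (\<integral>\<omega>. b \<omega> \<partial>?S)"
    unfolding eq using Src_g(1) pi bi by simp
  moreover have "(g (Ybar M \<omega>) - ?h (snd \<omega>))\<^sup>2 = b \<omega>" for \<omega> using b2[of \<omega>] by (simp add: b_def Ybar_eq power2_eq_square)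
  ultimately have "(\<integral>\<omega>. (fst \<omega> - g (Ybar M \<omega>)) * b \<omega> \<partial>?S) = 0"
    using Src_pythagoras_real(3)[OF hm i] by simp
  then show ?thesis by (simp add: b_def mult.commute)
qed

lemma Vcond_meas: "Vcond f sW2 M \<in> borel_measurable (Src f sW2 M)"
  unfolding Vcond_def by simp

text \<open>The conditioning sets are preimages under \<open>Ybar M\<close>, on which
  \<open>g_set_integral\<close> gives the defining identity of conditional expectation. All later
  work uses this explicit version.\<close>

lemma Vcond_eq: "AE \<omega> in Src f sW2 M. Vcond f sW2 M \<omega> = g (Ybar M \<omega>)"
proof -
  let ?S = "Src f sW2 M"
  let ?F = "vimage_algebra (space ?S) (Ybar M) borel"
  have Ym: "Ybar M \<in> borel_measurable ?S" unfolding measurable_Src_iff by measurable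
  interpret F: finite_measure_subalgebra ?S ?F
  proof
    show "subalgebra ?S ?F" using Ym by (simp add: subalgebra_def measurable_iff_sets)
  qed
  have iX: "integrable ?S fst"
  proof -
    have m: "(\<lambda>\<omega>. fst \<omega> - \<mu>) \<in> borel_measurable ?S" unfolding measurable_Src_iff by measurable
    have "integrable ?S (\<lambda>\<omega>. fst \<omega> - \<mu>)" by (rule S.square_integrable_imp_integrable[OF m Src_X(1)])
    then have "integrable ?S (\<lambda>\<omega>. (fst \<omega> - \<mu>) + \<mu>)" by (intro Bochner_Integration.integrable_add) auto
    then show ?thesis by simp
  qed
  have gm: "(\<lambda>\<omega>. g (Ybar M \<omega>)) \<in> borel_measurable ?S" unfolding measurable_Src_iff by measurable
  have iG: "integrable ?S (\<lambda>\<omega>. g (Ybar M \<omega>))"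
  proof -
    have m: "(\<lambda>\<omega>. g (Ybar M \<omega>) - \<mu>) \<in> borel_measurable ?S" using gm by measurable
    have "integrable ?S (\<lambda>\<omega>. g (Ybar M \<omega>) - \<mu>)" by (rule S.square_integrable_imp_integrable[OF m Src_g(2)])
    then have "integrable ?S (\<lambda>\<omega>. (g (Ybar M \<omega>) - \<mu>) + \<mu>)" by (intro Bochner_Integration.integrable_add) auto
    then show ?thesis by simp
  qed
  show ?thesis unfolding Vcond_def
  proof (rule F.real_cond_exp_charact)
    show "integrable ?S fst" by (rule iX)
    show "integrable ?S (\<lambda>\<omega>. g (Ybar M \<omega>))" by (rule iG)
    show "(\<lambda>\<omega>. g (Ybar M \<omega>)) \<in> borel_measurable ?F"
      by (rule measurable_compose[OF measurable_vimage_algebra1 g_meas]) simp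
    fix A assume "A \<in> sets ?F"
    then obtain B where B: "B \<in> sets borel" "A = Ybar M -` B \<inter> space ?S"
      by (auto simp: sets_vimage_algebra2)
    have ind: "indicator A \<omega> = (indicator B (Ybar M \<omega>) :: real)" if "\<omega> \<in> space ?S" for \<omega> using that B(2) by (auto simp: indicator_def)
    have A: "A \<in> sets ?S" unfolding B(2) by (rule measurable_sets[OF Ym B(1)])
    have d: "(\<integral>\<omega>\<in>A. fst \<omega> \<partial>?S) - (\<integral>\<omega>\<in>A. g (Ybar M \<omega>) \<partial>?S) = (\<integral>\<omega>. indicator A \<omega> * (fst \<omega> - g (Ybar M \<omega>)) \<partial>?S)"
      using integrable_mult_indicator[OF A iX] integrable_mult_indicator[OF A iG]
      by (simp add: set_lebesgue_integral_def right_diff_distrib Bochner_Integration.integral_diff)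
    also have "\<dots> = (\<integral>\<omega>. indicator B (Ybar M \<omega>) * (fst \<omega> - g (Ybar M \<omega>)) \<partial>?S)"
      using ind by (intro Bochner_Integration.integral_cong) auto
    also have "\<dots> = 0" by (rule g_set_integral[OF B(1)])
    finally show "(\<integral>\<omega>\<in>A. fst \<omega> \<partial>?S) = (\<integral>\<omega>\<in>A. g (Ybar M \<omega>) \<partial>?S)" by simp
  qed
qed

lemma mmse_eq: "mmse f sW2 M = (\<integral>\<omega>. (fst \<omega> - g (Ybar M \<omega>))\<^sup>2 \<partial>Src f sW2 M)"
  unfolding mmse_def
proof (rule integral_cong_AE)
  show "(\<lambda>\<omega>. (fst \<omega> - Vcond f sW2 M \<omega>)\<^sup>2) \<in> borel_measurable (Src f sW2 M)"
  proof -
    have [measurable]: "fst \<in> borel_measurable (Src f sW2 M)" unfolding measurable_Src_iff by measurable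
    show ?thesis using Vcond_meas by measurable
  qed
  show "(\<lambda>\<omega>. (fst \<omega> - g (Ybar M \<omega>))\<^sup>2) \<in> borel_measurable (Src f sW2 M)" unfolding measurable_Src_iff by measurable
  show "AE \<omega> in Src f sW2 M. (fst \<omega> - Vcond f sW2 M \<omega>)\<^sup>2 = (fst \<omega> - g (Ybar M \<omega>))\<^sup>2"
    using Vcond_eq by eventually_elim simp
qed

text \<open>\<open>DN0\<close> is the error of the best linear estimator, the case
  \<open>k = M\<close>, \<open>\<tau> = sW2\<close> of the innovation formula, and the projection
  cannot do worse.\<close>

lemma mmse_le_DN0: "mmse f sW2 M \<le> DN0 f sW2 M"
proof -
  let ?s = "varX f" and ?S = "Src f sW2 M"
  have M: "0 < real M" using M_pos by simp
  define a where "a = ?s / (M * ?s + sW2)"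
  have fm: "form 1 (\<lambda>_. - a) \<omega> = fst \<omega> - (\<mu> + a * (\<Sum>i<M. snd \<omega> i - \<mu>))" for \<omega>
    by (simp add: form_def sum_distrib_left sum_negf)
  let ?h = "\<lambda>u. \<mu> + a * (\<Sum>i<M. u i - \<mu>)"
  have hm: "?h \<in> borel_measurable (PiM {..<M} (\<lambda>_. borel))" by measurable
  note f2 = form_second_moment[of 1 "\<lambda>_. - a", unfolded fm]
  have "mmse f sW2 M \<le> (\<integral>\<omega>. (fst \<omega> - g (Ybar M \<omega>))\<^sup>2 \<partial>?S) + (\<integral>\<omega>. (g (Ybar M \<omega>) - ?h (snd \<omega>))\<^sup>2 \<partial>?S)"
    unfolding mmse_eq by simp
  also have "\<dots> = (\<integral>\<omega>. (fst \<omega> - ?h (snd \<omega>))\<^sup>2 \<partial>?S)" using Src_pythagoras_real(3)[OF hm] f2(1) by simp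
  also have "\<dots> = (1 - M * a)\<^sup>2 * ?s + sW2 * (M * a\<^sup>2)" using f2(2) by simp
  also have "\<dots> = DN0 f sW2 M"
    using innovation_variance(1)[OF var_pos sW2_pos, of "real M"] by (simp add: a_def DN0_def)
  finally show ?thesis .
qed

text \<open>The exponential family identity: shifting the natural parameter \<open>y / nv\<close>
  differentiates the mean into the variance. Strict monotonicity of \<open>g\<close>, and with it
  the change of variables for \<open>V\<close>, follows.\<close>

lemma g_deriv: "(g has_real_derivative cvar y / nv) (at y)"
proof -
  have "((\<lambda>y. mom 1 y / mom 0 y) has_real_derivative ((mom (Suc 1) y / nv) * mom 0 y - mom 1 y * (mom (Suc 0) y / nv)) / (mom 0 y * mom 0 y)) (at y)"
    by (intro DERIV_divide mom_deriv) (use mom0_pos[of y] in auto)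
  moreover have "((mom (Suc 1) y / nv) * mom 0 y - mom 1 y * (mom (Suc 0) y / nv)) / (mom 0 y * mom 0 y) = cvar y / nv"
    using mom0_pos[of y] nv_pos by (simp add: cvar_def g_def numeral_2_eq_2 field_simps power2_eq_square)
  ultimately show ?thesis unfolding g_def[abs_def] by simp
qed

lemma g_strict_mono: "strict_mono g"
proof (rule strict_monoI)
  fix x y :: real assume "x < y"
  then show "g x < g y"
    by (rule DERIV_pos_imp_increasing) (use g_deriv cvar_pos nv_pos in \<open>metis divide_pos_pos\<close>)
qed

lemma g_cont: "continuous_on A g"
  by (meson DERIV_isCont continuous_at_imp_continuous_on g_deriv)

lemma cvar_cont: "continuous_on A cvar"
  unfolding cvar_def[abs_def] by (intro continuous_intros mom_cont g_cont) (use mom0_pos in \<open>auto simp: less_imp_neq[THEN not_sym]\<close>)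

lemma cvar_meas[measurable]: "cvar \<in> borel_measurable borel"
  unfolding cvar_def[abs_def] by measurable

section \<open>Densities of the sample mean and of the posterior mean\<close>

definition pY :: "real \<Rightarrow> real" where "pY y = normal_density 0 (sqrt nv) y * mom 0 y"

lemma pY_pos: "0 < pY y"
  unfolding pY_def using nv_pos mom0_pos by (intro mult_pos_pos normal_density_pos) auto

lemma pY_meas[measurable]: "pY \<in> borel_measurable borel"
  unfolding pY_def by measurable

lemma noise_mean: "distr (Wlaw sW2 M) borel (\<lambda>w. \<Sum>i<M. w i / M) = nrm nv"
proof -
  let ?W = "Wlaw sW2 M"
  have M: "0 < real M" "{..<M} \<noteq> {}" using M_pos by (auto simp: lessThan_empty_iff)
  have pn: "prob_space (nrm sW2)" by (rule prob_space_nrm[OF sW2_pos])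
  interpret PP: product_prob_space "\<lambda>_. nrm sW2" "{..<M}" by (intro product_prob_spaceI pn)
  have rv: "(\<lambda>w. w i / M) \<in> borel_measurable ?W" if "i \<in> {..<M}" for i
    using that by measurable
  have comp: "distr ?W borel (\<lambda>w. w i / M) = distr (nrm sW2) borel (\<lambda>x. x / M)" if "i \<in> {..<M}" for i
  proof -
    have "distr (nrm sW2) borel (\<lambda>x. x / M) = distr (distr ?W (nrm sW2) (\<lambda>w. w i)) borel (\<lambda>x. x / M)"
      using PP.PiM_component[OF that] by (simp add: Wlaw_eq)
    also have "\<dots> = distr ?W borel ((\<lambda>x. x / M) \<circ> (\<lambda>w. w i))"
      using that by (intro distr_distr) (auto simp: Wlaw_eq intro!: measurable_component_singleton)
    finally show ?thesis by (simp add: comp_def)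
  qed
  have ind: "W.indep_vars (\<lambda>_. borel) (\<lambda>i w. w i / M) {..<M}"
  proof (subst W.indep_vars_iff_distr_eq_PiM'[OF M(2) rv])
    have "distr ?W (PiM {..<M} (\<lambda>_. borel)) (\<lambda>x. \<lambda>i\<in>{..<M}. x i / M) = PiM {..<M} (\<lambda>_. distr (nrm sW2) borel (\<lambda>x. x / M))"
      unfolding Wlaw_eq by (intro distr_PiM_componentwise pn) auto
    also have "\<dots> = PiM {..<M} (\<lambda>i. distr ?W borel (\<lambda>w. w i / M))"
      by (intro PiM_cong refl) (simp add: comp)
    finally show "distr ?W (PiM {..<M} (\<lambda>_. borel)) (\<lambda>x. \<lambda>i\<in>{..<M}. x i / M) = PiM {..<M} (\<lambda>i. distr ?W borel (\<lambda>w. w i / M))" .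
  qed
  have nd: "distributed ?W lborel (\<lambda>w. w i / M) (normal_density 0 (1 / M * sqrt sW2))" if "i \<in> {..<M}" for i
  proof -
    have "distributed (nrm sW2) lborel (\<lambda>x. x) (normal_density 0 (sqrt sW2))"
      unfolding distributed_def nrm_def by (auto simp: distr_id2)
    from prob_space.normal_density_affine[OF pn this, of "1 / M" 0] M sW2_pos
    have "distributed (nrm sW2) lborel (\<lambda>x. x / M) (normal_density 0 (1 / M * sqrt sW2))" by simp
    then have "distr (nrm sW2) lborel (\<lambda>x. x / M) = density lborel (\<lambda>x. ennreal (normal_density 0 (1 / M * sqrt sW2) x))"
      by (rule distributed_distr_eq_density)
    moreover have "distr ?W lborel (\<lambda>w. w i / M) = distr ?W borel (\<lambda>w. w i / M)" by (rule distr_cong) auto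
    moreover have "distr (nrm sW2) lborel (\<lambda>x. x / M) = distr (nrm sW2) borel (\<lambda>x. x / M)" by (rule distr_cong) auto
    ultimately show ?thesis unfolding distributed_def using comp[OF that] rv[OF that] by auto
  qed
  have "distributed ?W lborel (\<lambda>w. \<Sum>i<M. w i / M) (normal_density (\<Sum>i<M. 0) (sqrt (\<Sum>i<M. (1 / M * sqrt sW2)\<^sup>2)))"
    by (rule W.sum_indep_normal[OF _ M(2) ind]) (use nd sW2_pos M in auto)
  also have "(\<Sum>i<M. (1 / M * sqrt sW2)\<^sup>2) = nv"
    using sW2_pos M by (simp add: nv_def power_mult_distrib power_divide power2_eq_square)
  finally have "distr ?W lborel (\<lambda>w. \<Sum>i<M. w i / M) = nrm nv" by (simp add: distributed_def nrm_def)
  moreover have "distr ?W lborel (\<lambda>w. \<Sum>i<M. w i / M) = distr ?W borel (\<lambda>w. \<Sum>i<M. w i / M)" by (rule distr_cong) auto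
  ultimately show ?thesis by simp
qed

lemma nd_factor: "normal_density x (sqrt nv) y = normal_density 0 (sqrt nv) y * K x y"
proof -
  have "- (y - x)\<^sup>2 / (2 * nv) = - (y - 0)\<^sup>2 / (2 * nv) + (- x\<^sup>2 / (2 * nv) + x * y / nv)"
    using nv_pos by (simp add: power2_eq_square field_simps)
  then show ?thesis using nv_pos by (simp only: normal_density_def K_def exp_add real_sqrt_pow2 less_imp_le mult.assoc)
qed

lemma nn_Ybar:
  assumes F[measurable]: "F \<in> borel_measurable borel"
  shows "(\<integral>\<^sup>+\<omega>. F (Ybar M \<omega>) \<partial>Src f sW2 M) = (\<integral>\<^sup>+y. F y * ennreal (pY y) \<partial>lborel)"
proof -
  interpret XL: pair_sigma_finite "Xlaw f" "lborel :: real measure" ..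
  have M: "real M \<noteq> 0" using M_pos by simp
  have FY: "(\<lambda>\<omega>. F (Ybar M \<omega>)) \<in> borel_measurable (Src f sW2 M)" unfolding measurable_Src_iff by measurable
  have Yc: "Ybar M (chan (x, w)) = x + (\<Sum>i<M. w i / M)" for x w
    using M by (simp add: Ybar_def chan_def sum.distrib add_divide_distrib sum_divide_distrib)
  have m: "(\<lambda>p. F (Ybar M (chan p))) \<in> borel_measurable (Xlaw f \<Otimes>\<^sub>M Wlaw sW2 M)"
    by (rule measurable_compose[OF chan_meas]) measurable
  have "(\<integral>\<^sup>+\<omega>. F (Ybar M \<omega>) \<partial>Src f sW2 M) = (\<integral>\<^sup>+p. F (Ybar M (chan p)) \<partial>(Xlaw f \<Otimes>\<^sub>M Wlaw sW2 M))"
    by (rule nn_integral_Src[OF FY])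
  also have "\<dots> = (\<integral>\<^sup>+x. \<integral>\<^sup>+w. F (x + (\<Sum>i<M. w i / M)) \<partial>Wlaw sW2 M \<partial>Xlaw f)"
    using W.nn_integral_fst[OF m] by (simp add: Yc)
  also have "\<dots> = (\<integral>\<^sup>+x. \<integral>\<^sup>+y. F y * ennreal (normal_density 0 (sqrt nv) y * K x y) \<partial>lborel \<partial>Xlaw f)"
  proof (intro nn_integral_cong)
    fix x
    have "(\<integral>\<^sup>+w. F (x + (\<Sum>i<M. w i / M)) \<partial>Wlaw sW2 M) = (\<integral>\<^sup>+z. F (x + z) \<partial>nrm nv)"
      unfolding noise_mean[symmetric] by (intro nn_integral_distr[symmetric]) measurable
    also have "\<dots> = (\<integral>\<^sup>+y. F y \<partial>distr (nrm nv) borel (\<lambda>z. x + z))"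
      by (intro nn_integral_distr[symmetric]) measurable
    also have "\<dots> = (\<integral>\<^sup>+y. ennreal (normal_density x (sqrt nv) y) * F y \<partial>lborel)"
      unfolding nrm_shift[OF nv_pos] by (intro nn_integral_density) measurable
    finally show "(\<integral>\<^sup>+w. F (x + (\<Sum>i<M. w i / M)) \<partial>Wlaw sW2 M) = (\<integral>\<^sup>+y. F y * ennreal (normal_density 0 (sqrt nv) y * K x y) \<partial>lborel)"
      by (simp only: nd_factor[of x] mult.commute)
  qed
  also have "\<dots> = (\<integral>\<^sup>+y. \<integral>\<^sup>+x. F y * ennreal (normal_density 0 (sqrt nv) y * K x y) \<partial>Xlaw f \<partial>lborel)"
    by (rule XL.Fubini'[symmetric]) (simp add: split_beta')
  also have "\<dots> = (\<integral>\<^sup>+y. F y * ennreal (pY y) \<partial>lborel)"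
  proof (intro nn_integral_cong)
    fix y
    have "(\<integral>\<^sup>+x. F y * ennreal (normal_density 0 (sqrt nv) y * K x y) \<partial>Xlaw f) = (\<integral>\<^sup>+x. (F y * ennreal (normal_density 0 (sqrt nv) y)) * ennreal (K x y) \<partial>Xlaw f)"
      using K_pos by (intro nn_integral_cong) (simp add: ennreal_mult less_imp_le mult_ac)
    also have "\<dots> = F y * ennreal (normal_density 0 (sqrt nv) y) * ennreal (mom 0 y)" by (rule nn_weighted_const)
    also have "\<dots> = F y * ennreal (pY y)" using mom0_pos[of y] by (simp add: pY_def ennreal_mult less_imp_le mult_ac)
    finally show "(\<integral>\<^sup>+x. F y * ennreal (normal_density 0 (sqrt nv) y * K x y) \<partial>Xlaw f) = F y * ennreal (pY y)" .
  qed
  finally show ?thesis .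
qed

text \<open>Exhaustion of the range by images of compact intervals, via the intermediate value
  theorem. It shows that the range is Borel and matches the intervals on which the substitution rule
  is applied.\<close>

lemma range_g: "range g = (\<Union>k::nat. {g (- real k)..g (real k)})"
proof (intro set_eqI iffI)
  fix v assume "v \<in> range g"
  then obtain y where y: "v = g y" by blast
  obtain k where k: "\<bar>y\<bar> \<le> real k" using real_arch_simple by blast
  then have "g (- real k) \<le> v" "v \<le> g (real k)"
    unfolding y using g_strict_mono by (auto simp: strict_mono_less_eq)
  then show "v \<in> (\<Union>k::nat. {g (- real k)..g (real k)})" by auto
next
  fix v assume "v \<in> (\<Union>k::nat. {g (- real k)..g (real k)})"
  then obtain k where k: "g (- real k) \<le> v" "v \<le> g (real k)" by auto
  have "\<exists>x\<ge>- real k. x \<le> real k \<and> g x = v"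
    using k by (intro IVT') (auto intro: g_cont)
  then show "v \<in> range g" by blast
qed

lemma range_g_borel[measurable]: "range g \<in> sets borel"
  unfolding range_g by measurable

definition \<psi> :: "real \<Rightarrow> real" where "\<psi> v = (if v \<in> range g then inv g v else 0)"

lemma \<psi>_g: "\<psi> (g y) = y"
  using inv_f_f[OF strict_mono_imp_inj_on[OF g_strict_mono]] by (simp add: \<psi>_def)

lemma \<psi>_meas[measurable]: "\<psi> \<in> borel_measurable borel"
proof (rule borel_measurableI_le)
  fix a
  \<comment> \<open>Points outside the range carry the default 0, so they join the sublevel set
    exactly when \<open>0 \<le> a\<close>.\<close>
  have "{v. \<psi> v \<le> a} = (range g \<inter> {..g a}) \<union> (if 0 \<le> a then - range g else {})"
  proof (intro set_eqI)
    fix v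
    show "v \<in> {v. \<psi> v \<le> a} \<longleftrightarrow> v \<in> (range g \<inter> {..g a}) \<union> (if 0 \<le> a then - range g else {})"
    proof (cases "v \<in> range g")
      case True
      then obtain y where y: "v = g y" by blast
      then show ?thesis using g_strict_mono by (simp add: \<psi>_g strict_mono_less_eq)
    qed (simp add: \<psi>_def)
  qed
  then show "{v \<in> space borel. \<psi> v \<le> a} \<in> sets borel" by simp
qed

text \<open>The change-of-variables density \<open>pY / g'\<close> at the preimage.\<close>

definition pV :: "real \<Rightarrow> real" where "pV v = (if v \<in> range g then pY (\<psi> v) / (cvar (\<psi> v) / nv) else 0)"

lemma pV_meas[measurable]: "pV \<in> borel_measurable borel"
  unfolding pV_def by measurable

lemma pV_g: "pV (g y) = pY y / (cvar y / nv)"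
  by (simp add: pV_def \<psi>_g)

lemma pV_nonneg: "0 \<le> pV v"
  using pY_pos cvar_pos nv_pos by (simp add: pV_def less_imp_le)

text \<open>The substitution rule works on compact intervals. Both sides are therefore written as
  monotone limits over \<open>[-k, k]\<close> and its image, and compared for each
  \<open>k\<close>.\<close>

lemma distr_V: "distr (Src f sW2 M) lborel (\<lambda>\<omega>. g (Ybar M \<omega>)) = density lborel (\<lambda>v. ennreal (pV v))"
proof (rule measure_eqI)
  let ?S = "Src f sW2 M"
  have gm: "(\<lambda>\<omega>. g (Ybar M \<omega>)) \<in> measurable ?S lborel" unfolding measurable_Src_iff by measurable
  fix A assume "A \<in> sets (distr ?S lborel (\<lambda>\<omega>. g (Ybar M \<omega>)))"
  then have A[measurable]: "A \<in> sets borel" by simp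
  have "emeasure (distr ?S lborel (\<lambda>\<omega>. g (Ybar M \<omega>))) A = (\<integral>\<^sup>+v. indicator A v \<partial>distr ?S lborel (\<lambda>\<omega>. g (Ybar M \<omega>)))"
    by simp
  also have "\<dots> = (\<integral>\<^sup>+\<omega>. indicator A (g (Ybar M \<omega>)) \<partial>?S)"
    using gm by (intro nn_integral_distr) auto
  also have "\<dots> = (\<integral>\<^sup>+y. indicator A (g y) * ennreal (pY y) \<partial>lborel)"
    by (rule nn_Ybar) measurable
  also have "\<dots> = (\<integral>\<^sup>+y. (SUP k::nat. ennreal ((indicator A (g y) * pV (g y)) * (cvar y / nv) * indicator {- real k..real k} y)) \<partial>lborel)"
  proof (intro nn_integral_cong)
    fix y
    have c: "cvar y / nv \<noteq> 0" using cvar_pos[of y] nv_pos by simp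
    have e: "indicator A (g y) * ennreal (pY y) = ennreal ((indicator A (g y) * pV (g y)) * (cvar y / nv))"
      using c by (simp add: pV_g indicator_def)
    obtain k0 where k0: "\<bar>y\<bar> \<le> real k0" using real_arch_simple by blast
    show "indicator A (g y) * ennreal (pY y) = (SUP k::nat. ennreal ((indicator A (g y) * pV (g y)) * (cvar y / nv) * indicator {- real k..real k} y))"
    proof (rule antisym)
      show "indicator A (g y) * ennreal (pY y) \<le> (SUP k::nat. ennreal ((indicator A (g y) * pV (g y)) * (cvar y / nv) * indicator {- real k..real k} y))"
        using k0 unfolding e by (intro SUP_upper2[of k0]) (auto simp: indicator_def)
      show "(SUP k::nat. ennreal ((indicator A (g y) * pV (g y)) * (cvar y / nv) * indicator {- real k..real k} y)) \<le> indicator A (g y) * ennreal (pY y)"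
        unfolding e by (intro SUP_least) (auto simp: indicator_def)
    qed
  qed
  also have "\<dots> = (SUP k::nat. \<integral>\<^sup>+y. ennreal ((indicator A (g y) * pV (g y)) * (cvar y / nv) * indicator {- real k..real k} y) \<partial>lborel)"
  proof (rule nn_integral_monotone_convergence_SUP)
    show "incseq (\<lambda>k y. ennreal ((indicator A (g y) * pV (g y)) * (cvar y / nv) * indicator {- real k..real k} y))"
      unfolding incseq_def le_fun_def
      by (auto simp: indicator_def intro!: ennreal_leI)
    show "(\<lambda>y. ennreal ((indicator A (g y) * pV (g y)) * (cvar y / nv) * indicator {- real k..real k} y)) \<in> borel_measurable lborel" for k :: nat
      by measurable
  qed
  also have "\<dots> = (SUP k::nat. \<integral>\<^sup>+v. ennreal ((indicator A v * pV v) * indicator {g (- real k)..g (real k)} v) \<partial>lborel)"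
  proof (intro SUP_cong refl nn_integral_substitution[symmetric])
    fix k :: nat
    show "set_borel_measurable borel {g (- real k)..g (real k)} (\<lambda>v. indicator A v * pV v)"
      unfolding set_borel_measurable_def by measurable
    show "(g has_real_derivative cvar y / nv) (at y)" for y by (rule g_deriv)
    show "continuous_on {- real k..real k} (\<lambda>y. cvar y / nv)" using nv_pos by (intro continuous_intros cvar_cont) auto
    show "0 \<le> cvar y / nv" for y using cvar_pos[of y] nv_pos by simp
  qed simp
  also have "\<dots> = (\<integral>\<^sup>+v. (SUP k::nat. ennreal ((indicator A v * pV v) * indicator {g (- real k)..g (real k)} v)) \<partial>lborel)"
  proof (rule nn_integral_monotone_convergence_SUP[symmetric])
    show "incseq (\<lambda>k v. ennreal ((indicator A v * pV v) * indicator {g (- real k)..g (real k)} v))"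
      unfolding incseq_def le_fun_def
    proof (intro allI impI)
      fix m k :: nat and v assume mk: "m \<le> k"
      have "g (- real k) \<le> g (- real m)" "g (real m) \<le> g (real k)" using mk g_strict_mono by (auto simp: strict_mono_less_eq)
      then show "ennreal ((indicator A v * pV v) * indicator {g (- real m)..g (real m)} v) \<le> ennreal ((indicator A v * pV v) * indicator {g (- real k)..g (real k)} v)"
        using pV_nonneg[of v] by (auto simp: indicator_def intro!: ennreal_leI)
    qed
    show "(\<lambda>v. ennreal ((indicator A v * pV v) * indicator {g (- real k)..g (real k)} v)) \<in> borel_measurable lborel" for k :: nat
      by measurable
  qed
  also have "\<dots> = (\<integral>\<^sup>+v. ennreal (pV v) * indicator A v \<partial>lborel)"
  proof (intro nn_integral_cong antisym)
    fix v
    show "(SUP k::nat. ennreal ((indicator A v * pV v) * indicator {g (- real k)..g (real k)} v)) \<le> ennreal (pV v) * indicator A v"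
      using pV_nonneg[of v] by (intro SUP_least) (auto simp: indicator_def)
    show "ennreal (pV v) * indicator A v \<le> (SUP k::nat. ennreal ((indicator A v * pV v) * indicator {g (- real k)..g (real k)} v))"
    proof (cases "v \<in> range g")
      case True
      then obtain k where "v \<in> {g (- real k)..g (real k)}" unfolding range_g by blast
      then show ?thesis by (intro SUP_upper2[of k]) (auto simp: indicator_def)
    qed (simp add: pV_def)
  qed
  also have "\<dots> = emeasure (density lborel (\<lambda>v. ennreal (pV v))) A" by (rule emeasure_density[symmetric]) auto
  finally show "emeasure (distr ?S lborel (\<lambda>\<omega>. g (Ybar M \<omega>))) A = emeasure (density lborel (\<lambda>v. ennreal (pV v))) A" .
qed simp

end

subsection \<open>Finite entropy of the posterior mean\<close>

locale ceo_source_entropy = ceo_source +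
  assumes fin_ent: "integrable lborel (\<lambda>x. f x * ln (f x))"
begin

lemma integrable_ln_f: "integrable (Xlaw f) (\<lambda>x. ln (f x))"
  unfolding Xlaw_def using fin_ent f_nonneg by (subst integrable_real_density) auto

lemma AE_f_pos: "AE x in Xlaw f. 0 < f x"
  unfolding Xlaw_def using f_nonneg by (subst AE_density) auto

definition EX2 :: real where "EX2 = (\<integral>x. x\<^sup>2 \<partial>Xlaw f)"

lemma ln_K: "ln (K x y) = - x\<^sup>2 / (2 * nv) + x * y / nv"
  by (simp add: K_def)

lemma K_le: "K x y \<le> exp (y\<^sup>2 / (2 * nv))"
proof -
  have "0 \<le> (x - y)\<^sup>2 / (2 * nv)" using nv_pos by simp
  also have "\<dots> = y\<^sup>2 / (2 * nv) - (- x\<^sup>2 / (2 * nv) + x * y / nv)" using nv_pos by (simp add: power2_eq_square field_simps)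
  finally show ?thesis unfolding K_def by simp
qed

lemma mom0_upper: "mom 0 y \<le> exp (y\<^sup>2 / (2 * nv))"
proof -
  have "mom 0 y \<le> (\<integral>x. exp (y\<^sup>2 / (2 * nv)) \<partial>Xlaw f)"
    unfolding mom_def using integrable_K K_le by (intro integral_mono) auto
  then show ?thesis by simp
qed

text \<open>Jensen's inequality, carried out with the tangent of \<open>exp\<close> at the mean
  exponent \<open>?e\<close>.\<close>

lemma mom0_lower: "exp (- EX2 / (2 * nv) + \<mu> * y / nv) \<le> mom 0 y"
proof -
  let ?e = "- EX2 / (2 * nv) + \<mu> * y / nv"
  have i: "integrable (Xlaw f) (\<lambda>x. - x\<^sup>2 / (2 * nv) + x * y / nv)" using integrable_X2 integrable_X by simp
  have e: "(\<integral>x. - x\<^sup>2 / (2 * nv) + x * y / nv \<partial>Xlaw f) = ?e"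
    using integrable_X2 integrable_X by (simp add: EX2_def \<mu>_def)
  have "exp ?e * (1 + (- x\<^sup>2 / (2 * nv) + x * y / nv - ?e)) \<le> K x y" for x
  proof -
    have "exp ?e * (1 + (- x\<^sup>2 / (2 * nv) + x * y / nv - ?e)) \<le> exp ?e * exp (- x\<^sup>2 / (2 * nv) + x * y / nv - ?e)"
      by (intro mult_left_mono exp_ge_add_one_self) auto
    then show ?thesis by (simp add: K_def mult_exp_exp)
  qed
  then have "(\<integral>x. exp ?e * (1 + (- x\<^sup>2 / (2 * nv) + x * y / nv - ?e)) \<partial>Xlaw f) \<le> (\<integral>x. K x y \<partial>Xlaw f)"
    using i integrable_K[of y] by (intro integral_mono) auto
  moreover have "(\<integral>x. exp ?e * (1 + (- x\<^sup>2 / (2 * nv) + x * y / nv - ?e)) \<partial>Xlaw f) = exp ?e"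
  proof -
    have "(\<integral>x. 1 + (- x\<^sup>2 / (2 * nv) + x * y / nv - ?e) \<partial>Xlaw f) = 1 + (?e - ?e)"
      using i e by (simp add: Bochner_Integration.integral_add Bochner_Integration.integral_diff del: minus_add_distrib)
    then show ?thesis by simp
  qed
  ultimately show ?thesis by (simp add: mom_def)
qed

text \<open>The point is the quadratic growth in \<open>y\<close>, which the finite second moment of
  the sample mean makes integrable.\<close>

lemma abs_ln_mom0: "\<bar>ln (mom 0 y)\<bar> \<le> (EX2 / (2 * nv) + \<mu>\<^sup>2 / nv) + (2 / nv) * y\<^sup>2"
proof -
  have u: "ln (mom 0 y) \<le> y\<^sup>2 / (2 * nv)"
    using mom0_upper[of y] mom0_pos[of y] by (metis ln_exp ln_le_cancel_iff exp_gt_zero)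
  have l: "- EX2 / (2 * nv) + \<mu> * y / nv \<le> ln (mom 0 y)"
    using mom0_lower[of y] mom0_pos[of y] by (metis ln_exp ln_le_cancel_iff exp_gt_zero)
  have "0 \<le> (\<bar>\<mu>\<bar> - \<bar>y\<bar>)\<^sup>2" "0 \<le> \<mu>\<^sup>2" "0 \<le> y\<^sup>2" by simp_all
  then have "2 * (\<bar>\<mu>\<bar> * \<bar>y\<bar>) \<le> \<mu>\<^sup>2 + y\<^sup>2" by (simp add: power2_diff)
  moreover have "0 \<le> \<bar>\<mu>\<bar> * \<bar>y\<bar>" by simp
  ultimately have "\<bar>\<mu> * y\<bar> \<le> \<mu>\<^sup>2 + y\<^sup>2" unfolding abs_mult by linarith
  then have "- (\<mu>\<^sup>2 + y\<^sup>2) \<le> \<mu> * y" by linarith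
  then have "- (\<mu>\<^sup>2 + y\<^sup>2) / nv \<le> \<mu> * y / nv" using nv_pos by (intro divide_right_mono) auto
  then have l': "- EX2 / (2 * nv) - \<mu>\<^sup>2 / nv - y\<^sup>2 / nv \<le> ln (mom 0 y)"
    using l unfolding minus_divide_left[symmetric] add_divide_distrib by linarith
  have E: "0 \<le> EX2 / (2 * nv)" "0 \<le> \<mu>\<^sup>2 / nv" "0 \<le> y\<^sup>2 / nv" using nv_pos by (simp_all add: EX2_def)
  have "y\<^sup>2 / (2 * nv) \<le> y\<^sup>2 / nv" using nv_pos by (intro divide_left_mono) auto
  moreover have "(2 / nv) * y\<^sup>2 = y\<^sup>2 / nv + y\<^sup>2 / nv" by simp
  ultimately show ?thesis using u l' E by (intro abs_leI) linarith+
qed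

text \<open>The posterior mean of \<open>\<bar>ln (f X)\<bar>\<close> given the sample mean
  \<open>y\<close>.\<close>

definition Lf :: "real \<Rightarrow> real" where "Lf y = (\<integral>x. \<bar>ln (f x)\<bar> * K x y \<partial>Xlaw f) / mom 0 y"

lemma integrable_lnf_K: "integrable (Xlaw f) (\<lambda>x. \<bar>ln (f x)\<bar> * K x y)" "integrable (Xlaw f) (\<lambda>x. ln (f x) * K x y)"
proof -
  have b: "integrable (Xlaw f) (\<lambda>x. exp (y\<^sup>2 / (2 * nv)) * ln (f x))" using integrable_ln_f by simp
  have le: "\<bar>ln (f x)\<bar> * K x y \<le> exp (y\<^sup>2 / (2 * nv)) * \<bar>ln (f x)\<bar>" for x
    using mult_left_mono[OF K_le[of x y], of "\<bar>ln (f x)\<bar>"] by (simp add: mult.commute)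
  show "integrable (Xlaw f) (\<lambda>x. \<bar>ln (f x)\<bar> * K x y)"
    using b by (rule Bochner_Integration.integrable_bound) (use le K_pos in \<open>auto simp: abs_mult less_imp_le\<close>)
  show "integrable (Xlaw f) (\<lambda>x. ln (f x) * K x y)"
    using b by (rule Bochner_Integration.integrable_bound) (use le K_pos in \<open>auto simp: abs_mult less_imp_le\<close>)
qed

lemma Lf_nonneg: "0 \<le> Lf y"
  unfolding Lf_def using K_pos mom0_pos by (intro divide_nonneg_nonneg Bochner_Integration.integral_nonneg mult_nonneg_nonneg) (auto simp: less_imp_le)

lemma Lf_meas[measurable]: "Lf \<in> borel_measurable borel"
proof -
  have "(\<lambda>p. \<bar>ln (f (snd p))\<bar> * K (snd p) (fst p)) \<in> borel_measurable (borel \<Otimes>\<^sub>M Xlaw f)"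
    unfolding K_def by measurable
  then have "(\<lambda>y. \<integral>x. \<bar>ln (f x)\<bar> * K x y \<partial>Xlaw f) \<in> borel_measurable borel"
    by (intro X.borel_measurable_lebesgue_integral) (simp add: split_beta')
  then show ?thesis unfolding Lf_def[abs_def] by measurable
qed

text \<open>Gibbs' inequality for the posterior given \<open>y\<close> against the Gaussian of the same mean and variance:
  finite entropy of the source keeps the posterior variance from being too small on average.\<close>

lemma neg_ln_cvar_le: "- ln (cvar y) \<le> ln (2 * pi) + 1 + 2 * \<bar>ln (mom 0 y)\<bar> + 2 * Lf y + y\<^sup>2 / nv"
proof -
  let ?\<kappa> = "cvar y" and ?m = "mom 0 y"
  let ?N = "\<lambda>x. normal_density (g y) (sqrt ?\<kappa>) x"
  have \<kappa>: "0 < ?\<kappa>" by (rule cvar_pos)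
  have m: "0 < ?m" by (rule mom0_pos)
  have N_pos: "0 < ?N x" for x using \<kappa> by (intro normal_density_pos) simp
  have lnN: "ln (?N x) = - (1/2) * ln (2 * pi * ?\<kappa>) - (x - g y)\<^sup>2 / (2 * ?\<kappa>)" for x
    using \<kappa> by (simp add: normal_density_def ln_mult ln_div ln_sqrt)
  \<comment> \<open>The posterior has Lebesgue density \<open>f x * K x y / mom 0 y\<close>, so
    \<open>u\<close> is the kernel times the log-ratio of the Gaussian to the posterior.\<close>
  define u where "u x = K x y * (ln (?N x) - ln (f x) - ln (K x y) + ln ?m)" for x
  have u_eq: "u x = (- (1/2) * ln (2 * pi * ?\<kappa>) + ln ?m) * K x y - (1 / (2 * ?\<kappa>)) * ((x - g y)\<^sup>2 * K x y) - ln (f x) * K x y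
      + (1 / (2 * nv)) * (x ^ 2 * K x y) - (y / nv) * (x ^ 1 * K x y)" for x
    by (simp add: u_def lnN ln_K algebra_simps)
  have ui: "integrable (Xlaw f) u"
    unfolding u_eq[abs_def]
    by (intro Bochner_Integration.integrable_add Bochner_Integration.integrable_diff integrable_mult_right integrable_mom integrable_K weighted_square(1) integrable_lnf_K)
  have ub: "AE x in Xlaw f. u x \<le> ?m * (?N x / f x) - K x y"
    using AE_f_pos
  proof eventually_elim
    case (elim x)
    let ?z = "?N x * ?m / (f x * K x y)"
    have z: "0 < ?z" using elim N_pos[of x] m K_pos[of x y] by simp
    have "ln ?z = ln (?N x) - ln (f x) - ln (K x y) + ln ?m"
      using elim N_pos[of x] m K_pos[of x y] by (simp add: ln_mult ln_div)
    then have "u x = K x y * ln ?z" by (simp add: u_def)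
    also have "\<dots> \<le> K x y * (?z - 1)" using K_pos[of x y] ln_le_minus_one[OF z] by (intro mult_left_mono) auto
    also have "\<dots> = ?m * (?N x / f x) - K x y" using K_pos[of x y] elim by (simp add: field_simps)
    finally show ?case .
  qed
  \<comment> \<open>Only an inequality: the Gaussian also charges the set where \<open>f\<close>
    vanishes, which the law of \<open>X\<close> does not see.\<close>
  have nn: "(\<integral>\<^sup>+x. ennreal (?N x / f x) \<partial>Xlaw f) \<le> 1"
  proof -
    have "(\<integral>\<^sup>+x. ennreal (?N x / f x) \<partial>Xlaw f) = (\<integral>\<^sup>+x. ennreal (f x) * ennreal (?N x / f x) \<partial>lborel)"
      unfolding Xlaw_def by (intro nn_integral_density) measurable
    also have "\<dots> \<le> (\<integral>\<^sup>+x. ennreal (?N x) \<partial>lborel)"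
      using f_nonneg N_pos by (intro nn_integral_mono) (simp add: ennreal_mult[symmetric] less_imp_le)
    also have "\<dots> = emeasure (density lborel (\<lambda>x. ennreal (?N x))) UNIV" by (simp add: emeasure_density)
    also have "\<dots> = 1" using prob_space.emeasure_space_1[OF prob_space_normal_density[of "sqrt ?\<kappa>" "g y"]] \<kappa> by simp
    finally show ?thesis .
  qed
  have Nm: "(\<lambda>x. ?N x / f x) \<in> borel_measurable (Xlaw f)" by measurable
  have Ni: "integrable (Xlaw f) (\<lambda>x. ?N x / f x)"
    using nn f_nonneg N_pos Nm by (intro integrableI_nonneg) (auto simp: less_imp_le intro: order_le_less_trans)
  have N1: "(\<integral>x. ?N x / f x \<partial>Xlaw f) \<le> 1"
    using nn nn_integral_eq_integral[OF Ni] f_nonneg N_pos by (simp add: less_imp_le)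
  have "(\<integral>x. u x \<partial>Xlaw f) \<le> (\<integral>x. ?m * (?N x / f x) - K x y \<partial>Xlaw f)"
    using ub by (rule integral_mono_AE[OF ui Bochner_Integration.integrable_diff[OF integrable_mult_right[OF Ni] integrable_K]])
  also have "\<dots> = ?m * (\<integral>x. ?N x / f x \<partial>Xlaw f) - ?m"
    unfolding Bochner_Integration.integral_diff[OF integrable_mult_right[OF Ni] integrable_K] integral_mult_right_zero
    by (simp add: mom_def)
  also have "\<dots> \<le> 0" using N1 m by (simp add: mult_le_cancel_left1)
  finally have u0: "(\<integral>x. u x \<partial>Xlaw f) \<le> 0" .
  \<comment> \<open>The integrand is \<open>- K x y * ln (K x y)\<close>, and
    \<open>ln (K x y)\<close> is at most \<open>y\<^sup>2 / (2 * nv)\<close>.\<close>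
  have kk: "(\<integral>x. (1 / (2 * nv)) * (x ^ 2 * K x y) - (y / nv) * (x ^ 1 * K x y) \<partial>Xlaw f) \<ge> - (y\<^sup>2 / (2 * nv)) * ?m"
  proof -
    have "- (y\<^sup>2 / (2 * nv)) * K x y \<le> (1 / (2 * nv)) * (x ^ 2 * K x y) - (y / nv) * (x ^ 1 * K x y)" for x
    proof -
      have "0 \<le> (x - y)\<^sup>2 / (2 * nv) * K x y" using nv_pos K_pos[of x y] by simp
      also have "\<dots> = (1 / (2 * nv)) * (x ^ 2 * K x y) - (y / nv) * (x ^ 1 * K x y) + (y\<^sup>2 / (2 * nv)) * K x y"
        using nv_pos by (simp add: power2_eq_square field_simps)
      finally show ?thesis by simp
    qed
    then have "(\<integral>x. - (y\<^sup>2 / (2 * nv)) * K x y \<partial>Xlaw f) \<le> (\<integral>x. (1 / (2 * nv)) * (x ^ 2 * K x y) - (y / nv) * (x ^ 1 * K x y) \<partial>Xlaw f)"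
      by (intro integral_mono Bochner_Integration.integrable_diff integrable_mult_right integrable_mom integrable_K)
    then show ?thesis by (simp add: mom_def)
  qed
  have lf: "(\<integral>x. ln (f x) * K x y \<partial>Xlaw f) \<le> Lf y * ?m"
  proof -
    have "(\<integral>x. ln (f x) * K x y \<partial>Xlaw f) \<le> (\<integral>x. \<bar>ln (f x)\<bar> * K x y \<partial>Xlaw f)"
      using K_pos by (intro integral_mono integrable_lnf_K mult_right_mono) (auto simp: less_imp_le)
    also have "\<dots> = Lf y * ?m" using m by (simp add: Lf_def)
    finally show ?thesis .
  qed
  have "(\<integral>x. u x \<partial>Xlaw f) = (- (1/2) * ln (2 * pi * ?\<kappa>) + ln ?m) * ?m - (1 / (2 * ?\<kappa>)) * (?m * ?\<kappa>) - (\<integral>x. ln (f x) * K x y \<partial>Xlaw f)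
      + (\<integral>x. (1 / (2 * nv)) * (x ^ 2 * K x y) - (y / nv) * (x ^ 1 * K x y) \<partial>Xlaw f)"
  proof -
    let ?c = "- (1/2) * ln (2 * pi * ?\<kappa>) + ln ?m"
    let ?t = "\<lambda>x. (1 / (2 * nv)) * (x ^ 2 * K x y) - (y / nv) * (x ^ 1 * K x y)"
    have u': "u x = ?c * K x y - (1 / (2 * ?\<kappa>)) * ((x - g y)\<^sup>2 * K x y) - ln (f x) * K x y + ?t x" for x
      using u_eq[of x] by linarith
    have i1: "integrable (Xlaw f) (\<lambda>x. ?c * K x y)" "integrable (Xlaw f) (\<lambda>x. (1 / (2 * ?\<kappa>)) * ((x - g y)\<^sup>2 * K x y))"
      "integrable (Xlaw f) (\<lambda>x. ln (f x) * K x y)" "integrable (Xlaw f) ?t"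
      by (intro Bochner_Integration.integrable_diff integrable_mult_right integrable_mom integrable_K weighted_square(1) integrable_lnf_K)+
    have i2: "integrable (Xlaw f) (\<lambda>x. ?c * K x y - (1 / (2 * ?\<kappa>)) * ((x - g y)\<^sup>2 * K x y))"
      using i1 by (intro Bochner_Integration.integrable_diff)
    have i3: "integrable (Xlaw f) (\<lambda>x. ?c * K x y - (1 / (2 * ?\<kappa>)) * ((x - g y)\<^sup>2 * K x y) - ln (f x) * K x y)"
      using i2 i1 by (intro Bochner_Integration.integrable_diff)
    have "(\<integral>x. u x \<partial>Xlaw f) = (\<integral>x. ?c * K x y \<partial>Xlaw f) - (\<integral>x. (1 / (2 * ?\<kappa>)) * ((x - g y)\<^sup>2 * K x y) \<partial>Xlaw f)
       - (\<integral>x. ln (f x) * K x y \<partial>Xlaw f) + (\<integral>x. ?t x \<partial>Xlaw f)"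
      unfolding u' Bochner_Integration.integral_add[OF i3 i1(4)] Bochner_Integration.integral_diff[OF i2 i1(3)] Bochner_Integration.integral_diff[OF i1(1,2)] ..
    moreover have "(\<integral>x. ?c * K x y \<partial>Xlaw f) = ?c * ?m" by (simp add: mom_def)
    moreover have "(\<integral>x. (1 / (2 * ?\<kappa>)) * ((x - g y)\<^sup>2 * K x y) \<partial>Xlaw f) = (1 / (2 * ?\<kappa>)) * (?m * ?\<kappa>)"
      unfolding integral_mult_right_zero weighted_square(2) by simp
    ultimately show ?thesis by simp
  qed
  moreover have "(1 / (2 * ?\<kappa>)) * (?m * ?\<kappa>) = ?m / 2" using \<kappa> by simp
  ultimately have "(- (1/2) * ln (2 * pi * ?\<kappa>) + ln ?m) * ?m - ?m / 2 - Lf y * ?m - (y\<^sup>2 / (2 * nv)) * ?m \<le> 0"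
    using u0 kk lf by linarith
  then have "(- (1/2) * ln (2 * pi * ?\<kappa>) + ln ?m - 1/2 - Lf y - y\<^sup>2 / (2 * nv)) * ?m \<le> 0"
    by (simp add: left_diff_distrib)
  then have "- (1/2) * ln (2 * pi * ?\<kappa>) + ln ?m - 1/2 - Lf y - y\<^sup>2 / (2 * nv) \<le> 0"
    using m by (simp add: mult_le_0_iff)
  moreover have "ln (2 * pi * ?\<kappa>) = ln (2 * pi) + ln ?\<kappa>" using \<kappa> by (simp add: ln_mult)
  moreover have "y\<^sup>2 / nv = 2 * (y\<^sup>2 / (2 * nv))" by simp
  moreover have "- ln ?m \<le> \<bar>ln ?m\<bar>" by simp
  ultimately show ?thesis by linarith
qed

text \<open>The tower property: the hypothesis \<open>eq\<close> says that \<open>F y\<close> is the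
  posterior mean of \<open>H\<close> given \<open>y\<close>. It turns the averages of
  \<open>cvar\<close> and \<open>Lf\<close> into the mean square error of \<open>V\<close> and the
  mean of \<open>\<bar>ln (f X)\<bar>\<close>.\<close>

lemma nn_Src_posterior:
  assumes F[measurable]: "F \<in> borel_measurable borel" and nn: "\<And>y. 0 \<le> F y"
    and H[measurable]: "H \<in> borel_measurable (borel \<Otimes>\<^sub>M borel)"
    and eq: "\<And>y. (\<integral>\<^sup>+x. H (x, y) * ennreal (K x y) \<partial>Xlaw f) = ennreal (F y) * ennreal (mom 0 y)"
  shows "(\<integral>\<^sup>+\<omega>. ennreal (F (Ybar M \<omega>)) \<partial>Src f sW2 M) = (\<integral>\<^sup>+\<omega>. H (fst \<omega>, Ybar M \<omega>) \<partial>Src f sW2 M)"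
proof -
  have "(\<integral>\<^sup>+\<omega>. ennreal (F (Ybar M \<omega>)) \<partial>Src f sW2 M) = (\<integral>\<^sup>+u. ennreal (cden u) * (ennreal (F (ybar u)) * ennreal (mom 0 (ybar u))) \<partial>PiM {..<M} (\<lambda>_. lborel))"
    by (subst nn_Src_density) (simp_all add: nn_weighted_const Ybar_eq)
  also have "\<dots> = (\<integral>\<^sup>+\<omega>. H (fst \<omega>, Ybar M \<omega>) \<partial>Src f sW2 M)"
    by (subst nn_Src_density) (simp_all add: eq Ybar_eq)
  finally show ?thesis .
qed

lemma integrable_Ybar2: "integrable (Src f sW2 M) (\<lambda>\<omega>. (Ybar M \<omega>)\<^sup>2)"
proof -
  have M: "real M \<noteq> 0" using M_pos by simp
  have e: "form 0 (\<lambda>_. 1 / M) \<omega> = Ybar M \<omega> - \<mu>" for \<omega>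
    using M by (simp add: form_def Ybar_def sum_subtractf sum_divide_distrib diff_divide_distrib)
  have i: "integrable (Src f sW2 M) (\<lambda>\<omega>. (Ybar M \<omega> - \<mu>)\<^sup>2)"
    using form_second_moment(1)[of 0 "\<lambda>_. 1 / M"] by (simp only: e)
  have "integrable (Src f sW2 M) (\<lambda>\<omega>. 2 * (Ybar M \<omega> - \<mu>)\<^sup>2 + 2 * \<mu>\<^sup>2)" using i by simp
  then show ?thesis
  proof (rule Bochner_Integration.integrable_bound)
    have "(Ybar M \<omega>)\<^sup>2 \<le> 2 * (Ybar M \<omega> - \<mu>)\<^sup>2 + 2 * \<mu>\<^sup>2" for \<omega>
    proof -
      have "0 \<le> (Ybar M \<omega> - 2 * \<mu>)\<^sup>2" by simp
      then show ?thesis by (simp add: power2_eq_square algebra_simps)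
    qed
    then show "AE \<omega> in Src f sW2 M. norm ((Ybar M \<omega>)\<^sup>2) \<le> norm (2 * (Ybar M \<omega> - \<mu>)\<^sup>2 + 2 * \<mu>\<^sup>2)" by simp
  qed measurable
qed

lemma integrable_cvar: "integrable (Src f sW2 M) (\<lambda>\<omega>. cvar (Ybar M \<omega>))"
proof (rule integrableI_nonneg)
  have "(\<integral>\<^sup>+\<omega>. ennreal (cvar (Ybar M \<omega>)) \<partial>Src f sW2 M) = (\<integral>\<^sup>+\<omega>. ennreal ((fst (fst \<omega>, Ybar M \<omega>) - g (snd (fst \<omega>, Ybar M \<omega>)))\<^sup>2) \<partial>Src f sW2 M)"
  proof (rule nn_Src_posterior)
    show "(\<integral>\<^sup>+x. ennreal ((fst (x, y) - g (snd (x, y)))\<^sup>2) * ennreal (K x y) \<partial>Xlaw f) = ennreal (cvar y) * ennreal (mom 0 y)" for y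
      using nn_weighted_square[of "g y" y] cvar_pos[of y] mom0_pos[of y] by (simp add: ennreal_mult less_imp_le mult.commute)
  qed (use cvar_pos in \<open>auto simp: less_imp_le\<close>)
  also have "\<dots> < \<infinity>" using nn_integral_eq_integral[OF Src_g(1)] by simp
  finally show "(\<integral>\<^sup>+\<omega>. ennreal (cvar (Ybar M \<omega>)) \<partial>Src f sW2 M) < \<infinity>" .
qed (use cvar_pos in \<open>auto simp: less_imp_le\<close>)

lemma integrable_Lf: "integrable (Src f sW2 M) (\<lambda>\<omega>. Lf (Ybar M \<omega>))"
proof (rule integrableI_nonneg)
  have "(\<integral>\<^sup>+\<omega>. ennreal (Lf (Ybar M \<omega>)) \<partial>Src f sW2 M) = (\<integral>\<^sup>+\<omega>. ennreal \<bar>ln (f (fst (fst \<omega>, Ybar M \<omega>)))\<bar> \<partial>Src f sW2 M)"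
  proof (rule nn_Src_posterior)
    fix y
    have "(\<integral>\<^sup>+x. ennreal \<bar>ln (f (fst (x, y)))\<bar> * ennreal (K x y) \<partial>Xlaw f) = (\<integral>\<^sup>+x. ennreal (\<bar>ln (f x)\<bar> * K x y) \<partial>Xlaw f)"
      using K_pos by (intro nn_integral_cong) (simp add: ennreal_mult less_imp_le)
    also have "\<dots> = ennreal (\<integral>x. \<bar>ln (f x)\<bar> * K x y \<partial>Xlaw f)"
      using K_pos by (intro nn_integral_eq_integral integrable_lnf_K) (simp add: less_imp_le)
    also have "\<dots> = ennreal (Lf y * mom 0 y)" using mom0_pos[of y] by (simp add: Lf_def)
    finally show "(\<integral>\<^sup>+x. ennreal \<bar>ln (f (fst (x, y)))\<bar> * ennreal (K x y) \<partial>Xlaw f) = ennreal (Lf y) * ennreal (mom 0 y)"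
      using Lf_nonneg[of y] mom0_pos[of y] by (simp add: ennreal_mult)
  qed (use Lf_nonneg in auto)
  also have "\<dots> = (\<integral>\<^sup>+x. ennreal \<bar>ln (f x)\<bar> \<partial>Xlaw f)"
  proof -
    have m: "(\<lambda>\<omega>. ennreal \<bar>ln (f (fst \<omega>))\<bar>) \<in> borel_measurable (Src f sW2 M)" unfolding measurable_Src_iff by measurable
    have mc: "(\<lambda>p. ennreal \<bar>ln (f (fst (chan p)))\<bar>) \<in> borel_measurable (Xlaw f \<Otimes>\<^sub>M Wlaw sW2 M)"
      by (rule measurable_compose[OF chan_meas]) measurable
    show ?thesis
      using nn_integral_Src[OF m] W.nn_integral_fst[OF mc] by (simp add: chan_def W.emeasure_space_1)
  qed
  also have "\<dots> < \<infinity>" using nn_integral_eq_integral[OF integrable_abs[OF integrable_ln_f]] by simp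
  finally show "(\<integral>\<^sup>+\<omega>. ennreal (Lf (Ybar M \<omega>)) \<partial>Src f sW2 M) < \<infinity>" .
qed (use Lf_nonneg in auto)

lemma integrable_ln_mom0: "integrable (Src f sW2 M) (\<lambda>\<omega>. ln (mom 0 (Ybar M \<omega>)))"
proof (rule Bochner_Integration.integrable_bound)
  show "integrable (Src f sW2 M) (\<lambda>\<omega>. (EX2 / (2 * nv) + \<mu>\<^sup>2 / nv) + (2 / nv) * (Ybar M \<omega>)\<^sup>2)"
    using integrable_Ybar2 by simp
  show "AE \<omega> in Src f sW2 M. norm (ln (mom 0 (Ybar M \<omega>))) \<le> norm ((EX2 / (2 * nv) + \<mu>\<^sup>2 / nv) + (2 / nv) * (Ybar M \<omega>)\<^sup>2)"
    using abs_ln_mom0 by (intro AE_I2) (metis abs_ge_self order_trans real_norm_def)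
qed measurable

text \<open>From above \<open>ln\<close> is dominated by its argument, whose mean is finite; from
  below by \<open>neg_ln_cvar_le\<close>, every term of which has just been shown
  integrable.\<close>

lemma integrable_ln_cvar: "integrable (Src f sW2 M) (\<lambda>\<omega>. ln (cvar (Ybar M \<omega>)))"
proof (rule Bochner_Integration.integrable_bound)
  let ?B = "\<lambda>y. cvar y + (ln (2 * pi) + 1 + 2 * \<bar>ln (mom 0 y)\<bar> + 2 * Lf y + (1 / nv) * y\<^sup>2)"
  show "integrable (Src f sW2 M) (\<lambda>\<omega>. ?B (Ybar M \<omega>))"
    using integrable_cvar integrable_ln_mom0 integrable_Lf integrable_Ybar2 by auto
  show "AE \<omega> in Src f sW2 M. norm (ln (cvar (Ybar M \<omega>))) \<le> norm (?B (Ybar M \<omega>))"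
  proof (rule AE_I2)
    fix \<omega>
    let ?y = "Ybar M \<omega>"
    have pi: "0 \<le> ln (2 * pi)" using pi_ge_two by simp
    have "ln (cvar ?y) \<le> cvar ?y" using ln_le_minus_one[OF cvar_pos[of ?y]] by simp
    moreover have "0 \<le> Lf ?y" "0 < cvar ?y" "0 \<le> (1 / nv) * ?y\<^sup>2" using Lf_nonneg cvar_pos nv_pos by simp_all
    moreover have "- ln (cvar ?y) \<le> ln (2 * pi) + 1 + 2 * \<bar>ln (mom 0 ?y)\<bar> + 2 * Lf ?y + (1 / nv) * ?y\<^sup>2"
      using neg_ln_cvar_le[of ?y] by simp
    ultimately have "\<bar>ln (cvar ?y)\<bar> \<le> ?B ?y" using pi by (intro abs_leI) linarith+
    then show "norm (ln (cvar ?y)) \<le> norm (?B ?y)" by (simp add: order_trans[OF _ abs_ge_self])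
  qed
qed measurable

abbreviation V :: "real \<times> (nat \<Rightarrow> real) \<Rightarrow> real" where "V \<omega> \<equiv> g (Ybar M \<omega>)"

lemma pV_V_pos: "0 < pV (V \<omega>)"
  using pY_pos cvar_pos nv_pos by (simp add: pV_g)

text \<open>Up to constants the log-density is a quadratic in the sample mean plus \<open>ln\<close>
  of \<open>mom 0\<close> minus \<open>ln\<close> of \<open>cvar\<close>. Integrability makes
  \<open>hV\<close> the true entropy and allows Gibbs' inequality to be integrated term by
  term.\<close>

lemma integrable_ln_pV: "integrable (Src f sW2 M) (\<lambda>\<omega>. ln (pV (V \<omega>)))"
proof -
  have "ln (pV (V \<omega>)) = (ln (1 / sqrt (2 * pi * nv)) + ln nv) - (1 / (2 * nv)) * (Ybar M \<omega>)\<^sup>2 + ln (mom 0 (Ybar M \<omega>)) - ln (cvar (Ybar M \<omega>))" for \<omega>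
  proof -
    have "ln (pV (V \<omega>)) = ln (pY (Ybar M \<omega>)) - (ln (cvar (Ybar M \<omega>)) - ln nv)"
    proof -
      have "ln (pY y / (cvar y / nv)) = ln (pY y) - ln (cvar y / nv)" "ln (cvar y / nv) = ln (cvar y) - ln nv" for y
        using pY_pos[of y] cvar_pos[of y] nv_pos by (intro ln_divide_pos; simp)+
      then show ?thesis by (simp add: pV_g)
    qed
    moreover have "ln (pY (Ybar M \<omega>)) = ln (normal_density 0 (sqrt nv) (Ybar M \<omega>)) + ln (mom 0 (Ybar M \<omega>))"
      unfolding pY_def using mom0_pos nv_pos normal_density_pos[of "sqrt nv" 0 "Ybar M \<omega>"] by (intro ln_mult_pos) auto
    moreover have "ln (normal_density 0 (sqrt nv) (Ybar M \<omega>)) = ln (1 / sqrt (2 * pi * nv)) - (1 / (2 * nv)) * (Ybar M \<omega>)\<^sup>2"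
    proof -
      have "0 < 1 / sqrt (2 * pi * nv)" using nv_pos by simp
      moreover have "normal_density 0 (sqrt nv) (Ybar M \<omega>) = 1 / sqrt (2 * pi * nv) * exp (- (1 / (2 * nv)) * (Ybar M \<omega>)\<^sup>2)"
        using nv_pos by (simp add: normal_density_def)
      ultimately show ?thesis by (simp only: ln_mult_pos[OF _ exp_gt_zero] ln_exp)
    qed
    ultimately show ?thesis by simp
  qed
  then show ?thesis
    using integrable_Ybar2 integrable_ln_mom0 integrable_ln_cvar by simp
qed

definition hV :: real where "hV = - (\<integral>\<omega>. ln (pV (V \<omega>)) \<partial>Src f sW2 M)"

lemma V_meas[measurable]: "V \<in> borel_measurable (Src f sW2 M)"
  by measurable

text \<open>Entropy depends only on the law, so the almost sure version \<open>V\<close> may replace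
  the abstract conditional expectation, and its explicit density turns entropy into an expectation
  under the source.\<close>

lemma NV_eq: "NV f sW2 M = exp (2 * hV) / (2 * pi * exp 1)"
proof -
  let ?S = "Src f sW2 M"
  interpret I: information_space ?S "exp 1" by unfold_locales simp
  have d: "distributed ?S lborel V (\<lambda>v. ennreal (pV v))"
    unfolding distributed_def using distr_V by simp
  have "S.entropy (exp 1) lborel (Vcond f sW2 M) = S.entropy (exp 1) lborel V"
  proof -
    have "distr ?S lborel (Vcond f sW2 M) = distr ?S lborel V"
      using Vcond_eq Vcond_meas V_meas by (intro distr_cong_AE) auto
    then show ?thesis by (simp add: S.entropy_def)
  qed
  also have "\<dots> = - (\<integral>v. pV v * log (exp 1) (pV v) \<partial>lborel)"
    by (rule I.entropy_distr[OF d]) (rule pV_nonneg)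
  also have "(\<integral>v. pV v * log (exp 1) (pV v) \<partial>lborel) = (\<integral>\<omega>. log (exp 1) (pV (V \<omega>)) \<partial>?S)"
    by (rule distributed_integral[OF d]) (auto simp: pV_nonneg)
  also have "- \<dots> = hV" by (simp add: hV_def log_def)
  finally show ?thesis by (simp add: NV_def)
qed


subsection \<open>Shannon lower bound\<close>

lemma V_comp_meas: "t \<in> {..<n} \<Longrightarrow> (\<lambda>\<omega>. V (\<omega> t)) \<in> borel_measurable (Blk f sW2 M n)"
  unfolding Blk_def by (rule measurable_compose[where N="Src f sW2 M", OF _ V_meas]) (rule measurable_component_singleton)

lemma Blk_V_law:
  "distr (Blk f sW2 M n) (PiM {..<n} (\<lambda>_. lborel)) (\<lambda>\<omega>. \<lambda>t\<in>{..<n}. V (\<omega> t)) =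
    density (PiM {..<n} (\<lambda>_. lborel)) (\<lambda>v. \<Prod>t\<in>{..<n}. ennreal (pV (v t)))"
proof -
  have V: "V \<in> measurable (Src f sW2 M) lborel" using V_meas by simp
  have p: "prob_space (density lborel (\<lambda>v. ennreal (pV v)))"
    using S.prob_space_distr[OF V] unfolding distr_V .
  show ?thesis unfolding Blk_def
    by (subst distr_PiM_componentwise)
      (auto simp: prob_space_Src V distr_V PiM_density[OF _ _ p] simp del: measurable_lborel1 intro!: PiM_density p)
qed

text \<open>Likelihood ratio, along the block of \<open>V\<close>, of the Gaussian with centre
  \<open>c\<close> and variance \<open>d\<close> against the true product law.\<close>

definition dratio :: "nat \<Rightarrow> real \<Rightarrow> (nat \<Rightarrow> real) \<Rightarrow> (nat \<Rightarrow> real \<times> (nat \<Rightarrow> real)) \<Rightarrow> real" where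
  "dratio n d c \<omega> = (\<Prod>t<n. normal_density (c t) (sqrt d) (V (\<omega> t))) / (\<Prod>t<n. pV (V (\<omega> t)))"

lemma dratio_meas[measurable]: "dratio n d c \<in> borel_measurable (Blk f sW2 M n)"
proof -
  have "(\<lambda>\<omega>. \<Prod>t\<in>{..<n}. normal_density (c t) (sqrt d) (V (\<omega> t))) \<in> borel_measurable (Blk f sW2 M n)"
    by (intro borel_measurable_prod measurable_compose[OF V_comp_meas]) auto
  moreover have "(\<lambda>\<omega>. \<Prod>t\<in>{..<n}. pV (V (\<omega> t))) \<in> borel_measurable (Blk f sW2 M n)"
    by (intro borel_measurable_prod measurable_compose[OF V_comp_meas]) auto
  ultimately show ?thesis unfolding dratio_def[abs_def] by (intro borel_measurable_divide)
qed

lemma dratio_pos: "0 < d \<Longrightarrow> 0 < dratio n d c \<omega>"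
  unfolding dratio_def by (intro divide_pos_pos prod_pos) (auto simp: pV_V_pos normal_density_pos)

text \<open>Transferring to the law of the block cancels the denominator. The Gaussian mass is 1;
  what lies where the density of \<open>V\<close> vanishes is lost, hence the inequality.\<close>

lemma nn_integral_dratio:
  assumes d: "0 < d"
  shows "(\<integral>\<^sup>+\<omega>. ennreal (dratio n d c \<omega>) \<partial>Blk f sW2 M n) \<le> 1"
proof -
  let ?L = "PiM {..<n} (\<lambda>_. lborel :: real measure)"
  let ?A = "\<lambda>v. \<Prod>t<n. normal_density (c t) (sqrt d) (v t)" and ?P = "\<lambda>v. \<Prod>t<n. pV (v t)"
  let ?F = "\<lambda>v. ennreal (?A v / ?P v)"
  have mA: "?A \<in> borel_measurable ?L"
    by (intro borel_measurable_prod measurable_compose[OF measurable_component_singleton]) auto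
  have mP: "?P \<in> borel_measurable ?L"
    by (intro borel_measurable_prod measurable_compose[OF measurable_component_singleton]) auto
  have mF: "?F \<in> borel_measurable ?L" using mA mP by measurable
  have mV: "(\<lambda>\<omega>. \<lambda>t\<in>{..<n}. V (\<omega> t)) \<in> measurable (Blk f sW2 M n) ?L"
    using V_comp_meas by (intro measurable_restrict) auto
  have "(\<integral>\<^sup>+\<omega>. ennreal (dratio n d c \<omega>) \<partial>Blk f sW2 M n) = (\<integral>\<^sup>+\<omega>. ?F (\<lambda>t\<in>{..<n}. V (\<omega> t)) \<partial>Blk f sW2 M n)"
    by (simp add: dratio_def)
  also have "\<dots> = (\<integral>\<^sup>+v. ?F v \<partial>distr (Blk f sW2 M n) ?L (\<lambda>\<omega>. \<lambda>t\<in>{..<n}. V (\<omega> t)))"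
    using mV mF by (simp add: nn_integral_distr)
  also have "\<dots> = (\<integral>\<^sup>+v. ennreal (?P v) * ?F v \<partial>?L)"
    unfolding Blk_V_law using mP mF by (subst nn_integral_density) (simp_all add: prod_ennreal pV_nonneg)
  also have "\<dots> \<le> (\<integral>\<^sup>+v. 1 * ennreal (?A v) \<partial>?L)"
  proof (rule nn_integral_mono)
    fix v
    have "0 \<le> ?P v" "0 \<le> ?A v" by (auto intro!: prod_nonneg simp: pV_nonneg)
    then show "ennreal (?P v) * ?F v \<le> 1 * ennreal (?A v)"
      by (cases "?P v = 0") (simp_all only: ennreal_0 mult_zero_left zero_le mult_1 ennreal_mult[symmetric] divide_nonneg_nonneg, simp)
  qed
  also have "\<dots> = (\<integral>\<^sup>+z. 1 \<partial>nrmn n d)"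
    using nn_integral_nrmn_shift[OF d, of "\<lambda>_. 1" n c] by simp
  also have "\<dots> = 1" using prob_space.emeasure_space_1[OF prob_space_nrmn[OF d, of n]] by simp
  finally show ?thesis .
qed

lemma ln_normal_density:
  fixes m d v :: real
  assumes "0 < d"
  shows "ln (normal_density m (sqrt d) v) = - (1/2) * ln (2 * pi * d) - (v - m)\<^sup>2 / (2 * d)"
proof -
  have p: "0 < 2 * pi * d" using assms by simp
  have "normal_density m (sqrt d) v = 1 / sqrt (2 * pi * d) * exp (- (v - m)\<^sup>2 / (2 * d))"
    using assms by (simp add: normal_density_def)
  moreover have "0 < 1 / sqrt (2 * pi * d)" using p by simp
  ultimately have "ln (normal_density m (sqrt d) v) = ln (1 / sqrt (2 * pi * d)) - (v - m)\<^sup>2 / (2 * d)"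
    by (simp only: ln_mult_pos[OF _ exp_gt_zero] ln_exp)
  moreover have "ln (1 / sqrt (2 * pi * d)) = - (1/2) * ln (2 * pi * d)"
    using p by (simp add: ln_divide_pos ln_sqrt)
  ultimately show ?thesis by simp
qed

text \<open>Gibbs' inequality against the mixture of the Gaussians centred at the reproductions; the
  mixture over \<open>C\<close> dominates \<open>1 / card C\<close> times the Gaussian at the reproduction actually used.\<close>

lemma gibbs_block:
  fixes C :: "(nat \<Rightarrow> real) set" and est :: "(nat \<Rightarrow> real \<times> (nat \<Rightarrow> real)) \<Rightarrow> nat \<Rightarrow> real" and d :: real
  assumes C: "finite C" and est: "\<And>\<omega>. est \<omega> \<in> C"
    and i: "\<And>t. t < n \<Longrightarrow> integrable (Blk f sW2 M n) (\<lambda>\<omega>. (V (\<omega> t) - est \<omega> t)\<^sup>2)"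
    and s: "(\<Sum>t<n. \<integral>\<omega>. (V (\<omega> t) - est \<omega> t)\<^sup>2 \<partial>Blk f sW2 M n) \<le> real n * d" and d: "0 < d"
  shows "real n * (hV - (1/2 * ln (2 * pi * d) + 1/2)) \<le> ln (real (card C))"
proof -
  let ?P = "Blk f sW2 M n"
  interpret P: prob_space ?P by (rule prob_space_Blk)
  have ne: "C \<noteq> {}" using est by blast
  then have cC: "0 < real (card C)" using C by (simp add: card_gt_0_iff)
  \<comment> \<open>Likelihood ratio of the uniform mixture over all reproductions; its mean is at
    most 1.\<close>
  define Z where "Z \<omega> = (1 / real (card C)) * (\<Sum>c\<in>C. dratio n d c \<omega>)" for \<omega>
  have Zm: "Z \<in> borel_measurable ?P" unfolding Z_def[abs_def] by measurable
  have rp: "0 \<le> dratio n d c \<omega>" for c \<omega> using dratio_pos[OF d] by (simp add: less_imp_le)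
  have ri: "integrable ?P (dratio n d c)" for c
    using nn_integral_dratio[OF d, of n c] rp by (intro integrableI_nonneg) (auto simp: le_less_trans)
  have rl: "(\<integral>\<omega>. dratio n d c \<omega> \<partial>?P) \<le> 1" for c
    using nn_integral_dratio[OF d, of n c] nn_integral_eq_integral[OF ri[of c]] rp by simp
  have Zi: "integrable ?P Z" unfolding Z_def[abs_def] using ri by simp
  have "(\<integral>\<omega>. Z \<omega> \<partial>?P) = (1 / real (card C)) * (\<Sum>c\<in>C. \<integral>\<omega>. dratio n d c \<omega> \<partial>?P)"
    unfolding Z_def using ri by (simp add: Bochner_Integration.integral_sum)
  also have "\<dots> \<le> (1 / real (card C)) * (\<Sum>c\<in>C. 1)" using cC rl by (intro mult_left_mono sum_mono) auto
  finally have ZI: "(\<integral>\<omega>. Z \<omega> \<partial>?P) \<le> 1" using cC by simp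
  \<comment> \<open>\<open>exp (U \<omega>)\<close> is the single mixture term at the reproduction
    in use, so it is at most \<open>Z \<omega>\<close>. In contrast to the logarithm of
    \<open>Z\<close>, \<open>U\<close> splits into letters and can be integrated explicitly.\<close>
  define U where "U \<omega> = - ln (real (card C)) + (\<Sum>t<n. (- (1/2) * ln (2 * pi * d) - (V (\<omega> t) - est \<omega> t)\<^sup>2 / (2 * d)) - ln (pV (V (\<omega> t))))" for \<omega>
  have UZ: "U \<omega> \<le> Z \<omega> - 1" for \<omega>
  proof -
    have "exp (U \<omega>) = exp (- ln (real (card C))) * (\<Prod>t<n. exp (ln (normal_density (est \<omega> t) (sqrt d) (V (\<omega> t))) - ln (pV (V (\<omega> t)))))"
      unfolding U_def exp_add ln_normal_density[OF d] by (simp add: exp_sum)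
    also have "exp (- ln (real (card C))) = 1 / real (card C)" using cC by (simp add: exp_minus divide_inverse)
    also have "(\<Prod>t<n. exp (ln (normal_density (est \<omega> t) (sqrt d) (V (\<omega> t))) - ln (pV (V (\<omega> t))))) = dratio n d (est \<omega>) \<omega>"
      using d pV_V_pos by (simp add: exp_diff dratio_def prod_dividef normal_density_pos)
    also have "1 / real (card C) * dratio n d (est \<omega>) \<omega> \<le> Z \<omega>"
      unfolding Z_def using cC C est rp by (intro mult_left_mono member_le_sum) auto
    finally show ?thesis using exp_ge_add_one_self[of "U \<omega>"] by linarith
  qed
  have li: "integrable ?P (\<lambda>\<omega>. ln (pV (V (\<omega> t))))" "(\<integral>\<omega>. ln (pV (V (\<omega> t))) \<partial>?P) = - hV" if "t < n" for t
    using PiM_component_integral[where N="\<lambda>_. Src f sW2 M" and I="{..<n}" and i=t, OF prob_space_Src _ integrable_ln_pV] that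
    by (simp_all add: Blk_def hV_def)
  have Ui: "integrable ?P U" unfolding U_def[abs_def]
    using li i by (intro Bochner_Integration.integrable_add Bochner_Integration.integrable_sum Bochner_Integration.integrable_diff) auto
  have tI: "(\<integral>\<omega>. (- (1/2) * ln (2 * pi * d) - (V (\<omega> t) - est \<omega> t)\<^sup>2 / (2 * d)) - ln (pV (V (\<omega> t))) \<partial>?P)
      = - (1/2) * ln (2 * pi * d) + hV - (\<integral>\<omega>. (V (\<omega> t) - est \<omega> t)\<^sup>2 \<partial>?P) / (2 * d)" if "t < n" for t
    using li[OF that] i[OF that] by (simp add: P.prob_space)
  have "(\<integral>\<omega>. U \<omega> \<partial>?P) = - ln (real (card C)) + (\<Sum>t<n. - (1/2) * ln (2 * pi * d) + hV - (\<integral>\<omega>. (V (\<omega> t) - est \<omega> t)\<^sup>2 \<partial>?P) / (2 * d))"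
  proof -
    have "(\<integral>\<omega>. U \<omega> \<partial>?P) = - ln (real (card C)) + (\<Sum>t<n. \<integral>\<omega>. (- (1/2) * ln (2 * pi * d) - (V (\<omega> t) - est \<omega> t)\<^sup>2 / (2 * d)) - ln (pV (V (\<omega> t))) \<partial>?P)"
      unfolding U_def using li i
      by (subst Bochner_Integration.integral_add) (auto intro!: Bochner_Integration.integral_sum simp: P.prob_space)
    then show ?thesis using tI by simp
  qed
  also have "\<dots> = - ln (real (card C)) + real n * (hV - 1/2 * ln (2 * pi * d)) - (\<Sum>t<n. \<integral>\<omega>. (V (\<omega> t) - est \<omega> t)\<^sup>2 \<partial>?P) / (2 * d)"
    by (simp add: sum.distrib sum_subtractf sum_divide_distrib algebra_simps)
  finally have e: "(\<integral>\<omega>. U \<omega> \<partial>?P) = \<dots>" .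
  have "(\<integral>\<omega>. U \<omega> \<partial>?P) \<le> (\<integral>\<omega>. Z \<omega> - 1 \<partial>?P)" using Ui Zi UZ by (intro integral_mono) auto
  also have "\<dots> \<le> 0" using Zi ZI by (simp add: P.prob_space)
  finally have u: "(\<integral>\<omega>. U \<omega> \<partial>?P) \<le> 0" .
  \<comment> \<open>The Gaussian variance was taken equal to the allowed distortion, so the
    quadratic term contributes at most 1/2 per letter.\<close>
  have "(\<Sum>t<n. \<integral>\<omega>. (V (\<omega> t) - est \<omega> t)\<^sup>2 \<partial>?P) / (2 * d) \<le> real n * d / (2 * d)" using s d by (intro divide_right_mono) auto
  also have "\<dots> = real n / 2" using d by simp
  finally have "(\<Sum>t<n. \<integral>\<omega>. (V (\<omega> t) - est \<omega> t)\<^sup>2 \<partial>?P) / (2 * d) \<le> real n / 2" .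
  then show ?thesis using u e by (simp add: algebra_simps)
qed

lemma Blk_pythagoras:
  assumes t: "t < n" and H: "H \<in> borel_measurable (PiM {..<n} (\<lambda>_. PiM {..<M} (\<lambda>_. borel)))"
    and i: "integrable (Blk f sW2 M n) (\<lambda>\<omega>. (fst (\<omega> t) - H (\<lambda>s\<in>{..<n}. \<lambda>i\<in>{..<M}. snd (\<omega> s) i))\<^sup>2)"
  shows "integrable (Blk f sW2 M n) (\<lambda>\<omega>. (V (\<omega> t) - H (\<lambda>s\<in>{..<n}. \<lambda>i\<in>{..<M}. snd (\<omega> s) i))\<^sup>2)"
    "(\<integral>\<omega>. (fst (\<omega> t) - H (\<lambda>s\<in>{..<n}. \<lambda>i\<in>{..<M}. snd (\<omega> s) i))\<^sup>2 \<partial>Blk f sW2 M n) =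
      mmse f sW2 M + (\<integral>\<omega>. (V (\<omega> t) - H (\<lambda>s\<in>{..<n}. \<lambda>i\<in>{..<M}. snd (\<omega> s) i))\<^sup>2 \<partial>Blk f sW2 M n)"
proof -
  let ?P = "Blk f sW2 M n" and ?S = "Src f sW2 M" and ?I = "{..<n} - {t}"
  let ?Y = "\<lambda>\<omega>. \<lambda>s\<in>{..<n}. \<lambda>i\<in>{..<M}. snd (\<omega> s) i"
  interpret Q: product_sigma_finite "\<lambda>_ :: nat. ?S"
    by (intro product_sigma_finite.intro prob_space_imp_sigma_finite prob_space_Src)
  have ins: "insert t ?I = {..<n}" using t by auto
  \<comment> \<open>Fubini with letter \<open>t\<close> as the inner integral.\<close>
  have fold: "(\<integral>\<^sup>+\<omega>. G \<omega> \<partial>?P) = (\<integral>\<^sup>+x. (\<integral>\<^sup>+y. G (x(t := y)) \<partial>?S) \<partial>PiM ?I (\<lambda>_. ?S))" if "G \<in> borel_measurable ?P" for G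
    using Q.product_nn_integral_insert[of ?I t G] that unfolding ins Blk_def by simp
  have Ym: "?Y \<in> measurable ?P (PiM {..<n} (\<lambda>_. PiM {..<M} (\<lambda>_. borel)))"
    by (intro measurable_restrict Blk_snd) auto
  have HY: "(\<lambda>\<omega>. H (?Y \<omega>)) \<in> borel_measurable ?P" by (rule measurable_compose[OF Ym H])
  have Vt: "(\<lambda>\<omega>. V (\<omega> t)) \<in> borel_measurable ?P" and Xt: "(\<lambda>\<omega>. fst (\<omega> t)) \<in> borel_measurable ?P"
    using t by (auto intro!: V_comp_meas Blk_fst)
  have m0: "(\<lambda>\<omega>. (fst (\<omega> t) - H (?Y \<omega>))\<^sup>2) \<in> borel_measurable ?P"
    and m1: "(\<lambda>\<omega>. (fst (\<omega> t) - V (\<omega> t))\<^sup>2) \<in> borel_measurable ?P"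
    and m2: "(\<lambda>\<omega>. (V (\<omega> t) - H (?Y \<omega>))\<^sup>2) \<in> borel_measurable ?P"
    using HY Vt Xt by measurable
  have inner: "(\<integral>\<^sup>+y. ennreal ((fst ((x(t := y)) t) - H (?Y (x(t := y))))\<^sup>2) \<partial>?S) =
      (\<integral>\<^sup>+y. ennreal ((fst ((x(t := y)) t) - V ((x(t := y)) t))\<^sup>2) + ennreal ((V ((x(t := y)) t) - H (?Y (x(t := y))))\<^sup>2) \<partial>?S)" for x
  proof -
    let ?h = "\<lambda>u. H (\<lambda>s\<in>{..<n}. \<lambda>i\<in>{..<M}. if s = t then u i else snd (x s) i)"
    have c: "(\<lambda>u. if s = t then u i else snd (x s) i) \<in> borel_measurable (PiM {..<M} (\<lambda>_. borel))" if "i \<in> {..<M}" for s i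
      using that by (cases "s = t") auto
    have h: "?h \<in> borel_measurable (PiM {..<M} (\<lambda>_. borel))"
      by (rule measurable_compose[OF _ H]) (intro measurable_restrict c)
    have hy: "H (?Y (x(t := y))) = ?h (snd y)" for y
      by (intro arg_cong[of _ _ H] restrict_ext) auto
    have "V \<in> borel_measurable (borel \<Otimes>\<^sub>M PiM {..<M} (\<lambda>_. borel))" using V_meas unfolding measurable_Src_iff .
    then have mm: "(\<lambda>y. (fst y - V y)\<^sup>2) \<in> borel_measurable ?S" "(\<lambda>y. (V y - ?h (snd y))\<^sup>2) \<in> borel_measurable ?S"
      unfolding measurable_Src_iff using measurable_compose[OF measurable_snd h] by measurable
    show ?thesis unfolding hy fun_upd_same using Src_pythagoras[OF h] mm by (simp add: nn_integral_add)
  qed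
  have p: "(\<integral>\<^sup>+\<omega>. ennreal ((fst (\<omega> t) - H (?Y \<omega>))\<^sup>2) \<partial>?P) =
      (\<integral>\<^sup>+\<omega>. ennreal ((fst (\<omega> t) - V (\<omega> t))\<^sup>2) \<partial>?P) + (\<integral>\<^sup>+\<omega>. ennreal ((V (\<omega> t) - H (?Y \<omega>))\<^sup>2) \<partial>?P)"
  proof -
    have "(\<integral>\<^sup>+\<omega>. ennreal ((fst (\<omega> t) - H (?Y \<omega>))\<^sup>2) \<partial>?P)
        = (\<integral>\<^sup>+\<omega>. ennreal ((fst (\<omega> t) - V (\<omega> t))\<^sup>2) + ennreal ((V (\<omega> t) - H (?Y \<omega>))\<^sup>2) \<partial>?P)"
      using m0 m1 m2 by (subst (1 2) fold) (simp_all only: inner borel_measurable_add measurable_compose[OF _ measurable_ennreal])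
    also have "\<dots> = (\<integral>\<^sup>+\<omega>. ennreal ((fst (\<omega> t) - V (\<omega> t))\<^sup>2) \<partial>?P) + (\<integral>\<^sup>+\<omega>. ennreal ((V (\<omega> t) - H (?Y \<omega>))\<^sup>2) \<partial>?P)"
      using m1 m2 by (intro nn_integral_add) (auto intro: measurable_compose[OF _ measurable_ennreal])
    finally show ?thesis .
  qed
  have e0: "(\<integral>\<^sup>+\<omega>. ennreal ((fst (\<omega> t) - H (?Y \<omega>))\<^sup>2) \<partial>?P) = ennreal (\<integral>\<omega>. (fst (\<omega> t) - H (?Y \<omega>))\<^sup>2 \<partial>?P)"
    using i by (intro nn_integral_eq_integral) auto
  have "(\<integral>\<^sup>+\<omega>. ennreal ((V (\<omega> t) - H (?Y \<omega>))\<^sup>2) \<partial>?P) \<le> ennreal (\<integral>\<omega>. (fst (\<omega> t) - H (?Y \<omega>))\<^sup>2 \<partial>?P)"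
    unfolding e0[symmetric] p by simp
  also have "\<dots> < \<infinity>" by simp
  finally have "(\<integral>\<^sup>+\<omega>. ennreal ((V (\<omega> t) - H (?Y \<omega>))\<^sup>2) \<partial>?P) < \<infinity>" .
  then show i2: "integrable ?P (\<lambda>\<omega>. (V (\<omega> t) - H (?Y \<omega>))\<^sup>2)" using m2 by (intro integrableI_nonneg) auto
  have i1: "integrable ?P (\<lambda>\<omega>. (fst (\<omega> t) - V (\<omega> t))\<^sup>2)" "(\<integral>\<omega>. (fst (\<omega> t) - V (\<omega> t))\<^sup>2 \<partial>?P) = mmse f sW2 M"
    using PiM_component_integral[where N="\<lambda>_. ?S" and I="{..<n}" and i=t, OF prob_space_Src _ Src_g(1)] t
    by (simp_all add: Blk_def mmse_eq)
  have "ennreal (\<integral>\<omega>. (fst (\<omega> t) - H (?Y \<omega>))\<^sup>2 \<partial>?P) = ennreal (mmse f sW2 M + (\<integral>\<omega>. (V (\<omega> t) - H (?Y \<omega>))\<^sup>2 \<partial>?P))"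
    using p[unfolded e0] nn_integral_eq_integral[OF i1(1)] nn_integral_eq_integral[OF i2] i1(2)
    by (simp add: ennreal_plus mmse_eq)
  then show "(\<integral>\<omega>. (fst (\<omega> t) - H (?Y \<omega>))\<^sup>2 \<partial>?P) = mmse f sW2 M + (\<integral>\<omega>. (V (\<omega> t) - H (?Y \<omega>))\<^sup>2 \<partial>?P)"
    by (subst (asm) ennreal_inj) (auto intro: add_nonneg_nonneg simp: mmse_def)
qed

lemma NV_pos: "0 < NV f sW2 M"
  by (simp add: NV_eq)

text \<open>The block inequality in entropy form is the Shannon lower bound in entropy power form;
  the extra 1/2 is the factor \<open>exp 1\<close> in the normalisation of
  \<open>NV\<close>.\<close>

lemma ln_NV: "0 < d \<Longrightarrow> 1/2 * ln (NV f sW2 M / d) = hV - (1/2 * ln (2 * pi * d) + 1/2)"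
proof -
  assume d: "0 < d"
  have "NV f sW2 M / d = exp (2 * hV - 1) / (2 * pi * d)"
    by (simp add: NV_eq exp_diff)
  moreover have "ln (exp (2 * hV - 1) / (2 * pi * d)) = ln (exp (2 * hV - 1)) - ln (2 * pi * d)"
    using d by (intro ln_divide_pos) auto
  ultimately show ?thesis by simp
qed

\<comment> \<open>Obtained from the block inequality with a single reproduction.\<close>
lemma NV_le: "NV f sW2 M \<le> varX f - mmse f sW2 M"
proof (rule field_le_epsilon)
  fix e :: real assume e: "0 < e"
  \<comment> \<open>The slack \<open>e\<close> keeps the Gaussian variance positive; it is removed
    by \<open>field_le_epsilon\<close>.\<close>
  let ?d = "varX f - mmse f sW2 M + e"
  have v: "(\<integral>\<omega>. (V \<omega> - \<mu>)\<^sup>2 \<partial>Src f sW2 M) = varX f - mmse f sW2 M" using Src_g(3) by (simp add: mmse_eq)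
  have "0 \<le> varX f - mmse f sW2 M" unfolding v[symmetric] by simp
  then have d: "0 < ?d" using e by simp
  have c: "integrable (Blk f sW2 M 1) (\<lambda>\<omega>. (V (\<omega> 0) - \<mu>)\<^sup>2)" "(\<integral>\<omega>. (V (\<omega> 0) - \<mu>)\<^sup>2 \<partial>Blk f sW2 M 1) = varX f - mmse f sW2 M"
    using PiM_component_integral[where N="\<lambda>_. Src f sW2 M" and I="{..<1::nat}" and i=0, OF prob_space_Src _ Src_g(2)]
    by (simp_all add: Blk_def v)
  have "real 1 * (hV - (1/2 * ln (2 * pi * ?d) + 1/2)) \<le> ln (real (card {\<lambda>_::nat. \<mu>}))"
    using c d e by (intro gibbs_block[where est="\<lambda>_ _. \<mu>"]) auto
  then have "1/2 * ln (NV f sW2 M / ?d) \<le> 0" using ln_NV[OF d] by simp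
  then have "ln (NV f sW2 M / ?d) \<le> 0" by simp
  then have "NV f sW2 M / ?d \<le> 1" using NV_pos d by (subst (asm) ln_le_zero_iff) auto
  then show "NV f sW2 M \<le> varX f - mmse f sW2 M + e" using d by (simp add: field_simps)
qed

text \<open>Subtracting the mmse leaves a description of the block of \<open>V\<close> with
  distortion \<open>d - mmse\<close>, and the decoder has at most \<open>exp (n * R)\<close>
  reproductions.\<close>

lemma joint_code_converse:
  fixes R d :: real
  assumes n: "0 < n" and code: "joint_code f sW2 M n R d" and d: "mmse f sW2 M < d"
  shows "1/2 * ln (NV f sW2 M / (d - mmse f sW2 M)) \<le> R"
proof -
  let ?P = "Blk f sW2 M n" and ?K = "nat \<lfloor>exp (real n * R)\<rfloor>"
  let ?Y = "\<lambda>\<omega>::nat \<Rightarrow> real \<times> (nat \<Rightarrow> real). \<lambda>s\<in>{..<n}. \<lambda>i\<in>{..<M}. snd (\<omega> s) i"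
  from code obtain enc :: "(nat \<Rightarrow> nat \<Rightarrow> real) \<Rightarrow> nat" and dec :: "nat \<Rightarrow> nat \<Rightarrow> real" where
    e: "\<And>y. enc y \<in> {1..?K}" and
    em: "enc \<in> measurable (PiM {..<n} (\<lambda>_. PiM {..<M} (\<lambda>_. borel))) (count_space UNIV)" and
    ei: "\<And>t. t < n \<Longrightarrow> integrable ?P (\<lambda>\<omega>. (fst (\<omega> t) - dec (enc (?Y \<omega>)) t)\<^sup>2)" and
    es: "(1 / real n) * (\<Sum>t<n. \<integral>\<omega>. (fst (\<omega> t) - dec (enc (?Y \<omega>)) t)\<^sup>2 \<partial>?P) \<le> d"
    unfolding joint_code_def Let_def by blast
  have H: "(\<lambda>y. dec (enc y) t) \<in> borel_measurable (PiM {..<n} (\<lambda>_. PiM {..<M} (\<lambda>_. borel)))" for t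
    by (rule measurable_compose[OF em]) simp
  note py = Blk_pythagoras[OF _ H ei]
  let ?m = "mmse f sW2 M" and ?C = "dec ` {1..?K}"
  have "(\<Sum>t<n. \<integral>\<omega>. (fst (\<omega> t) - dec (enc (?Y \<omega>)) t)\<^sup>2 \<partial>?P)
      = real n * ?m + (\<Sum>t<n. \<integral>\<omega>. (V (\<omega> t) - dec (enc (?Y \<omega>)) t)\<^sup>2 \<partial>?P)"
  proof -
    have "(\<Sum>t<n. \<integral>\<omega>. (fst (\<omega> t) - dec (enc (?Y \<omega>)) t)\<^sup>2 \<partial>?P)
        = (\<Sum>t<n. ?m + (\<integral>\<omega>. (V (\<omega> t) - dec (enc (?Y \<omega>)) t)\<^sup>2 \<partial>?P))"
      by (intro sum.cong refl py(2)) simp_all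
    then show ?thesis by (simp only: sum.distrib) simp
  qed
  moreover have "(\<Sum>t<n. \<integral>\<omega>. (fst (\<omega> t) - dec (enc (?Y \<omega>)) t)\<^sup>2 \<partial>?P) \<le> real n * d"
    using es n by (simp add: field_simps)
  ultimately have s: "(\<Sum>t<n. \<integral>\<omega>. (V (\<omega> t) - dec (enc (?Y \<omega>)) t)\<^sup>2 \<partial>?P) \<le> real n * (d - ?m)"
    by (simp add: algebra_simps)
  have "real n * (hV - (1/2 * ln (2 * pi * (d - ?m)) + 1/2)) \<le> ln (real (card ?C))"
  proof (rule gibbs_block)
    show "finite ?C" by simp
    show "dec (enc (?Y \<omega>)) \<in> ?C" for \<omega> using e by (rule imageI)
    show "integrable ?P (\<lambda>\<omega>. (V (\<omega> t) - dec (enc (?Y \<omega>)) t)\<^sup>2)" if "t < n" for t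
      by (rule py(1)[OF that that])
    show "(\<Sum>t<n. \<integral>\<omega>. (V (\<omega> t) - dec (enc (?Y \<omega>)) t)\<^sup>2 \<partial>?P) \<le> real n * (d - ?m)" by (rule s)
    show "0 < d - ?m" using d by simp
  qed
  also have "\<dots> \<le> real n * R"
  proof -
    have "0 < real (card ?C)" using e[of undefined] by (auto simp: card_gt_0_iff)
    moreover have "real (card ?C) \<le> exp (real n * R)"
    proof -
      have "card ?C \<le> ?K" using card_image_le[of "{1..?K}" dec] by simp
      then have "real (card ?C) \<le> real ?K" by (rule of_nat_mono)
      also have "\<dots> \<le> exp (real n * R)" by (rule of_nat_floor) simp
      finally show ?thesis .
    qed
    ultimately show ?thesis by (metis ln_exp ln_le_cancel_iff exp_gt_zero)
  qed
  finally show ?thesis using ln_NV[of "d - ?m"] d n by simp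
qed

text \<open>Achievability tolerates every excess \<open>\<epsilon>\<close>, so the converse is
  available at \<open>D + \<epsilon>\<close>; continuity of the logarithm lets
  \<open>\<epsilon>\<close> tend to 0.\<close>

lemma R_joint_ge:
  assumes D: "DN0 f sW2 M < D" "D < varX f"
  shows "1/2 * ln (NV f sW2 M / (D - mmse f sW2 M)) \<le> R_joint f sW2 M D"
  unfolding R_joint_def
proof (rule cInf_greatest[OF joint_achievable[OF D]])
  let ?m = "mmse f sW2 M"
  have Dm: "0 < D - ?m" using D mmse_le_DN0 by linarith
  fix R assume "R \<in> {R. \<forall>\<epsilon>>0. \<exists>N. \<forall>n\<ge>N. joint_code f sW2 M n R (D + \<epsilon>)}"
  then have R: "\<forall>\<epsilon>>0. \<exists>N. \<forall>n\<ge>N. joint_code f sW2 M n R (D + \<epsilon>)" by simp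
  have le: "1/2 * ln (NV f sW2 M / (D - ?m + \<epsilon>)) \<le> R" if "0 < \<epsilon>" for \<epsilon>
  proof -
    from R that obtain N where N: "\<forall>n\<ge>N. joint_code f sW2 M n R (D + \<epsilon>)" by blast
    \<comment> \<open>One good block length suffices; the successor guarantees that it is
      positive.\<close>
    have "joint_code f sW2 M (Suc N) R (D + \<epsilon>)" by (rule N[rule_format]) simp
    from joint_code_converse[OF _ this] show ?thesis using Dm that by (simp add: algebra_simps)
  qed
  have "((\<lambda>\<epsilon>. 1/2 * ln (NV f sW2 M / (D - ?m + \<epsilon>))) \<longlongrightarrow> 1/2 * ln (NV f sW2 M / (D - ?m + 0))) (at_right 0)"
    using Dm NV_pos by (intro tendsto_intros) auto
  moreover have "\<forall>\<^sub>F \<epsilon> in at_right 0. 1/2 * ln (NV f sW2 M / (D - ?m + \<epsilon>)) \<le> R"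
    using le by (auto simp: eventually_at_right_less eventually_at_filter)
  ultimately show "1/2 * ln (NV f sW2 M / (D - ?m)) \<le> R"
    using tendsto_upperbound[of _ _ "at_right (0::real)"] by force
qed

end

theorem theorem2:
  fixes f :: "real \<Rightarrow> real" and sW2 D :: real and M :: nat
  assumes f_meas: "f \<in> borel_measurable lborel"
    and f_nonneg: "\<And>x. f x \<ge> 0"
    and f_prob: "(\<integral>\<^sup>+x. ennreal (f x) \<partial>lborel) = 1"
    and fin_var: "integrable lborel (\<lambda>x. x\<^sup>2 * f x)"
    and var_pos: "varX f > 0"
    and fin_ent: "integrable lborel (\<lambda>x. f x * ln (f x))"
    and M_pos: "M \<ge> 1"
    and sW2_pos: "sW2 > 0"
    and D_low: "DN0 f sW2 M < D"
    and D_high: "D < mmse f sW2 M + NV f sW2 M"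
  shows "rate_loss f sW2 M D \<le>
      1/2 * ln (varX f / NV f sW2 M)
      + real M / 2 * ln (1 / (1 - sW2 / real M * (1 / D - 1 / varX f)))
      - 1/2 * ln (D / (D - mmse f sW2 M))"
proof -
  interpret ceo_source_entropy f sW2 M
    by unfold_locales (fact f_meas f_nonneg f_prob fin_var var_pos M_pos sW2_pos fin_ent)+
  \<comment> \<open>\<open>NV_le\<close> converts the upper end of the range into the condition
    under which the Gaussian scheme has finite test noise.\<close>
  have Dv: "D < varX f" using D_high NV_le by linarith
  have m: "0 < D - mmse f sW2 M" using D_low mmse_le_DN0 by linarith
  have "0 < DN0 f sW2 M"
    unfolding DN0_def using var_pos sW2_pos M_pos by (intro divide_pos_pos mult_pos_pos add_nonneg_pos) auto
  then have D: "0 < D" using D_low by linarith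
  have "rate_loss f sW2 M D \<le> gauss_sum_rate D - 1/2 * ln (NV f sW2 M / (D - mmse f sW2 M))"
    unfolding rate_loss_def using R_CEO_le[OF D_low Dv] R_joint_ge[OF D_low Dv] by linarith
  \<comment> \<open>With all logarithms split, both sides are linear in the same atoms: inserting
    and removing \<open>ln D\<close> is the whole difference between the bound obtained and the one
    claimed.\<close>
  moreover have "ln (varX f / D) = ln (varX f) - ln D" using var_pos D by (rule ln_divide_pos)
  moreover have "ln (NV f sW2 M / (D - mmse f sW2 M)) = ln (NV f sW2 M) - ln (D - mmse f sW2 M)"
    using NV_pos m by (rule ln_divide_pos)
  moreover have "ln (varX f / NV f sW2 M) = ln (varX f) - ln (NV f sW2 M)" using var_pos NV_pos by (rule ln_divide_pos)
  moreover have "ln (D / (D - mmse f sW2 M)) = ln D - ln (D - mmse f sW2 M)" using D m by (rule ln_divide_pos)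
  ultimately show ?thesis unfolding gauss_sum_rate_def by linarith
qed

end
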